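(* Let $(G,\alpha)$ and $(H,\beta)$ be locally compact contraction groups and $\phi\colon G\to H$ be a continuous group homomorphism. Then we have: (a) $\phi(G)$ is closed in $H$ if and only if $\phi(\mathrm{tor}(G))$ is closed in $H$, in which case the co-restriction $\phi|^{\phi(G)}\colon G\to\phi(G)$ is an open map. (b) If $\beta\circ\phi=\phi\circ\alpha$, then $\phi(G)$ is closed in $H$.
   Context: A locally compact contraction group is a pair $(G,\alpha)$ where $G$ is a (Hausdorff) locally compact group and $\alpha\colon G\to G$ is a bicontinuous automorphism with $\alpha^n(x)\to e$ as $n\to\infty$ for each $x\in G$. $\mathrm{tor}(G)$ denotes the set of all torsion elements (elements of finite order) of $G$. *)

theory Defs
  imports "HOL-Analysis.Analysis" "HOL-Algebra.Group"
begin

(* HOL-Analysis offers the type class topological_group_add, whose groups are whole types.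
   Here a topological group is an explicit carrier with a topology on it, so that subgroups
   and quotients are topological groups too. Commutativity is not assumed. *)

locale topological_group = group G for G (structure) +
  fixes T :: "'a topology"
  assumes topspace_eq_carrier: "topspace T = carrier G"
    and continuous_map_mult:
      "continuous_map (prod_topology T T) T (\<lambda>(x, y). x \<otimes> y)"
    and continuous_map_inv: "continuous_map T T (\<lambda>x. inv x)"

(* Only the values of \<alpha> on the carrier matter. *)

locale locally_compact_contraction_group = topological_group G T
  for G (structure) and T :: "'a topology" +
  fixes \<alpha> :: "'a \<Rightarrow> 'a"
  assumes Hausdorff: "Hausdorff_space T"
    and locally_compact: "locally_compact_space T"
    and automorphism: "\<alpha> \<in> iso G G"
    and bicontinuous: "homeomorphic_map T T \<alpha>"
    and contractive: "\<And>x. x \<in> carrier G \<Longrightarrow> limitin T (\<lambda>n. (\<alpha> ^^ n) x) \<one> sequentially"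

definition tor :: "('a, 'b) monoid_scheme \<Rightarrow> 'a set" where
  "tor G = {x \<in> carrier G. \<exists>n::nat. n > 0 \<and> x [^]\<^bsub>G\<^esub> n = \<one>\<^bsub>G\<^esub>}"

end

theory Submission
  imports Defs "HOL-Algebra.Coset" "HOL-Algebra.Generated_Groups" "HOL-Algebra.FiniteProduct"
begin

text \<open>
  A compact identity neighbourhood \<open>K\<close> can be chosen so that the balls \<open>\<alpha>\<^sup>k(K)\<close>, for integers \<open>k\<close>,
  are a basis at the identity and exhaust the group; closedness and continuity are then statements
  about these balls, and compactness arguments reduce to one scale by rescaling with \<open>\<alpha>\<close>.

  For an equivariant homomorphism, a point outside the kernel can be rescaled into a fixed annulus
  around the kernel, where its image stays away from the identity by compactness. Hence elements
  with small images lie close to the kernel, and the image is closed.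

  For part (a) the torsion must be separated from the rest. Let \<open>M\<close> be a minimal nontrivial closed
  \<open>\<alpha>\<close>-stable normal subgroup. It has small neighbourhoods that are invariant under conjugation. If
  these generate small subgroups, \<open>M\<close> is locally finite of finite exponent or it is abelian.
  Otherwise \<open>M\<close> is abelian: a convolution with respect to an invariant functional has first
  differences of order \<open>e\<close> but differences of order \<open>e\<^sup>2\<close> on commutators, so that commutators
  cannot generate. An abelian \<open>M\<close> without torsion is uniquely divisible and central, and for a
  suitable power \<open>p\<close> the map raising to the exponent \<open>(m / (m + 1))\<^sup>p\<close> contracts it by one scale.

  By the chain condition on such subgroups, \<open>G\<close> has a normal subgroup \<open>R\<close> of finite exponent for
  which \<open>G / R\<close> has unique roots, is divisible and is contracted by the maps above; the transfer
  moves torsion past central extensions. Thus \<open>R = tor(G)\<close>. If \<open>\<phi>(R)\<close> is closed, a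
  homomorphism commutes with these power maps modulo torsion, so they can play the role of \<open>\<alpha>\<close> in
  the annulus argument even though \<open>\<phi>\<close> is not equivariant. Openness onto a closed image is the
  open mapping theorem, by the Baire category theorem.
\<close>

text \<open>In (a) the map \<open>\<phi>\<close> need not intertwine \<open>\<alpha>\<close> and
  \<open>\<beta>\<close>, so no rescaling argument applies to it directly: a homomorphism respects
  only what the group law defines. Raising to a rational exponent is of this kind once roots exist
  and are unique. The exponent \<open>m / (m + 1)\<close> is made for two opposite situations. It is
  less than 1, so its powers contract factors resembling real vector spaces; and if a suitable
  factorial divides \<open>m\<close>, they also contract factors resembling p-adic groups, where
  \<open>m\<close> is small and \<open>m + 1\<close> is a unit. Integers would expand the former,
  reciprocals of integers the latter. Different factors need different \<open>m\<close> and
  \<open>p\<close>, so divisibility conditions on \<open>m\<close> are kept and exponents are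
  multiplied.

  That a minimal subgroup generated by each of its balls is abelian is shown without Lie theory. In
  a Lie group, commutators of elements of size \<open>e\<close> have size \<open>e ^ 2\<close>;
  iterated convolution yields functions so smooth along commutators that, if small elements were
  bounded products of commutators up to finer remainders, these functions would be constant.\<close>

context group
begin

lemma mult_inv_cancel [simp]: "x : carrier G ==> y : carrier G ==> x \<otimes> (inv x \<otimes> y) = y"
  by (simp flip: m_assoc)

lemma inv_mult_cancel [simp]: "x : carrier G ==> y : carrier G ==> inv x \<otimes> (x \<otimes> y) = y"
  by (simp flip: m_assoc)

definition cj :: "'a => 'a => 'a" where "cj g x = g \<otimes> x \<otimes> inv g"

definition comm :: "'a => 'a => 'a" where "comm g x = g \<otimes> x \<otimes> inv g \<otimes> inv x"

lemma cj_closed [simp]: "g : carrier G ==> x : carrier G ==> cj g x : carrier G"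
  by (simp add: cj_def)

lemma comm_closed [simp]: "g : carrier G ==> x : carrier G ==> comm g x : carrier G"
  by (simp add: comm_def)

lemma cj_mult: "g : carrier G ==> x : carrier G ==> y : carrier G ==>
    cj g (x \<otimes> y) = cj g x \<otimes> cj g y"
  by (simp add: cj_def m_assoc)

lemma cj_cj: "g : carrier G ==> h : carrier G ==> x : carrier G ==>
    cj g (cj h x) = cj (g \<otimes> h) x"
  by (simp add: cj_def m_assoc inv_mult_group)

lemma cj_inv: "g : carrier G ==> x : carrier G ==> cj g (inv x) = inv (cj g x)"
  by (simp add: cj_def m_assoc inv_mult_group)

lemma cj_one [simp]: "g : carrier G ==> cj g \<one> = \<one>"
  by (simp add: cj_def)

lemma cj_by_one [simp]: "x : carrier G ==> cj \<one> x = x"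
  by (simp add: cj_def)

lemma cj_inv_cancel [simp]: "g : carrier G ==> x : carrier G ==> cj g (cj (inv g) x) = x"
  "g : carrier G ==> x : carrier G ==> cj (inv g) (cj g x) = x"
  by (simp_all add: cj_cj)

lemma comm_cj: "g : carrier G ==> x : carrier G ==> comm g x = cj g x \<otimes> inv x"
  by (simp add: cj_def comm_def)

lemma cj_comm: "g : carrier G ==> x : carrier G ==> cj g x = comm g x \<otimes> x"
  by (simp add: cj_def comm_def m_assoc)

lemma cj_comm_distrib: "h : carrier G ==> g : carrier G ==> x : carrier G ==>
    cj h (comm g x) = comm (cj h g) (cj h x)"
  by (simp add: cj_def comm_def m_assoc inv_mult_group)

lemma cj_pow: "g : carrier G ==> x : carrier G ==> cj g (x [^] (n::nat)) = cj g x [^] n"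
  by (induction n) (simp_all add: cj_mult)

lemma comm_one_iff: "g : carrier G ==> x : carrier G ==> comm g x = \<one> \<longleftrightarrow> g \<otimes> x = x \<otimes> g"
  by (metis comm_cj cj_def cj_closed inv_closed inv_equality inv_inv inv_solve_right m_closed r_inv)

lemma inv_comm: "g : carrier G ==> x : carrier G ==> inv (comm g x) = comm x g"
  by (simp add: comm_def m_assoc inv_mult_group)

lemma rcos_eq_iff:
  assumes A: "subgroup A G" and xy: "x : carrier G" "y : carrier G"
  shows "A #> x = A #> y \<longleftrightarrow> x \<otimes> inv y : A"
proof
  assume "A #> x = A #> y"
  then have "x : A #> y" using rcos_self[OF xy(1) A] by simp
  then show "x \<otimes> inv y : A" using subgroup.rcos_module_imp[OF A is_group] xy by blast
next
  assume "x \<otimes> inv y : A"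
  then have "x : A #> y" using subgroup.rcos_module_rev[OF A is_group] xy by blast
  then show "A #> x = A #> y" using repr_independence[OF _ xy(2) A] by simp
qed

end

text \<open>The axioms keep what a compact symmetric identity neighbourhood \<open>K\<close> provides once
  \<open>a k\<close> is the \<open>k\<close>-th power of the contraction: the balls \<open>B k\<close> shrink as \<open>k\<close> grows, and
  \<open>K_comp\<close> is compactness in the form of cluster points.\<close>

locale contraction_balls = group G for G (structure) +
  fixes a :: "int => 'a => 'a" and K :: "'a set"
  assumes a_closed [simp]: "x : carrier G ==> a k x : carrier G"
    and a_mult: "x : carrier G ==> y : carrier G ==> a k (x \<otimes> y) = a k x \<otimes> a k y"
    and a_add: "x : carrier G ==> a (j + k) x = a j (a k x)"
    and a_zero: "x : carrier G ==> a 0 x = x"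
    and K_sub: "K <= carrier G" and one_K: "\<one> : K" and inv_K: "x : K ==> inv x : K"
    and K_cube: "x : a 1 ` K ==> y : a 1 ` K ==> z : a 1 ` K ==> x \<otimes> y \<otimes> z : K"
    and K_sep: "x : carrier G ==> (!!n::nat. x : a (int n) ` K) ==> x = \<one>"
    and K_exh: "x : carrier G ==> EX n::nat. x : a (- int n) ` K"
    and K_conj: "g : carrier G ==> EX n::nat. ALL x:a (int n) ` K. cj g x : K"
    and K_comp: "(!!n::nat. s n : K) ==> EX x:K. ALL k N. EX n>=N. inv x \<otimes> s n : a (int k) ` K"
begin

section \<open>Balls, cluster points and compactness\<close>

definition B :: "int => 'a set" where "B k = a k ` K"

lemma a_cancel [simp]: "x : carrier G ==> a (- k) (a k x) = x" "x : carrier G ==> a k (a (- k) x) = x"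
  using a_add[of x "- k" k] a_add[of x k "- k"] a_zero[of x] by simp_all

lemma a_inj: "x : carrier G ==> y : carrier G ==> a k x = a k y \<longleftrightarrow> x = y"
  by (metis a_cancel(1))

lemma a_one [simp]: "a k \<one> = \<one>"
  by (metis a_closed a_mult l_one one_closed r_cancel_one')

lemma a_inv: "x : carrier G ==> a k (inv x) = inv (a k x)"
  by (metis a_closed a_mult a_one inv_closed inv_equality l_inv)

lemma a_pow: "x : carrier G ==> a k (x [^] (n::nat)) = a k x [^] n"
  by (induction n) (simp_all add: a_mult)

lemma a_cj: "x : carrier G ==> g : carrier G ==> a k (cj g x) = cj (a k g) (a k x)"
  by (simp add: cj_def a_mult a_inv)

lemma a_comm: "x : carrier G ==> g : carrier G ==> a k (comm g x) = comm (a k g) (a k x)"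
  by (simp add: comm_def a_mult a_inv)

lemma B_carrier: "x : B k ==> x : carrier G"
  using K_sub by (auto simp: B_def)

lemma B_sub: "B k <= carrier G"
  using B_carrier by auto

lemma B_one [simp]: "\<one> : B k"
  using one_K a_one by (metis B_def image_eqI)

lemma B_0: "B 0 = K"
  using K_sub by (force simp: B_def a_zero)

lemma a_B: "x : B j ==> a k x : B (k + j)"
  using K_sub by (auto simp: B_def a_add intro!: image_eqI[of _ "a (k + j)"])

lemma a_B_iff: assumes x: "x : carrier G" shows "a k x : B j \<longleftrightarrow> x : B (j - k)"
proof
  { assume "a k x : B j"
    from a_B[OF this, of "-k"] show "x : B (j - k)" using x by simp }
  { assume "x : B (j - k)"
    from a_B[OF this, of k] show "a k x : B j" by simp }
qed

lemma B_inv: "x : B k ==> inv x : B k"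
proof -
  assume "x : B k"
  then obtain y where y: "y : K" "x = a k y" by (auto simp: B_def)
  then have "inv x = a k (inv y)" using a_inv K_sub by auto
  then show ?thesis using inv_K[OF y(1)] by (simp add: B_def)
qed

lemma B_cube: assumes "x : B (k + 1)" "y : B (k + 1)" "z : B (k + 1)" shows "x \<otimes> y \<otimes> z : B k"
proof -
  have "a (-k) x : B 1" "a (-k) y : B 1" "a (-k) z : B 1"
    using assms[THEN a_B, of "-k"] by simp_all
  then have "a (-k) x \<otimes> a (-k) y \<otimes> a (-k) z : B 0"
    using K_cube unfolding B_0 by (simp add: B_def)
  then have "a (-k) (x \<otimes> y \<otimes> z) : B 0"
    using assms by (simp add: a_mult B_carrier)
  then show ?thesis
    using assms by (simp add: a_B_iff B_carrier)
qed

lemma B_mult: "x : B (k + 1) ==> y : B (k + 1) ==> x \<otimes> y : B k"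
  using B_cube[of x k y \<one>] by (simp add: B_carrier)

lemma B_step: "B (k + 1) <= B k"
  using B_mult[of _ k \<one>] by (auto simp: B_carrier)

lemma B_mono: assumes "j <= k" shows "B k <= B j"
proof -
  have "B (j + int n) <= B j" for n
  proof (induction n)
    case (Suc n)
    have "B (j + int (Suc n)) <= B (j + int n)" using B_step[of "j + int n"] by (simp add: algebra_simps)
    then show ?case using Suc by blast
  qed simp
  from this[of "nat (k - j)"] show ?thesis using assms by simp
qed

lemma B_monoD: "x : B k ==> j <= k ==> x : B j"
  using B_mono by blast

lemma B_mult': "x : B i ==> y : B j ==> k < i ==> k < j ==> x \<otimes> y : B k"
  by (rule B_mult) (rule B_monoD, assumption, simp)+

lemma B_sep: "x : carrier G ==> (!!n::nat. x : B (int n)) ==> x = \<one>"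
  using K_sep by (simp add: B_def)

lemma B_exh: assumes "x : carrier G" obtains n where "x : B (- int n)"
  using K_exh[OF assms] by (auto simp: B_def)

lemma B_conj: assumes "g : carrier G" obtains n where "ALL x:B n. cj g x : B k"
proof -
  obtain m :: nat where m: "!!x. x : B (int m) ==> cj (a (-k) g) x : B 0"
    using K_conj[of "a (-k) g"] assms unfolding B_0 by (auto simp: B_def)
  have "cj g x : B k" if "x : B (int m + k)" for x
  proof -
    have x: "x : carrier G" using that by (rule B_carrier)
    have "a (-k) x : B (int m)" using that x by (simp add: a_B_iff)
    from m[OF this] have "a (-k) (cj g x) : B 0"
      using x assms by (simp add: a_cj)
    then show ?thesis using x assms by (simp add: a_B_iff)
  qed
  then show ?thesis using that by blast
qed

text \<open>Cluster points instead of convergent subsequences: later arguments only ever use one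
  late index at one prescribed scale.\<close>

definition clus :: "(nat => 'a) => 'a => bool" where
  "clus s x \<longleftrightarrow> (ALL k N. EX n>=N. inv x \<otimes> s n : B k)"

lemma clusD: assumes "clus s x" obtains n where "n >= N" "inv x \<otimes> s n : B k"
  using assms unfolding clus_def by metis

lemma B_cluster:
  assumes "!!n::nat. s n : B j"
  obtains x where "x : B j" "clus s x"
proof -
  have s: "s n : carrier G" for n using assms B_carrier by blast
  have "a (-j) (s n) : K" for n
    using assms a_B[of "s n" j "-j"] B_0 by simp
  from K_comp[of "%n. a (-j) (s n)", OF this] obtain x where x: "x : K"
      "!!k N. EX n>=N. inv x \<otimes> a (-j) (s n) : B (int k)"
    unfolding B_def[symmetric] by blast
  have xc: "x : carrier G" using x K_sub by auto
  show thesis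
  proof
    show "a j x : B j" using x(1) by (simp add: B_def)
    show "clus s (a j x)" unfolding clus_def
    proof (intro allI)
    fix k N
    obtain n where n: "n >= N" "inv x \<otimes> a (-j) (s n) : B (int (nat (k - j)))"
      using x(2) by blast
    then have "a j (inv x \<otimes> a (-j) (s n)) : B (j + int (nat (k - j)))"
      using a_B by blast
    then have "inv (a j x) \<otimes> s n : B (j + int (nat (k - j)))"
      using xc s by (simp add: a_mult a_inv)
    moreover have "k <= j + int (nat (k - j))" by simp
    ultimately show "EX n>=N. inv (a j x) \<otimes> s n : B k"
      using n(1) B_monoD by blast
    qed
  qed
qed

text \<open>Closedness expressed by left translates of balls. No topology is present at this level;
  \<open>clo_iff_closedin\<close> makes the connection at the end.\<close>

definition clo :: "'a set => bool" where
  "clo X \<longleftrightarrow> X <= carrier G & (ALL x:carrier G. (ALL k. EX b:B k. x \<otimes> b : X) --> x : X)"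

lemma cloI: "X <= carrier G ==> (!!x. x : carrier G ==> (!!k. EX b:B k. x \<otimes> b : X) ==> x : X) ==> clo X"
  by (simp add: clo_def)

lemma cloD: "clo X ==> x : carrier G ==> (!!k. EX b:B k. x \<otimes> b : X) ==> x : X"
  by (auto simp: clo_def)

lemma clo_sub: "clo X ==> X <= carrier G"
  by (simp add: clo_def)

lemma clo_carrier [simp]: "clo (carrier G)"
  by (simp add: clo_def)

lemma clo_INT:
  assumes "!!i. i : I ==> clo (X i)" "I ~= {}" shows "clo (\<Inter>i\<in>I. X i)"
proof (rule cloI)
  show "(\<Inter>i\<in>I. X i) <= carrier G" using assms clo_sub by fastforce
  fix x assume x: "x : carrier G" and *: "!!k. EX b:B k. x \<otimes> b : (\<Inter>i\<in>I. X i)"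
  have "x : X i" if "i : I" for i
    by (rule cloD[OF assms(1)[OF that] x]) (use * that in fastforce)
  then show "x : (\<Inter>i\<in>I. X i)" by blast
qed

lemma clo_Int: "clo X ==> clo Y ==> clo (X \<inter> Y)"
  using clo_INT[of "{X, Y}" "%x. x"] by auto

lemma clo_B [simp]: "clo (B j)"
proof (rule cloI[OF B_sub])
  fix x assume x: "x : carrier G" and *: "!!k. EX b:B k. x \<otimes> b : B j"
  have "ALL n. EX b. b : B (int n) & x \<otimes> b : B j" using * by blast
  from choice[OF this] obtain b where "ALL n. b n : B (int n) & x \<otimes> b n : B j" ..
  then have b: "!!n::nat. b n : B (int n)" "!!n::nat. x \<otimes> b n : B j" by auto
  obtain y where y: "y : B j" "clus (%n. x \<otimes> b n) y"
    by (rule B_cluster[of "%n. x \<otimes> b n" j, OF b(2)])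
  have yc: "y : carrier G" using y B_carrier by blast
  have "inv y \<otimes> x : B (int k)" for k
  proof -
    obtain n where n: "n >= Suc k" "inv y \<otimes> (x \<otimes> b n) : B (int k + 1)"
      by (rule clusD[OF y(2)])
    have "b n : B (int k + 1)" by (rule B_monoD[OF b(1)]) (use n in simp)
    from B_mult[OF n(2) B_inv[OF this]] have "inv y \<otimes> (x \<otimes> b n) \<otimes> inv (b n) : B (int k)" .
    then show ?thesis using x yc b(1)[of n] by (simp add: m_assoc B_carrier)
  qed
  then have "inv y \<otimes> x = \<one>" using B_sep x yc by simp
  then have "x = y" using x yc by (metis inv_closed inv_equality inv_inv)
  then show "x : B j" using y by simp
qed

lemma clo_cluster:
  assumes "!!n::nat. s n : C" "C <= B j" "clo C"
  obtains x where "x : C" "clus s x"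
proof -
  have "s n : B j" for n using assms by blast
  then obtain x where x: "x : B j" "clus s x"
    by (rule B_cluster)
  have xc: "x : carrier G" using x B_carrier by blast
  have "x : C"
  proof (rule cloD[OF assms(3) xc])
    fix k
    obtain n where "n >= 0" "inv x \<otimes> s n : B k" by (rule clusD[OF x(2)])
    moreover have "x \<otimes> (inv x \<otimes> s n) : C"
      using assms xc clo_sub[OF assms(3)] by (metis in_mono mult_inv_cancel)
    ultimately show "EX b:B k. x \<otimes> b : C" by blast
  qed
  with x(2) show thesis using that by blast
qed

text \<open>This replaces finite subcovers. If no single \<open>n\<close> worked, counterexamples
  \<open>s n\<close> would cluster at some \<open>x\<close> in \<open>C\<close>, and the bound valid
  near \<open>x\<close> would, by monotonicity, hold at a late counterexample as well.\<close>

lemma unif: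
  assumes C: "C <= B j" "clo C"
    and loc: "!!x. x : C ==> EX (n::nat) k. ALL b:B k. x \<otimes> b : C --> P (x \<otimes> b) n"
    and mono: "!!x m n. x : C ==> P x m ==> m <= n ==> P x n"
  shows "EX n. ALL x:C. P x n"
proof (rule ccontr)
  assume "~ ?thesis"
  then have "ALL n. EX x. x : C & ~ P x n" by auto
  from choice[OF this] obtain s where "ALL n. s n : C & ~ P (s n) n" ..
  then have s: "!!n. s n : C" "!!n. ~ P (s n) n" by auto
  obtain x where x: "x : C" "clus s x"
    by (rule clo_cluster[OF s(1) C])
  obtain n k where nk: "!!b. b : B k ==> x \<otimes> b : C ==> P (x \<otimes> b) n"
    using loc[OF x(1)] by blast
  obtain m where m: "m >= n" "inv x \<otimes> s m : B k" by (rule clusD[OF x(2)])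
  have "x \<otimes> (inv x \<otimes> s m) = s m"
    using x(1) s(1) clo_sub[OF C(2)] by (meson in_mono mult_inv_cancel)
  then have "P (s m) n" using nk[OF m(2)] s(1) by simp
  then show False using mono[OF s(1)] m(1) s(2) by blast
qed

text \<open>A bound for conjugation by \<open>g\<close> persists near \<open>g\<close>: a further
  factor \<open>b\<close> from \<open>B (m + 1)\<close> moves \<open>B (m + 1)\<close> only into
  \<open>B m\<close>, because cubes lose one scale. Compactness of \<open>B j\<close> then makes it
  uniform.\<close>

lemma conj_unif: obtains n where "ALL g:B j. ALL x:B n. cj g x : B k"
proof -
  define P where "P g n \<longleftrightarrow> (ALL x:B (int n). cj g x : B k)" for g and n :: nat
  have "EX n. ALL g:B j. P g n"
  proof (rule unif[where j = j])
    fix g assume "g : B j"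
    then have g: "g : carrier G" by (rule B_carrier)
    then obtain m where m: "ALL x:B m. cj g x : B k" by (rule B_conj)
    have "P (g \<otimes> b) (nat (m + 1))" if b: "b : B (m + 1)" for b
      unfolding P_def
    proof
      fix x assume x: "x : B (int (nat (m + 1)))"
      then have x: "x : B (m + 1)" by (rule B_monoD) simp
      have "cj b x : B m" unfolding cj_def by (rule B_cube[OF b x B_inv[OF b]])
      then have "cj g (cj b x) : B k" using m by blast
      then show "cj (g \<otimes> b) x : B k" using g b x by (simp add: cj_cj B_carrier)
    qed
    then show "EX n k. ALL b:B k. g \<otimes> b : B j --> P (g \<otimes> b) n" by blast
  next
    fix x m n assume "P x m" "m <= n"
    then show "P x n" unfolding P_def using B_monoD[of _ "int n" "int m"] by simp
  qed auto
  then show thesis using that unfolding P_def by blast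
qed

text \<open>If finitely many translates never suffice, a greedy choice produces a sequence in which
  no term lies in the translate of an earlier one; two terms near a common cluster point contradict
  this.\<close>

lemma totally_bounded: obtains F where "finite F" "F <= B j" "B j <= (\<Union>f\<in>F. (%b. f \<otimes> b) ` B k)"
proof -
  have "EX F. finite F & F <= B j & B j <= (\<Union>f\<in>F. (%b. f \<otimes> b) ` B k)"
  proof (rule ccontr)
    assume no: "~ ?thesis"
    define P where "P s n r \<longleftrightarrow> r : B j & r ~: (\<Union>f\<in>s ` {..<n}. (%b. f \<otimes> b) ` B k)"
      for s :: "nat => 'a" and n :: nat and r
    have "EX s. ALL n. P s n (s n)"
    proof (rule dependent_wellorder_choice)
      fix f g :: "nat => 'a" and x r
      assume "!!y. y < x ==> f y = g y"
      then have "f ` {..<x} = g ` {..<x}" by auto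
      then show "P f x r = P g x r" unfolding P_def by presburger
    next
      fix n :: nat and f :: "nat => 'a"
      assume "!!y. y < n ==> P f y (f y)"
      then have "finite (f ` {..<n})" "f ` {..<n} <= B j" unfolding P_def by auto
      then show "EX r. P f n r" unfolding P_def
        using no by blast
    qed
    then obtain s where "ALL n. P s n (s n)" ..
    then have s: "!!n::nat. s n : B j" "!!n. s n ~: (\<Union>f\<in>s ` {..<n}. (%b. f \<otimes> b) ` B k)"
      unfolding P_def by auto
    obtain x where x: "x : B j" "clus s x"
      by (rule B_cluster[OF s(1)])
    obtain m where "m >= 0" and m: "inv x \<otimes> s m : B (k + 1)" by (rule clusD[OF x(2)])
    obtain n where n: "n >= Suc m" "inv x \<otimes> s n : B (k + 1)" by (rule clusD[OF x(2)])
    have c: "x : carrier G" "s n : carrier G" "s m : carrier G" using x s B_carrier by blast+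
    have "inv (inv x \<otimes> s m) \<otimes> (inv x \<otimes> s n) : B k" by (rule B_mult[OF B_inv[OF m] n(2)])
    then have "inv (s m) \<otimes> s n : B k" using c by (simp add: inv_mult_group m_assoc)
    moreover have "s n = s m \<otimes> (inv (s m) \<otimes> s n)" using c by simp
    ultimately show False using s(2)[of n] n(1) by (auto simp: image_iff)
  qed
  then show thesis using that by blast
qed

end

section \<open>Closed stable subgroups\<close>

context contraction_balls
begin

definition cas :: "'a set => bool" where
  "cas A \<longleftrightarrow> subgroup A G & clo A & (ALL k. ALL x:A. a k x : A)"

definition cn :: "'a set => bool" where
  "cn A \<longleftrightarrow> cas A & (ALL g:carrier G. ALL x:A. cj g x : A)"

lemma cas_subgroup: "cas A ==> subgroup A G" and cas_clo: "cas A ==> clo A"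
  and cas_a: "cas A ==> x : A ==> a k x : A"
  by (simp_all add: cas_def)

lemma cas_carrier: "cas A ==> x : A ==> x : carrier G"
  using cas_clo clo_sub by blast

lemma cas_mult: "cas A ==> x : A ==> y : A ==> x \<otimes> y : A"
  and cas_inv: "cas A ==> x : A ==> inv x : A"
  and cas_one: "cas A ==> \<one> : A"
  by (simp_all add: cas_subgroup subgroup.m_closed subgroup.m_inv_closed subgroup.one_closed)

lemma cas_cancel_left: "cas A ==> d : A ==> x : carrier G ==> d \<otimes> x : A \<longleftrightarrow> x : A"
  using cas_mult[of A d x] cas_mult[of A "inv d" "d \<otimes> x"] cas_inv[of A d] cas_carrier[of A d] by auto

lemma cas_pow: "cas A ==> x : A ==> x [^] (n::nat) : A"
  by (induction n) (auto intro: cas_one cas_mult)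

lemma cas_whole: "cas (carrier G)"
  by (simp add: cas_def subgroup_self)

lemma clo_trivial: "clo {\<one>}"
proof (rule cloI)
  fix x assume x: "x : carrier G" and *: "!!k. EX b:B k. x \<otimes> b : {\<one>}"
  have "x : B (int n)" for n
  proof -
    obtain b where b: "b : B (int n)" "x \<otimes> b = \<one>" using * by auto
    then have "x = inv b" using x B_carrier inv_equality by metis
    then show ?thesis using b B_inv by simp
  qed
  then show "x : {\<one>}" using B_sep x by blast
qed simp

lemma cas_trivial: "cas {\<one>}"
  by (simp add: cas_def clo_trivial triv_subgroup)

lemma cas_Inter: assumes "!!X. X : F ==> cas X" "F ~= {}" shows "cas (\<Inter>F)"
  unfolding cas_def
proof (intro conjI)
  show "subgroup (\<Inter>F) G" using assms cas_subgroup by (intro subgroups_Inter) auto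
  show "clo (\<Inter>F)" using clo_INT[of F "%x. x"] assms cas_clo by auto
  show "ALL k. ALL x:\<Inter>F. a k x : \<Inter>F" using assms cas_a by auto
qed

lemma cn_cas: "cn A ==> cas A" and cn_cj: "cn A ==> g : carrier G ==> x : A ==> cj g x : A"
  by (simp_all add: cn_def)

lemma cn_trivial: "cn {\<one>}" and cn_whole: "cn (carrier G)"
  by (simp_all add: cn_def cas_trivial cas_whole)

lemma cn_normal: "cn A ==> A \<lhd> G"
  unfolding normal_inv_iff using cn_cas[of A] cas_subgroup[of A] cn_cj[of A] by (auto simp: cj_def)

subsection \<open>Relative balls and chain conditions\<close>

definition nb :: "'a set => int => 'a set" where
  "nb A k = {d \<otimes> b | d b. d : A & b : B k}"

lemma nbI: "d : A ==> b : B k ==> d \<otimes> b : nb A k"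
  by (auto simp: nb_def)

lemma nbE: assumes "x : nb A k" obtains d b where "d : A" "b : B k" "x = d \<otimes> b"
  using assms by (auto simp: nb_def)

lemma nb_mono: "j <= k ==> nb A k <= nb A j"
  unfolding nb_def using B_monoD by blast

lemma nb_mono_set: "A <= A' ==> nb A k <= nb A' k"
  by (auto simp: nb_def)

lemma nb_a: assumes "cas A" "x : nb A k" shows "a j x : nb A (j + k)"
proof -
  obtain d b where "d : A" "b : B k" "x = d \<otimes> b" using nbE assms(2) .
  then have "a j x = a j d \<otimes> a j b" "a j d : A" "a j b : B (j + k)"
    using assms(1) a_mult a_B cas_a cas_carrier B_carrier by auto
  then show ?thesis using nbI by metis
qed

lemma nb_left: assumes "cas A" "d : A" "x : nb A k" shows "d \<otimes> x : nb A k"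
proof -
  obtain e b where "e : A" "b : B k" "x = e \<otimes> b" using nbE assms(3) .
  then have "d \<otimes> x = (d \<otimes> e) \<otimes> b" "d \<otimes> e : A"
    using assms cas_carrier B_carrier cas_mult by (auto simp: m_assoc)
  then show ?thesis using nbI \<open>b : B k\<close> by metis
qed

lemma nb_self: "cas A ==> x : A ==> x : nb A k"
  using nbI[of x A \<one> k] cas_carrier by auto

lemma nb_B: "cas A ==> x : B k ==> x : nb A k"
  using nbI[of \<one> A x k] cas_one B_carrier by auto

lemma nb_exh: assumes "cas A" "x : carrier G" obtains n :: nat where "x : nb A (- int n)"
  using B_exh[OF assms(2)] nb_B[OF assms(1)] by blast

lemma nb_sep: assumes A: "cas A" and x: "x : carrier G" and *: "!!n::nat. x : nb A (int n)"
  shows "x : A"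
proof (rule cloD[OF cas_clo[OF A] x])
  fix k
  have "x : nb A k" by (rule subsetD[OF nb_mono *[of "nat k"]]) simp
  then obtain d b where d: "d : A" "b : B k" "x = d \<otimes> b" using nbE by blast
  then have "x \<otimes> inv b = d" using A cas_carrier B_carrier by (simp add: m_assoc)
  then have "x \<otimes> inv b : A" using d(1) by simp
  then show "EX b:B k. x \<otimes> b : A" using B_inv[OF d(2)] by blast
qed

text \<open>Rescaling by the contraction brings every point off \<open>A\<close> into the fixed annulus
  around \<open>A\<close>; this replaces all compactness arguments at infinity.\<close>

lemma annulus:
  assumes A: "cas A" and x: "x : carrier G" and k: "x ~: nb A k"
  obtains i where "i >= - k" "a i x : nb A (-1)" "a i x ~: nb A 0"
proof -
  define S where "S = {j. x : nb A j}"
  have bound: "j < k" if "j : S" for j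
    using k nb_mono[of k j A] that unfolding S_def by (meson mem_Collect_eq not_le subsetD)
  obtain n :: nat where n: "x : nb A (- int n)" using nb_exh[OF A x] .
  define T where "T = S \<inter> {- int n..k}"
  have T: "finite T" "- int n : T"
    using n bound unfolding T_def S_def by (auto intro: less_imp_le)
  define j where "j = Max T"
  have j: "j : T" using Max_in[of T] T unfolding j_def by blast
  have "j + 1 ~: S"
  proof
    assume h: "j + 1 : S"
    then have "j + 1 : T" using j bound[OF h] unfolding T_def by auto
    then show False using Max_ge[of T "j + 1"] T unfolding j_def by linarith
  qed
  moreover have "j : S" "j < k" using j bound unfolding T_def by auto
  moreover have "x : nb A (j + 1)" if "a (- (j + 1)) x : nb A 0"
    using nb_a[OF A that, of "j + 1"] a_cancel(2)[OF x, of "j + 1"] by simp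
  moreover have "x : nb A j ==> a (- (j + 1)) x : nb A (-1)"
    using nb_a[OF A, of x j "- (j + 1)"] by simp
  ultimately show thesis using that[of "- (j + 1)"] unfolding S_def by auto
qed

text \<open>A point of \<open>X\<close> off \<open>A\<close> could be rescaled into the annulus
  around \<open>A\<close>; removing its factor in \<open>A\<close> leaves a point of
  \<open>X\<close> in \<open>B (-1)\<close> that \<open>ann\<close> excludes. Inclusion is thereby
  decided at a single scale, which turns both chain conditions into compactness statements.\<close>

lemma annulus_subset:
  assumes A: "cas A" and X: "X <= carrier G" "!!x k. x : X ==> a k x : X"
    "!!d x. d : A ==> x : X ==> d \<otimes> x : X" and ann: "X \<inter> B (-1) <= nb A 0"
  shows "X <= A"
proof
  fix x assume x: "x : X"
  then have xc: "x : carrier G" using X by auto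
  show "x : A"
  proof (rule ccontr)
    assume "x ~: A"
    then obtain n :: nat where "x ~: nb A (int n)" using nb_sep[OF A xc] by blast
    then obtain i where i: "a i x : nb A (-1)" "a i x ~: nb A 0" using annulus[OF A xc] by metis
    obtain d y where d: "d : A" "y : B (-1)" "a i x = d \<otimes> y" using nbE[OF i(1)] .
    have "y = inv d \<otimes> a i x" using d A cas_carrier B_carrier by auto
    then have "y : X" using X(2,3) x d cas_inv[OF A] by metis
    then have "y : nb A 0" using d ann by auto
    then have "a i x : nb A 0" using nb_left[OF A d(1)] d(3) by simp
    then show False using i by simp
  qed
qed

lemma annulus_cas: assumes "cas A" "cas X" "A <= X" "X \<inter> B (-1) <= nb A 0" shows "X = A"
proof -
  have "X <= A"
    by (rule annulus_subset) (use assms cas_a cas_mult cas_carrier in auto)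
  then show ?thesis using assms by auto
qed

text \<open>Compactness of \<open>B (-1)\<close> forces some \<open>X n\<close>, inside that ball,
  to lie close to the intersection \<open>A\<close>; by \<open>annulus_cas\<close> it then equals
  \<open>A\<close>.\<close>

lemma DCC:
  assumes X: "!!n::nat. cas (X n)" and dec: "!!n. X (Suc n) <= X n"
  shows "EX n. ALL m>=n. X m = X n"
proof -
  define A where "A = (\<Inter>n. X n)"
  have A: "cas A" unfolding A_def by (rule cas_Inter) (use X in auto)
  have mono: "X n <= X m" if "m <= n" for m n using lift_Suc_antimono_le[of X, OF dec that] .
  have "EX n. X n \<inter> B (-1) <= nb A 0"
  proof (rule ccontr)
    assume "~ ?thesis"
    then have "ALL n. EX x. x : X n \<inter> B (-1) & x ~: nb A 0" by auto
    from choice[OF this] obtain s where "ALL n. s n : X n \<inter> B (-1) & s n ~: nb A 0" ..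
    then have s: "!!n. s n : X n" "!!n. s n : B (-1)" "!!n. s n ~: nb A 0" by auto
    obtain x where x: "x : B (-1)" "clus s x" by (rule B_cluster[OF s(2)])
    have xc: "x : carrier G" using x B_carrier by auto
    have "x : X m" for m
    proof (rule cloD[OF cas_clo[OF X] xc])
      fix k
      obtain n where n: "n >= m" "inv x \<otimes> s n : B k" by (rule clusD[OF x(2)])
      have "x \<otimes> (inv x \<otimes> s n) : X m" using xc s(1)[of n] mono[OF n(1)] cas_carrier[OF X] by auto
      then show "EX b:B k. x \<otimes> b : X m" using n(2) by blast
    qed
    then have "x : A" by (simp add: A_def)
    obtain n where n: "n >= 0" "inv x \<otimes> s n : B 0" by (rule clusD[OF x(2)])
    have "x \<otimes> (inv x \<otimes> s n) : nb A 0" using nbI[OF \<open>x : A\<close> n(2)] .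
    then show False using s(3)[of n] xc cas_carrier[OF X s(1)] by simp
  qed
  then obtain n where n: "X n \<inter> B (-1) <= nb A 0" ..
  have "X n = A" by (rule annulus_cas[OF A X _ n]) (auto simp: A_def)
  then have "ALL m>=n. X m = X n" using mono unfolding A_def by blast
  then show ?thesis ..
qed

definition cl :: "'a set => 'a set" where
  "cl X = {x : carrier G. ALL k. EX b:B k. x \<otimes> b : X}"

lemma clE: assumes "x : cl X" obtains b where "b : B k" "x \<otimes> b : X"
  using assms by (auto simp: cl_def)

lemma cl_carrier: "x : cl X ==> x : carrier G"
  by (simp add: cl_def)

lemma clI: "x : carrier G ==> (!!k. EX b:B k. x \<otimes> b : X) ==> x : cl X"
  by (simp add: cl_def)

lemma cl_superset: "X <= carrier G ==> X <= cl X"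
  by (auto simp: cl_def intro!: bexI[of _ \<one>])

lemma cl_minimal: assumes "clo Y" "X <= Y" shows "cl X <= Y"
proof
  fix x assume x: "x : cl X"
  show "x : Y"
    by (rule cloD[OF assms(1) cl_carrier[OF x]]) (use clE[OF x] assms(2) in blast)
qed

lemma clo_cl: "clo (cl X)"
proof (rule cloI)
  fix x assume x: "x : carrier G" and *: "!!k. EX b:B k. x \<otimes> b : cl X"
  show "x : cl X"
  proof (rule clI[OF x])
    fix k
    obtain b where b: "b : B (k + 1)" "x \<otimes> b : cl X" using * by blast
    obtain c where c: "c : B (k + 1)" "x \<otimes> b \<otimes> c : X" using clE[OF b(2)] .
    have "b \<otimes> c : B k" by (rule B_mult[OF b(1) c(1)])
    moreover have "x \<otimes> (b \<otimes> c) : X" using c x b by (simp add: B_carrier m_assoc)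
    ultimately show "EX b:B k. x \<otimes> b : X" by blast
  qed
qed (auto simp: cl_def)

lemma subgroup_cl: assumes X: "subgroup X G" shows "subgroup (cl X) G"
proof (rule subgroupI)
  note Xc = subgroup.mem_carrier[OF X]
  show "cl X <= carrier G" by (auto simp: cl_def)
  show "cl X ~= {}" using cl_superset[OF subgroup.subset[OF X]] subgroup.one_closed[OF X] by auto
  { fix x assume x: "x : cl X"
    note xc = cl_carrier[OF x]
    show "inv x : cl X"
    proof (rule clI)
      fix k
      obtain n where n: "ALL b:B n. cj x b : B k" by (rule B_conj[OF xc, where k = k])
      obtain b where b: "b : B n" "x \<otimes> b : X" using clE[OF x] .
      have "inv (x \<otimes> b) : X" using X b subgroup.m_inv_closed by metis
      moreover have "inv (x \<otimes> b) = inv x \<otimes> cj x (inv b)"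
        using xc b by (simp add: cj_def inv_mult_group m_assoc B_carrier)
      moreover have "cj x (inv b) : B k" using n B_inv[OF b(1)] by blast
      ultimately show "EX b:B k. inv x \<otimes> b : X" by auto
    qed (use xc in simp) }
  { fix x y assume x: "x : cl X" and y: "y : cl X"
    note xc = cl_carrier[OF x] and yc = cl_carrier[OF y]
    show "x \<otimes> y : cl X"
    proof (rule clI)
      fix k
      obtain n where n: "ALL b:B n. cj (inv y) b : B (k + 1)" by (rule B_conj[OF inv_closed[OF yc], where k = "k + 1"])
      obtain b where b: "b : B n" "x \<otimes> b : X" using clE[OF x] .
      obtain c where c: "c : B (k + 1)" "y \<otimes> c : X" using clE[OF y] .
      have "(x \<otimes> b) \<otimes> (y \<otimes> c) : X" using X b c subgroup.m_closed by metis
      moreover have "(x \<otimes> b) \<otimes> (y \<otimes> c) = x \<otimes> y \<otimes> (cj (inv y) b \<otimes> c)"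
        using xc yc b c by (simp add: cj_def m_assoc B_carrier)
      moreover have "cj (inv y) b \<otimes> c : B k" by (rule B_mult[OF bspec[OF n b(1)] c(1)])
      ultimately show "EX b:B k. x \<otimes> y \<otimes> b : X" by auto
    qed (use xc yc in simp) }
qed

lemma cas_cl: assumes X: "subgroup X G" "!!x k. x : X ==> a k x : X" shows "cas (cl X)"
  unfolding cas_def
proof (intro conjI allI ballI)
  fix k x assume x: "x : cl X"
  note xc = cl_carrier[OF x]
  show "a k x : cl X"
  proof (rule clI)
    fix j
    obtain b where b: "b : B (j - k)" "x \<otimes> b : X" using clE[OF x] .
    have "a k x \<otimes> a k b : X" using X(2)[OF b(2), of k] b xc by (simp add: a_mult B_carrier)
    moreover have "a k b : B j" using a_B[OF b(1), of k] by simp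
    ultimately show "EX b:B j. a k x \<otimes> b : X" by blast
  qed (use xc in simp)
qed (use X subgroup_cl clo_cl in auto)

lemma cn_cl: assumes X: "subgroup X G" "!!x k. x : X ==> a k x : X"
  "!!g x. g : carrier G ==> x : X ==> cj g x : X" shows "cn (cl X)"
  unfolding cn_def
proof (intro conjI ballI)
  show "cas (cl X)" using X cas_cl by blast
  fix g x assume g: "g : carrier G" and x: "x : cl X"
  note xc = cl_carrier[OF x]
  show "cj g x : cl X"
  proof (rule clI)
    fix k
    obtain n where n: "ALL b:B n. cj g b : B k" by (rule B_conj[OF g, where k = k])
    obtain b where b: "b : B n" "x \<otimes> b : X" using clE[OF x] .
    have "cj g x \<otimes> cj g b : X" using X(3)[OF g b(2)] b xc g by (simp add: cj_mult B_carrier)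
    then show "EX b:B k. cj g x \<otimes> b : X" using bspec[OF n b(1)] by blast
  qed (use xc g in simp)
qed

text \<open>Dual to \<open>DCC\<close>: here the closure of the union is the larger group. Each of
  its points is within \<open>B 1\<close> of some \<open>X n\<close>, so a whole neighbourhood lies
  in \<open>nb (X n) 0\<close>, and \<open>unif\<close> selects one \<open>n\<close> for the
  ball.\<close>

lemma ACC:
  assumes X: "!!n::nat. cas (X n)" and inc: "!!n. X n <= X (Suc n)"
  shows "EX n. ALL m>=n. X m = X n"
proof -
  have mono: "X m <= X n" if "m <= n" for m n using lift_Suc_mono_le[of X, OF inc that] .
  define U where "U = (\<Union>n. X n)"
  have "subgroup U G"
  proof (rule subgroupI)
    show "U <= carrier G" using X cas_carrier by (auto simp: U_def)
    show "U ~= {}" using cas_one[OF X] by (auto simp: U_def)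
    show "inv x : U" if "x : U" for x using that cas_inv[OF X] by (auto simp: U_def)
    show "x \<otimes> y : U" if "x : U" "y : U" for x y
    proof -
      obtain m n where "x : X m" "y : X n" using \<open>x : U\<close> \<open>y : U\<close> unfolding U_def by auto
      then have "x : X (max m n)" "y : X (max m n)" using mono[of m "max m n"] mono[of n "max m n"] by auto
      then show ?thesis using cas_mult[OF X] unfolding U_def by blast
    qed
  qed
  moreover have "a k x : U" if "x : U" for x k using that cas_a[OF X] by (auto simp: U_def)
  ultimately have A: "cas (cl U)" by (rule cas_cl)
  have "EX n. ALL x:cl U \<inter> B (-1). x : nb (X n) 0"
  proof (rule unif)
    show "cl U \<inter> B (-1) <= B (-1)" "clo (cl U \<inter> B (-1))" by (auto intro: clo_Int clo_cl)
    fix x assume "x : cl U \<inter> B (-1)"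
    then have x: "x : cl U" and xc: "x : carrier G" using cl_carrier by auto
    obtain b where b: "b : B 1" "x \<otimes> b : U" using clE[OF x] .
    obtain n where n: "x \<otimes> b : X n" using b(2) by (auto simp: U_def)
    have "x \<otimes> c : nb (X n) 0" if c: "c : B 1" for c
    proof -
      have "inv b \<otimes> c : B 0" by (rule B_mult) (use b c B_inv in auto)
      from nbI[OF n this] show ?thesis using xc b c by (simp add: m_assoc B_carrier)
    qed
    then show "EX n k. ALL b:B k. x \<otimes> b : cl U \<inter> B (-1) --> x \<otimes> b : nb (X n) 0" by blast
  next
    show "x : nb (X n) 0" if "x : nb (X m) 0" "m <= n" for x m n
      using nb_mono_set[OF mono[OF that(2)]] that(1) by blast
  qed
  then obtain n where n: "cl U \<inter> B (-1) <= nb (X n) 0" by blast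
  have XU: "X m <= cl U" for m using cl_superset[of U] X cas_carrier by (fastforce simp: U_def)
  have "cl U = X n" by (rule annulus_cas[OF X A XU n])
  then have "ALL m>=n. X m = X n" using mono XU by blast
  then show ?thesis ..
qed

lemma cas_minimal:
  assumes F: "!!X. X : F ==> cas X" and ne: "F ~= {}"
  obtains M where "M : F" "!!X. X : F ==> X <= M ==> X = M"
proof -
  have "wf {(X, Y). X : F & Y : F & X \<subset> Y}"
    unfolding wf_iff_no_infinite_down_chain
  proof
    assume "EX f. ALL i. (f (Suc i), f i) : {(X, Y). X : F & Y : F & X \<subset> Y}"
    then obtain f where "ALL i. (f (Suc i), f i) : {(X, Y). X : F & Y : F & X \<subset> Y}" ..
    then have f: "!!i. f i : F" "!!i. f (Suc i) \<subset> f i" by auto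
    have "EX n. ALL m>=n. f m = f n" by (rule DCC) (use f F in auto)
    then obtain n where n: "ALL m>=n. f m = f n" ..
    have "f (Suc n) = f n" by (rule n[rule_format]) simp
    then show False using f(2)[of n] by simp
  qed
  moreover obtain X where "X : F" using ne by auto
  ultimately have "EX M:F. ALL Y. (Y, M) : {(X, Y). X : F & Y : F & X \<subset> Y} --> Y ~: F"
    by (rule wf_eq_minimal[THEN iffD1, rule_format])
  then obtain M where M: "M : F" "ALL Y. (Y, M) : {(X, Y). X : F & Y : F & X \<subset> Y} --> Y ~: F" by (rule bexE)
  show thesis
  proof (rule that[OF M(1)])
    fix X assume X: "X : F" "X <= M"
    show "X = M"
    proof (rule ccontr)
      assume "X ~= M"
      then have "(X, M) : {(X, Y). X : F & Y : F & X \<subset> Y}" using X M(1) by simp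
      then show False using M(2) X(1) by blast
    qed
  qed
qed

lemma cas_maximal:
  assumes F: "!!X. X : F ==> cas X" and ne: "F ~= {}"
  obtains M where "M : F" "!!X. X : F ==> M <= X ==> X = M"
proof -
  have "wf {(X, Y). X : F & Y : F & Y \<subset> X}"
    unfolding wf_iff_no_infinite_down_chain
  proof
    assume "EX f. ALL i. (f (Suc i), f i) : {(X, Y). X : F & Y : F & Y \<subset> X}"
    then obtain f where "ALL i. (f (Suc i), f i) : {(X, Y). X : F & Y : F & Y \<subset> X}" ..
    then have f: "!!i. f i : F" "!!i. f i \<subset> f (Suc i)" by auto
    have "EX n. ALL m>=n. f m = f n" by (rule ACC) (use f F in auto)
    then obtain n where n: "ALL m>=n. f m = f n" ..
    have "f (Suc n) = f n" by (rule n[rule_format]) simp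
    then show False using f(2)[of n] by simp
  qed
  moreover obtain X where "X : F" using ne by auto
  ultimately have "EX M:F. ALL Y. (Y, M) : {(X, Y). X : F & Y : F & Y \<subset> X} --> Y ~: F"
    by (rule wf_eq_minimal[THEN iffD1, rule_format])
  then obtain M where M: "M : F" "ALL Y. (Y, M) : {(X, Y). X : F & Y : F & Y \<subset> X} --> Y ~: F" by (rule bexE)
  show thesis
  proof (rule that[OF M(1)])
    fix X assume X: "X : F" "M <= X"
    show "X = M"
    proof (rule ccontr)
      assume "X ~= M"
      then have "(X, M) : {(X, Y). X : F & Y : F & Y \<subset> X}" using X M(1) by simp
      then show False using M(2) X(1) by blast
    qed
  qed
qed

text \<open>Closedness near the identity is enough: one approximating element
  \<open>x \<otimes> b0\<close> of \<open>P\<close> translates the limit point \<open>x\<close> to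
  \<open>inv b0\<close>, which is a limit of elements of \<open>P\<close> inside \<open>B k\<close>.
  Closedness of images is always reduced to this.\<close>

lemma locally_closed_subgroup:
  assumes P: "subgroup P G" and C: "P \<inter> B k <= C" "C <= P" "clo C"
  shows "clo P"
proof (rule cloI)
  note Pc = subgroup.mem_carrier[OF P]
  show "P <= carrier G" using Pc by auto
  fix x assume x: "x : carrier G" and *: "!!k. EX b:B k. x \<otimes> b : P"
  obtain b0 where b0: "b0 : B (k + 1)" "x \<otimes> b0 : P" using * by blast
  have "inv b0 : C"
  proof (rule cloD[OF C(3)])
    show "inv b0 : carrier G" using b0 B_carrier by simp
    fix j
    obtain b where b: "b : B (max j (k + 1))" "x \<otimes> b : P" using * by blast
    have bj: "b : B j" "b : B (k + 1)" using b B_monoD[of b "max j (k + 1)"] by auto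
    have "inv (x \<otimes> b0) \<otimes> (x \<otimes> b) : P"
      by (intro subgroup.m_closed[OF P] subgroup.m_inv_closed[OF P] b0 b)
    then have "inv b0 \<otimes> b : P" using x b0 b by (simp add: inv_mult_group m_assoc B_carrier)
    moreover have "inv b0 \<otimes> b : B k" using B_mult[OF B_inv[OF b0(1)] bj(2)] .
    ultimately show "EX b:B j. inv b0 \<otimes> b : C" using C(1) bj by blast
  qed
  then have "(x \<otimes> b0) \<otimes> inv b0 : P" using C(2) b0 subgroup.m_closed[OF P] by blast
  then show "x : P" using x b0 by (simp add: m_assoc B_carrier)
qed

lemma open_subgroup_clo:
  assumes "subgroup P G" "X \<inter> B k <= P" "P <= X" "clo X" shows "clo P"
  by (rule locally_closed_subgroup[of _ k "X \<inter> B k"]) (use assms clo_Int in auto)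

end

section \<open>Equivariant homomorphisms between two groups\<close>

locale contraction_balls_pair = contraction_balls G a K + H: contraction_balls H b L
  for G (structure) and a :: "int => 'a => 'a" and K and H (structure) and b :: "int => 'b => 'b" and L
begin

text \<open>Preimages of ever better approximations to \<open>h\<close> cluster in the compact set
  \<open>X \<inter> B j\<close>, and the image of a cluster point can only be
  \<open>h\<close>.\<close>

lemma bounded_image_clo:
  assumes X: "subgroup X G" "clo X" and fc: "!!x. x : X ==> f x : carrier H"
    and hom: "!!x y. x : X ==> y : X ==> f (x \<otimes> y) = f x \<otimes>\<^bsub>H\<^esub> f y"
    and cont: "!!k. EX n. ALL x:X \<inter> B n. f x : H.B k"
  shows "H.clo (f ` (X \<inter> B j))"
proof (rule H.cloI)
  show "f ` (X \<inter> B j) <= carrier H" using fc by auto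
  fix h assume h: "h : carrier H" and *: "!!k. EX c:H.B k. h \<otimes>\<^bsub>H\<^esub> c : f ` (X \<inter> B j)"
  have "ALL n::nat. EX x. x : X \<inter> B j & inv\<^bsub>H\<^esub> h \<otimes>\<^bsub>H\<^esub> f x : H.B (int n)"
  proof
    fix n :: nat
    obtain c where c: "c : H.B (int n)" "h \<otimes>\<^bsub>H\<^esub> c : f ` (X \<inter> B j)" using * by blast
    then obtain x where x: "x : X \<inter> B j" "h \<otimes>\<^bsub>H\<^esub> c = f x" by auto
    have "inv\<^bsub>H\<^esub> h \<otimes>\<^bsub>H\<^esub> f x = c" using h c H.B_carrier by (simp flip: x(2))
    then show "EX x. x : X \<inter> B j & inv\<^bsub>H\<^esub> h \<otimes>\<^bsub>H\<^esub> f x : H.B (int n)" using x c by auto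
  qed
  from choice[OF this] obtain s where
    "ALL n. s n : X \<inter> B j & inv\<^bsub>H\<^esub> h \<otimes>\<^bsub>H\<^esub> f (s n) : H.B (int n)" ..
  then have s: "!!n. s n : X \<inter> B j" "!!n. inv\<^bsub>H\<^esub> h \<otimes>\<^bsub>H\<^esub> f (s n) : H.B (int n)" by auto
  obtain x where x: "x : X \<inter> B j" "clus s x"
    by (rule clo_cluster[of s, OF s(1)]) (use X clo_Int clo_B in auto)
  have xc: "x : carrier G" "f x : carrier H" using x fc B_carrier by auto
  have "inv\<^bsub>H\<^esub> h \<otimes>\<^bsub>H\<^esub> f x : H.B (int k)" for k
  proof -
    obtain n where n: "ALL x:X \<inter> B n. f x : H.B (int k + 1)" using cont by blast
    obtain m where m: "m >= k + 1" "inv x \<otimes> s m : B n" by (rule clusD[OF x(2)])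
    have sm: "s m : X" "s m : carrier G" "f (s m) : carrier H" using s(1)[of m] fc B_carrier by auto
    have "inv x \<otimes> s m : X" using X(1) x(1) sm by (simp add: subgroup.m_closed subgroup.m_inv_closed)
    with m n have 1: "f (inv x \<otimes> s m) : H.B (int k + 1)" by blast
    have "f x \<otimes>\<^bsub>H\<^esub> f (inv x \<otimes> s m) = f (s m)"
      using hom[of x "inv x \<otimes> s m"] x \<open>inv x \<otimes> s m : X\<close> xc sm by simp
    then have "f x = f (s m) \<otimes>\<^bsub>H\<^esub> inv\<^bsub>H\<^esub> (f (inv x \<otimes> s m))"
      using xc fc[OF \<open>inv x \<otimes> s m : X\<close>] by (metis H.inv_solve_right sm(3))
    then have "inv\<^bsub>H\<^esub> h \<otimes>\<^bsub>H\<^esub> f x = (inv\<^bsub>H\<^esub> h \<otimes>\<^bsub>H\<^esub> f (s m)) \<otimes>\<^bsub>H\<^esub> inv\<^bsub>H\<^esub> (f (inv x \<otimes> s m))"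
      using h sm fc[OF \<open>inv x \<otimes> s m : X\<close>] by (simp add: H.m_assoc)
    moreover have "inv\<^bsub>H\<^esub> h \<otimes>\<^bsub>H\<^esub> f (s m) : H.B (int k + 1)"
      by (rule H.B_monoD[OF s(2)]) (use m in simp)
    ultimately show ?thesis using H.B_mult[OF _ H.B_inv[OF 1]] by simp
  qed
  then have "inv\<^bsub>H\<^esub> h \<otimes>\<^bsub>H\<^esub> f x = \<one>\<^bsub>H\<^esub>" using H.B_sep h xc by simp
  then have "h = f x" using h xc by (metis H.inv_closed H.inv_equality H.inv_inv)
  then show "h : f ` (X \<inter> B j)" using x by blast
qed

text \<open>The second claim is properness modulo the kernel. Small images far from the kernel could
  be rescaled to bounded points off \<open>nb N 0\<close> whose images tend to the identity; a
  cluster point would lie in the kernel and bring terms of the sequence into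
  \<open>nb N 0\<close>.\<close>

lemma equivariant_proper:
  assumes X: "cas X" and fc: "!!x. x : X ==> f x : carrier H"
    and hom: "!!x y. x : X ==> y : X ==> f (x \<otimes> y) = f x \<otimes>\<^bsub>H\<^esub> f y"
    and cont: "!!k. EX n. ALL x:X \<inter> B n. f x : H.B k"
    and eqv: "!!x k. x : X ==> f (a k x) = b k (f x)"
  shows "cas {x : X. f x = \<one>\<^bsub>H\<^esub>}" and "EX n::nat. ALL x:X. f x : H.B (int n) --> x : nb {x : X. f x = \<one>\<^bsub>H\<^esub>} 0"
proof -
  note Xs = cas_subgroup[OF X]
  interpret f: group_hom "G\<lparr>carrier := X\<rparr>" H f
    by (rule group_hom.intro[OF subgroup_imp_group[OF Xs] H.is_group])
      (unfold_locales, auto simp: hom_def fc hom)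
  have f1: "f \<one> = \<one>\<^bsub>H\<^esub>" using f.hom_one by simp
  have finv: "f (inv x) = inv\<^bsub>H\<^esub> f x" if "x : X" for x
    using f.hom_inv[of x] that m_inv_consistent[OF Xs] by simp
  define N where "N = {x : X. f x = \<one>\<^bsub>H\<^esub>}"
  have N: "cas N" unfolding cas_def
  proof (intro conjI)
    show "subgroup N G"
    proof (rule subgroupI)
      show "N <= carrier G" "N ~= {}"
        unfolding N_def using X cas_carrier cas_one f1 by auto
      show "inv x : N" if "x : N" for x using that X cas_inv finv unfolding N_def by auto
      show "x \<otimes> y : N" if "x : N" "y : N" for x y
        using that X cas_mult hom unfolding N_def by auto
    qed
    show "clo N"
    proof (rule cloI)
      show "N <= carrier G" unfolding N_def using X cas_carrier by auto
      fix x assume x: "x : carrier G" and *: "!!k. EX c:B k. x \<otimes> c : N"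
      have xX: "x : X" by (rule cloD[OF cas_clo[OF X] x]) (use * in \<open>auto simp: N_def\<close>)
      have "f x : H.B (int k)" for k
      proof -
        obtain n where n: "ALL x:X \<inter> B n. f x : H.B (int k)" using cont by blast
        obtain c where c: "c : B n" "x \<otimes> c : N" using * by blast
        have "inv x \<otimes> (x \<otimes> c) : X" using cas_mult[OF X cas_inv[OF X xX]] c(2) unfolding N_def by blast
        then have cX: "c : X" using x c B_carrier by simp
        have "f x \<otimes>\<^bsub>H\<^esub> f c = \<one>\<^bsub>H\<^esub>" using hom[OF xX cX] c unfolding N_def by auto
        then have "f x = inv\<^bsub>H\<^esub> (f c)" using fc xX cX H.inv_equality by metis
        then show ?thesis using n c cX H.B_inv by auto
      qed
      then have "f x = \<one>\<^bsub>H\<^esub>" using H.B_sep fc[OF xX] by blast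
      then show "x : N" using xX by (simp add: N_def)
    qed
    show "ALL k. ALL x:N. a k x : N" using cas_a[OF X] eqv H.a_one unfolding N_def by auto
  qed
  show "cas {x : X. f x = \<one>\<^bsub>H\<^esub>}" using N by (simp add: N_def)
  have "EX n::nat. ALL x:X. f x : H.B (int n) --> x : nb N 0"
  proof (rule ccontr)
    assume no: "~ ?thesis"
    have "ALL n::nat. EX y. y : X \<inter> B (-1) & f y : H.B (int n) & y ~: nb N 0"
    proof
      fix n :: nat
      obtain x where x: "x : X" "f x : H.B (int n)" "x ~: nb N 0" using no by blast
      note xc = cas_carrier[OF X x(1)]
      \<comment> \<open>As \<open>x\<close> misses \<open>nb N 0\<close>, the rescaling exponent is
        nonnegative, so it can only shrink the image further.\<close>
      obtain i where i: "i >= - 0" "a i x : nb N (-1)" "a i x ~: nb N 0"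
        by (rule annulus[OF N xc x(3)])
      obtain d y where d: "d : N" "y : B (-1)" "a i x = d \<otimes> y" using nbE[OF i(2)] .
      have dX: "d : X" "f d = \<one>\<^bsub>H\<^esub>" using d unfolding N_def by auto
      have "y = inv d \<otimes> a i x" using d dX cas_carrier[OF X] B_carrier by auto
      then have yX: "y : X" using cas_mult[OF X cas_inv[OF X dX(1)] cas_a[OF X x(1)]] by simp
      have "b i (f x) = f y" using eqv[OF x(1), of i] hom[OF dX(1) yX] d(3) dX fc[OF yX] by simp
      moreover have "b i (f x) : H.B (i + int n)" using H.a_B x(2) by blast
      ultimately have "f y : H.B (int n)" using H.B_monoD[of _ "i + int n"] i(1) by simp
      moreover have "y ~: nb N 0" using nb_left[OF N d(1)] i(3) d(3) by metis
      ultimately show "EX y. y : X \<inter> B (-1) & f y : H.B (int n) & y ~: nb N 0" using yX d(2) by blast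
    qed
    from choice[OF this] obtain s where
      "ALL n. s n : X \<inter> B (-1) & f (s n) : H.B (int n) & s n ~: nb N 0" ..
    then have s: "!!n. s n : X \<inter> B (-1)" "!!n. f (s n) : H.B (int n)" "!!n. s n ~: nb N 0" by auto
    obtain x where x: "x : X \<inter> B (-1)" "clus s x"
      by (rule clo_cluster[of s, OF s(1)]) (use X cas_clo clo_Int clo_B in auto)
    have xX: "x : X" and xc: "x : carrier G" using x B_carrier by auto
    have "f x : H.B (int k)" for k
    proof -
      obtain n where n: "ALL x:X \<inter> B n. f x : H.B (int k + 1)" using cont by blast
      obtain m where m: "m >= k + 1" "inv x \<otimes> s m : B n" by (rule clusD[OF x(2)])
      have sm: "s m : X" "s m : carrier G" using s(1)[of m] B_carrier by auto
      have iX: "inv x \<otimes> s m : X" using cas_mult[OF X cas_inv[OF X xX] sm(1)] .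
      have "f (s m) : H.B (int k + 1)" by (rule H.B_monoD[OF s(2)]) (use m in simp)
      moreover have "f (inv x \<otimes> s m) : H.B (int k + 1)" using n m iX by blast
      ultimately have "f (s m) \<otimes>\<^bsub>H\<^esub> inv\<^bsub>H\<^esub> f (inv x \<otimes> s m) : H.B (int k)" by (intro H.B_mult H.B_inv)
      moreover have "f (inv x \<otimes> s m) = inv\<^bsub>H\<^esub> f x \<otimes>\<^bsub>H\<^esub> f (s m)"
        using hom[of "inv x" "s m"] finv[OF xX] cas_inv[OF X xX] sm by simp
      ultimately show ?thesis using fc xX sm by (simp add: H.inv_mult_group)
    qed
    then have "x : N" using H.B_sep fc[OF xX] xX by (simp add: N_def)
    obtain n where n: "n >= 0" "inv x \<otimes> s n : B 0" by (rule clusD[OF x(2)])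
    have "x \<otimes> (inv x \<otimes> s n) : nb N 0" by (rule nbI[OF \<open>x : N\<close> n(2)])
    then show False using s(1,3)[of n] xc B_carrier by auto
  qed
  then show "EX n::nat. ALL x:X. f x : H.B (int n) --> x : nb {x : X. f x = \<one>\<^bsub>H\<^esub>} 0"
    by (simp add: N_def)
qed

text \<open>Near the identity of \<open>H\<close> the image is already the image of the compact set
  \<open>X \<inter> B 0\<close>: properness splits a preimage into a kernel element and an element
  of \<open>B 0\<close>.\<close>

theorem equivariant_image_clo:
  assumes X: "cas X" and fc: "!!x. x : X ==> f x : carrier H"
    and hom: "!!x y. x : X ==> y : X ==> f (x \<otimes> y) = f x \<otimes>\<^bsub>H\<^esub> f y"
    and cont: "!!k. EX n. ALL x:X \<inter> B n. f x : H.B k"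
    and eqv: "!!x k. x : X ==> f (a k x) = b k (f x)"
  shows "H.clo (f ` X)"
proof -
  note Xs = cas_subgroup[OF X]
  interpret f: group_hom "G\<lparr>carrier := X\<rparr>" H f
    by (rule group_hom.intro[OF subgroup_imp_group[OF Xs] H.is_group])
      (unfold_locales, auto simp: hom_def fc hom)
  define N where "N = {x : X. f x = \<one>\<^bsub>H\<^esub>}"
  have "EX n::nat. ALL x:X. f x : H.B (int n) --> x : nb N 0"
    unfolding N_def by (rule equivariant_proper(2)[where f = f, OF X fc hom cont eqv])
  then obtain n :: nat where n: "!!x. x : X ==> f x : H.B (int n) ==> x : nb N 0" by blast
  show ?thesis
  proof (rule H.locally_closed_subgroup)
    show "subgroup (f ` X) H" using f.img_is_subgroup by simp
    show "H.clo (f ` (X \<inter> B 0))" by (rule bounded_image_clo[OF Xs cas_clo[OF X] fc hom cont])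
    show "f ` (X \<inter> B 0) <= f ` X" by auto
    show "f ` X \<inter> H.B (int n) <= f ` (X \<inter> B 0)"
    proof
      fix h assume "h : f ` X \<inter> H.B (int n)"
      then obtain x where x: "x : X" "h = f x" "f x : H.B (int n)" by auto
      obtain d y where d: "d : N" "y : B 0" "x = d \<otimes> y" using nbE[OF n[OF x(1,3)]] .
      have dX: "d : X" "f d = \<one>\<^bsub>H\<^esub>" using d unfolding N_def by auto
      have "y = inv d \<otimes> x" using d dX cas_carrier[OF X] B_carrier by auto
      then have yX: "y : X" using cas_mult[OF X cas_inv[OF X dX(1)] x(1)] by simp
      have "h = f y" using x d dX hom[OF dX(1) yX] fc[OF yX] by simp
      then show "h : f ` (X \<inter> B 0)" using yX d by blast
    qed
  qed
qed

end

context contraction_balls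
begin

subsection \<open>Bounded conjugacy classes\<close>

lemma B0_not_B1: assumes "carrier G ~= {\<one>}" obtains x where "x : B 0" "x ~: B 1"
proof -
  have "~ B 0 <= B 1"
  proof
    assume sub: "B 0 <= B 1"
    have "B 0 <= B (int n)" for n
    proof (induction n)
      case (Suc n)
      have "x : B (int (Suc n))" if x: "x : B 0" for x
      proof -
        have "a (- 1) x : B (int n)"
          using a_B[of x 1 "-1"] sub x Suc by auto
        from a_B[OF this, of 1] show ?thesis using x B_carrier a_cancel(2)[of x 1] by simp
      qed
      then show ?case by blast
    qed simp
    then have B0: "x = \<one>" if "x : B 0" for x using B_sep[OF B_carrier[OF that]] that by blast
    have "x = \<one>" if x: "x : carrier G" for x
    proof -
      obtain n :: nat where "x : B (- int n)" using B_exh[OF x] .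
      then have "a (int n) x : B 0" using a_B[of x "- int n" "int n"] by simp
      from B0[OF this] have "a (int n) x = a (int n) \<one>" by simp
      then show ?thesis using a_inj x by blast
    qed
    then show False using assms one_closed by blast
  qed
  then show thesis using that by blast
qed

definition conj_growth :: "nat => nat" where
  "conj_growth r = (LEAST h. ALL g:B (- int r). ALL x:B 0. cj g x : B (- int h))"

lemma conj_growth: "g : B (- int r) ==> x : B 0 ==> cj g x : B (- int (conj_growth r))"
  and conj_growth_le: "conj_growth r <= r + 1"
proof -
  have *: "ALL g:B (- int r). ALL x:B 0. cj g x : B (- int (r + 1))"
  proof (intro ballI)
    fix g x assume gx: "g : B (- int r)" "x : B 0"
    have "x : B (- int r)" using B_monoD[OF gx(2)] by simp
    with gx(1) show "cj g x : B (- int (r + 1))"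
      unfolding cj_def by (intro B_cube) (auto intro: B_inv)
  qed
  show "conj_growth r <= r + 1" unfolding conj_growth_def by (rule Least_le) (rule *)
  assume "g : B (- int r)" "x : B 0"
  then show "cj g x : B (- int (conj_growth r))"
    using LeastI[of "%h. ALL g:B (- int r). ALL x:B 0. cj g x : B (- int h)", OF *]
    unfolding conj_growth_def by blast
qed

lemma conj_growth_least: "h < conj_growth r ==> EX g:B (- int r). EX x:B 0. cj g x ~: B (- int h)"
  unfolding conj_growth_def using not_less_Least[of h "%h. ALL g:B (- int r). ALL x:B 0. cj g x : B (- int h)"]
  by blast

text \<open>Rescaling by \<open>a (int r)\<close> turns a conjugator of size \<open>r\<close> into
  an element of \<open>B 0\<close> and \<open>x\<close> into an element of \<open>B (int r)\<close>;
  uniform continuity of conjugation over \<open>B 0\<close> gives a fixed gain \<open>s\<close>. So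
  \<open>r - conj_growth r\<close> tends to infinity.\<close>

lemma conj_growth_slow: "EX R. ALL r>=R. conj_growth r + s <= r"
proof -
  obtain n where n: "ALL g:B 0. ALL x:B n. cj g x : B (int s)" by (rule conj_unif)
  have "conj_growth r + s <= r" if r: "r >= max (nat n) s" for r
  proof -
    have "conj_growth r <= r - s"
      unfolding conj_growth_def
    proof (rule Least_le, intro ballI)
      fix g x assume g: "g : B (- int r)" and x: "x : B 0"
      have "a (int r) g : B 0" using a_B[OF g, of "int r"] by simp
      moreover have "n <= int r" using r by (simp add: nat_le_iff)
      then have "a (int r) x : B n" using B_monoD[OF a_B[OF x, of "int r"], of n] by simp
      ultimately have "cj (a (int r) g) (a (int r) x) : B (int s)" using n by blast
      then have "a (int r) (cj g x) : B (int s)" using a_cj B_carrier g x by simp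
      then have "cj g x : B (int s - int r)" using a_B_iff B_carrier g x by simp
      then show "cj g x : B (- int (r - s))" using r by (simp add: of_nat_diff)
    qed
    then show ?thesis using r by linarith
  qed
  then show ?thesis by blast
qed

text \<open>Jumps of two or more from some radius on would give growth at rate two, against the
  bound \<open>r + 1\<close>.\<close>

lemma conj_growth_jump: "EX r>=R. conj_growth (r + 1) <= conj_growth r + 1"
proof (rule ccontr)
  assume "~ ?thesis"
  then have "~ conj_growth (r + 1) <= conj_growth r + 1" if "r >= R" for r
    using that by blast
  then have *: "conj_growth (r + 1) >= conj_growth r + 2" if "r >= R" for r
    using that by (simp add: not_le Suc_le_eq)
  have "conj_growth (R + n) >= 2 * n" for n
  proof (induction n)
    case (Suc n)
    then show ?case using *[of "R + n"] by simp
  qed simp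
  from this[of "R + 2"] conj_growth_le[of "R + (R + 2)"] show False by simp
qed

text \<open>At a radius where the conjugation growth increases by at most one, an extremal conjugate,
  rescaled to unit size, has all of its nearby conjugates bounded.\<close>

lemma bounded_class:
  assumes "carrier G ~= {\<one>}"
  obtains y where "y : carrier G" "y ~= \<one>" "ALL g:carrier G. cj g y : B (-2)"
proof -
  have "ALL s::nat. EX y. y : B 0 & y ~: B 1 & (ALL g:B (- int s). cj g y : B (-1))"
  proof
    fix s :: nat
    obtain R where R: "ALL r>=R. conj_growth r + s <= r" using conj_growth_slow by blast
    obtain r where r: "r >= R" "conj_growth (r + 1) <= conj_growth r + 1" using conj_growth_jump by blast
    define h where "h = conj_growth r"
    have hs: "h + s <= r" using R r by (simp add: h_def)
    \<comment> \<open>The witness has to violate the next sharper bound. For positive growth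
      minimality provides it; for growth zero it is a point of \<open>B 0\<close> outside
      \<open>B 1\<close>.\<close>
    have "EX g:B (- int r). EX x:B 0. cj g x ~: B (- int h + 1)"
    proof (cases h)
      case 0
      obtain x where "x : B 0" "x ~: B 1" using B0_not_B1[OF assms] .
      then show ?thesis using 0 B_carrier by (intro bexI[of _ \<one>] bexI[of _ x]) auto
    next
      case (Suc m)
      then show ?thesis using conj_growth_least[of m r] by (simp add: h_def)
    qed
    then obtain g x where gx: "g : B (- int r)" "x : B 0" "cj g x ~: B (- int h + 1)" by blast
    have c: "g : carrier G" "x : carrier G" using gx B_carrier by auto
    define y where "y = a (int h) (cj g x)"
    have y0: "y : B 0" using a_B[OF conj_growth[OF gx(1,2)], of "int h"] by (simp add: y_def h_def)
    have y1: "y ~: B 1" using gx(3) c by (simp add: y_def a_B_iff)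
    have "cj g' y : B (-1)" if g': "g' : B (- int s)" for g'
    proof -
      have g'c: "g' : carrier G" using g' B_carrier by auto
      \<comment> \<open>The inequality \<open>h + s <= r\<close> absorbs the rescaled conjugator
        into size \<open>r\<close>. Multiplying it by \<open>g\<close> costs one unit of radius,
        which by the choice of \<open>r\<close> costs at most one scale.\<close>
      have "a (- int h) g' : B (- int r)" using B_monoD[OF a_B[OF g', of "- int h"], of "- int r"] hs by simp
      then have "a (- int h) g' \<otimes> g : B (- int (r + 1))" using B_mult[of _ "- int (r + 1)" g] gx by simp
      from conj_growth[OF this gx(2)] have "cj (a (- int h) g' \<otimes> g) x : B (- int h - 1)"
        by (rule B_monoD) (use r in \<open>simp add: h_def\<close>)
      from a_B[OF this, of "int h"] show ?thesis
        using c g'c by (simp add: y_def a_cj a_mult flip: cj_cj)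
    qed
    then show "EX y. y : B 0 & y ~: B 1 & (ALL g:B (- int s). cj g y : B (-1))" using y0 y1 by blast
  qed
  from choice[OF this] obtain t where
    "ALL s. t s : B 0 & t s ~: B 1 & (ALL g:B (- int s). cj g (t s) : B (-1))" ..
  then have t: "!!s. t s : B 0" "!!s. t s ~: B 1" "!!s g. g : B (- int s) ==> cj g (t s) : B (-1)" by auto
  obtain y where y: "y : B 0" "clus t y" by (rule B_cluster[of t, OF t(1)])
  have yc: "y : carrier G" using y B_carrier by auto
  show thesis
  proof (rule that[OF yc])
    show "y ~= \<one>"
    proof
      assume y1: "y = \<one>"
      obtain n where "n >= 0" "inv y \<otimes> t n : B 1" by (rule clusD[OF y(2)])
      then show False using t(2)[of n] B_carrier[OF t(1)] y1 by simp
    qed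
    show "ALL g:carrier G. cj g y : B (-2)"
    proof
      fix g assume g: "g : carrier G"
      obtain s :: nat where s: "g : B (- int s)" using B_exh[OF g] .
      obtain k where k: "ALL x:B k. cj g x : B (-1)" by (rule B_conj[OF g])
      obtain n where n: "n >= s" "inv y \<otimes> t n : B k" by (rule clusD[OF y(2)])
      have tc: "t n : carrier G" using t(1) B_carrier by blast
      have 1: "cj g (t n) : B (-1)" by (rule t(3)[OF B_monoD[OF s]]) (use n in simp)
      have 2: "cj g (inv (inv y \<otimes> t n)) : B (-1)" using k B_inv[OF n(2)] by blast
      have "cj g (t n) \<otimes> cj g (inv (inv y \<otimes> t n)) = cj g y"
        using g tc yc by (simp add: inv_mult_group flip: cj_mult)
      then show "cj g y : B (-2)" using B_mult[of "cj g (t n)" "-2" "cj g (inv (inv y \<otimes> t n))"] 1 2 by simp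
    qed
  qed
qed

text \<open>The largest conjugation invariant subset of \<open>B k\<close>. It need not be a
  neighbourhood of the identity; \<open>exists_sin\<close> finds a subgroup in which it is
  one.\<close>

definition Y :: "int => 'a set" where "Y k = {y : carrier G. ALL g:carrier G. cj g y : B k}"

lemma Y_carrier: "y : Y k ==> y : carrier G"
  by (simp add: Y_def)

lemma Y_D: "y : Y k ==> g : carrier G ==> cj g y : B k"
  by (simp add: Y_def)

lemma Y_I: "y : carrier G ==> (!!g. g : carrier G ==> cj g y : B k) ==> y : Y k"
  by (simp add: Y_def)

lemma Y_B: "y : Y k ==> y : B k"
  using Y_D[of y k \<one>] Y_carrier[of y k] by simp

lemma Y_one [simp]: "\<one> : Y k"
  by (rule Y_I) auto

lemma Y_inv: "y : Y k ==> inv y : Y k"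
  by (rule Y_I) (use Y_carrier Y_D B_inv in \<open>auto simp: cj_inv\<close>)

lemma Y_cube: "x : Y (k + 1) ==> y : Y (k + 1) ==> z : Y (k + 1) ==> x \<otimes> y \<otimes> z : Y k"
  by (rule Y_I) (use Y_carrier Y_D B_cube in \<open>auto simp: cj_mult\<close>)

lemma Y_mult: "x : Y (k + 1) ==> y : Y (k + 1) ==> x \<otimes> y : Y k"
  using Y_cube[of x k y \<one>] by (simp add: Y_carrier)

lemma Y_monoD: "x : Y k ==> j <= k ==> x : Y j"
  unfolding Y_def using B_monoD by blast

lemma Y_cj: "x : Y k ==> g : carrier G ==> cj g x : Y k"
  by (rule Y_I) (use Y_carrier Y_D in \<open>auto simp: cj_cj\<close>)

lemma Y_a: assumes "x : Y k" shows "a j x : Y (j + k)"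
proof (rule Y_I)
  note xc = Y_carrier[OF assms]
  show "a j x : carrier G" using xc by simp
  fix g assume g: "g : carrier G"
  have "a j (cj (a (- j) g) x) : B (j + k)" using a_B[OF Y_D[OF assms]] g by simp
  then show "cj g (a j x) : B (j + k)" using g xc by (simp add: a_cj)
qed

lemma clo_Y: "clo (Y k)"
proof (rule cloI)
  fix x assume x: "x : carrier G" and *: "!!j. EX b:B j. x \<otimes> b : Y k"
  show "x : Y k"
  proof (rule Y_I[OF x])
    fix g assume g: "g : carrier G"
    show "cj g x : B k"
    proof (rule cloD[OF clo_B])
      fix j
      obtain n where n: "ALL x:B n. cj g x : B j" by (rule B_conj[OF g])
      obtain b where b: "b : B n" "x \<otimes> b : Y k" using * by blast
      have "cj g x \<otimes> cj g b : B k" using Y_D[OF b(2) g] x g b B_carrier by (simp add: cj_mult)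
      then show "EX b:B j. cj g x \<otimes> b : B k" using n b by blast
    qed (use x g in simp)
  qed
qed (auto simp: Y_def)

text \<open>Elements with bounded conjugacy class form a stable normal subgroup \<open>U\<close>,
  nontrivial by \<open>bounded_class\<close>. On its closure a covering at one scale, rescaled and
  iterated, writes each element as a limit of products from invariant balls, and these balls are
  closed.\<close>

lemma exists_sin:
  assumes "carrier G ~= {\<one>}"
  obtains N c where "cn N" "N ~= {\<one>}" "ALL k. N \<inter> B (k + c) <= Y k"
proof -
  obtain y where y: "y : carrier G" "y ~= \<one>" "ALL g:carrier G. cj g y : B (-2)"
    by (rule bounded_class[OF assms])
  then have yY: "y : Y (-2)" by (auto intro: Y_I)
  define U where "U = (\<Union>n::nat. Y (- int n))"
  have UI: "x : U" if "x : Y k" for x k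
  proof -
    have "x : Y (- int (nat (- k)))" by (rule Y_monoD[OF that]) simp
    then show ?thesis unfolding U_def by blast
  qed
  have UE: "EX n::nat. x : Y (- int n)" if "x : U" for x using that unfolding U_def by auto
  have U: "subgroup U G"
  proof (rule subgroupI)
    show "U <= carrier G" using Y_carrier by (auto simp: U_def)
    show "U ~= {}" using UI[OF yY] by auto
    show "inv x : U" if "x : U" for x using UE[OF that] Y_inv UI by blast
    show "x \<otimes> z : U" if xz: "x : U" "z : U" for x z
    proof -
      obtain m n where mn: "x : Y (- int m)" "z : Y (- int n)" using UE xz by meson
      have "x \<otimes> z : Y (- int (max m n) - 1)"
        by (rule Y_mult; rule Y_monoD, rule mn, simp)
      then show ?thesis by (rule UI)
    qed
  qed
  define N where "N = cl U"
  have Ua: "a k x : U" if "x : U" for x k using UE[OF that] Y_a UI by blast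
  have Ucj: "cj g x : U" if "g : carrier G" "x : U" for x g using UE[OF that(2)] that(1) Y_cj UI by blast
  have N: "cn N" unfolding N_def by (rule cn_cl[OF U Ua Ucj])
  note Nc = cn_cas[OF N]
  have UN: "U <= N" unfolding N_def by (rule cl_superset[OF subgroup.subset[OF U]])
  have "EX j::nat. ALL x:N \<inter> B 0. EX p:Y (- int j). EX w:B 1. x = p \<otimes> w"
  proof (rule unif)
    show "N \<inter> B 0 <= B 0" "clo (N \<inter> B 0)" using clo_Int[OF cas_clo[OF Nc] clo_B] by auto
    fix x assume "x : N \<inter> B 0"
    then have x: "x : cl U" "x : carrier G" using B_carrier by (auto simp: N_def)
    obtain b where b: "b : B 2" "x \<otimes> b : U" using clE[OF x(1)] .
    obtain n :: nat where n: "x \<otimes> b : Y (- int n)" using UE[OF b(2)] by blast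
    have "EX p:Y (- int n). EX w:B 1. x \<otimes> b' = p \<otimes> w" if b': "b' : B 2" for b'
    proof (intro bexI)
      show "inv b \<otimes> b' : B 1" by (rule B_mult) (use b b' B_inv in auto)
      show "x \<otimes> b' = (x \<otimes> b) \<otimes> (inv b \<otimes> b')" using x b b' B_carrier by (simp add: m_assoc)
    qed (rule n)
    then show "EX n k. ALL b:B k. x \<otimes> b : N \<inter> B 0 --> (EX p:Y (- int n). EX w:B 1. x \<otimes> b = p \<otimes> w)" by blast
  next
    fix x and m n :: nat assume "EX p:Y (- int m). EX w:B 1. x = p \<otimes> w" "m <= n"
    then show "EX p:Y (- int n). EX w:B 1. x = p \<otimes> w" using Y_monoD[of _ "- int m" "- int n"] by auto
  qed
  then obtain j :: nat where j: "ALL x:N \<inter> B 0. EX p:Y (- int j). EX w:B 1. x = p \<otimes> w" ..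
  have step: "EX p:Y (i - int j). EX w:N \<inter> B (i + 1). x = p \<otimes> w" if x: "x : N" "x : B i" for x i
  proof -
    have xc: "x : carrier G" using x B_carrier by auto
    have "a (- i) x : N \<inter> B 0" using cas_a[OF Nc x(1)] a_B[OF x(2), of "- i"] by simp
    then obtain p w where p: "p : Y (- int j)" "w : B 1" "a (- i) x = p \<otimes> w" using j by blast
    have pw: "p : carrier G" "w : carrier G" using p Y_carrier B_carrier by auto
    have eq: "x = a i p \<otimes> a i w" using arg_cong[OF p(3), of "a i"] xc pw by (simp add: a_mult)
    have ip: "a i p : Y (i - int j)" using Y_a[OF p(1), of i] by simp
    have "a i p : N" using UI[OF ip] UN by blast
    then have "a i w : N" using eq x(1) cas_cancel_left[OF Nc] pw by simp
    moreover have "a i w : B (i + 1)" using a_B[OF p(2)] .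
    ultimately show ?thesis using ip eq by blast
  qed
  \<comment> \<open>Factors gain one scale per step and products are nested to the right. Each step
    thus multiplies two elements of \<open>Y (i - int j)\<close>, and the loss stays a single scale
    for every \<open>n\<close>.\<close>
  have iter: "ALL i x. x : N --> x : B i --> (EX p:Y (i - int j - 1). EX w:B (i + int n). x = p \<otimes> w)" for n
  proof (induction n)
    case 0
    show ?case
    proof (intro allI impI)
      fix i x assume "x : N" "x : B i"
      then show "EX p:Y (i - int j - 1). EX w:B (i + int 0). x = p \<otimes> w"
        using B_carrier by (intro bexI[of _ \<one>] bexI[of _ x]) auto
    qed
  next
    case (Suc n)
    show ?case
    proof (intro allI impI)
      fix i x assume x: "x : N" "x : B i"
      obtain p w where p: "p : Y (i - int j)" "w : N" "w : B (i + 1)" "x = p \<otimes> w" using step[OF x] by blast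
      obtain q v where q: "q : Y (i + 1 - int j - 1)" "v : B (i + 1 + int n)" "w = q \<otimes> v"
        using Suc p(2,3) by blast
      have "p \<otimes> q : Y (i - int j - 1)" using Y_mult[of p "i - int j - 1" q] p q by simp
      moreover have "x = (p \<otimes> q) \<otimes> v" using p q Y_carrier B_carrier by (simp add: m_assoc)
      moreover have "v : B (i + int (Suc n))" using q(2) by (simp add: algebra_simps)
      ultimately show "EX p:Y (i - int j - 1). EX w:B (i + int (Suc n)). x = p \<otimes> w" by blast
    qed
  qed
  have fin: "x : Y (i - int j - 1)" if x: "x : N" "x : B i" for x i
  proof (rule cloD[OF clo_Y])
    show xc: "x : carrier G" using x B_carrier by auto
    fix k
    obtain p w where p: "p : Y (i - int j - 1)" "w : B (i + int (nat (k - i)))" "x = p \<otimes> w"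
      using iter x by blast
    have "w : B k" by (rule B_monoD[OF p(2)]) simp
    moreover have "x \<otimes> inv w : Y (i - int j - 1)" using p Y_carrier B_carrier by (simp add: m_assoc)
    ultimately show "EX b:B k. x \<otimes> b : Y (i - int j - 1)" using B_inv by blast
  qed
  show thesis
  proof (rule that[OF N])
    show "N ~= {\<one>}" using UI[OF yY] UN y(2) by blast
    show "ALL k. N \<inter> B (k + (int j + 1)) <= Y k"
    proof (intro allI subsetI)
      fix k x assume "x : N \<inter> B (k + (int j + 1))"
      then show "x : Y k" using fin[of x "k + (int j + 1)"] by simp
    qed
  qed
qed

lemma exists_minimal_sin:
  assumes "carrier G ~= {\<one>}"
  obtains M c where "cn M" "M ~= {\<one>}" "ALL X. cn X --> X <= M --> X = {\<one>} | X = M"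
    "ALL k. M \<inter> B (k + c) <= Y k"
proof -
  obtain N c where N: "cn N" "N ~= {\<one>}" "ALL k. N \<inter> B (k + c) <= Y k" by (rule exists_sin[OF assms])
  define F where "F = {X. cn X & X ~= {\<one>} & X <= N}"
  obtain M where M: "M : F" "ALL X. X : F --> X <= M --> X = M"
  proof -
    have 1: "!!X. X : F ==> cas X" using cn_cas by (auto simp: F_def)
    have 2: "F ~= {}" using N by (auto simp: F_def)
    show thesis using cas_minimal[OF 1 2] that by metis
  qed
  have Mp: "cn M" "M ~= {\<one>}" "M <= N" using M(1) by (auto simp: F_def)
  show thesis
  proof (rule that[OF Mp(1,2)])
    show "ALL X. cn X --> X <= M --> X = {\<one>} | X = M"
    proof (intro allI impI)
      fix X assume X: "cn X" "X <= M"
      then have "X : F | X = {\<one>}" using Mp(3) by (auto simp: F_def)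
      then show "X = {\<one>} | X = M" using M(2) X(2) by blast
    qed
    show "ALL k. M \<inter> B (k + c) <= Y k" using N(3) Mp(3) by blast
  qed
qed

section \<open>Subgroups generated by small balls\<close>

lemma generate_map_subset:
  assumes S: "S <= carrier G" and f: "f : hom G G" and P: "subgroup P G" "!!x. x : S ==> f x : P"
    and x: "x : generate G S"
  shows "f x : P"
proof -
  interpret f: group_hom G G f
    by (rule group_hom.intro) (unfold_locales, rule f)
  have "subgroup {x : carrier G. f x : P} G"
    by (rule subgroupI)
      (use P f.hom_one f.hom_inv in \<open>auto simp: subgroup.one_closed subgroup.m_closed subgroup.m_inv_closed\<close>)
  then have "generate G S <= {x : carrier G. f x : P}"
    by (rule generate_subgroup_incl[rotated]) (use S P in auto)
  then show ?thesis using x by blast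
qed

lemma a_hom: "a k : hom G G" and cj_hom: "g : carrier G ==> cj g : hom G G"
  by (auto simp: hom_def a_mult cj_mult)

text \<open>A trivial core means that small balls generate small subgroups, as in totally
  disconnected groups; a full core means that every ball generates \<open>M\<close>, as in connected
  groups. Minimality will leave only these two cases.\<close>

definition core :: "'a set => 'a set" where
  "core M = (\<Inter>n::nat. generate G (M \<inter> B (int n)))"

lemma generate_ball_clo: assumes "cas M" shows "clo (generate G (M \<inter> B k))"
proof (rule open_subgroup_clo)
  have "M \<inter> B k <= carrier G" using B_carrier by auto
  then show "subgroup (generate G (M \<inter> B k)) G" by (rule generate_is_subgroup)
  show "M \<inter> B k <= generate G (M \<inter> B k)" by (auto intro: generate.incl)
  show "generate G (M \<inter> B k) <= M" by (rule generate_subgroup_incl) (use assms cas_subgroup in auto)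
  show "clo M" using assms by (rule cas_clo)
qed

lemma generate_ball_mono: "j <= k ==> generate G (M \<inter> B k) <= generate G (M \<inter> B j)"
  by (rule mono_generate) (use B_monoD in blast)

lemma core_iff: "x : core M \<longleftrightarrow> (ALL k. x : generate G (M \<inter> B k))"
proof
  assume x: "x : core M"
  show "ALL k. x : generate G (M \<inter> B k)"
  proof
    fix k
    have "x : generate G (M \<inter> B (int (nat k)))" using x unfolding core_def by blast
    moreover have "k <= int (nat k)" by simp
    ultimately show "x : generate G (M \<inter> B k)" using generate_ball_mono by blast
  qed
qed (auto simp: core_def)

lemma cn_core: assumes M: "cn M" shows "cn (core M)" and "core M <= M"
proof -
  note Mc = cn_cas[OF M]
  have sub: "M \<inter> B k <= carrier G" for k using B_carrier by auto
  have sg: "subgroup (generate G (M \<inter> B k)) G" for k by (rule generate_is_subgroup[OF sub])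
  have gM: "generate G (M \<inter> B k) <= M" for k
    by (rule generate_subgroup_incl) (use cas_subgroup[OF Mc] in auto)
  then show "core M <= M" by (auto simp: core_def)
  show "cn (core M)" unfolding cn_def cas_def
  proof (intro conjI allI ballI)
    have "subgroup (\<Inter> (range (%n::nat. generate G (M \<inter> B (int n))))) G"
      by (rule subgroups_Inter) (use sg in auto)
    then show "subgroup (core M) G" by (simp add: core_def)
    show "clo (core M)" unfolding core_def by (rule clo_INT) (use generate_ball_clo[OF Mc] in auto)
    show "a k x : core M" if x: "x : core M" for k x
      unfolding core_iff
    proof
      fix j
      show "a k x : generate G (M \<inter> B j)"
      proof (rule generate_map_subset[OF sub a_hom sg])
        show "x : generate G (M \<inter> B (j - k))" using x core_iff by blast
        fix y assume "y : M \<inter> B (j - k)"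
        then have "a k y : M \<inter> B j" using cas_a[OF Mc] a_B[of y "j - k" k] by auto
        then show "a k y : generate G (M \<inter> B j)" by (rule generate.incl)
      qed
    qed
    show "cj g x : core M" if g: "g : carrier G" and x: "x : core M" for g x
      unfolding core_iff
    proof
      fix j
      obtain n where n: "ALL x:B n. cj g x : B j" by (rule B_conj[OF g])
      show "cj g x : generate G (M \<inter> B j)"
      proof (rule generate_map_subset[OF sub cj_hom[OF g] sg])
        show "x : generate G (M \<inter> B n)" using x core_iff by blast
        fix y assume "y : M \<inter> B n"
        then have "cj g y : M \<inter> B j" using n cn_cj[OF M g] by auto
        then show "cj g y : generate G (M \<inter> B j)" by (rule generate.incl)
      qed
    qed
  qed
qed

text \<open>By compactness some late generated subgroup meets \<open>B (-1)\<close> only inside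
  \<open>B 0\<close>. A product of two of its elements from \<open>B 0\<close> lies in
  \<open>B (-1)\<close>, hence again in \<open>B 0\<close>, so the subgroup can never leave.\<close>

lemma core_trivial_bounded:
  assumes M: "cas M" and triv: "core M = {\<one>}"
  obtains n :: nat where "generate G (M \<inter> B (int n)) <= B 0"
proof -
  have sub: "M \<inter> B k <= carrier G" for k using B_carrier by auto
  have "EX n::nat. generate G (M \<inter> B (int n)) \<inter> B (-1) <= B 0"
  proof (rule ccontr)
    assume "~ ?thesis"
    then have "ALL n::nat. EX x. x : generate G (M \<inter> B (int n)) & x : B (-1) & x ~: B 0" by auto
    from choice[OF this] obtain s where
      "ALL n::nat. s n : generate G (M \<inter> B (int n)) & s n : B (-1) & s n ~: B 0" ..
    then have s: "!!n::nat. s n : generate G (M \<inter> B (int n))" "!!n. s n : B (-1)" "!!n. s n ~: B 0" by auto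
    obtain x where x: "x : B (-1)" "clus s x" by (rule B_cluster[of s, OF s(2)])
    have xc: "x : carrier G" using x B_carrier by auto
    have "x : generate G (M \<inter> B (int m))" for m
    proof (rule cloD[OF generate_ball_clo[OF M] xc])
      fix k
      obtain n where n: "n >= m" "inv x \<otimes> s n : B k" by (rule clusD[OF x(2)])
      have "s n : generate G (M \<inter> B (int m))"
        using s(1)[of n] generate_ball_mono[of "int m" "int n" M] n(1) by auto
      then have "x \<otimes> (inv x \<otimes> s n) : generate G (M \<inter> B (int m))" using xc B_carrier[OF s(2)] by simp
      then show "EX b:B k. x \<otimes> b : generate G (M \<inter> B (int m))" using n(2) by blast
    qed
    then have "x = \<one>" using triv by (auto simp: core_def)
    obtain n where "n >= 0" "inv x \<otimes> s n : B 0" by (rule clusD[OF x(2)])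
    then show False using s(3)[of n] \<open>x = \<one>\<close> B_carrier[OF s(2)] by simp
  qed
  then obtain n :: nat where n: "generate G (M \<inter> B (int n)) \<inter> B (-1) <= B 0" ..
  have gB: "y : B 0" if "y : M \<inter> B (int n)" for y using that B_monoD[of y "int n" 0] by auto
  have "x : B 0" if "x : generate G (M \<inter> B (int n))" for x
    using that
  proof (induction rule: generate.induct)
    case (eng x y)
    have "x \<otimes> y : B (-1)" using B_mult[of x "-1" y] eng.IH by simp
    then show ?case using n generate.eng[OF eng.hyps] by blast
  qed (use gB B_inv in auto)
  then show thesis using that by blast
qed

end

section \<open>Finite exponent and local finiteness\<close>

context group
begin

text \<open>The \<open>\<Theta> k\<close> act like homomorphisms to groups of bounded order.
  Compatibility across different indices makes the values at \<open>x\<close> and \<open>y\<close>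
  determine \<open>\<Theta> k\<close> on \<open>generate G {x, y}\<close>; so only finitely many of
  these maps differ there, and they separate points.\<close>

lemma residually_bounded:
  fixes \<Theta> :: "'k => 'a => 'f"
  assumes M: "subgroup M G" and R: "finite R" "!!k u. u : M ==> \<Theta> k u : R"
    and mult: "!!k k' u u' v v'. u : M ==> u' : M ==> v : M ==> v' : M ==>
      \<Theta> k u = \<Theta> k' u' ==> \<Theta> k v = \<Theta> k' v' ==> \<Theta> k (u \<otimes> v) = \<Theta> k' (u' \<otimes> v')"
    and inverse: "!!k k' u u'. u : M ==> u' : M ==> \<Theta> k u = \<Theta> k' u' ==> \<Theta> k (inv u) = \<Theta> k' (inv u')"
    and one: "!!k k'. \<Theta> k \<one> = \<Theta> k' \<one>"
    and sep: "!!u. u : M ==> (!!k. \<Theta> k u = \<Theta> k \<one>) ==> u = \<one>"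
  shows "EX e>0. ALL x:M. x [^] (e::nat) = \<one>" and "!!x y. x : M ==> y : M ==> finite (generate G {x, y})"
proof -
  note Mc = subgroup.mem_carrier[OF M] and Mm = subgroup.m_closed[OF M] and Mi = subgroup.m_inv_closed[OF M]
    and M1 = subgroup.one_closed[OF M]
  have Mp: "x [^] (n::nat) : M" if "x : M" for x n
    by (induction n) (use that M1 Mm in auto)
  have inj: "u = v" if uv: "u : M" "v : M" "!!k. \<Theta> k u = \<Theta> k v" for u v
  proof -
    have "\<Theta> k (inv v \<otimes> u) = \<Theta> k \<one>" for k
      using mult[OF Mi[OF uv(2)] Mi[OF uv(2)] uv(1,2) refl uv(3)] Mc[OF uv(2)] by simp
    then have "inv v \<otimes> u = \<one>" using sep Mm[OF Mi[OF uv(2)] uv(1)] by blast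
    then show ?thesis using Mc uv by (metis inv_closed inv_equality inv_inv)
  qed
  \<comment> \<open>Two of the powers with exponents \<open>0\<close> to \<open>card R\<close> have
    the same value, and the difference of their exponents divides the factorial, whatever
    \<open>k\<close> is.\<close>
  have pow1: "\<Theta> k (x [^] (fact (card R) :: nat)) = \<Theta> k \<one>" if x: "x : M" for x k
  proof -
    have "~ inj_on (%i. \<Theta> k (x [^] i)) {..card R}"
    proof
      assume "inj_on (%i. \<Theta> k (x [^] i)) {..card R}"
      then have "card {..card R} <= card R"
        by (rule card_inj_on_le) (use R Mp[OF x] in auto)
      then show False by simp
    qed
    then have "EX i j. i < j & j <= card R & \<Theta> k (x [^] i) = \<Theta> k (x [^] j)"
      unfolding inj_on_def by (metis atMost_iff linorder_neqE_nat)
    then obtain i j where ij: "i < j" "j <= card R" "\<Theta> k (x [^] i) = \<Theta> k (x [^] j)" by blast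
    have xc: "x : carrier G" by (rule Mc[OF x])
    have "x [^] j = x [^] i \<otimes> x [^] (j - i)" using ij xc by (simp add: nat_pow_mult)
    then have "inv (x [^] i) \<otimes> x [^] j = x [^] (j - i)" using xc by simp
    then have 1: "\<Theta> k (x [^] (j - i)) = \<Theta> k \<one>"
      using mult[OF Mi[OF Mp[OF x]] Mi[OF Mp[OF x]] Mp[OF x] Mp[OF x] refl ij(3)[symmetric], of i] xc by simp
    have 2: "\<Theta> k ((x [^] (j - i)) [^] t) = \<Theta> k \<one>" for t :: nat
    proof (induction t)
      case (Suc t)
      from mult[OF Mp[OF Mp[OF x]] M1 Mp[OF x] M1 Suc 1] show ?case by simp
    qed simp
    have "(j - i) dvd (fact (card R) :: nat)" using ij by (intro dvd_fact) auto
    then obtain t where "(fact (card R) :: nat) = (j - i) * t" by (rule dvdE)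
    then show ?thesis using 2[of t] xc by (simp add: nat_pow_pow)
  qed
  have "x [^] (fact (card R) :: nat) = \<one>" if "x : M" for x
    by (rule sep[OF Mp[OF that]]) (rule pow1[OF that])
  then show "EX e>0. ALL x:M. x [^] (e::nat) = \<one>" by (intro exI[of _ "fact (card R)"]) auto
  fix x y assume x: "x : M" and y: "y : M"
  have sub: "generate G {x, y} <= M" by (rule generate_subgroup_incl[OF _ M]) (use x y in auto)
  define S where "S = (%k. (\<Theta> k x, \<Theta> k y)) ` UNIV"
  have S: "finite S" by (rule finite_subset[of _ "R \<times> R"]) (use R x y in \<open>auto simp: S_def\<close>)
  define rep where "rep p = (SOME k. (\<Theta> k x, \<Theta> k y) = p)" for p
  have rep: "(\<Theta> (rep p) x, \<Theta> (rep p) y) = p" if "p : S" for p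
    unfolding rep_def by (rule someI_ex) (use that in \<open>auto simp: S_def\<close>)
  have const: "\<Theta> k w = \<Theta> k' w"
    if w: "w : generate G {x, y}" and k: "\<Theta> k x = \<Theta> k' x" "\<Theta> k y = \<Theta> k' y" for w k k'
    using w
  proof (induction rule: generate.induct)
    case one
    show ?case by (rule assms(6))
  next
    case (incl h)
    then show ?case using k by auto
  next
    case (inv h)
    then show ?case using k inverse[OF x x k(1)] inverse[OF y y k(2)] by auto
  next
    case (eng h1 h2)
    have "h1 : M" "h2 : M" using sub eng.hyps by auto
    then show ?case by (intro mult eng.IH)
  qed
  define F where "F w = restrict (%p. \<Theta> (rep p) w) S" for w
  have "inj_on F (generate G {x, y})"
  proof (rule inj_onI)
    fix u v assume uv: "u : generate G {x, y}" "v : generate G {x, y}" "F u = F v"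
    show "u = v"
    proof (rule inj)
      fix k
      define p where "p = (\<Theta> k x, \<Theta> k y)"
      have p: "p : S" by (simp add: S_def p_def)
      have r: "\<Theta> (rep p) x = \<Theta> k x" "\<Theta> (rep p) y = \<Theta> k y" using rep[OF p] by (simp_all add: p_def)
      have "\<Theta> (rep p) u = \<Theta> (rep p) v" using fun_cong[OF uv(3), of p] p by (simp add: F_def)
      then show "\<Theta> k u = \<Theta> k v" using const[OF uv(1) r] const[OF uv(2) r] by simp
    qed (use uv sub in auto)
  qed
  moreover have "F ` generate G {x, y} <= (\<Pi>\<^sub>E p\<in>S. R)" using sub R by (auto simp: F_def)
  ultimately show "finite (generate G {x, y})"
    using finite_PiE[OF S, of "%_. R"] R(1) by (metis finite_imageD finite_subset)
qed

lemma finite_generate_commuting: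
  assumes xy: "x : carrier G" "y : carrier G" "x \<otimes> y = y \<otimes> x"
    and e: "e > 0" "x [^] (e::nat) = \<one>" "y [^] e = \<one>"
  shows "finite (generate G {x, y})"
proof -
  define S where "S = (%(i, j). x [^] i \<otimes> y [^] j) ` ({..<e} \<times> {..<e})"
  have red: "z [^] n = z [^] (n mod e)" if "z : carrier G" "z [^] e = \<one>" for z and n :: nat
  proof -
    have "z [^] n = z [^] (e * (n div e) + n mod e)" by simp
    also have "\<dots> = (z [^] e) [^] (n div e) \<otimes> z [^] (n mod e)"
      using that(1) by (simp only: nat_pow_mult[symmetric] nat_pow_pow)
    finally show ?thesis using that by simp
  qed
  have mem: "x [^] i \<otimes> y [^] j : S" for i j :: nat
    unfolding S_def using red[OF xy(1) e(2), of i] red[OF xy(2) e(3), of j] e(1)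
    by (intro image_eqI[of _ _ "(i mod e, j mod e)"]) auto
  have comm: "y [^] j \<otimes> x [^] i = x [^] i \<otimes> y [^] j" for i j :: nat
  proof -
    have "x [^] i \<otimes> y = y \<otimes> x [^] i" by (rule group_commutes_pow[OF xy(3,1,2)])
    from group_commutes_pow[OF this[symmetric] xy(2), of j] xy show ?thesis by simp
  qed
  have "subgroup S G"
  proof (rule subgroupI)
    show "S <= carrier G" using xy by (auto simp: S_def)
    show "S ~= {}" using mem by auto
    fix u assume "u : S"
    then obtain i j :: nat where u: "u = x [^] i \<otimes> y [^] j" "i < e" "j < e" by (auto simp: S_def)
    have iv: "inv (z [^] n) = z [^] (e - n)" if "z : carrier G" "z [^] e = \<one>" "n < e" for z n
    proof -
      have "z [^] (e - n) \<otimes> z [^] n = \<one>" using that by (simp add: nat_pow_mult)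
      then show ?thesis using that by (intro inv_equality) auto
    qed
    have "inv u = x [^] (e - i) \<otimes> y [^] (e - j)"
      using u iv[OF xy(1) e(2)] iv[OF xy(2) e(3)] xy comm by (simp add: inv_mult_group)
    then show "inv u : S" using mem by simp
    fix v assume "v : S"
    then obtain i' j' :: nat where v: "v = x [^] i' \<otimes> y [^] j'" by (auto simp: S_def)
    have "u \<otimes> v = x [^] i \<otimes> (y [^] j \<otimes> x [^] i') \<otimes> y [^] j'" using u v xy by (simp add: m_assoc)
    also have "\<dots> = (x [^] i \<otimes> x [^] i') \<otimes> (y [^] j \<otimes> y [^] j')" using comm xy by (simp add: m_assoc)
    also have "\<dots> = x [^] (i + i') \<otimes> y [^] (j + j')" using xy by (simp add: nat_pow_mult)
    finally show "u \<otimes> v : S" using mem by simp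
  qed
  moreover have "{x, y} <= S" using mem[of 1 0] mem[of 0 1] xy by auto
  ultimately have "generate G {x, y} <= S" by (intro generate_subgroup_incl)
  moreover have "finite S" by (simp add: S_def)
  ultimately show ?thesis by (rule finite_subset)
qed

end

section \<open>Minimal subgroups with small invariant neighbourhoods\<close>

locale minimal_sin = contraction_balls G a K for G (structure) and a and K +
  fixes M and c :: int
  assumes cnM: "cn M" and M_nontriv: "M ~= {\<one>}"
    and M_min: "!!X. cn X ==> X <= M ==> X = {\<one>} | X = M"
    and M_sin: "!!k. M \<inter> B (k + c) <= Y k"
begin

lemma casM: "cas M"
  using cnM by (rule cn_cas)

lemmas M_carrier = cas_carrier[OF casM] and M_mult = cas_mult[OF casM] and M_inv = cas_inv[OF casM]
  and M_one = cas_one[OF casM] and M_a = cas_a[OF casM] and M_cj = cn_cj[OF cnM]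
  and M_pow = cas_pow[OF casM] and subgroupM = cas_subgroup[OF casM]

lemma M_comm: "g : carrier G ==> x : M ==> comm g x : M"
  using M_cj M_carrier M_mult M_inv by (simp add: comm_cj)

end

section \<open>Minimal subgroups with trivial core\<close>

locale td_minimal = minimal_sin +
  fixes n :: int
  assumes V_bounded: "generate G (M \<inter> Y n) <= B 0"
begin

text \<open>Because invariant balls generate them, these are subgroups normal in \<open>G\<close>.
  They are open in \<open>M\<close>, lie in \<open>B k\<close> and are permuted by \<open>a\<close>:
  a filtration like that of a p-adic group.\<close>

definition V :: "int => 'a set" where "V k = generate G (M \<inter> Y (n + k))"

lemma V_subgroup: "subgroup (V k) G"
  unfolding V_def by (rule generate_is_subgroup) (use Y_carrier in auto)

lemmas V_carrier = subgroup.mem_carrier[OF V_subgroup] and V_mult = subgroup.m_closed[OF V_subgroup]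
  and V_inv = subgroup.m_inv_closed[OF V_subgroup] and V_one = subgroup.one_closed[OF V_subgroup]

lemma V_M: "V k <= M"
  unfolding V_def by (rule generate_subgroup_incl) (use subgroupM in auto)

lemma V_a: assumes "x : V k" shows "a j x : V (j + k)"
proof (rule generate_map_subset[OF _ a_hom V_subgroup])
  show "x : generate G (M \<inter> Y (n + k))" using assms by (simp add: V_def)
  show "M \<inter> Y (n + k) <= carrier G" using Y_carrier by auto
  fix y assume "y : M \<inter> Y (n + k)"
  then have "a j y : M \<inter> Y (n + (j + k))" using M_a Y_a[of y "n + k" j] by (auto simp: algebra_simps)
  then show "a j y : V (j + k)" unfolding V_def by (rule generate.incl)
qed

lemma V_a_iff: "x : carrier G ==> a j x : V k \<longleftrightarrow> x : V (k - j)"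
  using V_a[of x "k - j" j] V_a[of "a j x" k "- j"] by auto

lemma V_cj: assumes "g : carrier G" "x : V k" shows "cj g x : V k"
proof (rule generate_map_subset[OF _ cj_hom V_subgroup])
  show "x : generate G (M \<inter> Y (n + k))" using assms by (simp add: V_def)
  show "M \<inter> Y (n + k) <= carrier G" using Y_carrier by auto
  fix y assume "y : M \<inter> Y (n + k)"
  then have "cj g y : M \<inter> Y (n + k)" using M_cj Y_cj assms by auto
  then show "cj g y : V k" unfolding V_def by (rule generate.incl)
qed (rule assms)

lemma V_comm: "g : carrier G ==> x : V k ==> comm g x : V k"
  using V_cj V_inv V_mult V_carrier by (simp add: comm_cj)

lemma V_comm': "g : V k ==> x : carrier G ==> comm g x : V k"
  using V_comm[of x g k] V_inv[of "comm x g" k] V_carrier by (simp add: inv_comm)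

lemma V_B: assumes "x : V k" shows "x : B k"
proof -
  have "a (- k) x : V 0" using V_a[OF assms, of "- k"] by simp
  then have "a (- k) x : B 0" using V_bounded by (auto simp: V_def)
  then show ?thesis using a_B_iff V_carrier[OF assms] by simp
qed

lemma V_mono: "j <= k ==> V k <= V j"
  unfolding V_def by (rule mono_generate) (use Y_monoD[of _ "n + k" "n + j"] in auto)

lemma V_monoD: "x : V k ==> j <= k ==> x : V j"
  using V_mono by blast

lemma V_open: "x : M ==> x : B (n + k + c) ==> x : V k"
  unfolding V_def using M_sin[of "n + k"] by (auto intro: generate.incl)

lemma V_exh: assumes "x : M" obtains k where "x : V k"
proof -
  obtain m :: nat where "x : B (- int m)" using B_exh M_carrier assms by blast
  then have "x : V (- int m - n - c)" using V_open[OF assms, of "- int m - n - c"] by simp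
  then show thesis by (rule that)
qed

definition D :: "'a set set" where "D = (%v. V 1 #> v) ` V 0"

lemmas V1_coset_eq = rcos_eq_iff[OF V_subgroup[of 1]]

lemma finite_D: "finite D"
proof -
  obtain F where F: "finite F" "F <= B 0" "B 0 <= (\<Union>f\<in>F. (%b. f \<otimes> b) ` B (n + 1 + c + 1))"
    by (rule totally_bounded)
  have "ALL C:D. EX f. f : F & (EX b:B (n + 1 + c + 1). inv (f \<otimes> b) : C & f \<otimes> b : V 0)"
  proof
    fix C assume "C : D"
    then obtain v where v: "v : V 0" "C = V 1 #> v" by (auto simp: D_def)
    \<comment> \<open>The covering is by left translates while \<open>D\<close> consists of right
      cosets, so inverses are covered. Two cosets with the same \<open>f\<close> agree, because the
      quotient of their representatives is small enough for \<open>V_open\<close>.\<close>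
    have "inv v : B 0" using V_B V_inv v by blast
    then obtain f b where f: "f : F" "b : B (n + 1 + c + 1)" "inv v = f \<otimes> b" using F(3) by blast
    have vc: "v : carrier G" using v V_carrier by blast
    have "inv (f \<otimes> b) = v" using f(3) vc by (metis inv_inv)
    then have "inv (f \<otimes> b) : C" using v rcos_self[OF vc V_subgroup] by simp
    moreover have "f \<otimes> b : V 0" using f(3) V_inv v by metis
    ultimately show "EX f. f : F & (EX b:B (n + 1 + c + 1). inv (f \<otimes> b) : C & f \<otimes> b : V 0)" using f by blast
  qed
  from bchoice[OF this] obtain h where
    h: "ALL C:D. h C : F & (EX b:B (n + 1 + c + 1). inv (h C \<otimes> b) : C & h C \<otimes> b : V 0)" ..
  have "inj_on h D"
  proof (rule inj_onI)
    fix C C' assume C: "C : D" "C' : D" "h C = h C'"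
    obtain v v' where v: "v : V 0" "C = V 1 #> v" "v' : V 0" "C' = V 1 #> v'" using C by (auto simp: D_def)
    obtain b where b: "b : B (n + 1 + c + 1)" "inv (h C \<otimes> b) : C" "h C \<otimes> b : V 0" using h C by blast
    obtain b' where b': "b' : B (n + 1 + c + 1)" "inv (h C \<otimes> b') : C'" "h C \<otimes> b' : V 0" using h C by metis
    have hc: "h C : carrier G" "b : carrier G" "b' : carrier G" using h C F B_carrier b b' by blast+
    have vc: "v : carrier G" "v' : carrier G" using v V_carrier by blast+
    have e1: "C = V 1 #> inv (h C \<otimes> b)" using repr_independence[OF _ vc(1) V_subgroup] b(2) v(2) by metis
    have e2: "C' = V 1 #> inv (h C \<otimes> b')" using repr_independence[OF _ vc(2) V_subgroup] b'(2) v(4) by metis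
    have "inv (h C \<otimes> b) \<otimes> inv (inv (h C \<otimes> b')) = inv b \<otimes> b'"
      using hc by (simp add: inv_mult_group m_assoc)
    moreover have "inv b \<otimes> b' : B (n + 1 + c)" using B_mult[OF B_inv[OF b(1)] b'(1)] by simp
    moreover have "inv (h C \<otimes> b) \<otimes> inv (inv (h C \<otimes> b')) : M"
      using b(3) b'(3) V_M M_inv M_mult by blast
    ultimately have "inv (h C \<otimes> b) \<otimes> inv (inv (h C \<otimes> b')) : V 1" using V_open by metis
    then have "V 1 #> inv (h C \<otimes> b) = V 1 #> inv (h C \<otimes> b')" using V1_coset_eq hc by simp
    then show "C = C'" using e1 e2 by simp
  qed
  moreover have "h ` D <= F" using h by auto
  ultimately show ?thesis using F(1) by (meson finite_imageD finite_subset)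
qed

lemma cj_V1_coset: assumes "g : carrier G" "v : carrier G" shows "cj g ` (V 1 #> v) = V 1 #> cj g v"
proof
  show "cj g ` (V 1 #> v) <= V 1 #> cj g v"
    using assms V_carrier V_cj by (auto simp: r_coset_def cj_mult)
  show "V 1 #> cj g v <= cj g ` (V 1 #> v)"
  proof
    fix z assume "z : V 1 #> cj g v"
    then obtain w where w: "w : V 1" "z = w \<otimes> cj g v" by (auto simp: r_coset_def)
    have wc: "w : carrier G" using w V_carrier by blast
    have "cj (inv g) w \<otimes> v : V 1 #> v" using V_cj[OF inv_closed[OF assms(1)] w(1)] by (auto simp: r_coset_def)
    moreover have "cj g (cj (inv g) w \<otimes> v) = z" using w wc assms by (simp add: cj_mult)
    ultimately show "z : cj g ` (V 1 #> v)" by blast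
  qed
qed

text \<open>The conjugation action on the finite quotient of \<open>V 0\<close> by
  \<open>V 1\<close>. Composed with \<open>a k\<close> it probes every other level of the
  filtration.\<close>

definition \<rho> :: "'a => 'a set => 'a set" where "\<rho> g = restrict (%C. cj g ` C) D"

lemma \<rho>_coset: "g : carrier G ==> v : V 0 ==> \<rho> g (V 1 #> v) = V 1 #> cj g v"
  using cj_V1_coset V_carrier by (auto simp: \<rho>_def D_def)

lemma \<rho>_D: "g : carrier G ==> \<rho> g : (\<Pi>\<^sub>E C\<in>D. D)"
  using \<rho>_coset V_cj by (fastforce simp: D_def \<rho>_def)

lemma \<rho>_mult: assumes "g : carrier G" "h : carrier G" shows "\<rho> (g \<otimes> h) = restrict (%C. \<rho> g (\<rho> h C)) D"
proof
  fix C
  show "\<rho> (g \<otimes> h) C = restrict (%C. \<rho> g (\<rho> h C)) D C"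
  proof (cases "C : D")
    case True
    then obtain v where v: "v : V 0" "C = V 1 #> v" by (auto simp: D_def)
    then show ?thesis using assms True \<rho>_coset V_cj V_carrier by (simp add: cj_cj)
  qed (simp add: \<rho>_def)
qed

lemma \<rho>_inv: assumes gh: "g : carrier G" "h : carrier G" and eq: "\<rho> g = \<rho> h" shows "\<rho> (inv g) = \<rho> (inv h)"
proof -
  have 1: "\<rho> (inv h) (\<rho> h C) = C" if "C : D" for C
    using that gh \<rho>_coset V_cj V_carrier by (auto simp: D_def)
  have 2: "\<rho> g (\<rho> (inv g) C) = C" if "C : D" for C
    using that gh \<rho>_coset V_cj V_carrier by (auto simp: D_def)
  show ?thesis
  proof
    fix C
    show "\<rho> (inv g) C = \<rho> (inv h) C"
    proof (cases "C : D")
      case True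
      then have "\<rho> (inv g) C : D" using \<rho>_D[of "inv g"] gh by auto
      from 1[OF this] show ?thesis using 2[OF True] eq by simp
    qed (simp add: \<rho>_def)
  qed
qed

text \<open>Elements whose commutators push every level \<open>s\<close> steps deeper. Each
  \<open>J s\<close> is a closed stable normal subgroup, so minimality makes it trivial or all of
  \<open>M\<close>.\<close>

definition J :: "int => 'a set" where
  "J s = {g : M. ALL k. ALL v:V k. comm g v : V (k + s)}"

lemma comm_mult_left: "g : carrier G ==> h : carrier G ==> v : carrier G ==>
    comm (g \<otimes> h) v = cj g (comm h v) \<otimes> comm g v"
  by (simp add: comm_def cj_def m_assoc inv_mult_group)

lemma comm_inv_left: "g : carrier G ==> v : carrier G ==> comm (inv g) v = cj (inv g) (inv (comm g v))"
  by (simp add: comm_def cj_def m_assoc inv_mult_group)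

lemma cn_J: "cn (J s)"
  unfolding cn_def cas_def
proof (intro conjI allI ballI)
  have JM: "g : M" "g : carrier G" if "g : J s" for g using that M_carrier by (auto simp: J_def)
  have Jv: "comm g v : V (k + s)" if "g : J s" "v : V k" for g v k using that by (auto simp: J_def)
  have mult: "g \<otimes> h : J s" if gh: "g : J s" "h : J s" for g h
  proof -
    note gc = JM(2)[OF gh(1)] and hc = JM(2)[OF gh(2)]
    have "comm (g \<otimes> h) v : V (k + s)" if v: "v : V k" for k v
      using V_mult[OF V_cj[OF gc Jv[OF gh(2) v]] Jv[OF gh(1) v]]
      by (simp only: comm_mult_left[OF gc hc V_carrier[OF v]])
    then show ?thesis using M_mult[OF JM(1)[OF gh(1)] JM(1)[OF gh(2)]] unfolding J_def by blast
  qed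
  show "subgroup (J s) G"
  proof (rule subgroupI)
    show "J s <= carrier G" using JM by blast
    have "comm \<one> v : V (k + s)" if "v : V k" for k v
      using V_carrier[OF that] V_one by (simp add: comm_def)
    then have "\<one> : J s" using M_one unfolding J_def by blast
    then show "J s ~= {}" by blast
    show "inv g : J s" if g: "g : J s" for g
    proof -
      have "comm (inv g) v : V (k + s)" if v: "v : V k" for k v
        using V_cj[OF inv_closed[OF JM(2)[OF g]] V_inv[OF Jv[OF g v]]]
        by (simp only: comm_inv_left[OF JM(2)[OF g] V_carrier[OF v]])
      then show ?thesis using M_inv[OF JM(1)[OF g]] unfolding J_def by blast
    qed
  qed (rule mult)
  show "clo (J s)"
  proof (rule cloI)
    show "J s <= carrier G" using JM by blast
    fix x assume x: "x : carrier G" and *: "!!k. EX b:B k. x \<otimes> b : J s"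
    have xM: "x : M"
      by (rule cloD[OF cas_clo[OF casM] x]) (use * JM in blast)
    have "comm x v : V (k + s)" if v: "v : V k" for k v
    proof -
      obtain b where b: "b : B (n + (k + s) + c)" "x \<otimes> b : J s" using * by blast
      have bc: "b : carrier G" and vc: "v : carrier G" using b B_carrier v V_carrier by auto
      have "inv x \<otimes> (x \<otimes> b) : M" using M_mult M_inv xM JM b by blast
      then have "b : M" using x bc by simp
      from V_open[OF this b(1)] have bV: "b : V (k + s)" .
      have "cj (x \<otimes> b) (comm (inv b) v) : V (k + s)"
        by (rule V_cj[OF m_closed[OF x bc] V_comm'[OF V_inv[OF bV] vc]])
      moreover have "comm (x \<otimes> b) v : V (k + s)" using Jv[OF b(2) v] .
      moreover have "comm x v = cj (x \<otimes> b) (comm (inv b) v) \<otimes> comm (x \<otimes> b) v"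
        using comm_mult_left[of "x \<otimes> b" "inv b" v] x bc vc by (simp add: m_assoc)
      ultimately show ?thesis using V_mult by simp
    qed
    then show "x : J s" using xM unfolding J_def by blast
  qed
  show "a j x : J s" if x: "x : J s" for j x
  proof -
    have "comm (a j x) v : V (k + s)" if v: "v : V k" for k v
    proof -
      have "a (- j) v : V (k - j)" using V_a[OF v, of "- j"] by simp
      from V_a[OF Jv[OF x this], of j] show ?thesis
        using V_carrier[OF v] JM(2)[OF x] by (simp add: a_comm)
    qed
    then show ?thesis using M_a[OF JM(1)[OF x]] unfolding J_def by blast
  qed
  show "cj g x : J s" if g: "g : carrier G" and x: "x : J s" for g x
  proof -
    have "comm (cj g x) v : V (k + s)" if v: "v : V k" for k v
      using V_cj[OF g Jv[OF x V_cj[OF inv_closed[OF g] v]]] V_carrier[OF v] JM(2)[OF x] g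
      by (simp add: cj_comm_distrib)
    then show ?thesis using M_cj[OF g JM(1)[OF x]] unfolding J_def by blast
  qed
qed

lemma J_cases: "J s = {\<one>} | J s = M"
  by (rule M_min[OF cn_J]) (auto simp: J_def)

text \<open>An element acting trivially on every quotient of \<open>V k\<close> by
  \<open>V (k + 1)\<close> lies in \<open>J 1\<close>. If that is trivial, the finite permutation
  actions at all levels separate points, and \<open>residually_bounded\<close> applies.\<close>

lemma J1_trivial:
  assumes J1: "J 1 = {\<one>}"
  shows "EX e>0. ALL x:M. x [^] (e::nat) = \<one>" and "!!x y. x : M ==> y : M ==> finite (generate G {x, y})"
proof -
  have fin: "finite (\<Pi>\<^sub>E C\<in>D. D)" using finite_D by (intro finite_PiE) auto
  have mem: "\<rho> (a k u) : (\<Pi>\<^sub>E C\<in>D. D)" if "u : M" for k u using \<rho>_D M_carrier that by simp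
  have mul: "\<rho> (a k (u \<otimes> v)) = \<rho> (a k' (u' \<otimes> v'))"
    if "u : M" "u' : M" "v : M" "v' : M" "\<rho> (a k u) = \<rho> (a k' u')" "\<rho> (a k v) = \<rho> (a k' v')" for k k' u u' v v'
    using that M_carrier by (simp add: a_mult \<rho>_mult)
  have iv: "\<rho> (a k (inv u)) = \<rho> (a k' (inv u'))"
    if "u : M" "u' : M" "\<rho> (a k u) = \<rho> (a k' u')" for k k' u u'
    using that M_carrier \<rho>_inv by (simp add: a_inv)
  have on: "\<rho> (a k \<one>) = \<rho> (a k' \<one>)" for k k' by simp
  have sep: "u = \<one>" if u: "u : M" and eq: "!!k. \<rho> (a k u) = \<rho> (a k \<one>)" for u
  proof -
    have uc: "u : carrier G" using M_carrier u by blast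
    have "comm u v : V (k + 1)" if v: "v : V k" for k v
    proof -
      have vc: "v : carrier G" using V_carrier v by blast
      define w where "w = a (- k) v"
      have w: "w : V 0" "w : carrier G" using V_a[OF v, of "- k"] vc by (simp_all add: w_def)
      have "V 1 #> cj (a (- k) u) w = V 1 #> w"
        using \<rho>_coset[of "a (- k) u" w] \<rho>_coset[of \<one> w] eq[of "- k"] uc w by simp
      then have "cj (a (- k) u) w \<otimes> inv w : V 1" using V1_coset_eq uc w by simp
      moreover have "a (- k) (comm u v) = cj (a (- k) u) w \<otimes> inv w"
        using a_comm[OF vc uc, of "- k"] comm_cj[of "a (- k) u" w] uc w(2) by (simp add: w_def)
      ultimately have "a (- k) (comm u v) : V 1" by simp
      then show ?thesis using V_a_iff uc vc by (simp add: add.commute)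
    qed
    then have "u : J 1" using u by (simp add: J_def)
    then show ?thesis using J1 by simp
  qed
  show "EX e>0. ALL x:M. x [^] (e::nat) = \<one>"
    by (rule residually_bounded(1)[of M "\<Pi>\<^sub>E C\<in>D. D" "%k u. \<rho> (a k u)"])
      (fact subgroupM fin mem mul iv on sep)+
  show "finite (generate G {x, y})" if "x : M" "y : M" for x y
    by (rule residually_bounded(2)[of M "\<Pi>\<^sub>E C\<in>D. D" "%k u. \<rho> (a k u)"])
      (fact subgroupM fin mem mul iv on sep that)+
qed

text \<open>If some \<open>J s\<close> is not \<open>M\<close>, there is a first index
  \<open>t\<close> with \<open>J t\<close> trivial, and \<open>t >= 2\<close>. A commutator of
  elements of \<open>J (t - 1)\<close> gains \<open>2 * (t - 1)\<close>, which is at least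
  \<open>t\<close>, and is therefore trivial.\<close>

lemma J1_full_comm:
  assumes J1: "J 1 = M" and xy: "x : M" "y : M"
  shows "x \<otimes> y = y \<otimes> x"
proof (cases "ALL s>=1. J (int s) = M")
  case True
  obtain k where k: "y : V k" using V_exh[OF xy(2)] .
  have c: "x : carrier G" "y : carrier G" using xy M_carrier by auto
  have "comm x y : B (int m)" for m
  proof -
    have "J (int (Suc (nat (int m - k)))) = M" by (rule True[rule_format]) simp
    then have "x : J (int (Suc (nat (int m - k))))" using xy by simp
    then have "comm x y : V (k + int (Suc (nat (int m - k))))" using k by (simp add: J_def)
    from V_B[OF this] show ?thesis by (rule B_monoD) simp
  qed
  then have "comm x y = \<one>" using B_sep c by simp
  then show ?thesis using comm_one_iff c by simp
next
  case False
  define P where "P s \<longleftrightarrow> s >= 1 & J (int s) ~= M" for s :: nat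
  obtain s0 where s0: "P s0" using False unfolding P_def by blast
  define t where "t = (LEAST s. P s)"
  have t: "P t" using LeastI[of P s0, OF s0] by (simp only: t_def)
  have "t ~= 1"
  proof
    assume "t = 1"
    then have "J (int 1) ~= M" using t unfolding P_def by blast
    then show False using J1 by simp
  qed
  then have t2: "t >= 2" using t unfolding P_def by linarith
  have "t - 1 < (LEAST s. P s)" using t2 t_def by simp
  from not_less_Least[OF this] have "J (int (t - 1)) = M" using t2 unfolding P_def by simp
  then have Js: "J (int t - 1) = M" using t2 by (simp add: of_nat_diff)
  have Jt: "J (int t) = {\<one>}" using J_cases[of "int t"] t unfolding P_def by blast
  define s where "s = int t - 1"
  have s: "s >= 1" using t2 by (simp add: s_def)
  have Jv: "comm g v : V (k + s)" if "g : M" "v : V k" for g v k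
    using that Js by (auto simp: J_def s_def)
  have "comm x y : J (int t)"
    unfolding J_def
  proof (intro CollectI conjI allI ballI)
    have c: "x : carrier G" "y : carrier G" using xy M_carrier by auto
    show "comm x y : M" using M_comm c xy by blast
    fix k w assume w: "w : V k"
    \<comment> \<open>With \<open>v\<close> pulled back by \<open>y \<otimes> x\<close>, conjugating
      \<open>w\<close> by \<open>comm x y\<close> means conjugating \<open>v\<close> by
      \<open>x \<otimes> y\<close>. Comparing the two orders of conjugation below, the first order
      terms \<open>p\<close> and \<open>q\<close> enter only through
      \<open>comm p q\<close>.\<close>
    define v where "v = cj (inv (y \<otimes> x)) w"
    have wc: "w : carrier G" and v: "v : V k" using w V_carrier V_cj c by (auto simp: v_def)
    have vc: "v : carrier G" using v V_carrier by blast
    define p q where "p = comm y v" and "q = comm x v"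
    have p: "p : V (k + s)" and q: "q : V (k + s)" using Jv xy v by (auto simp: p_def q_def)
    have pc: "p : carrier G" "q : carrier G" using p q V_carrier by blast+
    define r r' where "r = comm x p" and "r' = comm y q"
    have r: "r : V (k + s + s)" "r' : V (k + s + s)" using Jv[OF xy(1) p] Jv[OF xy(2) q] by (auto simp: r_def r'_def)
    have rc: "r : carrier G" "r' : carrier G" using r V_carrier by blast+
    have pq: "comm p q : V (k + s + s)" using Jv[OF _ q, of p] p V_M by blast
    have e: "cj y v = p \<otimes> v" "cj x v = q \<otimes> v" "cj x p = r \<otimes> p" "cj y q = r' \<otimes> q"
      unfolding p_def q_def r_def r'_def using c vc by (simp_all only: cj_comm comm_closed)
    have 1: "cj (x \<otimes> y) v = r \<otimes> (p \<otimes> (q \<otimes> v))"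
    proof -
      have "cj (x \<otimes> y) v = cj x (p \<otimes> v)" using cj_cj[OF c vc] by (simp only: e)
      also have "\<dots> = (r \<otimes> p) \<otimes> (q \<otimes> v)" using cj_mult[OF c(1) pc(1) vc] by (simp only: e)
      finally show ?thesis using rc pc vc by (simp add: m_assoc)
    qed
    have 2: "w = r' \<otimes> (q \<otimes> (p \<otimes> v))"
    proof -
      have "w = cj (y \<otimes> x) v" using c wc by (simp add: v_def)
      also have "\<dots> = cj y (q \<otimes> v)" using cj_cj[OF c(2,1) vc] by (simp only: e)
      also have "\<dots> = (r' \<otimes> q) \<otimes> (p \<otimes> v)" using cj_mult[OF c(2) pc(2) vc] by (simp only: e)
      finally show ?thesis using rc pc vc by (simp add: m_assoc)
    qed
    have "comm x y \<otimes> (y \<otimes> x) = x \<otimes> y" using c by (simp add: comm_def m_assoc)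
    then have "cj (comm x y) w = cj (x \<otimes> y) v"
      using c wc vc by (simp add: v_def cj_cj inv_mult_group m_assoc comm_def)
    then have "comm (comm x y) w = cj (x \<otimes> y) v \<otimes> inv w" using c wc by (simp add: comm_cj)
    also have "\<dots> = r \<otimes> comm p q \<otimes> inv r'"
      unfolding 1 2 using rc pc vc by (simp add: comm_def m_assoc inv_mult_group)
    finally have "comm (comm x y) w : V (k + s + s)" using r pq V_mult V_inv by simp
    then show "comm (comm x y) w : V (k + int t)" by (rule V_monoD) (use s in \<open>simp add: s_def\<close>)
  qed
  then have "comm x y = \<one>" using Jt by simp
  then show ?thesis using comm_one_iff xy M_carrier by simp
qed

end

section \<open>Groups with conjugation invariant neighbourhoods\<close>

locale sin_group = group G for G (structure) +
  fixes Z :: "int => 'a set"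
  assumes Z_carrier: "x : Z k ==> x : carrier G"
    and Z_one [simp]: "\<one> : Z k" and Z_inv: "x : Z k ==> inv x : Z k"
    and Z_cj: "g : carrier G ==> x : Z k ==> cj g x : Z k"
    and Z_cube: "x : Z (k + 1) ==> y : Z (k + 1) ==> z : Z (k + 1) ==> x \<otimes> y \<otimes> z : Z k"
    and Z_exh: "x : carrier G ==> EX n::nat. x : Z (- int n)"
    and Z_tb: "EX F. finite F & F <= carrier G & Z j <= (\<Union>f\<in>F. (%z. f \<otimes> z) ` Z k)"
begin

lemma Z_mult: "x : Z (k + 1) ==> y : Z (k + 1) ==> x \<otimes> y : Z k"
  using Z_cube[of x k y \<one>] by (simp add: Z_carrier)

lemma Z_mono: "j <= k ==> Z k <= Z j"
proof -
  assume "j <= k"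
  have step: "Z (k + 1) <= Z k" for k using Z_mult[of _ k \<one>] by (auto simp: Z_carrier)
  have "Z (j + int n) <= Z j" for n
  proof (induction n)
    case (Suc n)
    have "Z (j + int (Suc n)) <= Z (j + int n)" using step[of "j + int n"] by (simp add: algebra_simps)
    then show ?case using Suc by blast
  qed simp
  from this[of "nat (k - j)"] show ?thesis using \<open>j <= k\<close> by simp
qed

lemma Z_monoD: "x : Z k ==> j <= k ==> x : Z j"
  using Z_mono by blast

subsection \<open>A conjugation invariant length function\<close>

definition wt :: "int => real" where "wt k = 2 powr (- real_of_int k)"

lemma wt_pos: "wt k > 0" by (simp add: wt_def)

lemma wt_less: "wt j < wt k \<longleftrightarrow> k < j"
  by (simp add: wt_def)

lemma wt_Suc: "wt (k + 1) = wt k / 2"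
  by (simp add: wt_def powr_diff powr_minus divide_simps)

text \<open>Each factor carries its scale, since an element lies in many \<open>Z k\<close> and its
  weight depends on the one chosen.\<close>

definition chain :: "('a \<times> int) list => bool" where
  "chain xs \<longleftrightarrow> (ALL (z, k):set xs. z : Z k)"

definition lprod :: "('a \<times> int) list => 'a" where
  "lprod xs = foldr (%p y. fst p \<otimes> y) xs \<one>"

definition lwt :: "('a \<times> int) list => real" where "lwt xs = sum_list (map (%p. wt (snd p)) xs)"

lemma chain_simps [simp]: "chain []" "chain (p # xs) \<longleftrightarrow> fst p : Z (snd p) & chain xs"
  "chain (xs @ ys) \<longleftrightarrow> chain xs & chain ys"
  by (auto simp: chain_def)

lemma lprod_simps [simp]: "lprod [] = \<one>" "lprod (p # xs) = fst p \<otimes> lprod xs"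
  by (simp_all add: lprod_def)

lemma lprod_closed [simp]: "chain xs ==> lprod xs : carrier G"
  by (induction xs) (auto simp: Z_carrier)

lemma lprod_append: "chain xs ==> chain ys ==> lprod (xs @ ys) = lprod xs \<otimes> lprod ys"
  by (induction xs) (auto simp: Z_carrier m_assoc)

lemma lwt_simps [simp]: "lwt [] = 0" "lwt (p # xs) = wt (snd p) + lwt xs" "lwt (xs @ ys) = lwt xs + lwt ys"
  by (simp_all add: lwt_def)

lemma lwt_nonneg: "lwt xs >= 0"
proof (induction xs)
  case (Cons p xs)
  then show ?case using wt_pos[of "snd p"] by simp
qed simp

text \<open>The list is cut at the first entry where the accumulated weight exceeds half of the
  total. Both ends have at most half of the weight and the cut entry is small by itself, so three
  factors in \<open>Z k\<close> remain; hence the cube axiom.\<close>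

lemma chain_small: "chain xs ==> lwt xs < wt k ==> lprod xs : Z (k - 1)"
proof (induction xs arbitrary: k rule: length_induct)
  case (1 xs)
  show ?case
  proof (cases "xs = []")
    case False
    define S where "S = lwt xs"
    have S: "S > 0" unfolding S_def using False wt_pos lwt_nonneg
      by (cases xs) (auto intro: add_pos_nonneg)
    define P where "P i \<longleftrightarrow> lwt (take (i + 1) xs) > S / 2" for i
    have "P (length xs)" using S by (simp add: P_def S_def)
    define i where "i = (LEAST i. P i)"
    have Pi: "P i" unfolding i_def by (rule LeastI[of P, OF \<open>P (length xs)\<close>])
    have Pm: "~ P j" if "j < i" for j using that not_less_Least unfolding i_def by blast
    have before: "lwt (take i xs) <= S / 2"
    proof (cases i)
      case 0 then show ?thesis using S by simp
    next
      case (Suc j) then show ?thesis using Pm[of j] by (simp add: P_def not_less)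
    qed
    have il: "i < length xs"
    proof (rule ccontr)
      assume "~ i < length xs"
      then have "take i xs = xs" by simp
      then show False using before S by (simp add: S_def)
    qed
    obtain z m where zm: "xs ! i = (z, m)" by (cases "xs ! i")
    have split: "xs = take i xs @ (z, m) # drop (i + 1) xs"
      using il zm id_take_nth_drop[OF il] by simp
    have tk: "take (i + 1) xs = take i xs @ [(z, m)]" using il zm by (simp add: take_Suc_conv_app_nth)
    have sum: "S = lwt (take i xs) + (wt m + lwt (drop (i + 1) xs))"
      unfolding S_def by (subst split) simp
    have after: "lwt (drop (i + 1) xs) < S / 2" using Pi sum unfolding P_def tk by simp
    have ch: "chain (take i xs)" "z : Z m" "chain (drop (i + 1) xs)"
      using 1(2) by (subst (asm) split, simp)+
    have Sk: "S / 2 < wt (k + 1)" using 1(3) by (simp add: S_def wt_Suc)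
    have 1: "lprod (take i xs) : Z k"
      using 1(1)[rule_format, of "take i xs" "k + 1"] il ch before Sk by simp
    have 3: "lprod (drop (i + 1) xs) : Z k"
      using "1.IH"[rule_format, of "drop (i + 1) xs" "k + 1"] il ch after Sk by simp
    have "wt m <= S" using sum lwt_nonneg[of "take i xs"] lwt_nonneg[of "drop (i + 1) xs"] by linarith
    then have "wt m < wt k" using Sk by (simp add: wt_Suc)
    then have 2: "z : Z k" using Z_monoD[OF ch(2)] wt_less by simp
    have "lprod xs = lprod (take i xs) \<otimes> z \<otimes> lprod (drop (i + 1) xs)"
      by (subst split) (use ch in \<open>simp add: lprod_append Z_carrier m_assoc\<close>)
    then show ?thesis using Z_cube[of _ "k - 1"] 1 2 3 by simp
  qed simp
qed

text \<open>The chain construction of Birkhoff and Kakutani, which is conjugation invariant because the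
  sets \<open>Z k\<close> are.\<close>

definition d :: "'a => real" where "d x = Inf {lwt xs | xs. chain xs & lprod xs = x}"

lemma d_bdd: "bdd_below {lwt xs | xs. chain xs & lprod xs = x}"
  using lwt_nonneg by (intro bdd_belowI[of _ 0]) auto

lemma d_le: "chain xs ==> lprod xs = x ==> d x <= lwt xs"
  unfolding d_def by (rule cInf_lower[OF _ d_bdd]) auto

lemma d_ne: assumes "x : carrier G" shows "{lwt xs | xs. chain xs & lprod xs = x} ~= {}"
proof -
  obtain n :: nat where "x : Z (- int n)" using Z_exh assms by blast
  then have "chain [(x, - int n)]" "lprod [(x, - int n)] = x" using assms by auto
  then show ?thesis by blast
qed

lemma d_nonneg: "x : carrier G ==> d x >= 0"
  unfolding d_def by (rule cInf_greatest[OF d_ne]) (use lwt_nonneg in auto)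

lemma d_Z: "x : Z k ==> d x <= wt k"
  using d_le[of "[(x, k)]" x] by (simp add: Z_carrier)

lemma d_approx: assumes "x : carrier G" "d x < t" obtains xs where "chain xs" "lprod xs = x" "lwt xs < t"
proof -
  have "EX s:{lwt xs | xs. chain xs & lprod xs = x}. s < t"
    using cInf_less_iff[OF d_ne[OF assms(1)] d_bdd] assms(2) unfolding d_def by blast
  then show thesis using that by blast
qed

lemma d_small: assumes "x : carrier G" "d x < wt k" shows "x : Z (k - 1)"
proof -
  obtain xs where "chain xs" "lprod xs = x" "lwt xs < wt k" using d_approx[OF assms] .
  then show ?thesis using chain_small by blast
qed

lemma d_step: assumes "x : carrier G" "g : Z k" shows "\<bar>d (g \<otimes> x) - d x\<bar> <= wt k"
proof -
  have *: "d (h \<otimes> y) <= wt k + d y" if y: "y : carrier G" and h: "h : Z k" for h y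
  proof (rule field_le_epsilon)
    fix e :: real assume "e > 0"
    then have "d y < d y + e" by simp
    then obtain xs where xs: "chain xs" "lprod xs = y" "lwt xs < d y + e" using d_approx[OF y] by blast
    have "d (h \<otimes> y) <= lwt ((h, k) # xs)" by (rule d_le) (use xs h in auto)
    then show "d (h \<otimes> y) <= wt k + d y + e" using xs(3) by simp
  qed
  have "d (inv g \<otimes> (g \<otimes> x)) <= wt k + d (g \<otimes> x)" by (rule *) (use assms Z_inv Z_carrier in auto)
  then show ?thesis using *[OF assms] assms Z_carrier[OF assms(2)] by simp
qed

subsection \<open>Uniformly continuous functions with bounded support\<close>

text \<open>Conjugation invariance of \<open>Z k\<close> makes left and right uniform continuity
  agree, so a condition on left factors also controls reflections and translates.\<close>

definition UC :: "('a => real) set" where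
  "UC = {f. (ALL x. f x >= 0) & (EX j. ALL x. x ~: Z j --> f x = 0) & (EX C. ALL x. f x <= C) &
     (ALL e>0. EX k. ALL x:carrier G. ALL z:Z k. \<bar>f (z \<otimes> x) - f x\<bar> <= e)}"

lemma UC_I:
  assumes "!!x. f x >= 0" "!!x. x ~: Z j ==> f x = 0" "!!x. f x <= C"
    "!!e. e > 0 ==> EX k. ALL x:carrier G. ALL z:Z k. \<bar>f (z \<otimes> x) - f x\<bar> <= e"
  shows "f : UC"
  using assms unfolding UC_def by blast

lemma UC_nonneg: "f : UC ==> f x >= 0" by (simp add: UC_def)

lemma UC_supp: assumes "f : UC" obtains j where "ALL x. x ~: Z j --> f x = 0"
  using assms unfolding UC_def by blast

lemma UC_bound: assumes "f : UC" obtains C where "C >= 0" "ALL x. f x <= C"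
proof -
  obtain C where C: "ALL x. f x <= C" using assms unfolding UC_def by blast
  have "0 <= f \<one>" "f \<one> <= C" using UC_nonneg[OF assms] C by auto
  then have "C >= 0" by linarith
  then show thesis by (rule that[OF _ C])
qed

lemma UC_cont: assumes "f : UC" "e > 0"
  obtains k where "ALL x:carrier G. ALL z:Z k. \<bar>f (z \<otimes> x) - f x\<bar> <= e"
  using assms unfolding UC_def by blast

text \<open>A tent over the length \<open>d\<close>, hence Lipschitz. The function
  \<open>bump 0\<close> normalises the functional and starts the iterated convolutions.\<close>

definition bump :: "int => 'a => real" where
  "bump j x = (if x : carrier G then max 0 (2 - d x / wt j) else 0)"

lemma bump_nonneg: "bump j x >= 0" by (simp add: bump_def)

lemma bump_ge: assumes "x : Z j" shows "bump j x >= 1"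
proof -
  have "d x / wt j <= 1" using d_Z[OF assms] wt_pos[of j] by simp
  then show ?thesis using Z_carrier[OF assms] by (simp add: bump_def)
qed

lemma bump_le: "bump j x <= 2"
  using d_nonneg[of x] wt_pos[of j] by (auto simp: bump_def)

lemma bump_supp: assumes "x ~: Z (j - 2)" shows "bump j x = 0"
proof (cases "x : carrier G")
  case True
  have "~ d x < wt (j - 1)" using d_small[OF True, of "j - 1"] assms by auto
  moreover have "wt (j - 1) = 2 * wt j" using wt_Suc[of "j - 1"] by simp
  ultimately have "d x / wt j >= 2" using wt_pos[of j] by (simp add: field_simps)
  then show ?thesis by (simp add: bump_def)
qed (simp add: bump_def)

lemma bump_step: assumes "x : carrier G" "z : Z k" shows "\<bar>bump j (z \<otimes> x) - bump j x\<bar> <= wt k / wt j"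
proof -
  have "\<bar>bump j (z \<otimes> x) - bump j x\<bar> <= \<bar>(2 - d (z \<otimes> x) / wt j) - (2 - d x / wt j)\<bar>"
    using assms Z_carrier[OF assms(2)] by (simp add: bump_def max_def)
  also have "\<dots> = \<bar>d (z \<otimes> x) - d x\<bar> / wt j"
  proof -
    have "(2 - d (z \<otimes> x) / wt j) - (2 - d x / wt j) = - ((d (z \<otimes> x) - d x) / wt j)"
      by (simp add: diff_divide_distrib)
    then show ?thesis using wt_pos[of j] by (simp add: abs_divide)
  qed
  also have "\<dots> <= wt k / wt j" using d_step[OF assms] wt_pos[of j] by (simp add: divide_right_mono)
  finally show ?thesis .
qed

lemma wt_small: assumes "e > 0" obtains k where "wt k <= e"
proof -
  obtain n :: nat where n: "1 / e < 2 ^ n" using real_arch_pow[of 2 "1 / e"] by auto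
  have "wt (int n) = 1 / 2 ^ n" by (simp add: wt_def powr_minus powr_realpow divide_simps)
  also have "\<dots> <= e" using n assms by (simp add: field_simps less_imp_le)
  finally show thesis by (rule that)
qed

lemma bump_UC: "bump j : UC"
proof (rule UC_I[OF bump_nonneg bump_supp bump_le])
  fix e :: real assume e: "e > 0"
  obtain k where k: "wt k <= e * wt j" using wt_small[of "e * wt j"] e wt_pos[of j] by auto
  have "\<bar>bump j (z \<otimes> x) - bump j x\<bar> <= e" if "x : carrier G" "z : Z k" for x z
  proof -
    have "wt k / wt j <= e" using k wt_pos[of j] by (simp add: field_simps)
    then show ?thesis using bump_step[OF that, of j] by linarith
  qed
  then show "EX k. ALL x:carrier G. ALL z:Z k. \<bar>bump j (z \<otimes> x) - bump j x\<bar> <= e" by blast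
qed

lemma UC_add: assumes f: "f : UC" and g: "g : UC" shows "(%x. f x + g x) : UC"
proof -
  obtain i where i: "ALL x. x ~: Z i --> f x = 0" by (rule UC_supp[OF f])
  obtain j where j: "ALL x. x ~: Z j --> g x = 0" by (rule UC_supp[OF g])
  obtain C where C: "ALL x. f x <= C" by (rule UC_bound[OF f])
  obtain D where D: "ALL x. g x <= D" by (rule UC_bound[OF g])
  show ?thesis
  proof (rule UC_I[of _ "min i j" "C + D"])
    fix x assume "x ~: Z (min i j)"
    then have "x ~: Z i" "x ~: Z j" using Z_monoD[of x i "min i j"] Z_monoD[of x j "min i j"] by auto
    then show "f x + g x = 0" using i j by simp
  next
    fix e :: real assume "e > 0"
    then have e2: "e / 2 > 0" by simp
    obtain k where k: "ALL x:carrier G. ALL z:Z k. \<bar>f (z \<otimes> x) - f x\<bar> <= e / 2" by (rule UC_cont[OF f e2])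
    obtain l where l: "ALL x:carrier G. ALL z:Z l. \<bar>g (z \<otimes> x) - g x\<bar> <= e / 2" by (rule UC_cont[OF g e2])
    have "\<bar>f (z \<otimes> x) + g (z \<otimes> x) - (f x + g x)\<bar> <= e" if x: "x : carrier G" and z: "z : Z (max k l)" for x z
    proof -
      have "z : Z k" "z : Z l" using Z_monoD[OF z] by auto
      then have "\<bar>f (z \<otimes> x) - f x\<bar> <= e / 2" "\<bar>g (z \<otimes> x) - g x\<bar> <= e / 2" using k l x by auto
      then show ?thesis by linarith
    qed
    then show "EX k. ALL x:carrier G. ALL z:Z k. \<bar>f (z \<otimes> x) + g (z \<otimes> x) - (f x + g x)\<bar> <= e" by blast
  qed (use f g UC_nonneg C D in \<open>auto intro: add_mono\<close>)
qed

lemma UC_mult: assumes f: "f : UC"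
  and g: "!!x. g x >= 0" "!!x. g x <= D" "!!e. e > 0 ==> EX k. ALL x:carrier G. ALL z:Z k. \<bar>g (z \<otimes> x) - g x\<bar> <= e"
  shows "(%x. f x * g x) : UC"
proof -
  obtain i where i: "ALL x. x ~: Z i --> f x = 0" by (rule UC_supp[OF f])
  obtain C where C: "C >= 0" "ALL x. f x <= C" by (rule UC_bound[OF f])
  have D: "D >= 0" using g(1,2)[of \<one>] by linarith
  show ?thesis
  proof (rule UC_I[of _ i "C * D"])
    fix e :: real assume "e > 0"
    then have e1: "e / (2 * (D + 1)) > 0" and e2: "e / (2 * (C + 1)) > 0" using C D by simp_all
    obtain k where k: "ALL x:carrier G. ALL z:Z k. \<bar>f (z \<otimes> x) - f x\<bar> <= e / (2 * (D + 1))" by (rule UC_cont[OF f e1])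
    obtain l where l: "ALL x:carrier G. ALL z:Z l. \<bar>g (z \<otimes> x) - g x\<bar> <= e / (2 * (C + 1))" using g(3)[OF e2] by blast
    have "\<bar>f (z \<otimes> x) * g (z \<otimes> x) - f x * g x\<bar> <= e" if x: "x : carrier G" and z: "z : Z (max k l)" for x z
    proof -
      have "z : Z k" "z : Z l" using Z_monoD[OF z] by auto
      then have 1: "\<bar>f (z \<otimes> x) - f x\<bar> <= e / (2 * (D + 1))" and 2: "\<bar>g (z \<otimes> x) - g x\<bar> <= e / (2 * (C + 1))"
        using k l x by auto
      have "f (z \<otimes> x) * g (z \<otimes> x) - f x * g x = (f (z \<otimes> x) - f x) * g (z \<otimes> x) + f x * (g (z \<otimes> x) - g x)"
        by (simp add: algebra_simps)
      then have "\<bar>f (z \<otimes> x) * g (z \<otimes> x) - f x * g x\<bar> <= \<bar>f (z \<otimes> x) - f x\<bar> * g (z \<otimes> x) + f x * \<bar>g (z \<otimes> x) - g x\<bar>"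
        using abs_triangle_ineq[of "(f (z \<otimes> x) - f x) * g (z \<otimes> x)" "f x * (g (z \<otimes> x) - g x)"]
          g(1)[of "z \<otimes> x"] UC_nonneg[OF f, of x] by (simp add: abs_mult)
      also have "\<dots> <= e / (2 * (D + 1)) * D + C * (e / (2 * (C + 1)))"
        using 1 2 g(1,2) C UC_nonneg[OF f] by (intro add_mono mult_mono) auto
      also have "\<dots> <= e / 2 + e / 2"
        using C D \<open>e > 0\<close> by (intro add_mono) (simp_all add: field_simps)
      finally show ?thesis by simp
    qed
    then show "EX k. ALL x:carrier G. ALL z:Z k. \<bar>f (z \<otimes> x) * g (z \<otimes> x) - f x * g x\<bar> <= e" by blast
  qed (use f UC_nonneg i C g D in \<open>auto intro: mult_mono\<close>)
qed

lemma UC_scale: assumes f: "f : UC" and r: "r >= 0" shows "(%x. r * f x) : UC"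
  using UC_mult[OF f, of "%_. r" r] r by (simp add: mult.commute)

lemma Z_bounded_mult: assumes "g : carrier G" obtains i where "ALL x. g \<otimes> x : Z j --> x : carrier G --> x : Z i"
proof -
  obtain n :: nat where n: "g : Z (- int n)" using Z_exh assms by blast
  have "x : Z (min (- int n) j - 1)" if "g \<otimes> x : Z j" "x : carrier G" for x
  proof -
    have "inv g \<otimes> (g \<otimes> x) : Z (min (- int n) j - 1)"
      by (rule Z_mult; rule Z_monoD, (rule Z_inv[OF n] that(1)), simp)
    then show ?thesis using that assms by simp
  qed
  then show thesis using that by blast
qed

lemma UC_translate: assumes f: "f : UC" and g: "g : carrier G"
  shows "(%x. if x : carrier G then f (g \<otimes> x) else 0) : UC"
proof -
  obtain j where j: "ALL x. x ~: Z j --> f x = 0" by (rule UC_supp[OF f])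
  obtain i where i: "ALL x. g \<otimes> x : Z j --> x : carrier G --> x : Z i" using Z_bounded_mult[OF g] by blast
  obtain C where C: "C >= 0" "ALL x. f x <= C" by (rule UC_bound[OF f])
  show ?thesis
  proof (rule UC_I[of _ i C])
    fix e :: real assume "e > 0"
    then obtain k where k: "ALL x:carrier G. ALL z:Z k. \<bar>f (z \<otimes> x) - f x\<bar> <= e" by (rule UC_cont[OF f])
    have "\<bar>f (g \<otimes> (z \<otimes> x)) - f (g \<otimes> x)\<bar> <= e" if x: "x : carrier G" and z: "z : Z k" for x z
    proof -
      have zc: "z : carrier G" using z Z_carrier by blast
      have "g \<otimes> (z \<otimes> x) = cj g z \<otimes> (g \<otimes> x)" using g x zc by (simp add: cj_def m_assoc)
      then show ?thesis using k Z_cj[OF g z] g x by simp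
    qed
    then show "EX k. ALL x:carrier G. ALL z:Z k. \<bar>(if z \<otimes> x : carrier G then f (g \<otimes> (z \<otimes> x)) else 0) -
        (if x : carrier G then f (g \<otimes> x) else 0)\<bar> <= e"
      using Z_carrier by auto
  qed (use f UC_nonneg C i j in auto)
qed

end

lemma sum_list_member_le: "(!!x. x : set xs ==> 0 <= f x) ==> y : set xs ==> (f y :: real) <= sum_list (map f xs)"
proof (induction xs)
  case (Cons x xs)
  have "sum_list (map f xs) >= 0" using Cons.prems(1) by (intro sum_list_nonneg) auto
  then show ?case using Cons by (cases "y = x") (auto intro: add_increasing)
qed simp

context sin_group
begin

subsection \<open>An invariant functional\<close>

definition pos :: "(real \<times> 'a) list => bool" where
  "pos xs \<longleftrightarrow> (ALL p:set xs. fst p >= 0 & snd p : carrier G)"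

text \<open>A pair \<open>(c, y)\<close> in the list stands for \<open>c\<close> times the indicator
  function of the translate of \<open>Z k\<close> by \<open>y\<close>.\<close>

definition val :: "int => (real \<times> 'a) list => 'a => real" where
  "val k xs x = sum_list (map (%p. if inv (snd p) \<otimes> x : Z k then fst p else 0) xs)"

definition tot :: "(real \<times> 'a) list => real" where "tot xs = sum_list (map fst xs)"

definition covers :: "('a => real) => int => (real \<times> 'a) list => bool" where
  "covers f k xs \<longleftrightarrow> pos xs & (ALL x:carrier G. f x <= val k xs x)"

text \<open>The Haar covering numbers of \<open>f\<close> by translates of \<open>Z k\<close>; an invariant functional is
  obtained as a limit of their ratios.\<close>

definition h :: "int => ('a => real) => real" where "h k f = Inf (tot ` Collect (covers f k))"

lemma tot_nonneg: "pos xs ==> tot xs >= 0"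
  unfolding tot_def pos_def by (intro sum_list_nonneg) auto

lemma val_nonneg: "pos xs ==> val k xs x >= 0"
  unfolding val_def pos_def by (intro sum_list_nonneg) auto

lemma val_le_tot: "pos xs ==> val k xs x <= tot xs"
  unfolding val_def tot_def pos_def by (intro sum_list_mono) auto

lemma h_bdd: "bdd_below (tot ` Collect (covers f k))"
  by (rule bdd_belowI[of _ 0]) (auto simp: covers_def tot_nonneg)

lemma h_le: "covers f k xs ==> h k f <= tot xs"
  unfolding h_def by (rule cInf_lower[OF _ h_bdd]) auto

lemma covers_exists: assumes f: "f : UC" shows "Collect (covers f k) ~= {}"
proof -
  obtain j where j: "ALL x. x ~: Z j --> f x = 0" by (rule UC_supp[OF f])
  obtain C where C: "C >= 0" "ALL x. f x <= C" by (rule UC_bound[OF f])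
  obtain F where F: "finite F" "F <= carrier G" "Z j <= (\<Union>y\<in>F. (%z. y \<otimes> z) ` Z k)" using Z_tb[of j k] by blast
  obtain ys where ys: "set ys = F" using finite_list[OF F(1)] by blast
  define xs where "xs = map (%y. (C, y)) ys"
  have p: "pos xs" using ys F C by (auto simp: pos_def xs_def)
  have "f x <= val k xs x" if "x : carrier G" for x
  proof (cases "x : Z j")
    case True
    then obtain y z where yz: "y : F" "z : Z k" "x = y \<otimes> z" using F(3) by blast
    have "inv y \<otimes> x : Z k" using yz F(2) Z_carrier by (auto simp: subset_iff)
    moreover have "(if inv y \<otimes> x : Z k then C else 0) <= (\<Sum>y\<leftarrow>ys. if inv y \<otimes> x : Z k then C else 0)"
      by (rule sum_list_member_le[of ys "%y. if inv y \<otimes> x : Z k then C else 0" y]) (use ys yz C in auto)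
    ultimately have "C <= val k xs x" unfolding val_def xs_def map_map o_def fst_conv snd_conv by simp
    then show ?thesis using C(2) order_trans by blast
  qed (use j val_nonneg[OF p] in auto)
  then have "covers f k xs" using p by (simp add: covers_def)
  then show ?thesis by blast
qed

lemma h_greatest: "f : UC ==> (!!xs. covers f k xs ==> r <= tot xs) ==> r <= h k f"
  unfolding h_def by (rule cInf_greatest) (use covers_exists in auto)

lemma h_approx: assumes f: "f : UC" and e: "e > 0" obtains xs where "covers f k xs" "tot xs < h k f + e"
proof -
  have "h k f < h k f + e" using e by simp
  then have "EX t:tot ` Collect (covers f k). t < h k f + e"
    using cInf_less_iff[OF _ h_bdd] covers_exists[OF f, of k] unfolding h_def by blast
  then show thesis using that by blast
qed

lemma h_nonneg: "f : UC ==> h k f >= 0"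
  by (rule h_greatest) (auto simp: covers_def tot_nonneg)

lemma h_mono: assumes "g : UC" "!!x. x : carrier G ==> f x <= g x" shows "h k f <= h k g"
  by (rule h_greatest[OF assms(1)], rule h_le) (use assms(2) in \<open>force simp: covers_def intro: order_trans\<close>)

lemma val_append: "val k (xs @ ys) x = val k xs x + val k ys x"
  by (simp add: val_def)

lemma h_add: assumes f: "f : UC" and g: "g : UC" shows "h k (%x. f x + g x) <= h k f + h k g"
proof (rule field_le_epsilon)
  fix e :: real assume "e > 0"
  then have e: "e / 2 > 0" by simp
  obtain xs where xs: "covers f k xs" "tot xs < h k f + e / 2" using h_approx[OF f e] .
  obtain ys where ys: "covers g k ys" "tot ys < h k g + e / 2" using h_approx[OF g e] .
  have "covers (%x. f x + g x) k (xs @ ys)"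
    using xs(1) ys(1) by (auto simp: covers_def pos_def val_append intro!: add_mono)
  from h_le[OF this] show "h k (%x. f x + g x) <= h k f + h k g + e"
    using xs(2) ys(2) by (simp add: tot_def)
qed

lemma h_scale: assumes f: "f : UC" and r: "r >= 0" shows "h k (%x. r * f x) <= r * h k f"
proof (rule field_le_epsilon)
  fix e :: real assume "e > 0"
  then have e: "e / (r + 1) > 0" using r by simp
  obtain xs where xs: "covers f k xs" "tot xs < h k f + e / (r + 1)" using h_approx[OF f e] .
  define ys where "ys = map (%p. (r * fst p, snd p)) xs"
  have v: "val k ys x = r * val k xs x" for x
    unfolding val_def ys_def by (simp add: o_def sum_list_const_mult[symmetric] if_distrib cong: if_cong)
  have "covers (%x. r * f x) k ys"
    using xs(1) r v by (auto simp: covers_def pos_def ys_def mult_left_mono)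
  from h_le[OF this] have "h k (%x. r * f x) <= r * tot xs"
    by (simp add: tot_def ys_def o_def sum_list_const_mult)
  also have "\<dots> <= r * (h k f + e / (r + 1))" using xs r by (intro mult_left_mono) auto
  also have "\<dots> <= r * h k f + e" using r \<open>e > 0\<close> by (simp add: field_simps)
  finally show "h k (%x. r * f x) <= r * h k f + e" .
qed

definition tr :: "'a => ('a => real) => 'a => real" where
  "tr g f x = (if x : carrier G then f (g \<otimes> x) else 0)"

lemma tr_UC: "f : UC ==> g : carrier G ==> tr g f : UC"
  using UC_translate[of f g] unfolding tr_def[abs_def] .

lemma covers_tr: assumes "covers f k xs" "g : carrier G"
  shows "covers (tr g f) k (map (%p. (fst p, inv g \<otimes> snd p)) xs)" (is "covers _ k ?ys")
proof -
  have "val k ?ys x = val k xs (g \<otimes> x)" if x: "x : carrier G" for x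
    unfolding val_def map_map
  proof (rule arg_cong[of _ _ sum_list], rule map_cong[OF refl])
    fix p assume "p : set xs"
    then have "snd p : carrier G" using assms by (auto simp: covers_def pos_def)
    then have "inv (inv g \<otimes> snd p) \<otimes> x = inv (snd p) \<otimes> (g \<otimes> x)" using assms x by (simp add: inv_mult_group m_assoc)
    then show "((%p. if inv (snd p) \<otimes> x : Z k then fst p else 0) \<circ> (%p. (fst p, inv g \<otimes> snd p))) p =
        (if inv (snd p) \<otimes> (g \<otimes> x) : Z k then fst p else 0)" by simp
  qed
  then show ?thesis using assms by (auto simp: covers_def pos_def tr_def)
qed

lemma h_tr_le: assumes f: "f : UC" and g: "g : carrier G" shows "h k (tr g f) <= h k f"
proof (rule h_greatest[OF f])
  fix xs assume "covers f k xs"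
  from h_le[OF covers_tr[OF this g]] show "h k (tr g f) <= tot xs" by (simp add: tot_def o_def)
qed

lemma h_tr: assumes f: "f : UC" and g: "g : carrier G" shows "h k (tr g f) = h k f"
proof (rule antisym[OF h_tr_le[OF assms]])
  have "h k f <= h k (tr (inv g) (tr g f))"
    by (rule h_mono[OF tr_UC[OF tr_UC[OF f g] inv_closed[OF g]]]) (use g in \<open>simp add: tr_def\<close>)
  also have "\<dots> <= h k (tr g f)" using h_tr_le[OF tr_UC[OF f g]] g by simp
  finally show "h k f <= h k (tr g f)" .
qed

lemma h_bump_ge: "h k (bump 0) >= 1"
proof (rule h_greatest[OF bump_UC])
  fix xs assume xs: "covers (bump 0) k xs"
  have "1 <= bump 0 \<one>" by (rule bump_ge) simp
  also have "\<dots> <= val k xs \<one>" using xs by (simp add: covers_def)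
  also have "\<dots> <= tot xs" by (rule val_le_tot) (use xs in \<open>simp add: covers_def\<close>)
  finally show "1 <= tot xs" .
qed

text \<open>Finitely many translates of \<open>bump 0\<close> dominate \<open>f\<close>. This bounds
  the ratios in \<open>nh\<close> independently of the scale, as the compactness argument for the
  limit requires.\<close>

lemma h_le_bump: assumes f: "f : UC" shows "EX C>=0. ALL k. h k f <= C * h k (bump 0)"
proof -
  obtain j where j: "ALL x. x ~: Z j --> f x = 0" by (rule UC_supp[OF f])
  obtain C where C: "C >= 0" "ALL x. f x <= C" by (rule UC_bound[OF f])
  obtain F where F: "finite F" "F <= carrier G" "Z j <= (\<Union>y\<in>F. (%z. y \<otimes> z) ` Z 0)" using Z_tb[of j 0] by blast
  have UCs: "(%x. \<Sum>y\<in>E. C * tr (inv y) (bump 0) x) : UC &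
      h k (%x. \<Sum>y\<in>E. C * tr (inv y) (bump 0) x) <= real (card E) * C * h k (bump 0)"
    if "finite E" "E <= carrier G" for E k
    using that
  proof (induction E rule: finite_induct)
    case empty
    have z: "(%x. 0 * bump 0 x) : UC" by (rule UC_scale[OF bump_UC]) simp
    have "h k (%x. 0 * bump 0 x) <= 0 * h k (bump 0)" by (rule h_scale[OF bump_UC]) simp
    with z show ?case by simp
  next
    case (insert y E)
    have y: "inv y : carrier G" using insert by auto
    have 1: "(%x. C * tr (inv y) (bump 0) x) : UC" by (rule UC_scale[OF tr_UC[OF bump_UC y] C(1)])
    have 2: "h k (%x. C * tr (inv y) (bump 0) x) <= C * h k (bump 0)"
      using h_scale[OF tr_UC[OF bump_UC y] C(1)] h_tr[OF bump_UC y] by simp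
    have IH: "(%x. \<Sum>y\<in>E. C * tr (inv y) (bump 0) x) : UC"
      "h k (%x. \<Sum>y\<in>E. C * tr (inv y) (bump 0) x) <= real (card E) * C * h k (bump 0)"
      using insert by auto
    have eq: "(%x. \<Sum>y\<in>insert y E. C * tr (inv y) (bump 0) x) =
        (%x. C * tr (inv y) (bump 0) x + (\<Sum>y\<in>E. C * tr (inv y) (bump 0) x))"
      using insert by simp
    show ?case unfolding eq using UC_add[OF 1 IH(1)] h_add[OF 1 IH(1), of k] 2 IH(2) insert
      by (simp add: algebra_simps)
  qed
  have "h k f <= real (card F) * C * h k (bump 0)" for k
  proof -
    have "h k f <= h k (%x. \<Sum>y\<in>F. C * tr (inv y) (bump 0) x)"
    proof (rule h_mono)
      show "(%x. \<Sum>y\<in>F. C * tr (inv y) (bump 0) x) : UC" using UCs[OF F(1,2)] by simp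
      fix x assume x: "x : carrier G"
      have nn: "0 <= C * tr (inv y) (bump 0) x" for y using C bump_nonneg by (simp add: tr_def)
      show "f x <= (\<Sum>y\<in>F. C * tr (inv y) (bump 0) x)"
      proof (cases "x : Z j")
        case True
        then obtain y z where yz: "y : F" "z : Z 0" "x = y \<otimes> z" using F(3) by blast
        have "inv y \<otimes> x = z" using yz F(2) Z_carrier by auto
        then have "tr (inv y) (bump 0) x >= 1" using bump_ge[OF yz(2)] x by (simp add: tr_def)
        then have "C * 1 <= C * tr (inv y) (bump 0) x" using C by (intro mult_left_mono) auto
        moreover have "\<dots> <= (\<Sum>y\<in>F. C * tr (inv y) (bump 0) x)"
          by (rule member_le_sum) (use yz F nn in auto)
        ultimately show ?thesis using C(2) by (smt (verit, best))
      qed (use j nn in \<open>auto intro: sum_nonneg\<close>)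
    qed
    also have "\<dots> <= real (card F) * C * h k (bump 0)" using UCs[OF F(1,2)] by simp
    finally show ?thesis .
  qed
  then show ?thesis using C by (intro exI[of _ "real (card F) * C"]) auto
qed

lemma quotient_estimate:
  fixes a b a' b' \<delta> :: real
  assumes "\<delta> > 0" "b >= \<delta>" "b' >= \<delta>" "0 <= a'" "a' <= b'"
  shows "\<bar>a / b - a' / b'\<bar> <= (\<bar>a - a'\<bar> + \<bar>b - b'\<bar>) / \<delta>"
proof -
  have b: "b > 0" "b' > 0" using assms by linarith+
  have "a / b - a' / b' = (a - a') / b + (a' / b') * ((b' - b) / b)"
    using b by (simp add: field_simps)
  then have "\<bar>a / b - a' / b'\<bar> <= \<bar>(a - a') / b\<bar> + \<bar>(a' / b') * ((b' - b) / b)\<bar>" by linarith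
  also have "\<dots> = \<bar>a - a'\<bar> / b + (a' / b') * (\<bar>b - b'\<bar> / b)"
    using b assms by (simp add: abs_mult abs_divide abs_minus_commute)
  also have "\<dots> <= \<bar>a - a'\<bar> / b + 1 * (\<bar>b - b'\<bar> / b)"
    using b assms by (intro add_mono mult_right_mono) (auto simp: divide_le_eq_1)
  also have "\<dots> <= \<bar>a - a'\<bar> / \<delta> + \<bar>b - b'\<bar> / \<delta>"
    using assms by (auto intro!: add_mono divide_left_mono mult_pos_pos)
  finally show ?thesis by (simp add: add_divide_distrib)
qed

text \<open>Covering numbers are only subadditive. A cover of a slight enlargement of
  \<open>f + g\<close> is split in the proportion of \<open>f\<close> to \<open>g\<close>; at fine
  scales the quotients hardly vary over one translate of \<open>Z k\<close>, so the parts cover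
  \<open>f\<close> and \<open>g\<close> at almost no extra cost.\<close>

lemma h_superadd:
  assumes f: "f : UC" and g: "g : UC" and e: "e > 0"
  shows "EX k0. ALL k>=k0. h k f + h k g <= (1 + e) * (h k (%x. f x + g x) + e * h k (bump 0))"
proof -
  obtain i where i: "ALL x. x ~: Z i --> f x = 0" by (rule UC_supp[OF f])
  obtain j where j: "ALL x. x ~: Z j --> g x = 0" by (rule UC_supp[OF g])
  define m where "m = min i j"
  have supp: "f x = 0" "g x = 0" if "x ~: Z m" for x
    using i j that Z_monoD[of x i m] Z_monoD[of x j m] by (auto simp: m_def)
  obtain C where C: "C >= 0" "ALL k. h k (bump m) <= C * h k (bump 0)" using h_le_bump[OF bump_UC[of m]] by blast
  \<comment> \<open>This keeps the denominators in \<open>q\<close> away from zero; division by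
    \<open>C + 1\<close> makes the bump added in \<open>E\<close> cost at most \<open>e\<close>
    times the covering number of \<open>bump 0\<close>.\<close>
  define \<delta> where "\<delta> = e / (C + 1)"
  have \<delta>: "\<delta> > 0" "\<delta> * C <= e" using e C by (auto simp: \<delta>_def field_simps)
  define E where "E x = f x + g x + \<delta> * bump m x" for x
  have UE: "E : UC" unfolding E_def[abs_def] using UC_add[OF UC_add[OF f g] UC_scale[OF bump_UC]] \<delta> by simp
  define q where "q u x = u x / (f x + g x + \<delta>)" for u :: "'a => real" and x
  have nn: "f x >= 0" "g x >= 0" for x using UC_nonneg f g by auto
  have den: "f x + g x + \<delta> >= \<delta>" for x using nn[of x] by linarith
  have uq: "u x <= q u x * E x" if u: "u = f | u = g" and x: "x : carrier G" for u x
  proof (cases "x : Z m")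
    case True
    have "q u x >= 0" using u nn[of x] \<delta> by (auto simp: q_def)
    have "u x = q u x * (f x + g x + \<delta>)" using den[of x] \<delta> by (simp add: q_def)
    also have "\<dots> <= q u x * E x"
      using \<open>q u x >= 0\<close> bump_ge[OF True] \<delta> by (intro mult_left_mono) (auto simp: E_def)
    finally show ?thesis .
  next
    case False
    then have "u x = 0" using u supp by auto
    then show ?thesis by (simp add: q_def)
  qed
  define \<epsilon> where "\<epsilon> = e / 2 * \<delta> / 4"
  have \<epsilon>: "\<epsilon> > 0" using e \<delta> by (simp add: \<epsilon>_def)
  obtain k1 where k1: "ALL x:carrier G. ALL z:Z k1. \<bar>f (z \<otimes> x) - f x\<bar> <= \<epsilon>" by (rule UC_cont[OF f \<epsilon>])
  obtain k2 where k2: "ALL x:carrier G. ALL z:Z k2. \<bar>g (z \<otimes> x) - g x\<bar> <= \<epsilon>" by (rule UC_cont[OF g \<epsilon>])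
  have qvar: "q u (y \<otimes> z) <= q u y + e / 2"
    if u: "u = f | u = g" and y: "y : carrier G" and z: "z : Z (max k1 k2)" for u y z
  proof -
    have zc: "z : carrier G" using z Z_carrier by blast
    define w where "w = cj y z"
    have "w : Z (max k1 k2)" unfolding w_def by (rule Z_cj[OF y z])
    then have w: "w : Z k1" "w : Z k2" using Z_monoD[of w "max k1 k2"] by auto
    have eq: "y \<otimes> z = w \<otimes> y" using y zc by (simp add: w_def cj_def m_assoc)
    have 1: "\<bar>f (y \<otimes> z) - f y\<bar> <= \<epsilon>" "\<bar>g (y \<otimes> z) - g y\<bar> <= \<epsilon>" using k1 k2 w y by (auto simp: eq)
    have "\<bar>q u (y \<otimes> z) - q u y\<bar> <= (\<bar>u (y \<otimes> z) - u y\<bar> + \<bar>(f (y \<otimes> z) + g (y \<otimes> z) + \<delta>) - (f y + g y + \<delta>)\<bar>) / \<delta>"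
      unfolding q_def by (rule quotient_estimate[OF \<delta>(1) den den]) (use u nn[of y] \<delta> in auto)
    also have "\<dots> <= (3 * \<epsilon>) / \<delta>"
      using u 1 \<delta> by (intro divide_right_mono) auto
    also have "\<dots> <= e / 2" using \<delta> e by (simp add: \<epsilon>_def field_simps)
    finally show ?thesis by linarith
  qed
  have "h k f + h k g <= (1 + e) * (h k (%x. f x + g x) + e * h k (bump 0))" if k: "k >= max k1 k2" for k
  proof -
    have "h k f + h k g <= (1 + e) * tot xs" if xs: "covers E k xs" for xs
    proof -
      define ys where "ys u = map (%p. (fst p * (q u (snd p) + e / 2), snd p)) xs" for u
      have px: "pos xs" using xs by (simp add: covers_def)
      have cov: "covers u k (ys u)" if u: "u = f | u = g" for u
      proof -
        have qn: "q u y >= 0" for y using u nn[of y] \<delta> by (auto simp: q_def)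
        have "u x <= val k (ys u) x" if x: "x : carrier G" for x
        proof -
          have "u x <= q u x * E x" by (rule uq[OF u x])
          also have "\<dots> <= q u x * val k xs x"
            using xs x qn by (intro mult_left_mono) (auto simp: covers_def)
          also have "\<dots> = sum_list (map (%p. q u x * (if inv (snd p) \<otimes> x : Z k then fst p else 0)) xs)"
            by (simp add: val_def sum_list_const_mult)
          also have "\<dots> <= val k (ys u) x"
            unfolding val_def ys_def map_map
          proof (rule sum_list_mono)
            fix p assume p: "p : set xs"
            have pp: "fst p >= 0" "snd p : carrier G" using px p by (auto simp: pos_def)
            show "q u x * (if inv (snd p) \<otimes> x : Z k then fst p else 0) <=
                ((%p. if inv (snd p) \<otimes> x : Z k then fst p else 0) \<circ> (%p. (fst p * (q u (snd p) + e / 2), snd p))) p"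
            proof (cases "inv (snd p) \<otimes> x : Z k")
              case True
              have "q u (snd p \<otimes> (inv (snd p) \<otimes> x)) <= q u (snd p) + e / 2"
                by (rule qvar[OF u pp(2) Z_monoD[OF True k]])
              then have "q u x <= q u (snd p) + e / 2" using pp x by simp
              then have "q u x * fst p <= (q u (snd p) + e / 2) * fst p" using pp by (intro mult_right_mono)
              then show ?thesis using True by (simp add: mult.commute)
            qed simp
          qed
          finally show ?thesis .
        qed
        moreover have "pos (ys u)" using px qn e by (auto simp: pos_def ys_def intro!: mult_nonneg_nonneg add_nonneg_nonneg)
        ultimately show ?thesis by (simp add: covers_def)
      qed
      have "h k f + h k g <= tot (ys f) + tot (ys g)" using h_le[OF cov] by (simp add: add_mono)
      also have "\<dots> = sum_list (map (%p. fst p * (q f (snd p) + e / 2) + fst p * (q g (snd p) + e / 2)) xs)"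
        by (simp add: tot_def ys_def o_def sum_list_addf)
      also have "\<dots> <= sum_list (map (%p. (1 + e) * fst p) xs)"
      proof (rule sum_list_mono)
        fix p assume "p : set xs"
        then have pp: "fst p >= 0" using px by (auto simp: pos_def)
        have "q f (snd p) + q g (snd p) = (f (snd p) + g (snd p)) / (f (snd p) + g (snd p) + \<delta>)"
          by (simp add: q_def add_divide_distrib)
        also have "\<dots> <= 1" using nn[of "snd p"] \<delta> by (simp add: divide_le_eq_1)
        finally have "(q f (snd p) + e / 2) + (q g (snd p) + e / 2) <= 1 + e" by simp
        then have "((q f (snd p) + e / 2) + (q g (snd p) + e / 2)) * fst p <= (1 + e) * fst p"
          using pp by (rule mult_right_mono)
        then show "fst p * (q f (snd p) + e / 2) + fst p * (q g (snd p) + e / 2) <= (1 + e) * fst p"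
          by (simp add: algebra_simps)
      qed
      also have "\<dots> = (1 + e) * tot xs" by (simp add: tot_def sum_list_const_mult)
      finally show ?thesis .
    qed
    then have "(h k f + h k g) / (1 + e) <= tot xs" if "covers E k xs" for xs
      using that e by (simp add: pos_divide_le_eq mult.commute)
    then have "(h k f + h k g) / (1 + e) <= h k E" by (rule h_greatest[OF UE])
    also have "h k E <= h k (%x. f x + g x) + h k (%x. \<delta> * bump m x)"
      unfolding E_def[abs_def] by (rule h_add[OF UC_add[OF f g] UC_scale[OF bump_UC]]) (use \<delta> in simp)
    also have "h k (%x. \<delta> * bump m x) <= \<delta> * h k (bump m)" by (rule h_scale[OF bump_UC]) (use \<delta> in simp)
    also have "\<delta> * h k (bump m) <= \<delta> * (C * h k (bump 0))" using C \<delta> by (intro mult_left_mono) auto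
    also have "\<dots> <= e * h k (bump 0)" using \<delta> h_bump_ge[of k] by (simp add: mult_right_mono flip: mult.assoc)
    finally show ?thesis using e by (simp add: pos_divide_le_eq mult.commute)
  qed
  then show ?thesis by blast
qed

definition nh :: "nat => ('a => real) => real" where "nh n f = h (int n) f / h (int n) (bump 0)"

text \<open>The normalised covering numbers all lie in a product of compact intervals. A cluster
  point there is approximated, on finitely many functions at a time, by arbitrarily late
  terms.\<close>

lemma invariant_cluster:
  obtains I where "ALL e>0. ALL N. ALL fs. finite fs --> fs <= UC --> (EX n>=N. ALL f:fs. \<bar>nh n f - I f\<bar> < e)"
proof -
  have "ALL f:UC. EX C. ALL k. h k f <= C * h k (bump 0)" using h_le_bump by blast
  from bchoice[OF this] obtain C where C: "ALL f:UC. ALL k. h k f <= C f * h k (bump 0)" ..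
  define S where "S = (\<Pi>\<^sub>E f\<in>UNIV. if f : UC then {0..C f} else {0 :: real})"
  define J where "J n = (%f. if f : UC then nh n f else 0)" for n
  have JS: "J n : S" for n
  proof -
    have "0 <= nh n f & nh n f <= C f" if f: "f : UC" for f
    proof -
      have b: "h (int n) (bump 0) > 0" using h_bump_ge[of "int n"] by linarith
      show ?thesis using C f h_nonneg[OF f, of "int n"] b by (simp add: nh_def pos_divide_le_eq)
    qed
    then show ?thesis by (auto simp: S_def J_def PiE_iff)
  qed
  have "compactin (product_topology (%_. euclidean) UNIV) S"
    unfolding S_def compactin_PiE by auto
  then have "compact S" by (simp add: euclidean_product_topology)
  moreover have "filtermap J sequentially ~= bot" by (simp add: filtermap_bot_iff)
  moreover have "eventually (%p. p : S) (filtermap J sequentially)" using JS by (simp add: eventually_filtermap)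
  ultimately obtain I where I: "I : S" "inf (nhds I) (filtermap J sequentially) ~= bot"
    unfolding compact_filter by blast
  show thesis
  proof (rule that[of I], intro allI impI)
    fix e :: real and N :: nat and fs assume e: "e > 0" and fs: "finite fs" "fs <= UC"
    define U where "U = {p. ALL f:fs. \<bar>p f - I f\<bar> < e}"
    have "open {p :: ('a => real) => real. \<bar>p f - I f\<bar> < e}" for f
      by (intro open_Collect_less continuous_intros continuous_on_product_coordinates)
    then have "open (\<Inter>f\<in>fs. {p. \<bar>p f - I f\<bar> < e})" using fs by (intro open_INT) auto
    moreover have "U = (\<Inter>f\<in>fs. {p. \<bar>p f - I f\<bar> < e})" by (auto simp: U_def)
    ultimately have "open U" by simp
    moreover have "I : U" using e by (simp add: U_def)
    ultimately have 1: "eventually (%p. p : U) (nhds I)" by (rule eventually_nhds_in_open)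
    show "EX n>=N. ALL f:fs. \<bar>nh n f - I f\<bar> < e"
    proof (rule ccontr)
      assume no: "~ ?thesis"
      have "J n ~: U" if "n >= N" for n
      proof
        assume "J n : U"
        have "\<bar>nh n f - I f\<bar> < e" if f: "f : fs" for f
        proof -
          have "\<bar>J n f - I f\<bar> < e" using \<open>J n : U\<close> f by (auto simp: U_def)
          moreover have "f : UC" using fs f by blast
          ultimately show ?thesis by (simp add: J_def)
        qed
        then show False using no that by blast
      qed
      then have "eventually (%n. J n ~: U) sequentially" by (auto simp: eventually_sequentially)
      then have 2: "eventually (%p. p ~: U) (filtermap J sequentially)" by (simp add: eventually_filtermap)
      have "eventually (%p. False) (inf (nhds I) (filtermap J sequentially))"
        unfolding eventually_inf using 1 2 by blast
      then show False using I(2) by (simp add: eventually_False)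
    qed
  qed
qed

lemma invariant_functional:
  obtains I where "ALL f:UC. I f >= 0" "ALL f:UC. ALL g:UC. (ALL x:carrier G. f x <= g x) --> I f <= I g"
    "ALL f:UC. ALL g:UC. I (%x. f x + g x) = I f + I g"
    "ALL f:UC. ALL r>=0. I (%x. r * f x) <= r * I f"
    "ALL f:UC. ALL g:carrier G. I (tr g f) = I f" "I (bump 0) = 1"
proof -
  obtain I where I: "ALL e>0. ALL N. ALL fs. finite fs --> fs <= UC --> (EX n>=N. ALL f:fs. \<bar>nh n f - I f\<bar> < e)"
    by (rule invariant_cluster)
  have b: "h k (bump 0) > 0" for k using h_bump_ge[of k] by linarith
  have approx: "EX n>=N. ALL f:fs. \<bar>nh n f - I f\<bar> < e" if "e > 0" "finite fs" "fs <= UC" for e fs and N :: nat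
    using I that by blast
  show thesis
  proof (rule that)
    show "ALL f:UC. I f >= 0"
    proof
      fix f assume f: "f : UC"
      show "I f >= 0"
      proof (rule ccontr)
        assume "~ I f >= 0"
        then obtain n where "ALL g:{f}. \<bar>nh n g - I g\<bar> < - I f" using approx[of "- I f" "{f}" 0] f by auto
        moreover have "nh n f >= 0" using h_nonneg[OF f, of "int n"] b[of "int n"] by (simp add: nh_def)
        ultimately show False by auto
      qed
    qed
    show "ALL f:UC. ALL g:UC. (ALL x:carrier G. f x <= g x) --> I f <= I g"
    proof (intro ballI impI)
      fix f g assume fg: "f : UC" "g : UC" "ALL x:carrier G. f x <= g x"
      show "I f <= I g"
      proof (rule field_le_epsilon)
        fix e :: real assume "e > 0"
        then obtain n where n: "ALL u:{f, g}. \<bar>nh n u - I u\<bar> < e / 2" using approx[of "e / 2" "{f, g}" 0] fg by auto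
        have "nh n f <= nh n g"
          unfolding nh_def using h_mono[OF fg(2)] fg(3) b[of "int n"] by (intro divide_right_mono) auto
        then show "I f <= I g + e" using n by (simp add: abs_if split: if_splits)
      qed
    qed
    show "ALL f:UC. ALL g:UC. I (%x. f x + g x) = I f + I g"
    proof (intro ballI)
      fix f g assume f: "f : UC" and g: "g : UC"
      note fg = UC_add[OF f g]
      have "I (%x. f x + g x) <= I f + I g"
      proof (rule field_le_epsilon)
        fix e :: real assume "e > 0"
        then obtain n where n: "ALL u:{f, g, %x. f x + g x}. \<bar>nh n u - I u\<bar> < e / 3"
          using approx[of "e / 3" "{f, g, %x. f x + g x}" 0] f g fg by auto
        have "nh n (%x. f x + g x) <= nh n f + nh n g"
          unfolding nh_def using h_add[OF f g, of "int n"] b[of "int n"] by (simp add: divide_right_mono flip: add_divide_distrib)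
        then show "I (%x. f x + g x) <= I f + I g + e" using n by (simp add: abs_if split: if_splits)
      qed
      moreover have "I f + I g <= I (%x. f x + g x)"
      proof (rule field_le_epsilon)
        fix e :: real assume e: "e > 0"
        define c where "c = I (%x. f x + g x) + 2"
        define d where "d = min 1 (e / (2 * (\<bar>c\<bar> + 4)))"
        have "e / (2 * (\<bar>c\<bar> + 4)) > 0" using e by (intro divide_pos_pos) auto
        then have d: "d > 0" "d <= 1" "d <= e / (2 * (\<bar>c\<bar> + 4))" by (simp_all add: d_def)
        have "d * (\<bar>c\<bar> + 4) <= e / (2 * (\<bar>c\<bar> + 4)) * (\<bar>c\<bar> + 4)" by (rule mult_right_mono[OF d(3)]) simp
        also have "\<dots> = e / 2" by (simp add: add_eq_0_iff field_simps)
        finally have dc: "d * (\<bar>c\<bar> + 4) <= e / 2" .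
        obtain k0 where k0: "ALL k>=k0. h k f + h k g <= (1 + d) * (h k (%x. f x + g x) + d * h k (bump 0))"
          using h_superadd[OF f g d(1)] by blast
        define e' where "e' = min 1 (e / 8)"
        have e': "e' > 0" "e' <= 1" "e' <= e / 8" using e by (auto simp: e'_def)
        obtain n where n: "n >= nat k0" "ALL u:{f, g, %x. f x + g x}. \<bar>nh n u - I u\<bar> < e'"
          using approx[of e' "{f, g, %x. f x + g x}" "nat k0"] f g fg e' by auto
        have "k0 <= int n" using n(1) by simp
        then have "h (int n) f + h (int n) g <= (1 + d) * (h (int n) (%x. f x + g x) + d * h (int n) (bump 0))"
          using k0 by blast
        then have "(h (int n) f + h (int n) g) / h (int n) (bump 0) <=
            (1 + d) * (h (int n) (%x. f x + g x) + d * h (int n) (bump 0)) / h (int n) (bump 0)"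
          using b[of "int n"] by (intro divide_right_mono) auto
        then have "nh n f + nh n g <= (1 + d) * (nh n (%x. f x + g x) + d)"
        proof -
          assume *: "(h (int n) f + h (int n) g) / h (int n) (bump 0) <=
            (1 + d) * (h (int n) (%x. f x + g x) + d * h (int n) (bump 0)) / h (int n) (bump 0)"
          have eq: "(1 + d) * (A + d * B) / B = (1 + d) * (A / B + d)" if "B > 0" for A B :: real
            using that by (simp add: field_simps)
          show ?thesis using * unfolding eq[OF b[of "int n"]] nh_def by (simp only: add_divide_distrib)
        qed
        also have "\<dots> <= (1 + d) * (I (%x. f x + g x) + e' + d)"
          using n(2) d by (intro mult_left_mono) auto
        also have "\<dots> = I (%x. f x + g x) + e' + d * (I (%x. f x + g x) + e' + 1 + d)"
          by (simp add: algebra_simps)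
        also have "\<dots> <= I (%x. f x + g x) + e' + d * (\<bar>c\<bar> + 4)"
          using d e' by (intro add_left_mono mult_left_mono) (auto simp: c_def)
        finally have "nh n f + nh n g <= I (%x. f x + g x) + e' + e / 2" using dc by linarith
        then show "I f + I g <= I (%x. f x + g x) + e" using n(2) e' by (simp add: abs_if split: if_splits)
      qed
      ultimately show "I (%x. f x + g x) = I f + I g" by linarith
    qed
    show "ALL f:UC. ALL r>=0. I (%x. r * f x) <= r * I f"
    proof (intro ballI allI impI)
      fix f and r :: real assume f: "f : UC" and r: "r >= 0"
      show "I (%x. r * f x) <= r * I f"
      proof (rule field_le_epsilon)
        fix e :: real assume e: "e > 0"
        define e' where "e' = e / (2 * (r + 1))"
        have "e' > 0" unfolding e'_def using e r by (intro divide_pos_pos) auto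
        moreover have "(r + 1) * e' = e / 2" using r by (simp add: e'_def field_simps)
        then have "r * e' + e' = e / 2" by (simp add: algebra_simps)
        moreover have "r * e' >= 0" using r \<open>e' > 0\<close> by simp
        ultimately have e': "e' > 0" "r * e' <= e / 2" "e' <= e / 2" by linarith+
        obtain n where n: "ALL u:{f, %x. r * f x}. \<bar>nh n u - I u\<bar> < e'"
          using approx[of e' "{f, %x. r * f x}" 0] f UC_scale[OF f r] e' by auto
        have "nh n (%x. r * f x) <= r * nh n f"
          unfolding nh_def using h_scale[OF f r, of "int n"] b[of "int n"] by (simp add: divide_right_mono)
        also have "\<dots> <= r * (I f + e')" using n r by (intro mult_left_mono) auto
        finally show "I (%x. r * f x) <= r * I f + e" using n e' by (auto simp: algebra_simps)
      qed
    qed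
    show "ALL f:UC. ALL g:carrier G. I (tr g f) = I f"
    proof (intro ballI)
      fix f g assume f: "f : UC" and g: "g : carrier G"
      have "\<bar>I (tr g f) - I f\<bar> <= e" if e: "e > 0" for e
      proof -
        obtain n where n: "ALL u:{f, tr g f}. \<bar>nh n u - I u\<bar> < e / 2"
          using approx[of "e / 2" "{f, tr g f}" 0] f tr_UC[OF f g] e by auto
        have "nh n (tr g f) = nh n f" using h_tr[OF f g] by (simp add: nh_def)
        then show ?thesis using n by (simp add: abs_if split: if_splits)
      qed
      then have "\<bar>I (tr g f) - I f\<bar> <= 0" by (rule dense_ge) 
      then show "I (tr g f) = I f" by simp
    qed
    have "\<bar>I (bump 0) - 1\<bar> <= e" if e: "e > 0" for e
    proof -
      obtain n where n: "ALL u:{bump 0}. \<bar>nh n u - I u\<bar> < e" using approx[of e "{bump 0}" 0] bump_UC e by auto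
      have "nh n (bump 0) = 1" using b[of "int n"] by (simp add: nh_def)
      then show ?thesis using n by auto
    qed
    then have "\<bar>I (bump 0) - 1\<bar> <= 0" by (rule dense_ge)
    then show "I (bump 0) = 1" by simp
  qed
qed

end

context monoid
begin

definition mlist :: "'a list => 'a" where "mlist xs = foldr (\<otimes>) xs \<one>"

lemma mlist_simps [simp]: "mlist [] = \<one>" "mlist (x # xs) = x \<otimes> mlist xs"
  by (simp_all add: mlist_def)

lemma mlist_closed: "set xs <= carrier G ==> mlist xs : carrier G"
  by (induction xs) auto

lemma mlist_append: "set xs <= carrier G ==> set ys <= carrier G ==> mlist (xs @ ys) = mlist xs \<otimes> mlist ys"
  by (induction xs) (auto simp: m_assoc mlist_closed)

end

section \<open>Convolution and smoothness along commutators\<close>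

locale sin_functional = sin_group G Z for G (structure) and Z +
  fixes I :: "('a => real) => real"
  assumes I_nonneg: "f : UC ==> I f >= 0"
    and I_mono: "f : UC ==> g : UC ==> (!!x. x : carrier G ==> f x <= g x) ==> I f <= I g"
    and I_add: "f : UC ==> g : UC ==> I (%x. f x + g x) = I f + I g"
    and I_scale: "f : UC ==> r >= 0 ==> I (%x. r * f x) <= r * I f"
    and I_tr: "f : UC ==> w : carrier G ==> I (tr w f) = I f"
    and I_bump: "I (bump 0) = 1"
begin

lemma I_zero: "I (%x. 0) = 0"
proof -
  have "I (%x. 0 * bump 0 x) <= 0 * I (bump 0)" by (rule I_scale[OF bump_UC]) simp
  moreover have "(%x. 0 * bump 0 x) : UC" by (rule UC_scale[OF bump_UC]) simp
  ultimately show ?thesis using I_nonneg[of "%x. 0 * bump 0 x"] by simp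
qed

text \<open>Finitely many translates of a narrow bump dominate \<open>bump 0\<close>, whose value is
  1.\<close>

lemma I_bump_pos: "I (bump j) > 0"
proof -
  obtain i where i: "ALL x. x ~: Z i --> bump 0 x = 0" by (rule UC_supp[OF bump_UC])
  obtain F where F: "finite F" "F <= carrier G" "Z i <= (\<Union>y\<in>F. (%z. y \<otimes> z) ` Z j)" using Z_tb[of i j] by blast
  have UCs: "(%x. \<Sum>y\<in>E. 2 * tr (inv y) (bump j) x) : UC &
      I (%x. \<Sum>y\<in>E. 2 * tr (inv y) (bump j) x) <= real (card E) * 2 * I (bump j)"
    if "finite E" "E <= carrier G" for E
    using that
  proof (induction E rule: finite_induct)
    case empty
    have "(%x. 0 * bump 0 x) : UC" by (rule UC_scale[OF bump_UC]) simp
    then show ?case using I_zero by simp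
  next
    case (insert y E)
    have y: "inv y : carrier G" using insert by auto
    have 1: "(%x. 2 * tr (inv y) (bump j) x) : UC" by (rule UC_scale[OF tr_UC[OF bump_UC y]]) simp
    have 2: "I (%x. 2 * tr (inv y) (bump j) x) <= 2 * I (bump j)"
      using I_scale[OF tr_UC[OF bump_UC y], of 2 j] I_tr[OF bump_UC y] by simp
    have IH: "(%x. \<Sum>y\<in>E. 2 * tr (inv y) (bump j) x) : UC"
      "I (%x. \<Sum>y\<in>E. 2 * tr (inv y) (bump j) x) <= real (card E) * 2 * I (bump j)"
      using insert by auto
    have eq: "(%x. \<Sum>y\<in>insert y E. 2 * tr (inv y) (bump j) x) =
        (%x. 2 * tr (inv y) (bump j) x + (\<Sum>y\<in>E. 2 * tr (inv y) (bump j) x))"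
      using insert by simp
    show ?case unfolding eq using UC_add[OF 1 IH(1)] I_add[OF 1 IH(1)] 2 IH(2) insert
      by (simp add: algebra_simps)
  qed
  have "1 <= I (%x. \<Sum>y\<in>F. 2 * tr (inv y) (bump j) x)"
    unfolding I_bump[symmetric]
  proof (rule I_mono[OF bump_UC])
    show "(%x. \<Sum>y\<in>F. 2 * tr (inv y) (bump j) x) : UC" using UCs[OF F(1,2)] by simp
    fix x assume x: "x : carrier G"
    have nn: "0 <= 2 * tr (inv y) (bump j) x" for y using bump_nonneg by (simp add: tr_def)
    show "bump 0 x <= (\<Sum>y\<in>F. 2 * tr (inv y) (bump j) x)"
    proof (cases "x : Z i")
      case True
      then obtain y z where yz: "y : F" "z : Z j" "x = y \<otimes> z" using F(3) by blast
      have "inv y \<otimes> x = z" using yz F(2) Z_carrier by auto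
      then have "2 <= 2 * tr (inv y) (bump j) x" using bump_ge[OF yz(2)] x by (simp add: tr_def)
      moreover have "\<dots> <= (\<Sum>y\<in>F. 2 * tr (inv y) (bump j) x)"
        by (rule member_le_sum) (use yz F nn in auto)
      ultimately show ?thesis using bump_le[of 0 x] by linarith
    next
      case False
      then have "bump 0 x = 0" using i by blast
      moreover have "0 <= (\<Sum>y\<in>F. 2 * tr (inv y) (bump j) x)" by (rule sum_nonneg) (rule nn)
      ultimately show ?thesis by simp
    qed
  qed
  also have "\<dots> <= real (card F) * 2 * I (bump j)" using UCs[OF F(1,2)] by simp
  finally have "0 < real (card F) * 2 * I (bump j)" by simp
  then show ?thesis using I_nonneg[OF bump_UC, of j] by (simp add: zero_less_mult_iff)
qed

definition rv :: "('a => real) => 'a => 'a => real" where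
  "rv u w y = (if y : carrier G then u (inv y \<otimes> w) else 0)"

definition conv :: "('a => real) => 'a => real" where
  "conv u x = (if x : carrier G then I (%y. u y * rv u x y) else 0)"

definition osc :: "('a => real) => real => int => bool" where
  "osc u e k \<longleftrightarrow> (ALL g:Z k. ALL x:carrier G. \<bar>u (g \<otimes> x) - u x\<bar> <= e)"

lemma rv_nonneg: "u : UC ==> rv u w y >= 0"
  by (simp add: rv_def UC_nonneg)

lemma rv_osc: assumes "osc u e k" "w : carrier G" "y : carrier G" "z : Z k"
  shows "\<bar>rv u w (z \<otimes> y) - rv u w y\<bar> <= e"
proof -
  have zc: "z : carrier G" using assms Z_carrier by blast
  have "inv (z \<otimes> y) \<otimes> w = cj (inv y) (inv z) \<otimes> (inv y \<otimes> w)"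
    using assms zc by (simp add: cj_def m_assoc inv_mult_group)
  moreover have "cj (inv y) (inv z) : Z k" using assms Z_cj Z_inv by simp
  ultimately show ?thesis using assms zc unfolding osc_def rv_def by simp
qed

lemma rv_osc': assumes "osc u e k" "x : carrier G" "y : carrier G" "b : Z k"
  shows "\<bar>rv u (b \<otimes> x) y - rv u x y\<bar> <= e"
proof -
  have bc: "b : carrier G" using assms Z_carrier by blast
  have "inv y \<otimes> (b \<otimes> x) = cj (inv y) b \<otimes> (inv y \<otimes> x)"
    using assms bc by (simp add: cj_def m_assoc)
  moreover have "cj (inv y) b : Z k" using assms Z_cj by simp
  ultimately show ?thesis using assms unfolding osc_def rv_def by simp
qed

lemma prod_UC: assumes "f : UC" "u : UC" "w : carrier G" shows "(%y. f y * rv u w y) : UC"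
proof -
  obtain C where C: "C >= 0" "ALL x. u x <= C" by (rule UC_bound[OF assms(2)])
  show ?thesis
  proof (rule UC_mult[OF assms(1) rv_nonneg[OF assms(2)]])
    show "rv u w x <= C" for x using C by (simp add: rv_def)
    fix e :: real assume "e > 0"
    then obtain k where k: "ALL x:carrier G. ALL z:Z k. \<bar>u (z \<otimes> x) - u x\<bar> <= e" by (rule UC_cont[OF assms(2)])
    then have "osc u e k" unfolding osc_def by blast
    then show "EX k. ALL x:carrier G. ALL z:Z k. \<bar>rv u w (z \<otimes> x) - rv u w x\<bar> <= e"
      using rv_osc assms(3) by blast
  qed
qed

text \<open>Invariance moves a left translation of the argument onto the first factor. A translation
  on the right of it stays in the second factor, so two increments fall on different
  factors.\<close>

lemma conv_tr: assumes "u : UC" "a : carrier G" "x : carrier G"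
  shows "conv u (a \<otimes> x) = I (%y. tr a u y * rv u x y)"
proof -
  have "tr a (%y. u y * rv u (a \<otimes> x) y) = (%y. tr a u y * rv u x y)"
  proof
    fix y
    show "tr a (%y. u y * rv u (a \<otimes> x) y) y = tr a u y * rv u x y"
    proof (cases "y : carrier G")
      case True
      have "inv (a \<otimes> y) \<otimes> (a \<otimes> x) = inv y \<otimes> x" using True assms by (simp add: inv_mult_group m_assoc)
      then show ?thesis using True assms by (simp add: tr_def rv_def)
    qed (simp add: tr_def)
  qed
  then show ?thesis
    using I_tr[OF prod_UC[OF assms(1,1), of "a \<otimes> x"] assms(2)] assms by (simp add: conv_def)
qed

lemma UC_supp_near: assumes "u : UC"
  obtains J where "ALL y. y ~: Z J --> u y = 0 & (ALL a:Z 0. tr a u y = 0)"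
proof -
  obtain j where j: "ALL x. x ~: Z j --> u x = 0" by (rule UC_supp[OF assms])
  have "u y = 0 & (ALL a:Z 0. tr a u y = 0)" if y: "y ~: Z (min j 0 - 1)" for y
  proof
    have "min j 0 - 1 <= j" by simp
    then have "y ~: Z j" using y Z_monoD by blast
    then show "u y = 0" using j by blast
    show "ALL a:Z 0. tr a u y = 0"
    proof
      fix a assume a: "a : Z 0"
      show "tr a u y = 0"
      proof (rule ccontr)
        assume "tr a u y ~= 0"
        then have yc: "y : carrier G" and "u (a \<otimes> y) ~= 0" by (auto simp: tr_def split: if_splits)
        then have "a \<otimes> y : Z j" using j by blast
        then have 1: "a \<otimes> y : Z (min j 0 - 1 + 1)" by (rule Z_monoD) simp
        have 2: "inv a : Z (min j 0 - 1 + 1)" by (rule Z_monoD[OF Z_inv[OF a]]) simp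
        from Z_mult[OF 2 1] show False using y yc Z_carrier[OF a] by simp
      qed
    qed
  qed
  then show thesis using that by blast
qed

lemma tr_bump: assumes u: "u : UC" and J: "ALL y. y ~: Z J --> u y = 0 & (ALL a:Z 0. tr a u y = 0)"
  and osc: "osc u e k" "k >= 0" "e >= 0" and g: "g : Z k"
  shows "\<bar>tr g u y - u y\<bar> <= e * bump J y"
proof (cases "y : Z J")
  case True
  then have "\<bar>tr g u y - u y\<bar> <= e * 1"
    using osc g Z_carrier[OF True] unfolding osc_def tr_def by simp
  also have "\<dots> <= e * bump J y" using bump_ge[OF True] osc by (intro mult_left_mono)
  finally show ?thesis .
next
  case False
  have "g : Z 0" using Z_monoD[OF g] osc by simp
  then show ?thesis using J False osc bump_nonneg by simp
qed

lemma conv_osc1: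
  assumes u: "u : UC" and C: "ALL x. u x <= C" "C >= 0"
    and J: "ALL y. y ~: Z J --> u y = 0 & (ALL a:Z 0. tr a u y = 0)"
    and osc: "osc u e k" "k >= 0" "e >= 0"
  shows "osc (conv u) (e * C * I (bump J)) k"
  unfolding osc_def
proof (intro ballI)
  fix g x assume g: "g : Z k" and x: "x : carrier G"
  have gc: "g : carrier G" using g Z_carrier by blast
  note P = prod_UC[OF tr_UC[OF u gc] u x] and Q = prod_UC[OF u u x]
  have E: "(%y. (e * C) * bump J y) : UC" by (rule UC_scale[OF bump_UC]) (use C osc in simp)
  have IE: "I (%y. (e * C) * bump J y) <= (e * C) * I (bump J)" by (rule I_scale[OF bump_UC]) (use C osc in simp)
  have pw: "\<bar>tr g u y * rv u x y - u y * rv u x y\<bar> <= (e * C) * bump J y" for y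
  proof -
    have "\<bar>tr g u y * rv u x y - u y * rv u x y\<bar> = \<bar>tr g u y - u y\<bar> * rv u x y"
      using rv_nonneg[OF u, of x y] by (simp add: abs_mult flip: left_diff_distrib)
    also have "\<dots> <= (e * bump J y) * C"
      using tr_bump[OF u J osc g, of y] rv_nonneg[OF u, of x y] C osc bump_nonneg
      by (intro mult_mono) (auto simp: rv_def)
    finally show ?thesis by (simp add: mult_ac)
  qed
  have "I (%y. tr g u y * rv u x y) <= I (%y. u y * rv u x y + (e * C) * bump J y)"
    by (rule I_mono[OF P UC_add[OF Q E]]) (use pw in \<open>smt (verit)\<close>)
  then have 1: "conv u (g \<otimes> x) <= conv u x + e * C * I (bump J)"
    using conv_tr[OF u gc x] I_add[OF Q E] IE x by (simp add: conv_def)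
  have "I (%y. u y * rv u x y) <= I (%y. tr g u y * rv u x y + (e * C) * bump J y)"
    by (rule I_mono[OF Q UC_add[OF P E]]) (use pw in \<open>smt (verit)\<close>)
  then have 2: "conv u x <= conv u (g \<otimes> x) + e * C * I (bump J)"
    using conv_tr[OF u gc x] I_add[OF P E] IE x by (simp add: conv_def)
  show "\<bar>conv u (g \<otimes> x) - conv u x\<bar> <= e * C * I (bump J)" using 1 2 by linarith
qed

text \<open>Second differences of a convolution split into a product of two first differences;
  this gains a factor \<open>e\<close> over the first differences on commutators.\<close>

lemma conv_second_diff:
  assumes u: "u : UC"
    and J: "ALL y. y ~: Z J --> u y = 0 & (ALL a:Z 0. tr a u y = 0)"
    and osc: "osc u e k" "k >= 0" "e >= 0"
    and a: "a : Z k" and b: "b : Z k" and x: "x : carrier G"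
  shows "\<bar>conv u (a \<otimes> (b \<otimes> x)) - conv u (a \<otimes> x) - conv u (b \<otimes> x) + conv u x\<bar> <= e * e * I (bump J)"
proof -
  have ac: "a : carrier G" and bc: "b : carrier G" using a b Z_carrier by auto
  then have bx: "b \<otimes> x : carrier G" using x by simp
  note P1 = prod_UC[OF tr_UC[OF u ac] u bx] and P2 = prod_UC[OF tr_UC[OF u ac] u x]
    and P3 = prod_UC[OF u u bx] and P4 = prod_UC[OF u u x]
  have E: "(%y. (e * e) * bump J y) : UC" by (rule UC_scale[OF bump_UC]) (use osc in simp)
  have IE: "I (%y. (e * e) * bump J y) <= (e * e) * I (bump J)" by (rule I_scale[OF bump_UC]) (use osc in simp)
  have pw: "\<bar>(tr a u y * rv u (b \<otimes> x) y + u y * rv u x y) - (tr a u y * rv u x y + u y * rv u (b \<otimes> x) y)\<bar> <= (e * e) * bump J y"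
    if y: "y : carrier G" for y
  proof -
    have "(tr a u y * rv u (b \<otimes> x) y + u y * rv u x y) - (tr a u y * rv u x y + u y * rv u (b \<otimes> x) y)
        = (tr a u y - u y) * (rv u (b \<otimes> x) y - rv u x y)" by (simp add: algebra_simps)
    then have "\<bar>(tr a u y * rv u (b \<otimes> x) y + u y * rv u x y) - (tr a u y * rv u x y + u y * rv u (b \<otimes> x) y)\<bar>
        = \<bar>tr a u y - u y\<bar> * \<bar>rv u (b \<otimes> x) y - rv u x y\<bar>" by (simp add: abs_mult)
    also have "\<dots> <= (e * bump J y) * e"
      using tr_bump[OF u J osc a, of y] rv_osc'[OF osc(1) x y b] osc bump_nonneg[of J y]
      by (intro mult_mono) auto
    finally show ?thesis by (simp add: mult_ac)
  qed
  have "I (%y. tr a u y * rv u (b \<otimes> x) y + u y * rv u x y)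
      <= I (%y. (tr a u y * rv u x y + u y * rv u (b \<otimes> x) y) + (e * e) * bump J y)"
    by (rule I_mono[OF UC_add[OF P1 P4] UC_add[OF UC_add[OF P2 P3] E]]) (use pw in \<open>smt (verit)\<close>)
  then have 1: "conv u (a \<otimes> (b \<otimes> x)) + conv u x <= conv u (a \<otimes> x) + conv u (b \<otimes> x) + e * e * I (bump J)"
    using conv_tr[OF u ac bx] conv_tr[OF u ac x] I_add[OF P1 P4] I_add[OF UC_add[OF P2 P3] E] I_add[OF P2 P3] IE x bx
    by (simp add: conv_def)
  have "I (%y. tr a u y * rv u x y + u y * rv u (b \<otimes> x) y)
      <= I (%y. (tr a u y * rv u (b \<otimes> x) y + u y * rv u x y) + (e * e) * bump J y)"
    by (rule I_mono[OF UC_add[OF P2 P3] UC_add[OF UC_add[OF P1 P4] E]]) (use pw in \<open>smt (verit)\<close>)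
  then have 2: "conv u (a \<otimes> x) + conv u (b \<otimes> x) <= conv u (a \<otimes> (b \<otimes> x)) + conv u x + e * e * I (bump J)"
    using conv_tr[OF u ac bx] conv_tr[OF u ac x] I_add[OF P2 P3] I_add[OF UC_add[OF P1 P4] E] I_add[OF P1 P4] IE x bx
    by (simp add: conv_def)
  show ?thesis using 1 2 by linarith
qed

text \<open>The point \<open>w\<close> satisfies
  \<open>a \<otimes> (b \<otimes> w) = comm a b \<otimes> x\<close> and
  \<open>b \<otimes> (a \<otimes> w) = x\<close>, so the first order terms of the two second
  differences cancel.\<close>

lemma conv_comm:
  assumes u: "u : UC"
    and J: "ALL y. y ~: Z J --> u y = 0 & (ALL a:Z 0. tr a u y = 0)"
    and osc: "osc u e k" "k >= 0" "e >= 0"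
    and a: "a : Z k" and b: "b : Z k" and x: "x : carrier G"
  shows "\<bar>conv u (comm a b \<otimes> x) - conv u x\<bar> <= 2 * (e * e * I (bump J))"
proof -
  have ac: "a : carrier G" and bc: "b : carrier G" using a b Z_carrier by auto
  define w where "w = inv a \<otimes> (inv b \<otimes> x)"
  have w: "w : carrier G" using ac bc x by (simp add: w_def)
  have 1: "a \<otimes> (b \<otimes> w) = comm a b \<otimes> x" "b \<otimes> (a \<otimes> w) = x"
    using ac bc x by (simp_all add: w_def comm_def m_assoc)
  show ?thesis
    using conv_second_diff[OF u J osc a b w] conv_second_diff[OF u J osc b a w] unfolding 1 by linarith
qed

lemma conv_UC: assumes u: "u : UC" shows "conv u : UC"
proof -
  obtain J where J: "ALL y. y ~: Z J --> u y = 0 & (ALL a:Z 0. tr a u y = 0)" using UC_supp_near[OF u] .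
  obtain C where C: "C >= 0" "ALL x. u x <= C" by (rule UC_bound[OF u])
  show ?thesis
  proof (rule UC_I[of _ "J - 1" "C * I u"])
    show "conv u x >= 0" for x using I_nonneg[OF prod_UC[OF u u]] by (simp add: conv_def)
    show "conv u x = 0" if x: "x ~: Z (J - 1)" for x
    proof (cases "x : carrier G")
      case True
      have "u y * rv u x y = 0" for y
      proof (rule ccontr)
        assume "u y * rv u x y ~= 0"
        then have ne: "u y ~= 0" "u (inv y \<otimes> x) ~= 0" "y : carrier G" by (auto simp: rv_def split: if_splits)
        then have "y : Z J" "inv y \<otimes> x : Z J" using J by blast+
        then have "y \<otimes> (inv y \<otimes> x) : Z (J - 1)" using Z_mult[of y "J - 1"] by simp
        then show False using x True ne by simp
      qed
      then have "(%y. u y * rv u x y) = (%_. 0)" by (intro ext)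
      then show ?thesis using I_zero by (simp add: conv_def)
    qed (simp add: conv_def)
    show "conv u x <= C * I u" for x
    proof (cases "x : carrier G")
      case True
      have "I (%y. u y * rv u x y) <= I (%y. C * u y)"
      proof (rule I_mono[OF prod_UC[OF u u True] UC_scale[OF u C(1)]])
        fix y
        have "u y * rv u x y <= u y * C" using C UC_nonneg[OF u] by (intro mult_left_mono) (auto simp: rv_def)
        then show "u y * rv u x y <= C * u y" by (simp add: mult.commute)
      qed
      also have "\<dots> <= C * I u" by (rule I_scale[OF u C(1)])
      finally show ?thesis using True by (simp add: conv_def)
    qed (use C I_nonneg[OF u] in \<open>simp add: conv_def\<close>)
    fix e :: real assume e: "e > 0"
    define c where "c = C * I (bump J)"
    have c: "c >= 0" using C I_nonneg[OF bump_UC] by (simp add: c_def)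
    have "e / (c + 1) > 0" using e c by simp
    then obtain k where k: "ALL x:carrier G. ALL z:Z k. \<bar>u (z \<otimes> x) - u x\<bar> <= e / (c + 1)" by (rule UC_cont[OF u])
    have "osc u (e / (c + 1)) (max k 0)" unfolding osc_def using k Z_monoD[of _ "max k 0" k] by auto
    then have "osc (conv u) (e / (c + 1) * C * I (bump J)) (max k 0)"
      by (rule conv_osc1[OF u C(2,1) J]) (use e c in auto)
    moreover have "e / (c + 1) * C * I (bump J) <= e"
    proof -
      have "e / (c + 1) * C * I (bump J) = e * (c / (c + 1))" by (simp add: c_def)
      also have "\<dots> <= e * 1" using e c by (intro mult_left_mono) auto
      finally show ?thesis by simp
    qed
    ultimately show "EX k. ALL x:carrier G. ALL z:Z k. \<bar>conv u (z \<otimes> x) - conv u x\<bar> <= e"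
      unfolding osc_def by fastforce
  qed
qed

text \<open>Near the identity both factors of the integrand are at least half of
  \<open>u \<one>\<close>, so it dominates a multiple of a narrow bump.\<close>

lemma conv_pos: assumes u: "u : UC" "u \<one> > 0" shows "conv u \<one> > 0"
proof -
  obtain k where k: "ALL x:carrier G. ALL z:Z k. \<bar>u (z \<otimes> x) - u x\<bar> <= u \<one> / 2"
    by (rule UC_cont[OF u(1), of "u \<one> / 2"]) (use u(2) in simp)
  have big: "u z >= u \<one> / 2" if "z : Z k" for z
  proof -
    have "\<bar>u (z \<otimes> \<one>) - u \<one>\<bar> <= u \<one> / 2" using k that by blast
    then have "\<bar>u z - u \<one>\<bar> <= u \<one> / 2" using Z_carrier[OF that] by simp
    then show ?thesis by linarith
  qed
  define c where "c = (u \<one> / 2) * (u \<one> / 2) / 2"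
  have c: "c > 0" using u by (simp add: c_def)
  have pw: "c * bump (k + 2) y <= u y * rv u \<one> y" for y
  proof (cases "y : Z k")
    case True
    have yc: "y : carrier G" using True Z_carrier by blast
    have "c * bump (k + 2) y <= c * 2" using c bump_le by (intro mult_left_mono) auto
    also have "\<dots> = (u \<one> / 2) * (u \<one> / 2)" by (simp add: c_def)
    also have "\<dots> <= u y * u (inv y)" using big[OF True] big[OF Z_inv[OF True]] u by (intro mult_mono) auto
    finally show ?thesis using yc by (simp add: rv_def)
  next
    case False
    then have "bump (k + 2) y = 0" using bump_supp[of y "k + 2"] by simp
    then show ?thesis using UC_nonneg[OF u(1)] rv_nonneg[OF u(1)] by simp
  qed
  have cb: "(%y. c * bump (k + 2) y) : UC" by (rule UC_scale[OF bump_UC]) (use c in simp)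
  have "I (bump (k + 2)) = I (%y. (1 / c) * (c * bump (k + 2) y))" using c by simp
  also have "\<dots> <= (1 / c) * I (%y. c * bump (k + 2) y)" by (rule I_scale[OF cb]) (use c in simp)
  also have "\<dots> <= (1 / c) * I (%y. u y * rv u \<one> y)"
    using I_mono[OF cb prod_UC[OF u(1,1) one_closed]] pw c by (intro mult_left_mono) auto
  finally have "0 < (1 / c) * conv u \<one>" using I_bump_pos[of "k + 2"] by (simp add: conv_def)
  then show ?thesis using c by (simp add: zero_less_mult_iff zero_less_divide_iff)
qed

lemma osc_mono: "osc u e k ==> e <= e' ==> osc u e' k"
  unfolding osc_def by fastforce

text \<open>A convolution doubles the Hoelder exponent. A small element is a bounded product of
  commutators times a remainder one scale finer; the commutators cost second order by
  \<open>conv_comm\<close>, and treating the remainder again and again gives a geometric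
  series.\<close>

lemma conv_Hoelder:
  assumes u: "u : UC" and t: "0 < t" "t < (1 :: real)" and hol: "ALL n::nat. osc u (A * t ^ n) (int n)"
    and perf: "ALL k. ALL x:Z k. EX ys y. length ys <= L & (ALL v:set ys. EX a:Z (k - int C). EX b:Z (k - int C). v = comm a b) &
      y : Z (k + 1) & x = mlist ys \<otimes> y"
  shows "EX A'. ALL n::nat. osc (conv u) (A' * (t * t) ^ n) (int n)"
proof -
  obtain J where J: "ALL y. y ~: Z J --> u y = 0 & (ALL a:Z 0. tr a u y = 0)" using UC_supp_near[OF u] .
  obtain D where D: "D >= 0" "ALL x. u x <= D" by (rule UC_bound[OF u])
  obtain D' where D': "D' >= 0" "ALL x. conv u x <= D'" by (rule UC_bound[OF conv_UC[OF u]])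
  have A: "A >= 0"
  proof -
    have "\<bar>u (\<one> \<otimes> \<one>) - u \<one>\<bar> <= A * t ^ 0" using hol[rule_format, of 0] unfolding osc_def by (metis Z_one one_closed of_nat_0)
    then show ?thesis by simp
  qed
  define b where "b = I (bump J)"
  have b: "b >= 0" unfolding b_def by (rule I_nonneg[OF bump_UC])
  \<comment> \<open>At most \<open>L\<close> commutators cost \<open>2 * (e * e * b)\<close> each,
    where \<open>e = A * t ^ (n - C)\<close>; the shift by \<open>C\<close> is moved into the
    constant.\<close>
  define A2 where "A2 = real L * (2 * (A * A * b)) / (t * t) ^ C"
  have A2: "A2 >= 0" using A b t by (simp add: A2_def)
  define A1 where "A1 = A * D * b"
  have tt: "0 < t * t" "t * t < 1" using t mult_strict_mono[of t 1 t 1] by auto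
  have base: "osc (conv u) (A1 * t ^ n) (int n)" for n
    using conv_osc1[OF u D(2,1) J hol[rule_format, of n]] A t by (simp add: A1_def b_def mult_ac)
  have commlist: "\<bar>conv u (mlist ys \<otimes> x) - conv u x\<bar> <= real (length ys) * (2 * (e * e * b))"
    if "osc u e k" "k >= 0" "e >= 0" "ALL v:set ys. EX a:Z k. EX b:Z k. v = comm a b" "x : carrier G" for ys e k x
    using that(4)
  proof (induction ys)
    case (Cons v ys)
    obtain a c where ac: "a : Z k" "c : Z k" "v = comm a c" using Cons.prems by auto
    have vc: "v : carrier G" using ac Z_carrier by simp
    have "w : carrier G" if "w : set ys" for w
      using Cons.prems that Z_carrier comm_closed by (metis list.set_intros(2))
    then have mc: "mlist ys : carrier G" by (intro mlist_closed) auto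
    have "\<bar>conv u (comm a c \<otimes> (mlist ys \<otimes> x)) - conv u (mlist ys \<otimes> x)\<bar> <= 2 * (e * e * I (bump J))"
      by (rule conv_comm[OF u J that(1-3) ac(1,2)]) (use mc that in simp)
    then have "\<bar>conv u (mlist (v # ys) \<otimes> x) - conv u (mlist ys \<otimes> x)\<bar> <= 2 * (e * e * b)"
      using ac(3) vc mc that(5) by (simp add: m_assoc b_def)
    moreover have "\<bar>conv u (mlist ys \<otimes> x) - conv u x\<bar> <= real (length ys) * (2 * (e * e * b))"
      using Cons by simp
    ultimately show ?case by (simp add: algebra_simps)
  qed (use that in simp)
  have step: "osc (conv u) (A2 * (t * t) ^ n + r) (int n)"
    if n: "n >= C" and r: "osc (conv u) r (int (Suc n))" for n r
    unfolding osc_def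
  proof (intro ballI)
    fix g x assume g: "g : Z (int n)" and x: "x : carrier G"
    obtain ys y where ys: "length ys <= L" "ALL v:set ys. EX a:Z (int n - int C). EX b:Z (int n - int C). v = comm a b"
      "y : Z (int n + 1)" "g = mlist ys \<otimes> y" using perf g by blast
    define e where "e = A * t ^ (n - C)"
    have e: "e >= 0" using A t by (simp add: e_def)
    have o: "osc u e (int n - int C)" using hol[rule_format, of "n - C"] n by (simp add: e_def of_nat_diff)
    have yc: "y : carrier G" using ys Z_carrier by blast
    have "w : carrier G" if "w : set ys" for w
      using ys(2) that Z_carrier comm_closed by metis
    then have mc: "mlist ys : carrier G" by (intro mlist_closed) auto
    have 1: "\<bar>conv u (mlist ys \<otimes> (y \<otimes> x)) - conv u (y \<otimes> x)\<bar> <= real (length ys) * (2 * (e * e * b))"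
      by (rule commlist[OF o _ e ys(2)]) (use n x yc in auto)
    have 2: "\<bar>conv u (y \<otimes> x) - conv u x\<bar> <= r" using r ys(3) x unfolding osc_def by (simp add: add.commute)
    have "real (length ys) * (2 * (e * e * b)) <= real L * (2 * (e * e * b))"
      using ys(1) e b by (intro mult_right_mono) auto
    also have "\<dots> = A2 * (t * t) ^ n"
    proof -
      have "t ^ n = t ^ C * t ^ (n - C)" using n by (simp flip: power_add)
      then show ?thesis using t by (simp add: A2_def e_def power_mult_distrib field_simps)
    qed
    finally show "\<bar>conv u (g \<otimes> x) - conv u x\<bar> <= A2 * (t * t) ^ n + r"
      using 1 2 ys(4) mc yc x by (simp add: m_assoc)
  qed
  \<comment> \<open>The remainder after \<open>m\<close> rounds is only known to satisfy the first
    order bound \<open>base\<close>; it disappears as \<open>m\<close> grows.\<close>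
  have iter: "osc (conv u) (A2 / (1 - t * t) * (t * t) ^ n + A1 * t ^ (n + m)) (int n)" if "n >= C" for n m
    using that
  proof (induction m arbitrary: n)
    case 0
    show ?case by (rule osc_mono[OF base]) (use A2 tt in simp)
  next
    case (Suc m)
    have "osc (conv u) (A2 / (1 - t * t) * (t * t) ^ Suc n + A1 * t ^ (Suc n + m)) (int (Suc n))"
      by (rule Suc.IH) (use Suc.prems in simp)
    from step[OF Suc.prems this] show ?case
    proof (rule osc_mono)
      have "A2 * (t * t) ^ n + A2 / (1 - t * t) * (t * t) ^ Suc n = A2 / (1 - t * t) * (t * t) ^ n"
        using tt by (simp add: field_simps)
      then show "A2 * (t * t) ^ n + (A2 / (1 - t * t) * (t * t) ^ Suc n + A1 * t ^ (Suc n + m))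
          <= A2 / (1 - t * t) * (t * t) ^ n + A1 * t ^ (n + Suc m)" by simp
    qed
  qed
  have lim: "osc (conv u) (A2 / (1 - t * t) * (t * t) ^ n) (int n)" if n: "n >= C" for n
    unfolding osc_def
  proof (intro ballI)
    fix g x assume gx: "g : Z (int n)" "x : carrier G"
    have "(%m. A2 / (1 - t * t) * (t * t) ^ n + A1 * (t ^ n * t ^ m)) \<longlonglongrightarrow> A2 / (1 - t * t) * (t * t) ^ n + A1 * (t ^ n * 0)"
      using t by (intro tendsto_intros LIMSEQ_power_zero) auto
    moreover have "\<bar>conv u (g \<otimes> x) - conv u x\<bar> <= A2 / (1 - t * t) * (t * t) ^ n + A1 * (t ^ n * t ^ m)" for m
      using iter[OF n, of m] gx unfolding osc_def by (simp add: power_add)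
    ultimately have "\<bar>conv u (g \<otimes> x) - conv u x\<bar> <= A2 / (1 - t * t) * (t * t) ^ n + A1 * (t ^ n * 0)"
      by (intro LIMSEQ_le_const) auto
    then show "\<bar>conv u (g \<otimes> x) - conv u x\<bar> <= A2 / (1 - t * t) * (t * t) ^ n" by simp
  qed
  \<comment> \<open>For \<open>n < C\<close> the commutators would come from scales that
    \<open>hol\<close> does not cover. There the trivial bound \<open>D'\<close> is used and
    absorbed into the constant.\<close>
  define A' where "A' = max (A2 / (1 - t * t)) (D' / (t * t) ^ C)"
  have "osc (conv u) (A' * (t * t) ^ n) (int n)" for n
  proof (cases "n >= C")
    case True
    have "A2 / (1 - t * t) * (t * t) ^ n <= A' * (t * t) ^ n"
      by (rule mult_right_mono) (use tt in \<open>auto simp: A'_def\<close>)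
    then show ?thesis by (rule osc_mono[OF lim[OF True]])
  next
    case False
    have "(t * t) ^ C <= (t * t) ^ n" using False tt by (intro power_decreasing) auto
    moreover have c: "(t * t) ^ C > 0" using tt by (intro zero_less_power) auto
    ultimately have "D' / (t * t) ^ C * (t * t) ^ C <= D' / (t * t) ^ C * (t * t) ^ n"
      using D' by (intro mult_left_mono divide_nonneg_pos) auto
    moreover have "D' / X * X = D'" if "X > 0" for X :: real using that by simp
    ultimately have "D' <= D' / (t * t) ^ C * (t * t) ^ n" using c by metis
    also have "\<dots> <= A' * (t * t) ^ n" using tt by (intro mult_right_mono) (auto simp: A'_def)
    finally have "D' <= A' * (t * t) ^ n" .
    moreover have "\<bar>conv u y - conv u x\<bar> <= D'" for x y
      using D' UC_nonneg[OF conv_UC[OF u], of x] UC_nonneg[OF conv_UC[OF u], of y] by (smt (verit))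
    ultimately show ?thesis unfolding osc_def by (meson order_trans)
  qed
  then show ?thesis by blast
qed

lemma osc_grow:
  assumes gen: "ALL k. ALL x:Z (k - 1). EX ys. length ys <= q & set ys <= Z k & x = mlist ys"
    and o: "osc u e k" "e >= 0"
  shows "osc u (real q ^ m * e) (k - int m)"
proof (induction m)
  case (Suc m)
  have one: "\<bar>u (mlist ys \<otimes> x) - u x\<bar> <= real (length ys) * (real q ^ m * e)"
    if "set ys <= Z (k - int m)" "x : carrier G" for ys x
    using that(1)
  proof (induction ys)
    case (Cons v ys)
    have vc: "v : carrier G" and mc: "mlist ys : carrier G"
      using Cons.prems Z_carrier by (auto intro!: mlist_closed)
    have "\<bar>u (v \<otimes> (mlist ys \<otimes> x)) - u (mlist ys \<otimes> x)\<bar> <= real q ^ m * e"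
      using Suc Cons.prems mc that(2) unfolding osc_def by simp
    then show ?case using Cons vc mc that(2) by (simp add: m_assoc algebra_simps)
  qed (use that in simp)
  show ?case
    unfolding osc_def
  proof (intro ballI)
    fix g x assume g: "g : Z (k - int (Suc m))" and x: "x : carrier G"
    have "g : Z (k - int m - 1)" using g by (simp add: algebra_simps)
    then obtain ys where ys: "length ys <= q" "set ys <= Z (k - int m)" "g = mlist ys" using gen by blast
    have "\<bar>u (g \<otimes> x) - u x\<bar> <= real (length ys) * (real q ^ m * e)" using one[OF ys(2) x] ys(3) by simp
    also have "\<dots> <= real q * (real q ^ m * e)" using ys(1) o by (intro mult_right_mono) auto
    finally show "\<bar>u (g \<otimes> x) - u x\<bar> <= real q ^ Suc m * e" by simp
  qed
qed (use o in simp)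

text \<open>Exponents double with each convolution, so some iterate beats the factor
  \<open>q\<close> lost per scale: an element of bounded size is a product of at most
  \<open>q ^ (i + j)\<close> elements of scale \<open>i\<close>, each changing the function by at
  most \<open>A * s ^ i\<close> with \<open>q * s < 1\<close>. The iterate is therefore constant,
  although it is positive at the identity and vanishes far out.\<close>

theorem perfect_contradiction:
  assumes unb: "ALL j. EX x:carrier G. x ~: Z j"
    and gen: "ALL k. ALL x:Z (k - 1). EX ys. length ys <= q & set ys <= Z k & x = mlist ys"
    and perf: "ALL k. ALL x:Z k. EX ys y. length ys <= L & (ALL v:set ys. EX a:Z (k - int C). EX b:Z (k - int C). v = comm a b) &
      y : Z (k + 1) & x = mlist ys \<otimes> y"
  shows False
proof -
  define U where "U n = (conv ^^ n) (bump 0)" for n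
  have U: "U n : UC & U n \<one> > 0 & (EX A. ALL i::nat. osc (U n) (A * ((1/2) ^ (2 ^ n)) ^ i) (int i))" for n
  proof (induction n)
    case 0
    have "osc (bump 0) (1 * (1 / 2) ^ i) (int i)" for i
    proof -
      have "wt (int i) = 1 / 2 ^ i" by (simp add: wt_def powr_minus powr_realpow divide_simps)
      moreover have "wt 0 = 1" by (simp add: wt_def)
      ultimately have "wt (int i) / wt 0 = (1 / 2) ^ i" by (simp add: power_one_over)
      then show ?thesis unfolding osc_def using bump_step[of _ _ "int i" 0] by auto
    qed
    moreover have "bump 0 \<one> > 0" using bump_ge[of \<one> 0] by simp
    ultimately show ?case using bump_UC unfolding U_def by (auto intro!: exI[of _ 1])
  next
    case (Suc n)
    then obtain A where A: "U n : UC" "U n \<one> > 0" "ALL i::nat. osc (U n) (A * ((1/2) ^ (2 ^ n)) ^ i) (int i)" by blast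
    have t: "0 < (1/2 :: real) ^ (2 ^ n)" "(1/2 :: real) ^ (2 ^ n) < 1" by (auto simp: power_less_one_iff)
    have "(1/2 :: real) ^ (2 ^ n) * (1/2) ^ (2 ^ n) = (1/2) ^ (2 ^ Suc n)" by (simp add: mult_2 flip: power_add)
    then show ?case
      using conv_Hoelder[OF A(1) t A(3) perf] conv_UC[OF A(1)] conv_pos[OF A(1,2)] by (simp add: U_def)
  qed
  obtain n where n: "real q < 2 ^ n" using real_arch_pow[of 2 "real q"] by auto
  define s where "s = (1/2 :: real) ^ (2 ^ n)"
  have s: "s > 0" "real q * s < 1"
  proof -
    show "s > 0" by (simp add: s_def)
    have "n <= 2 ^ n" by (simp add: less_imp_le)
    then have "s <= (1/2) ^ n" unfolding s_def by (intro power_decreasing) auto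
    then have "real q * s <= real q * (1/2) ^ n" by (intro mult_left_mono) auto
    also have "\<dots> < 1" using n by (simp add: field_simps power_one_over)
    finally show "real q * s < 1" .
  qed
  obtain A where A: "ALL i::nat. osc (U n) (A * s ^ i) (int i)" using U[of n] unfolding s_def by blast
  have A0: "A >= 0"
  proof -
    have "\<bar>U n (\<one> \<otimes> \<one>) - U n \<one>\<bar> <= A * s ^ 0" using A[rule_format, of 0] unfolding osc_def by (metis Z_one one_closed of_nat_0)
    then show ?thesis by simp
  qed
  have const: "U n x = U n \<one>" if x: "x : carrier G" for x
  proof -
    obtain j :: nat where j: "x : Z (- int j)" using Z_exh x by blast
    have "\<bar>U n (x \<otimes> \<one>) - U n \<one>\<bar> <= real q ^ j * A * (real q * s) ^ i" for i
    proof -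
      have "osc (U n) (real q ^ (i + j) * (A * s ^ i)) (int i - int (i + j))"
        by (rule osc_grow[OF gen]) (use A A0 s in auto)
      then have "osc (U n) (real q ^ (i + j) * (A * s ^ i)) (- int j)" by simp
      then have "\<bar>U n (x \<otimes> \<one>) - U n \<one>\<bar> <= real q ^ (i + j) * (A * s ^ i)" using j unfolding osc_def by blast
      then show ?thesis by (simp add: power_add power_mult_distrib mult_ac)
    qed
    moreover have "(%i. real q ^ j * A * (real q * s) ^ i) \<longlonglongrightarrow> real q ^ j * A * 0"
      using s by (intro tendsto_intros LIMSEQ_power_zero) auto
    ultimately have "\<bar>U n (x \<otimes> \<one>) - U n \<one>\<bar> <= real q ^ j * A * 0" by (intro LIMSEQ_le_const) auto
    then show ?thesis using x by simp
  qed
  obtain J where J: "ALL x. x ~: Z J --> U n x = 0" by (rule UC_supp[OF conjunct1[OF U[of n]]])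
  obtain x where x: "x : carrier G" "x ~: Z J" using unb by blast
  have "U n x = 0" using J x(2) by blast
  moreover have "U n \<one> > 0" using conjunct1[OF conjunct2[OF U[of n]]] .
  ultimately show False using const[OF x(1)] by simp
qed

end

theorem (in sin_group) not_perfect:
  assumes "ALL j. EX x:carrier G. x ~: Z j"
    "ALL k. ALL x:Z (k - 1). EX ys. length ys <= q & set ys <= Z k & x = mlist ys"
    "ALL k. ALL x:Z k. EX ys y. length ys <= L & (ALL v:set ys. EX a:Z (k - int C). EX b:Z (k - int C). v = comm a b) &
      y : Z (k + 1) & x = mlist ys \<otimes> y"
  shows False
proof -
  obtain I where I: "ALL f:UC. I f >= 0" "ALL f:UC. ALL g:UC. (ALL x:carrier G. f x <= g x) --> I f <= I g"
    "ALL f:UC. ALL g:UC. I (%x. f x + g x) = I f + I g"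
    "ALL f:UC. ALL r>=0. I (%x. r * f x) <= r * I f"
    "ALL f:UC. ALL g:carrier G. I (tr g f) = I f" "I (bump 0) = 1"
    by (rule invariant_functional)
  interpret sin_functional G Z I
    by unfold_locales (use I in \<open>simp_all\<close>)
  show False by (rule perfect_contradiction[OF assms])
qed

section \<open>Length functions on abelian groups\<close>

locale comm_group_length = comm_group G for G (structure) +
  fixes len :: "'a => nat" and F :: "'a set"
  assumes len_one: "len \<one> = 0"
    and len_mult: "x : carrier G ==> y : carrier G ==> len (x \<otimes> y) <= len x + len y"
    and len_inv: "x : carrier G ==> len (inv x) = len x"
    and F: "finite F" "F <= carrier G"
    and decomp: "x : carrier G ==> EX w:carrier G. EX c. len w <= 1 & (\<Sum>f\<in>F. c f) <= len x &
      x = w \<otimes> (\<Otimes>f\<in>F. f [^] (c f :: nat))"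
begin

text \<open>The length induced on the quotient by \<open>S\<close>. Lengths are natural numbers, so
  the least value is attained on each coset.\<close>

definition qlen :: "'a set => 'a => nat" where
  "qlen S x = (LEAST n. EX s:S. len (x \<otimes> s) <= n)"

lemma qlen_le: "s : S ==> qlen S x <= len (x \<otimes> s)"
  unfolding qlen_def by (rule Least_le) blast

lemma qlen_ex: assumes "subgroup S G" obtains s where "s : S" "len (x \<otimes> s) = qlen S x"
proof -
  have "EX s:S. len (x \<otimes> s) <= len (x \<otimes> \<one>)" using subgroup.one_closed[OF assms] by blast
  then have "EX s:S. len (x \<otimes> s) <= qlen S x" unfolding qlen_def by (rule LeastI)
  then obtain s where s: "s : S" "len (x \<otimes> s) <= qlen S x" ..
  show thesis by (rule that[OF s(1) le_antisym[OF s(2) qlen_le[OF s(1)]]])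
qed

lemma qlen_le_len: "subgroup S G ==> x : carrier G ==> qlen S x <= len x"
  using qlen_le[of \<one> S x] subgroup.one_closed by auto

lemma qlen_mult: assumes S: "subgroup S G" and xy: "x : carrier G" "y : carrier G"
  shows "qlen S (x \<otimes> y) <= qlen S x + qlen S y"
proof -
  obtain s where s: "s : S" "len (x \<otimes> s) = qlen S x" using qlen_ex[OF S] .
  obtain t where t: "t : S" "len (y \<otimes> t) = qlen S y" using qlen_ex[OF S] .
  have c: "s : carrier G" "t : carrier G" using s t subgroup.mem_carrier[OF S] by auto
  have "qlen S (x \<otimes> y) <= len (x \<otimes> y \<otimes> (s \<otimes> t))"
    by (rule qlen_le) (use s t subgroup.m_closed[OF S] in auto)
  also have "x \<otimes> y \<otimes> (s \<otimes> t) = (x \<otimes> s) \<otimes> (y \<otimes> t)" using xy c by (simp add: m_ac)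
  also have "len \<dots> <= len (x \<otimes> s) + len (y \<otimes> t)" by (rule len_mult) (use xy c in auto)
  finally show ?thesis using s t by simp
qed

lemma qlen_one: "subgroup S G ==> qlen S \<one> = 0"
  using qlen_le_len[of S \<one>] len_one by simp

lemma qlen_pow: "subgroup S G ==> x : carrier G ==> qlen S (x [^] (n::nat)) <= n * qlen S x"
proof (induction n)
  case (Suc n)
  have "qlen S (x [^] n \<otimes> x) <= qlen S (x [^] n) + qlen S x" by (rule qlen_mult) (use Suc in auto)
  then show ?case using Suc by simp
qed (simp add: qlen_one)

lemma qlen_coset: assumes S: "subgroup S G" and x: "x : carrier G" "s : S" shows "qlen S (x \<otimes> s) = qlen S x"
proof -
  have sc: "s : carrier G" using x subgroup.mem_carrier[OF S] by auto
  have 0: "qlen S t = 0" if "t : S" for t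
    using qlen_le[of "inv t" S t] subgroup.m_inv_closed[OF S that] subgroup.mem_carrier[OF S that] len_one by simp
  have "qlen S (x \<otimes> s) <= qlen S x" using qlen_mult[OF S x(1) sc] 0[OF x(2)] by simp
  moreover have "qlen S (x \<otimes> s \<otimes> inv s) <= qlen S (x \<otimes> s) + qlen S (inv s)"
    by (rule qlen_mult[OF S]) (use x sc in auto)
  ultimately show ?thesis using 0[OF subgroup.m_inv_closed[OF S x(2)]] x sc by (simp add: m_assoc)
qed

text \<open>Modulo \<open>S\<close> the powers of \<open>f\<close> grow at a rate of at most one
  half. The half is what lets the estimate in \<open>all_small_bounded\<close> close up.\<close>

definition small :: "'a set => 'a => bool" where
  "small S f \<longleftrightarrow> (EX n>0. 2 * qlen S (f [^] (n::nat)) <= n)"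

lemma small_bound: assumes S: "subgroup S G" and f: "f : carrier G" "small S f"
  shows "EX D. ALL c::nat. 2 * qlen S (f [^] c) <= c + D"
proof -
  obtain n where n: "n > 0" "2 * qlen S (f [^] (n::nat)) <= n" using f by (auto simp: small_def)
  have "2 * qlen S (f [^] c) <= c + 2 * (n * qlen S f)" for c :: nat
  proof -
    define q r where "q = c div n" and "r = c mod n"
    have c: "c = n * q + r" "r < n" using n by (auto simp: q_def r_def)
    have "f [^] c = (f [^] n) [^] q \<otimes> f [^] r" using f c by (simp add: nat_pow_mult nat_pow_pow)
    then have "qlen S (f [^] c) <= qlen S ((f [^] n) [^] q) + qlen S (f [^] r)"
      using qlen_mult[OF S] f by simp
    moreover have "qlen S ((f [^] n) [^] q) <= q * qlen S (f [^] n)" by (rule qlen_pow[OF S]) (use f in auto)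
    moreover have "2 * (q * qlen S (f [^] n)) <= q * n" using n by simp
    moreover have "qlen S (f [^] r) <= r * qlen S f" by (rule qlen_pow[OF S f(1)])
    moreover have "r * qlen S f <= n * qlen S f" using c by simp
    moreover have "q * n <= c" using c by (simp add: mult.commute)
    ultimately show ?thesis by linarith
  qed
  then show ?thesis by blast
qed

lemma qlen_finprod: assumes S: "subgroup S G" and "finite E" "E <= carrier G"
  shows "qlen S (\<Otimes>f\<in>E. f [^] (c f :: nat)) <= (\<Sum>f\<in>E. qlen S (f [^] (c f)))"
  using assms(2,3)
proof (induction E rule: finite_induct)
  case (insert f E)
  have fc: "(%f. f [^] c f) : E \<rightarrow> carrier G" "f [^] c f : carrier G" using insert by auto
  have "qlen S (f [^] c f \<otimes> (\<Otimes>f\<in>E. f [^] c f)) <= qlen S (f [^] c f) + qlen S (\<Otimes>f\<in>E. f [^] c f)"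
    by (rule qlen_mult[OF S]) (use fc finprod_closed in auto)
  then show ?case using insert fc by (simp add: finprod_insert)
qed (simp add: qlen_one[OF S])

text \<open>A shortest element of a coset is a bounded factor times at most \<open>qlen S x\<close>
  generators. If each generator grows at a rate of at most one half modulo \<open>S\<close>, then
  \<open>qlen S x\<close> is at most half of itself plus a constant.\<close>

lemma all_small_bounded:
  assumes S: "subgroup S G" and small: "ALL f:F. small S f"
  shows "EX N. ALL x:carrier G. qlen S x <= N"
proof -
  have "ALL f:F. EX D. ALL c::nat. 2 * qlen S (f [^] c) <= c + D"
    using small_bound[OF S] small F by blast
  from bchoice[OF this] obtain D where D: "ALL f:F. ALL c::nat. 2 * qlen S (f [^] c) <= c + D f" ..
  have "qlen S x <= 2 + (\<Sum>f\<in>F. D f)" if x: "x : carrier G" for x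
  proof -
    obtain s where s: "s : S" "len (x \<otimes> s) = qlen S x" using qlen_ex[OF S] .
    have sc: "s : carrier G" using s subgroup.mem_carrier[OF S] by auto
    define y where "y = x \<otimes> s"
    have y: "y : carrier G" "len y = qlen S x" "qlen S y = qlen S x"
      using x sc s qlen_coset[OF S x s(1)] by (auto simp: y_def)
    obtain w c where w: "w : carrier G" "len w <= 1" "(\<Sum>f\<in>F. c f) <= len y"
      "y = w \<otimes> (\<Otimes>f\<in>F. f [^] (c f :: nat))" using decomp[OF y(1)] by blast
    have pc: "(\<Otimes>f\<in>F. f [^] c f) : carrier G" by (rule finprod_closed) (use F in auto)
    have "qlen S y <= qlen S w + qlen S (\<Otimes>f\<in>F. f [^] c f)" unfolding w(4) by (rule qlen_mult[OF S w(1) pc])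
    moreover have "qlen S w <= 1" using qlen_le_len[OF S w(1)] w(2) by simp
    moreover have "qlen S (\<Otimes>f\<in>F. f [^] c f) <= (\<Sum>f\<in>F. qlen S (f [^] (c f)))" by (rule qlen_finprod[OF S F])
    moreover have "2 * (\<Sum>f\<in>F. qlen S (f [^] (c f))) <= (\<Sum>f\<in>F. c f + D f)"
      unfolding sum_distrib_left by (rule sum_mono) (use D in auto)
    ultimately have "2 * qlen S y <= 2 + ((\<Sum>f\<in>F. c f) + (\<Sum>f\<in>F. D f))" by (simp add: sum.distrib)
    then show ?thesis using w(3) y by linarith
  qed
  then show ?thesis by blast
qed

definition undistorted :: "'a set => bool" where
  "undistorted S \<longleftrightarrow> subgroup S G & (EX C. ALL s:S. ALL k::nat. k * len s <= C * len (s [^] k))"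

text \<open>Since \<open>f\<close> is not small, its exponent in a product
  \<open>s \<otimes> f [^] i\<close> is bounded by twice the length modulo \<open>S\<close>. Once
  the exponent is under control so is \<open>s\<close>, and \<open>f\<close> joins \<open>S\<close>
  like a new coordinate direction.\<close>

lemma undistorted_extend:
  assumes S: "undistorted S" and f: "f : carrier G" "~ small S f"
  obtains S' where "undistorted S'" "S <= S'" "f : S'"
proof -
  have Ss: "subgroup S G" using S by (simp add: undistorted_def)
  obtain C where C: "ALL s:S. ALL k::nat. k * len s <= C * len (s [^] k)" using S by (auto simp: undistorted_def)
  have ns: "n <= 2 * qlen S (f [^] n)" for n :: nat
  proof (cases "n = 0")
    case False
    then have "~ 2 * qlen S (f [^] n) <= n" using f(2) unfolding small_def by blast
    then show ?thesis by linarith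
  qed simp
  have len_pow: "len (x [^] (n::nat)) <= n * len x" if "x : carrier G" for x n
  proof (induction n)
    case (Suc n)
    have "len (x [^] n \<otimes> x) <= len (x [^] n) + len x" by (rule len_mult) (use that in auto)
    then show ?case using Suc by simp
  qed (simp add: len_one)
  have len_ipow: "len (x [^] (i::int)) <= nat \<bar>i\<bar> * len x" if "x : carrier G" for x i
    using len_pow[OF that] len_inv that by (cases i rule: int_cases2) (auto simp: int_pow_int int_pow_neg)
  define S' where "S' = {s \<otimes> f [^] (i::int) | s i. s : S}"
  have Sc: "s : carrier G" if "s : S" for s using subgroup.mem_carrier[OF Ss that] .
  have S'c: "S' <= carrier G" using Sc f by (auto simp: S'_def)
  have "subgroup S' G"
  proof (rule subgroupI[OF S'c])
    show "S' ~= {}" using subgroup.one_closed[OF Ss] by (auto simp: S'_def)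
    show "inv x : S'" if xS: "x : S'" for x
    proof -
      obtain s i where x: "x = s \<otimes> f [^] (i::int)" "s : S" using xS unfolding S'_def by blast
      have "inv x = inv s \<otimes> f [^] (- i)" using x Sc f by (simp add: inv_mult int_pow_neg)
      then show ?thesis using subgroup.m_inv_closed[OF Ss x(2)] unfolding S'_def by blast
    qed
    show "x \<otimes> y : S'" if xS: "x : S'" and yS: "y : S'" for x y
    proof -
      obtain s i where x: "x = s \<otimes> f [^] (i::int)" "s : S" using xS unfolding S'_def by blast
      obtain t j where y: "y = t \<otimes> f [^] (j::int)" "t : S" using yS unfolding S'_def by blast
      have "x \<otimes> y = (s \<otimes> t) \<otimes> f [^] (i + j)" using x y Sc f by (simp add: m_ac int_pow_mult)
      then show ?thesis using subgroup.m_closed[OF Ss x(2) y(2)] unfolding S'_def by blast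
    qed
  qed
  moreover have "EX C'. ALL s:S'. ALL k::nat. k * len s <= C' * len (s [^] k)"
  proof (intro exI ballI allI)
    fix x and k :: nat assume "x : S'"
    then obtain s i where x: "x = s \<otimes> f [^] (i::int)" "s : S" by (auto simp: S'_def)
    note sc = Sc[OF x(2)]
    have xc: "x : carrier G" using x sc f by simp
    have xk: "x [^] k = s [^] k \<otimes> f [^] (i * int k)"
    proof -
      have "x [^] k = s [^] k \<otimes> (f [^] i) [^] k" using x sc f by (simp add: nat_pow_distrib)
      then show ?thesis using f by (simp add: int_pow_pow flip: int_pow_int)
    qed
    define A where "A = len (x [^] k)"
    define m where "m = nat \<bar>i\<bar> * k"
    have sk: "s [^] k : S" using x(2) by (induction k) (auto simp: subgroup.one_closed[OF Ss] subgroup.m_closed[OF Ss])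
    have m: "m <= 2 * A"
    proof -
      have "qlen S (f [^] m) <= A"
      proof (cases "i >= 0")
        case True
        then have "f [^] (i * int k) = f [^] m" by (simp add: m_def flip: int_pow_int)
        then have "f [^] m \<otimes> s [^] k = x [^] k" using xk sc f by (simp add: m_comm)
        then show ?thesis using qlen_le[OF sk, of "f [^] m"] by (simp add: A_def)
      next
        case False
        then have "i * int k = - int m" by (simp add: m_def)
        then have "f [^] (i * int k) = inv (f [^] m)" using f by (simp add: int_pow_neg int_pow_int)
        then have "f [^] m \<otimes> inv (s [^] k) = inv (x [^] k)" using xk sc f by (simp add: inv_mult m_comm)
        then show ?thesis
          using qlen_le[OF subgroup.m_inv_closed[OF Ss sk], of "f [^] m"] len_inv[of "x [^] k"] xc by (simp add: A_def)
      qed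
      then show ?thesis using ns[of m] by linarith
    qed
    have fi: "len (f [^] (i * int k)) <= m * len f"
      using len_ipow[OF f(1), of "i * int k"] by (simp add: m_def abs_mult nat_mult_distrib)
    have lsk: "len (s [^] k) <= A + m * len f"
    proof -
      have "s [^] k = x [^] k \<otimes> inv (f [^] (i * int k))" using xk sc f by (simp add: m_assoc)
      then have "len (s [^] k) <= len (x [^] k) + len (inv (f [^] (i * int k)))"
        using len_mult[of "x [^] k" "inv (f [^] (i * int k))"] xc f by simp
      then show ?thesis using fi len_inv f by (simp add: A_def)
    qed
    have lx: "len x <= len s + nat \<bar>i\<bar> * len f"
    proof -
      have "len x <= len s + len (f [^] i)" unfolding x(1) by (rule len_mult) (use sc f in auto)
      then show ?thesis using len_ipow[OF f(1), of i] by linarith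
    qed
    have "k * len x <= k * len s + m * len f"
      using mult_le_mono2[OF lx, of k] by (simp add: m_def algebra_simps)
    also have "\<dots> <= C * (A + m * len f) + m * len f"
      using C x(2) lsk by (meson add_le_mono1 mult_le_mono2 order_trans)
    also have "\<dots> <= C * (A + (2 * A) * len f) + (2 * A) * len f"
      using m by (intro add_mono mult_le_mono mult_le_mono1) auto
    also have "\<dots> = (C * (1 + 2 * len f) + 2 * len f) * A" by (simp add: algebra_simps)
    finally show "k * len x <= (C * (1 + 2 * len f) + 2 * len f) * len (x [^] k)" by (simp add: A_def)
  qed
  ultimately have "undistorted S'" by (simp add: undistorted_def)
  moreover have "S <= S'"
  proof
    fix s assume s: "s : S"
    then have "s = s \<otimes> f [^] (0::int)" using Sc by simp
    then show "s : S'" using s unfolding S'_def by blast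
  qed
  moreover have "f : S'"
  proof -
    have "f = \<one> \<otimes> f [^] (1::int)" using f by simp
    then show ?thesis using subgroup.one_closed[OF Ss] unfolding S'_def by blast
  qed
  ultimately show thesis by (rule that)
qed

lemma small_mono: assumes "subgroup S G" "subgroup S' G" "S <= S'" "small S f" shows "small S' f"
proof -
  have "qlen S' x <= qlen S x" for x using qlen_ex[OF assms(1), of x] qlen_le[of _ S' x] assms(3) by (metis subsetD)
  then show ?thesis using assms(4) unfolding small_def by (meson order_trans mult_le_mono2)
qed

text \<open>Adjoining a generator that is not small makes it small, and small ones stay small; the
  number of exceptions in the finite set \<open>F\<close> decreases.\<close>

lemma exists_undistorted: "EX S. undistorted S & (ALL f:F. small S f)"
proof -
  have "EX S'. undistorted S' & (ALL f:F. small S' f)" if "undistorted S" for S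
    using that
  proof (induction "card {f : F. ~ small S f}" arbitrary: S rule: less_induct)
    case less
    show ?case
    proof (cases "ALL f:F. small S f")
      case False
      then obtain f where f: "f : F" "~ small S f" by blast
      then have fc: "f : carrier G" using F by auto
      obtain S' where S': "undistorted S'" "S <= S'" "f : S'" using undistorted_extend[OF less.prems fc f(2)] .
      have sg: "subgroup S G" "subgroup S' G" using less.prems S' by (auto simp: undistorted_def)
      have "qlen S' (f [^] (1::nat)) = 0"
        using qlen_le[OF subgroup.m_inv_closed[OF sg(2) S'(3)], of f] fc len_one by simp
      then have fs: "small S' f" unfolding small_def by (intro exI[of _ 1]) simp
      have "{g : F. ~ small S' g} \<subset> {g : F. ~ small S g}"
        using small_mono[OF sg S'(2)] f fs by blast
      then have "card {g : F. ~ small S' g} < card {g : F. ~ small S g}"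
        using F by (intro psubset_card_mono) auto
      then show ?thesis using less.hyps S'(1) by blast
    qed (use less.prems in blast)
  qed
  moreover have "undistorted {\<one>}"
    unfolding undistorted_def using triv_subgroup len_one by auto
  ultimately show ?thesis by blast
qed

text \<open>Every element is within bounded distance of an undistorted subgroup, like the points of
  a vector space from a lattice. Taking \<open>k\<close>-th powers multiplies that distance, which
  accounts for the term \<open>C * k\<close>.\<close>

lemma linear_growth: "EX C. ALL x:carrier G. ALL k::nat. k * len x <= C * len (x [^] k) + C * k"
proof -
  obtain S where S: "undistorted S" "ALL f:F. small S f" using exists_undistorted by blast
  have Ss: "subgroup S G" using S by (simp add: undistorted_def)
  obtain C where C: "ALL s:S. ALL k::nat. k * len s <= C * len (s [^] k)" using S by (auto simp: undistorted_def)
  obtain N where N: "ALL x:carrier G. qlen S x <= N" using all_small_bounded[OF Ss S(2)] by blast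
  have "k * len x <= (C * N + N + C) * len (x [^] k) + (C * N + N + C) * k" if x: "x : carrier G" for x and k :: nat
  proof -
    obtain s where s: "s : S" "len (x \<otimes> s) = qlen S x" using qlen_ex[OF Ss] .
    have sc: "s : carrier G" using s subgroup.mem_carrier[OF Ss] by auto
    define w where "w = x \<otimes> s"
    have w: "w : carrier G" "len w <= N" using s N x sc by (auto simp: w_def)
    have "x = w \<otimes> inv s" "s = w \<otimes> inv x" using x sc by (simp_all add: w_def m_assoc) (simp add: m_ac)
    then have xw: "x = w \<otimes> inv s" and sw: "s = w \<otimes> inv x" by auto
    have 1: "len x <= N + len s" using len_mult[of w "inv s"] w sc len_inv[OF sc] xw by simp
    have lp: "len (w [^] k) <= k * N"
    proof (induction k)
      case (Suc k)
      have "len (w [^] k \<otimes> w) <= len (w [^] k) + len w" by (rule len_mult) (use w in auto)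
      then show ?case using Suc w by simp
    qed (simp add: len_one)
    have "s [^] k = w [^] k \<otimes> inv (x [^] k)"
      using sw w x by (metis inv_closed nat_pow_distrib nat_pow_inv)
    then have "len (s [^] k) <= k * N + len (x [^] k)"
      using len_mult[of "w [^] k" "inv (x [^] k)"] lp len_inv[of "x [^] k"] w x by simp
    then have "k * len s <= C * (k * N + len (x [^] k))" using C s(1) by (meson mult_le_mono2 order_trans)
    moreover have "k * len x <= k * N + k * len s" using mult_le_mono2[OF 1, of k] by (simp add: algebra_simps)
    ultimately have "k * len x <= k * N + C * (k * N + len (x [^] k))" by linarith
    also have "\<dots> <= (C * N + N + C) * len (x [^] k) + (C * N + N + C) * k" by (simp add: algebra_simps)
    finally show ?thesis .
  qed
  then show ?thesis by blast
qed

end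

context group
begin

lemma generate_mlist:
  assumes "!!s. s : S ==> inv s : S" "S <= carrier G" "x : generate G S"
  shows "EX ys. set ys <= S & x = mlist ys"
  using assms(3)
proof (induction rule: generate.induct)
  case one
  show ?case by (intro exI[of _ "[]"]) simp
next
  case (incl h)
  then show ?case using assms(2) by (intro exI[of _ "[h]"]) auto
next
  case (inv h)
  then show ?case using assms(1,2) by (intro exI[of _ "[inv h]"]) auto
next
  case (eng h1 h2)
  then obtain ys zs where "set ys <= S" "h1 = mlist ys" "set zs <= S" "h2 = mlist zs" by blast
  then show ?case using mlist_append[of ys zs] assms(2) by (intro exI[of _ "ys @ zs"]) auto
qed

lemma inv_comm_cj: "g : carrier G ==> x : carrier G ==> inv (comm g x) = comm (inv g) (cj g x)"
  by (simp add: comm_def cj_def m_assoc inv_mult_group)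

end

section \<open>Bounded products of commutators\<close>

context contraction_balls
begin

lemma a_mlist: "set ys <= carrier G ==> a k (mlist ys) = mlist (map (a k) ys)"
  by (induction ys) (auto simp: a_mult mlist_closed)

text \<open>The element of \<open>T n\<close> that approximates one point also serves its
  neighbours, so \<open>unif\<close> yields one \<open>n\<close> for a whole ball.\<close>

lemma uniform_approximation:
  assumes X: "clo X" and mono: "!!m n :: nat. m <= n ==> T m <= T n" and T: "!!n. T n <= carrier G"
    and dense: "!!x. x : X ==> EX b:B (k + 1). EX n. x \<otimes> b : T n"
  shows "EX n. ALL x:X \<inter> B j. EX t:T n. inv t \<otimes> x : B k"
proof (rule unif[where j = j])
  show "X \<inter> B j <= B j" "clo (X \<inter> B j)" using X clo_Int by auto
  fix x assume x: "x : X \<inter> B j"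
  then have xc: "x : carrier G" using B_carrier by auto
  obtain b n where b: "b : B (k + 1)" "x \<otimes> b : T n" using dense[of x] x by blast
  have "EX t:T n. inv t \<otimes> (x \<otimes> c) : B k" if c: "c : B (k + 1)" for c
  proof
    have "inv b \<otimes> c : B k" by (rule B_mult[OF B_inv[OF b(1)] c])
    then show "inv (x \<otimes> b) \<otimes> (x \<otimes> c) : B k"
      using xc b c by (simp add: B_carrier inv_mult_group m_assoc)
  qed (rule b(2))
  then show "EX n l. ALL c:B l. x \<otimes> c : X \<inter> B j --> (EX t:T n. inv t \<otimes> (x \<otimes> c) : B k)" by blast
next
  show "EX t:T n. inv t \<otimes> x : B k" if "EX t:T m. inv t \<otimes> x : B k" "m <= n" for x m n
    using that mono by blast
qed

text \<open>Compactness bounds how many commutators are needed for the unit ball and how far out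
  their entries lie. The maps \<open>a k\<close> send commutators to commutators and carry both
  bounds, merged into one number \<open>n\<close>, to every scale.\<close>

lemma comm_decomposition:
  assumes X: "cn X" and P: "cas P" and dense: "X <= cl (generate G {comm g z | g z. g : P & z : X})"
  obtains n :: nat where "ALL k. ALL x:X \<inter> B k. EX ys y. length ys <= n &
    (ALL v:set ys. EX g:P \<inter> B (k - int n). EX z:X \<inter> B (k - int n). v = comm g z) &
    y : X \<inter> B (k + j) & x = mlist ys \<otimes> y"
proof -
  note Xc = cas_carrier[OF cn_cas[OF X]] and Pc = cas_carrier[OF P]
  define S where "S = {comm g z | g z. g : P & z : X}"
  define S' where "S' k = {comm g z | g z. g : P \<inter> B k & z : X \<inter> B k}" for k
  define T where "T n = {mlist ys | ys. length ys <= n & set ys <= S' (- int n)}" for n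
  have Sc: "S <= carrier G" "S' k <= S" for k using Xc Pc unfolding S_def S'_def by auto
  have SX: "S <= X"
    using cn_cj[OF X] cas_mult[OF cn_cas[OF X]] cas_inv[OF cn_cas[OF X]] Xc Pc
    unfolding S_def by (auto simp: comm_cj)
  have Tc: "T n <= carrier G" for n using Sc mlist_closed unfolding T_def by (auto, blast)
  have mlX: "mlist ys : X" if "set ys <= S" for ys
    using that SX cas_one[OF cn_cas[OF X]] cas_mult[OF cn_cas[OF X]] by (induction ys) auto
  have "EX n. ALL x:X \<inter> B 0. EX t:T n. inv t \<otimes> x : B j"
  proof (rule uniform_approximation[OF cas_clo[OF cn_cas[OF X]] _ Tc])
    fix m n :: nat assume mn: "m <= n"
    have "S' (- int m) <= S' (- int n)"
      unfolding S'_def using B_monoD[of _ "- int m" "- int n"] mn by auto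
    then show "T m <= T n" unfolding T_def using mn by fastforce
  next
    fix x assume x: "x : X"
    obtain b where b: "b : B (j + 1)" "x \<otimes> b : generate G S"
      using clE[of x "generate G S" "j + 1"] dense x unfolding S_def by blast
    have inv: "inv s : S" if sS: "s : S" for s
    proof -
      obtain g z where g: "g : P" "z : X" "s = comm g z" using sS unfolding S_def by blast
      then have "inv s = comm (inv g) (cj g z)" using Pc Xc inv_comm_cj by simp
      moreover have "inv g : P" "cj g z : X" using g cas_inv[OF P] cn_cj[OF X] Pc by auto
      ultimately show ?thesis unfolding S_def by blast
    qed
    obtain ys where ys: "set ys <= S" "x \<otimes> b = mlist ys"
      using generate_mlist[OF inv Sc(1) b(2)] by blast
    have "EX n::nat. set ys <= S' (- int n)"
      using ys(1)
    proof (induction ys)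
      case (Cons v ys)
      then obtain n :: nat where n: "set ys <= S' (- int n)" by auto
      obtain g z where g: "g : P" "z : X" "v = comm g z" using Cons.prems unfolding S_def by auto
      obtain p q :: nat where pq: "g : B (- int p)" "z : B (- int q)" using B_exh g Pc Xc by metis
      define r where "r = max n (max p q)"
      have "p <= r" "q <= r" by (simp_all add: r_def)
      then have "g : B (- int r)" "z : B (- int r)" using B_monoD[OF pq(1), of "- int r"] B_monoD[OF pq(2), of "- int r"] by simp_all
      then have "v : S' (- int r)" unfolding S'_def using g by blast
      moreover have "S' (- int n) <= S' (- int r)"
        unfolding S'_def using B_monoD[of _ "- int n" "- int r"] by (auto simp: r_def)
      ultimately show ?case using n by (intro exI[of _ r]) auto
    qed simp
    then obtain n :: nat where n: "set ys <= S' (- int n)" ..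
    define r where "r = max n (length ys)"
    have "S' (- int n) <= S' (- int r)"
      unfolding S'_def using B_monoD[of _ "- int n" "- int r"] by (auto simp: r_def)
    then have "set ys <= S' (- int r)" "length ys <= r" using n by (auto simp: r_def)
    then have "x \<otimes> b : T r" unfolding T_def ys(2) by blast
    then show "EX b:B (j + 1). EX n. x \<otimes> b : T n" using b(1) by blast
  qed
  then obtain n where n: "ALL x:X \<inter> B 0. EX t:T n. inv t \<otimes> x : B j" by blast
  show thesis
  proof (rule that, intro allI ballI)
    fix k x assume x: "x : X \<inter> B k"
    then have xc: "x : carrier G" and ax: "a (- k) x : X \<inter> B 0"
      using Xc cas_a[OF cn_cas[OF X]] a_B[of x k "- k"] by auto
    obtain t where t: "t : T n" "inv t \<otimes> a (- k) x : B j" using n ax by blast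
    obtain ys where ys: "t = mlist ys" "length ys <= n" "set ys <= S' (- int n)" using t(1) unfolding T_def by blast
    have ysS: "set ys <= S" "set ys <= carrier G" using ys(3) Sc by blast+
    have tX: "t : X" using mlX[OF ysS(1)] ys(1) by simp
    note tc = Xc[OF tX]
    define y where "y = a k (inv t \<otimes> a (- k) x)"
    have "y : X" unfolding y_def
      by (intro cas_a[OF cn_cas[OF X]] cas_mult[OF cn_cas[OF X]] cas_inv[OF cn_cas[OF X]] tX) (use x in auto)
    moreover have "y : B (k + j)" unfolding y_def by (rule a_B[OF t(2)])
    moreover have "x = mlist (map (a k) ys) \<otimes> y"
      using xc tc by (simp add: y_def a_mult a_inv flip: a_mlist[OF ysS(2)] ys(1))
    moreover have "EX g:P \<inter> B (k - int n). EX z:X \<inter> B (k - int n). v = comm g z" if v: "v : set (map (a k) ys)" for v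
    proof -
      obtain w where w: "w : set ys" "v = a k w" using v by auto
      then obtain g z where g: "g : P" "g : B (- int n)" "z : X" "z : B (- int n)" "w = comm g z"
        using ys(3) unfolding S'_def by blast
      have "v = comm (a k g) (a k z)" using w g Pc Xc a_comm by simp
      moreover have "a k g : P \<inter> B (k - int n)" "a k z : X \<inter> B (k - int n)"
        using g a_B[OF g(2), of k] a_B[OF g(4), of k] cas_a[OF P] cas_a[OF cn_cas[OF X]] by simp_all
      ultimately show ?thesis by blast
    qed
    ultimately show "EX ys y. length ys <= n &
      (ALL v:set ys. EX g:P \<inter> B (k - int n). EX z:X \<inter> B (k - int n). v = comm g z) &
      y : X \<inter> B (k + j) & x = mlist ys \<otimes> y"
      using ys(2) by (intro exI[of _ "map (a k) ys"] exI[of _ y]) simp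
  qed
qed

lemma cn_commutators:
  assumes P: "cn P" and X: "cn X"
  shows "cn (cl (generate G {comm g z | g z. g : P & z : X}))"
    and "cl (generate G {comm g z | g z. g : P & z : X}) <= X"
proof -
  define C where "C = {comm g z | g z. g : P & z : X}"
  note Xc = cas_carrier[OF cn_cas[OF X]] and Pc = cas_carrier[OF cn_cas[OF P]]
  have CX: "C <= X"
    using cn_cj[OF X] cas_mult[OF cn_cas[OF X]] cas_inv[OF cn_cas[OF X]] Xc Pc
    unfolding C_def by (auto simp: comm_cj)
  then have Cc: "C <= carrier G" using Xc by auto
  have sg: "subgroup (generate G C) G" by (rule generate_is_subgroup[OF Cc])
  have "cn (cl (generate G C))"
  proof (rule cn_cl[OF sg])
    fix x k assume x: "x : generate G C"
    show "a k x : generate G C"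
    proof (rule generate_map_subset[OF Cc a_hom sg _ x])
      fix s assume "s : C"
      then obtain g z where gz: "g : P" "z : X" "s = comm g z" unfolding C_def by blast
      then have "a k s = comm (a k g) (a k z)" using a_comm Xc Pc by simp
      moreover have "a k g : P" "a k z : X" using gz cas_a[OF cn_cas[OF X]] cas_a[OF cn_cas[OF P]] by simp_all
      ultimately show "a k s : generate G C" unfolding C_def by (intro generate.incl) blast
    qed
  next
    fix h x assume h: "h : carrier G" and x: "x : generate G C"
    show "cj h x : generate G C"
    proof (rule generate_map_subset[OF Cc cj_hom[OF h] sg _ x])
      fix s assume "s : C"
      then obtain g z where gz: "g : P" "z : X" "s = comm g z" unfolding C_def by blast
      then have "cj h s = comm (cj h g) (cj h z)" using cj_comm_distrib h Xc Pc by simp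
      moreover have "cj h g : P" "cj h z : X" using gz h cn_cj[OF X] cn_cj[OF P] by simp_all
      ultimately show "cj h s : generate G C" unfolding C_def by (intro generate.incl) blast
    qed
  qed
  moreover have "cl (generate G C) <= X"
    by (rule cl_minimal[OF cas_clo[OF cn_cas[OF X]] generate_subgroup_incl[OF CX cas_subgroup[OF cn_cas[OF X]]]])
  ultimately show "cn (cl (generate G {comm g z | g z. g : P & z : X}))"
    "cl (generate G {comm g z | g z. g : P & z : X}) <= X" unfolding C_def by auto
qed

text \<open>The equation says that \<open>y\<close> is \<open>x\<close> to the power
  \<open>(m / (m + 1)) ^ p\<close> without choosing roots. It gives \<open>y\<close> one scale more
  than \<open>x\<close>.\<close>

definition contracts :: "nat => 'a set => bool" where
  "contracts m M \<longleftrightarrow> (EX p>0. ALL k. ALL x:M. ALL y:M. y [^] ((m + 1) ^ p :: nat) = x [^] (m ^ p :: nat) --> x : B k --> y : B (k + 1))"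

lemma cas_totally_bounded:
  assumes X: "cas X"
  obtains F where "finite F" "F <= X" "ALL x:X \<inter> B j. EX f:F. EX w:X \<inter> B k. x = f \<otimes> w"
proof -
  obtain F where F: "finite F" "F <= B j" "B j <= (\<Union>f\<in>F. (%b. f \<otimes> b) ` B (k + 1))" by (rule totally_bounded)
  define F' where "F' = {f : F. EX b:B (k + 1). f \<otimes> b : X}"
  have "ALL f:F'. EX m. m : X & (EX b:B (k + 1). m = f \<otimes> b)" unfolding F'_def by blast
  from bchoice[OF this] obtain r where r: "ALL f:F'. r f : X & (EX b:B (k + 1). r f = f \<otimes> b)" ..
  show thesis
  proof (rule that)
    show "finite (r ` F')" using F(1) unfolding F'_def by simp
    show "r ` F' <= X" using r by blast
    show "ALL x:X \<inter> B j. EX f:r ` F'. EX w:X \<inter> B k. x = f \<otimes> w"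
    proof
      fix x assume "x : X \<inter> B j"
      then have x: "x : X" "x : B j" by auto
      obtain f b where f: "f : F" "b : B (k + 1)" "x = f \<otimes> b" using F(3) x(2) by blast
      have fin: "f : F'" using f x unfolding F'_def by blast
      then obtain b' where b': "r f : X" "b' : B (k + 1)" "r f = f \<otimes> b'" using r by blast
      have fc: "f : carrier G" using f F(2) B_carrier by blast
      have eq: "inv (r f) \<otimes> x = inv b' \<otimes> b" using b' f fc by (simp add: B_carrier inv_mult_group m_assoc)
      have "inv b' \<otimes> b : B k" by (rule B_mult[OF B_inv[OF b'(2)] f(2)])
      then have "inv (r f) \<otimes> x : X \<inter> B k" using eq cas_mult[OF X cas_inv[OF X b'(1)] x(1)] by simp
      moreover have "x = r f \<otimes> (inv (r f) \<otimes> x)" using b'(1) x(1) cas_carrier[OF X] by simp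
      ultimately show "EX f:r ` F'. EX w:X \<inter> B k. x = f \<otimes> w" using fin by blast
    qed
  qed
qed

lemma B_pow: "x : B k ==> x [^] (n::nat) : B (k - int n)"
proof (induction n)
  case (Suc n)
  then show ?case using B_mult'[of "x [^] n" "k - int n" x k "k - int (Suc n)"] by simp
qed simp

lemma pow_cont: "EX j. ALL x:X \<inter> B j. x [^] (n::nat) : B k"
proof (intro exI ballI)
  fix x assume "x : X \<inter> B (k + int n)"
  then show "x [^] n : B k" using B_pow[of x "k + int n" n] by simp
qed

lemma mlist_B: "set ys <= B k ==> mlist ys : B (k - int (length ys))"
proof (induction ys)
  case (Cons y ys)
  then show ?case using B_mult'[of y k "mlist ys" "k - int (length ys)" "k - int (length (y # ys))"] by simp
qed simp

end

section \<open>Minimal subgroups with full core\<close>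

locale npo_minimal = minimal_sin +
  assumes core_full: "core M = M"
begin

text \<open>Every ball generates \<open>M\<close>; compactness bounds the number of factors needed
  for the unit ball, and rescaling makes the bound independent of \<open>k\<close>.\<close>

lemma ball_products:
  obtains q :: nat where "ALL k. ALL x:M \<inter> B k. EX ys. length ys <= q & set ys <= M \<inter> B (k + j) & x = mlist ys"
proof -
  define S where "S = M \<inter> B j"
  define T where "T n = {mlist ys | ys. length ys <= n & set ys <= S}" for n
  have Sc: "S <= carrier G" using M_carrier by (auto simp: S_def)
  have mlM: "mlist ys : M" if "set ys <= S" for ys
    using that M_one M_mult by (induction ys) (auto simp: S_def)
  have Tc: "T n <= carrier G" for n using mlM M_carrier unfolding T_def by auto
  have "EX n. ALL x:M \<inter> B 0. EX t:T n. inv t \<otimes> x : B j"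
  proof (rule uniform_approximation[OF cas_clo[OF casM] _ Tc])
    show "T m <= T n" if "m <= n" for m n unfolding T_def using that by fastforce
    fix x assume x: "x : M"
    then have "x : generate G S" using core_full core_iff unfolding S_def by blast
    then obtain ys where ys: "set ys <= S" "x = mlist ys"
      using generate_mlist[of S x] Sc M_inv B_inv unfolding S_def by blast
    then have "x \<otimes> \<one> : T (length ys)" using M_carrier[OF x] unfolding T_def by auto
    then show "EX b:B (j + 1). EX n. x \<otimes> b : T n" by (intro bexI[of _ \<one>]) auto
  qed
  then obtain n where n: "ALL x:M \<inter> B 0. EX t:T n. inv t \<otimes> x : B j" by blast
  show thesis
  proof (rule that, intro allI ballI)
    fix k x assume x: "x : M \<inter> B k"
    then have xc: "x : carrier G" and ax: "a (- k) x : M \<inter> B 0"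
      using M_carrier M_a a_B[of x k "- k"] by auto
    obtain t where t: "t : T n" "inv t \<otimes> a (- k) x : B j" using n ax by blast
    obtain ys where ys: "t = mlist ys" "length ys <= n" "set ys <= S" using t(1) unfolding T_def by blast
    have tM: "t : M" using mlM ys by simp
    note tc = M_carrier[OF tM]
    define y where "y = inv t \<otimes> a (- k) x"
    have y: "y : S" using t ax tM M_mult M_inv by (simp add: S_def y_def)
    have ysc: "set (ys @ [y]) <= carrier G" using ys y Sc by auto
    have "a (- k) x = mlist (ys @ [y])"
      using mlist_append[of ys "[y]"] ysc ys(1) tc xc by (simp add: y_def)
    from arg_cong[OF this, of "a k"] have "x = mlist (map (a k) (ys @ [y]))"
      using xc a_mlist[OF ysc] by simp
    moreover have "set (map (a k) (ys @ [y])) <= M \<inter> B (k + j)"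
      using ys(3) y M_a a_B[of _ j k] unfolding S_def by auto
    ultimately show "EX ys. length ys <= n + 1 & set ys <= M \<inter> B (k + j) & x = mlist ys"
      using ys(2) by (intro exI[of _ "map (a k) (ys @ [y])"]) simp
  qed
qed

lemma M_Y: "x : M ==> x : B (k + c) ==> x : Y k"
  using M_sin by blast

lemma unbounded: "EX x:M. x ~: B j"
proof (rule ccontr)
  assume no: "~ ?thesis"
  have "x = \<one>" if x: "x : M" for x
  proof (rule B_sep[OF M_carrier[OF x]])
    fix n :: nat
    have "a (j - int n) x : B j" using no M_a[OF x] by blast
    then show "x : B (int n)" using a_B_iff[OF M_carrier[OF x]] by simp
  qed
  then show False using M_nontriv M_one by blast
qed

lemma group_M: "group (G\<lparr>carrier := M\<rparr>)"
  by (rule subgroup_imp_group[OF subgroupM])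

lemma inv_M: "x : M ==> inv\<^bsub>G\<lparr>carrier := M\<rparr>\<^esub> x = inv x"
  using m_inv_consistent[OF subgroupM] by simp

lemma cj_M: "x : M ==> group.cj (G\<lparr>carrier := M\<rparr>) x y = cj x y"
  and comm_M: "x : M ==> y : M ==> group.comm (G\<lparr>carrier := M\<rparr>) x y = comm x y"
  using inv_M by (simp_all add: group.cj_def[OF group_M] group.comm_def[OF group_M] cj_def comm_def)

lemma mlist_M: "monoid.mlist (G\<lparr>carrier := M\<rparr>) ys = mlist ys"
  by (simp add: monoid.mlist_def[OF group.is_monoid[OF group_M]] mlist_def)

lemma sin_group_M: "sin_group (G\<lparr>carrier := M\<rparr>) (%k. M \<inter> Y k)"
proof (rule sin_group.intro[OF group_M], rule sin_group_axioms.intro)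
  fix x k assume "x : M \<inter> Y k"
  then show "x : carrier (G\<lparr>carrier := M\<rparr>)" "inv\<^bsub>G\<lparr>carrier := M\<rparr>\<^esub> x : M \<inter> Y k"
    using M_inv Y_inv by (simp_all add: inv_M)
next
  fix k show "\<one>\<^bsub>G\<lparr>carrier := M\<rparr>\<^esub> : M \<inter> Y k" using M_one by (simp add: Y_def)
next
  fix g x k assume "g : carrier (G\<lparr>carrier := M\<rparr>)" "x : M \<inter> Y k"
  then show "group.cj (G\<lparr>carrier := M\<rparr>) g x : M \<inter> Y k"
    using M_cj Y_cj M_carrier by (simp add: cj_M)
next
  fix x y z k assume "x : M \<inter> Y (k + 1)" "y : M \<inter> Y (k + 1)" "z : M \<inter> Y (k + 1)"
  then show "x \<otimes>\<^bsub>G\<lparr>carrier := M\<rparr>\<^esub> y \<otimes>\<^bsub>G\<lparr>carrier := M\<rparr>\<^esub> z : M \<inter> Y k"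
    using M_mult Y_cube by simp
next
  fix x assume "x : carrier (G\<lparr>carrier := M\<rparr>)"
  then have x: "x : M" by simp
  obtain n :: nat where "x : B (- int n)" using B_exh[OF M_carrier[OF x]] .
  then have "x : B (- int (n + nat c) + c)" using B_monoD by simp
  then show "EX n::nat. x : M \<inter> Y (- int n)" using M_Y[OF x] x by blast
next
  fix j k
  obtain F where F: "finite F" "F <= M" "ALL x:M \<inter> B j. EX f:F. EX w:M \<inter> B (k + c). x = f \<otimes> w"
    by (rule cas_totally_bounded[OF casM])
  have "M \<inter> Y j <= (\<Union>f\<in>F. (%z. f \<otimes>\<^bsub>G\<lparr>carrier := M\<rparr>\<^esub> z) ` (M \<inter> Y k))"
  proof
    fix x assume "x : M \<inter> Y j"
    then have "x : M \<inter> B j" using Y_B by auto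
    then obtain f w where "f : F" "w : M \<inter> B (k + c)" "x = f \<otimes> w" using F(3) by blast
    then show "x : (\<Union>f\<in>F. (%z. f \<otimes>\<^bsub>G\<lparr>carrier := M\<rparr>\<^esub> z) ` (M \<inter> Y k))" using M_Y by auto
  qed
  then show "EX F. finite F & F <= carrier (G\<lparr>carrier := M\<rparr>) &
      M \<inter> Y j <= (\<Union>f\<in>F. (%z. f \<otimes>\<^bsub>G\<lparr>carrier := M\<rparr>\<^esub> z) ` (M \<inter> Y k))"
    using F(1,2) by auto
qed

text \<open>By minimality the closure of the commutator subgroup is trivial or \<open>M\<close>. In
  the second case the invariant balls of \<open>M\<close> would satisfy all hypotheses of
  \<open>not_perfect\<close>.\<close>

lemma M_commute: assumes xy: "x : M" "y : M" shows "x \<otimes> y = y \<otimes> x"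
proof -
  define C where "C = {comm g z | g z. g : M & z : M}"
  have Cc: "C <= carrier G" using M_carrier unfolding C_def by auto
  have sg: "subgroup (generate G C) G" by (rule generate_is_subgroup[OF Cc])
  have "cn (cl (generate G C))" "cl (generate G C) <= M"
    unfolding C_def by (rule cn_commutators[OF cnM cnM])+
  then consider "cl (generate G C) = {\<one>}" | "cl (generate G C) = M" using M_min by blast
  then show ?thesis
  proof cases
    case 1
    have "comm x y : generate G C" using xy unfolding C_def by (intro generate.incl) blast
    then have "comm x y = \<one>" using cl_superset[OF subgroup.subset[OF sg]] 1 by blast
    then show ?thesis using comm_one_iff xy M_carrier by simp
  next
    case 2
    interpret S: sin_group "G\<lparr>carrier := M\<rparr>" "%k. M \<inter> Y k" by (rule sin_group_M)
    \<comment> \<open>The shift \<open>1 + c\<close> pays for the passage from balls to invariant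
      balls: a remainder in \<open>B (k + (1 + c))\<close> belongs to
      \<open>Y (k + 1)\<close>.\<close>
    obtain L :: nat where L: "ALL k. ALL x:M \<inter> B k. EX ys y. length ys <= L &
      (ALL v:set ys. EX g:M \<inter> B (k - int L). EX z:M \<inter> B (k - int L). v = comm g z) &
      y : M \<inter> B (k + (1 + c)) & x = mlist ys \<otimes> y"
      by (rule comm_decomposition[OF cnM casM, where j = "1 + c"]) (use 2 in \<open>auto simp: C_def\<close>)
    obtain q where q: "ALL k. ALL x:M \<inter> B k. EX ys. length ys <= q & set ys <= M \<inter> B (k + (1 + c)) & x = mlist ys"
      by (rule ball_products)
    have False
    proof (rule S.not_perfect[where q = q and L = L and C = "L + nat c"])
      show "ALL j. EX x:carrier (G\<lparr>carrier := M\<rparr>). x ~: M \<inter> Y j" using unbounded Y_B by fastforce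
      show "ALL k. ALL x:M \<inter> Y (k - 1). EX ys. length ys <= q & set ys <= M \<inter> Y k & x = S.mlist ys"
      proof (intro allI ballI)
        fix k x assume "x : M \<inter> Y (k - 1)"
        then have "x : M \<inter> B (k - 1)" using Y_B by auto
        then obtain ys where ys: "length ys <= q" "set ys <= M \<inter> B (k - 1 + (1 + c))" "x = mlist ys" using q by blast
        have "set ys <= M \<inter> Y k" using ys(2) M_Y by auto
        then show "EX ys. length ys <= q & set ys <= M \<inter> Y k & x = S.mlist ys" using ys mlist_M by auto
      qed
      show "ALL k. ALL x:M \<inter> Y k. EX ys y. length ys <= L &
          (ALL v:set ys. EX a:M \<inter> Y (k - int (L + nat c)). EX b:M \<inter> Y (k - int (L + nat c)). v = S.comm a b) &
          y : M \<inter> Y (k + 1) & x = S.mlist ys \<otimes>\<^bsub>G\<lparr>carrier := M\<rparr>\<^esub> y"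
      proof (intro allI ballI)
        fix k x assume "x : M \<inter> Y k"
        then have "x : M \<inter> B k" using Y_B by auto
        then obtain ys y where ys: "length ys <= L"
          "ALL v:set ys. EX g:M \<inter> B (k - int L). EX z:M \<inter> B (k - int L). v = comm g z"
          "y : M \<inter> B (k + (1 + c))" "x = mlist ys \<otimes> y" using L by blast
        have in_Y: "z : M \<inter> Y (k - int (L + nat c))" if "z : M \<inter> B (k - int L)" for z
          using M_Y[of z "k - int (L + nat c)"] B_monoD[of z "k - int L" "k - int (L + nat c) + c"] that by auto
        have "EX a:M \<inter> Y (k - int (L + nat c)). EX b:M \<inter> Y (k - int (L + nat c)). v = S.comm a b"
          if v: "v : set ys" for v
        proof -
          obtain g z where g: "g : M \<inter> B (k - int L)" "z : M \<inter> B (k - int L)" "v = comm g z" using ys(2) v by blast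
          have "v = S.comm g z" using g comm_M by simp
          then show ?thesis using in_Y[OF g(1)] in_Y[OF g(2)] by blast
        qed
        moreover have "y : M \<inter> Y (k + 1)" using ys(3) M_Y[of y "k + 1"] by (simp add: add.assoc)
        ultimately show "EX ys y. length ys <= L &
          (ALL v:set ys. EX a:M \<inter> Y (k - int (L + nat c)). EX b:M \<inter> Y (k - int (L + nat c)). v = S.comm a b) &
          y : M \<inter> Y (k + 1) & x = S.mlist ys \<otimes>\<^bsub>G\<lparr>carrier := M\<rparr>\<^esub> y"
          using ys(1,4) mlist_M by (intro exI[of _ ys] exI[of _ y]) simp
      qed
    qed
    then show ?thesis ..
  qed
qed

end

section \<open>Rational powers on minimal subgroups\<close>

text \<open>Bernoulli's inequality for \<open>(1 + 1 / m) ^ n\<close>, cleared of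
  denominators.\<close>

lemma power_ratio_bound: "m ^ n * (m + n) <= m * (m + 1) ^ n" for m n :: nat
proof (induction n)
  case (Suc n)
  have "m ^ Suc n * (m + Suc n) = m * (m ^ n * (m + n)) + m * m ^ n" by (simp add: algebra_simps)
  also have "\<dots> <= m * (m * (m + 1) ^ n) + m * (m + 1) ^ n"
    by (intro add_mono mult_le_mono2 Suc power_mono) auto
  also have "\<dots> = m * (m + 1) ^ Suc n" by (simp add: algebra_simps)
  finally show ?case .
qed simp

lemma power_ratio_eventually: "EX n0. ALL n>=n0. D * m ^ n <= (m + 1) ^ n" for m D :: nat
proof (cases "m = 0")
  case True
  then show ?thesis by (intro exI[of _ 1]) (auto simp: power_0_left)
next
  case False
  have "D * m ^ n <= (m + 1) ^ n" if "n >= D * m" for n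
  proof -
    have "m * (D * m ^ n) = m ^ n * (D * m)" by simp
    also have "\<dots> <= m ^ n * (m + n)" using that by (intro mult_le_mono2) simp
    also have "\<dots> <= m * (m + 1) ^ n" by (rule power_ratio_bound)
    finally show ?thesis using False by simp
  qed
  then show ?thesis by blast
qed

context npo_minimal
begin

text \<open>The word length for the generating set \<open>M \<inter> B 0\<close>; every element of
  \<open>M\<close> has a word because the core is full.\<close>

definition len :: "'a => nat" where
  "len x = (LEAST n. EX ys. length ys = n & set ys <= M \<inter> B 0 & x = mlist ys)"

lemma len_le: "set ys <= M \<inter> B 0 ==> len (mlist ys) <= length ys"
  unfolding len_def by (rule Least_le) blast

lemma len_ex: assumes "x : M" obtains ys where "length ys = len x" "set ys <= M \<inter> B 0" "x = mlist ys"
proof -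
  have "x : generate G (M \<inter> B 0)" using core_full core_iff assms by blast
  then have "EX ys. set ys <= M \<inter> B 0 & x = mlist ys"
    by (rule generate_mlist[rotated 2]) (use M_inv B_inv B_carrier in auto)
  then obtain ys0 where "set ys0 <= M \<inter> B 0" "x = mlist ys0" by blast
  then have "EX ys. length ys = length ys0 & set ys <= M \<inter> B 0 & x = mlist ys" by blast
  then have "EX ys. length ys = len x & set ys <= M \<inter> B 0 & x = mlist ys"
    unfolding len_def by (rule LeastI[where P = "%n. EX ys. length ys = n & set ys <= M \<inter> B 0 & x = mlist ys"])
  then show thesis using that by blast
qed

lemma len_one': "len \<one> = 0"
  using len_le[of "[]"] by simp

lemma len_mult': assumes "x : M" "y : M" shows "len (x \<otimes> y) <= len x + len y"
proof -
  obtain xs where xs: "length xs = len x" "set xs <= M \<inter> B 0" "x = mlist xs" using len_ex[OF assms(1)] .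
  obtain ys where ys: "length ys = len y" "set ys <= M \<inter> B 0" "y = mlist ys" using len_ex[OF assms(2)] .
  have "x \<otimes> y = mlist (xs @ ys)" using xs ys B_sub[of 0] by (simp add: mlist_append[of xs ys] subset_iff)
  then show ?thesis using len_le[of "xs @ ys"] xs ys by simp
qed

lemma mlist_inv_set:
  "set ys <= M \<inter> B 0 ==> EX zs. length zs = length ys & set zs <= M \<inter> B 0 & inv (mlist ys) = mlist zs"
proof (induction ys)
  case (Cons y ys)
  then obtain zs where zs: "length zs = length ys" "set zs <= M \<inter> B 0" "inv (mlist ys) = mlist zs" by auto
  have y: "y : M" "y : B 0" "y : carrier G" using Cons.prems M_carrier by auto
  have zc: "set zs <= carrier G" "set ys <= carrier G" using zs(2) Cons.prems M_carrier by auto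
  have "inv (mlist (y # ys)) = mlist (zs @ [inv y])"
    using zs y mlist_closed[OF zc(2)] mlist_append[of zs "[inv y]"] zc by (simp add: inv_mult_group)
  then show ?case using zs y M_inv B_inv by (intro exI[of _ "zs @ [inv y]"]) simp
qed simp

lemma len_inv_le: assumes "x : M" shows "len (inv x) <= len x"
proof -
  obtain ys where ys: "length ys = len x" "set ys <= M \<inter> B 0" "x = mlist ys" using len_ex[OF assms] .
  obtain zs where "length zs = length ys" "set zs <= M \<inter> B 0" "inv (mlist ys) = mlist zs"
    using mlist_inv_set[OF ys(2)] by blast
  then show ?thesis using len_le[of zs] ys by simp
qed

lemma len_B: assumes "x : M" "len x <= n" shows "x : B (- int n)"
proof -
  obtain ys where ys: "length ys = len x" "set ys <= M \<inter> B 0" "x = mlist ys" using len_ex[OF assms(1)] .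
  have "x : B (- int (len x))" using mlist_B[of ys 0] ys by simp
  then show ?thesis by (rule B_monoD) (use assms in simp)
qed

lemma len_bounded: "EX q. ALL x:M \<inter> B j. len x <= q"
proof -
  obtain q :: nat where q: "ALL k. ALL x:M \<inter> B k. EX ys. length ys <= q & set ys <= M \<inter> B (k + (- j)) & x = mlist ys"
    by (rule ball_products)
  have "len x <= q" if x: "x : M \<inter> B j" for x
  proof -
    obtain ys where "length ys <= q" "set ys <= M \<inter> B (j + (- j))" "x = mlist ys" using q x by blast
    then show ?thesis using len_le[of ys] by simp
  qed
  then show ?thesis by blast
qed

lemma comm_group_M: "comm_group (G\<lparr>carrier := M\<rparr>)"
  by (rule group.group_comm_groupI[OF group_M]) (use M_commute in simp)

text \<open>A product of two elements of \<open>M \<inter> B 0\<close> lies in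
  \<open>B (-1)\<close>, which finitely many translates of \<open>M \<inter> B 0\<close> cover.
  Processing a word letter by letter thus trades each letter for one of finitely many
  \<open>f\<close> and keeps a single short factor, as \<open>comm_group_length\<close>
  demands.\<close>

lemma M_linear_growth: "EX C. ALL x:M. ALL k::nat. k * len x <= C * len (x [^] k) + C * k"
proof -
  interpret A: comm_group "G\<lparr>carrier := M\<rparr>" by (rule comm_group_M)
  obtain F where F: "finite F" "F <= M" "ALL x:M \<inter> B (-1). EX f:F. EX w:M \<inter> B 0. x = f \<otimes> w"
    by (rule cas_totally_bounded[OF casM])
  have pow: "x [^] (n::nat) = x [^]\<^bsub>G\<lparr>carrier := M\<rparr>\<^esub> n" for x n
    by (rule nat_pow_consistent)
  define P where "P c = finprod (G\<lparr>carrier := M\<rparr>) (%f. f [^]\<^bsub>G\<lparr>carrier := M\<rparr>\<^esub> (c f :: nat)) F" for c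
  have dec: "EX w:M \<inter> B 0. EX c. (\<Sum>f\<in>F. c f) <= length ys & mlist ys = w \<otimes> P c" if "set ys <= M \<inter> B 0" for ys
    using that
  proof (induction ys)
    case Nil
    have "P (%_. 0) = \<one>" unfolding P_def using A.finprod_one_eqI[of F "%f. f [^]\<^bsub>G\<lparr>carrier := M\<rparr>\<^esub> (0::nat)"] by simp
    then show ?case using M_one by (intro bexI[of _ \<one>] exI[of _ "%_. 0"]) auto
  next
    case (Cons v ys)
    then obtain w c where w: "w : M \<inter> B 0" "(\<Sum>f\<in>F. c f) <= length ys" "mlist ys = w \<otimes> P c" by auto
    have vM: "v : M" "v : B 0" using Cons.prems by auto
    have "v \<otimes> w : M \<inter> B (-1)" using vM w(1) M_mult B_mult'[of v 0 w 0 "-1"] by simp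
    then obtain f u where f: "f : F" "u : M \<inter> B 0" "v \<otimes> w = f \<otimes> u" using F(3) by blast
    define c' where "c' g = c g + (if f = g then 1 else 0)" for g
    have PM: "P c : M" for c
      using A.finprod_closed[of "%f. f [^]\<^bsub>G\<lparr>carrier := M\<rparr>\<^esub> (c f :: nat)" F] F(2) M_pow
      unfolding P_def by (auto simp: pow[symmetric])
    have "P c' = finprod (G\<lparr>carrier := M\<rparr>) (%g. g [^]\<^bsub>G\<lparr>carrier := M\<rparr>\<^esub> (c g) \<otimes>\<^bsub>G\<lparr>carrier := M\<rparr>\<^esub>
        (if f = g then g else \<one>\<^bsub>G\<lparr>carrier := M\<rparr>\<^esub>)) F"
      unfolding P_def
      by (rule A.finprod_cong') (use F(2) M_pow M_carrier M_one M_mult in \<open>auto simp: c'_def pow[symmetric]\<close>)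
    also have "\<dots> = P c \<otimes> f"
    proof -
      have "finprod (G\<lparr>carrier := M\<rparr>) (%g. if f = g then g else \<one>\<^bsub>G\<lparr>carrier := M\<rparr>\<^esub>) F = f"
        by (rule A.finprod_singleton[OF f(1) F(1), of "%g. g"]) (use F(2) in auto)
      then show ?thesis
        unfolding P_def using F(2) M_pow M_one
        by (subst A.finprod_multf) (auto simp: pow[symmetric])
    qed
    finally have Pc': "P c' = P c \<otimes> f" .
    have fM: "f : M" and uM: "u : M" and wM: "w : M" using f F(2) w(1) by auto
    note cc = M_carrier[OF fM] M_carrier[OF uM] M_carrier[OF wM] M_carrier[OF PM[of c]] M_carrier[OF vM(1)]
    have "mlist (v # ys) = f \<otimes> u \<otimes> P c" using w(3) f(3) cc by (simp add: m_assoc flip: f(3))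
    also have "\<dots> = u \<otimes> P c \<otimes> f" using M_commute[OF fM M_mult[OF uM PM[of c]]] cc by (simp add: m_assoc)
    also have "\<dots> = u \<otimes> P c'" using Pc' cc by (simp add: m_assoc)
    finally have "mlist (v # ys) = u \<otimes> P c'" .
    moreover have "(\<Sum>f\<in>F. c' f) <= length (v # ys)"
      using w(2) F(1) f(1) by (simp add: c'_def sum.distrib)
    ultimately show ?case using f(2) by blast
  qed
  interpret L: comm_group_length "G\<lparr>carrier := M\<rparr>" len F
  proof (unfold_locales)
    show "len \<one>\<^bsub>G\<lparr>carrier := M\<rparr>\<^esub> = 0" using len_one' by simp
    show "len (x \<otimes>\<^bsub>G\<lparr>carrier := M\<rparr>\<^esub> y) <= len x + len y"
      if "x : carrier (G\<lparr>carrier := M\<rparr>)" "y : carrier (G\<lparr>carrier := M\<rparr>)" for x y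
      using that len_mult' by simp
    show "len (inv\<^bsub>G\<lparr>carrier := M\<rparr>\<^esub> x) = len x" if "x : carrier (G\<lparr>carrier := M\<rparr>)" for x
      using that len_inv_le[of x] len_inv_le[of "inv x"] M_inv M_carrier by (simp add: inv_M le_antisym)
    show "finite F" "F <= carrier (G\<lparr>carrier := M\<rparr>)" using F by auto
    fix x assume "x : carrier (G\<lparr>carrier := M\<rparr>)"
    then have "x : M" by simp
    from len_ex[OF this] obtain ys where ys: "length ys = len x" "set ys <= M \<inter> B 0" "x = mlist ys" .
    obtain w c where wc: "w : M \<inter> B 0" "(\<Sum>f\<in>F. c f) <= length ys" "mlist ys = w \<otimes> P c" using dec[OF ys(2)] by blast
    have "len w <= 1" using len_le[of "[w]"] wc(1) M_carrier by simp
    then show "EX w:carrier (G\<lparr>carrier := M\<rparr>). EX c. len w <= 1 & (\<Sum>f\<in>F. c f) <= len x &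
      x = w \<otimes>\<^bsub>G\<lparr>carrier := M\<rparr>\<^esub> finprod (G\<lparr>carrier := M\<rparr>) (%f. f [^]\<^bsub>G\<lparr>carrier := M\<rparr>\<^esub> (c f :: nat)) F"
      using wc ys unfolding P_def by (intro bexI[of _ w] exI[of _ c]) auto
  qed
  show ?thesis using L.linear_growth by (simp add: pow)
qed

lemma M_contracts: "contracts m M"
proof -
  obtain C where C: "ALL x:M. ALL k::nat. k * len x <= C * len (x [^] k) + C * k" using M_linear_growth by blast
  obtain q where q: "ALL x:M \<inter> B (- int (C + 2)). len x <= q" using len_bounded by blast
  obtain n0 where n0: "ALL n>=n0. (C * q) * m ^ n <= (m + 1) ^ n" using power_ratio_eventually by blast
  define p where "p = Suc n0"
  have "y : B (k + 1)" if xy: "x : M" "y : M" "y [^] ((m + 1) ^ p) = x [^] (m ^ p)" "x : B k" for k x y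
  proof -
    \<comment> \<open>The growth estimate can only bound the length of \<open>a t y\<close> by
      \<open>C + 1\<close>, because of its additive term. So \<open>x\<close> is first moved to
      \<open>B (- int (C + 2))\<close>, where this conclusion is a gain of one scale.\<close>
    define t where "t = - (k + int (C + 2))"
    note xc = M_carrier[OF xy(1)] and yc = M_carrier[OF xy(2)]
    have xM: "a t x : M" "a t y : M" using xy M_a by auto
    have eq: "a t y [^] ((m + 1) ^ p) = a t x [^] (m ^ p)" using xy(3) a_pow[OF yc, of t "(m + 1) ^ p"] a_pow[OF xc, of t "m ^ p"] by simp
    have lx: "len (a t x) <= q" using q xM(1) a_B[OF xy(4), of t] by (simp add: t_def)
    have lp: "len (a t x [^] i) <= i * len (a t x)" for i :: nat
    proof (induction i)
      case (Suc i)
      have "len (a t x [^] i \<otimes> a t x) <= len (a t x [^] i) + len (a t x)" by (rule len_mult'[OF M_pow[OF xM(1)] xM(1)])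
      then show ?case using Suc by simp
    qed (simp add: len_one')
    have "(m + 1) ^ p * len (a t y) <= C * len (a t y [^] ((m + 1) ^ p)) + C * (m + 1) ^ p" using C xM(2) by blast
    also have "\<dots> = C * len (a t x [^] (m ^ p)) + C * (m + 1) ^ p" by (simp only: eq)
    also have "\<dots> <= C * (m ^ p * q) + C * (m + 1) ^ p"
    proof -
      have "len (a t x [^] (m ^ p)) <= m ^ p * q"
        by (rule order_trans[OF lp]) (use lx in \<open>simp add: mult_le_mono2\<close>)
      then show ?thesis by (simp add: mult_le_mono2)
    qed
    also have "\<dots> <= (m + 1) ^ p + C * (m + 1) ^ p"
    proof -
      have "C * q * m ^ p <= (m + 1) ^ p" using n0[rule_format, of p] by (simp add: p_def)
      then show ?thesis by (simp add: mult_ac)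
    qed
    also have "\<dots> = (m + 1) ^ p * (C + 1)" by (simp add: algebra_simps)
    finally have "len (a t y) <= C + 1" by (simp only: mult_le_cancel1) simp
    then have "a t y : B (- int (C + 1))" using len_B xM(2) by blast
    then have "y : B (- int (C + 1) - t)" using a_B_iff[OF yc] by blast
    then show "y : B (k + 1)" by (simp add: t_def add.commute)
  qed
  then show ?thesis unfolding contracts_def by (intro exI[of _ p]) (auto simp: p_def)
qed

end

context minimal_sin
begin

text \<open>On the abelian \<open>M\<close> the power map is an equivariant homomorphism, so its
  kernel is closed and stable by \<open>equivariant_proper\<close>.\<close>

lemma cn_torsion:
  assumes ab: "!!x y. x : M ==> y : M ==> x \<otimes> y = y \<otimes> x"
  shows "cn {x : M. x [^] (n::nat) = \<one>}"
proof -
  interpret PP: contraction_balls_pair G a K G a K by unfold_locales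
  have pm: "(x \<otimes> y) [^] n = x [^] n \<otimes> y [^] n" if "x : M" "y : M" for x y
    using pow_mult_distrib[OF ab[OF that]] that M_carrier by blast
  have "cas {x : M. x [^] n = \<one>}"
    by (rule PP.equivariant_proper(1)[OF casM _ pm pow_cont]) (use M_carrier a_pow in auto)
  moreover have "cj g x [^] n = \<one>" if "g : carrier G" "x : M" "x [^] n = \<one>" for g x
    using cj_pow[OF that(1) M_carrier[OF that(2)], of n] that by (simp add: cj_def)
  ultimately show ?thesis unfolding cn_def using M_cj by blast
qed

lemma exponent_or_torsion_free:
  assumes ab: "!!x y. x : M ==> y : M ==> x \<otimes> y = y \<otimes> x"
  shows "(EX e>0. ALL x:M. x [^] (e::nat) = \<one>) | (ALL x:M. ALL n>0. x [^] (n::nat) = \<one> --> x = \<one>)"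
proof (cases "EX n>0. {x : M. x [^] (n::nat) = \<one>} = M")
  case True
  then show ?thesis by blast
next
  case False
  then have "{x : M. x [^] n = \<one>} = {\<one>}" if "n > 0" for n :: nat
    using M_min[OF cn_torsion[OF ab], of n] that by blast
  then show ?thesis by blast
qed

end

context td_minimal
begin

text \<open>The quotient of \<open>V 0\<close> by \<open>V 1\<close> is finite with
  \<open>card D\<close> elements, so the factorial annihilates it; rescaling transports this to
  level \<open>k\<close>.\<close>

lemma V_pow: assumes ab: "!!x y. x : M ==> y : M ==> x \<otimes> y = y \<otimes> x"
  and x: "x : V k" shows "x [^] (fact (card D) :: nat) : V (k + 1)"
proof -
  define v where "v = a (- k) x"
  have v: "v : V 0" "v : carrier G" using V_a[OF x, of "- k"] V_carrier unfolding v_def by auto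
  have vp: "v [^] (i::nat) : V 0" for i using v V_mult V_one by (induction i) auto
  have "~ inj_on (%i::nat. V 1 #> v [^] i) {..card D}"
  proof
    assume inj: "inj_on (%i::nat. V 1 #> v [^] i) {..card D}"
    have "(%i::nat. V 1 #> v [^] i) ` {..card D} <= D" using vp unfolding D_def by blast
    from card_inj_on_le[OF inj this finite_D] show False by simp
  qed
  then obtain i j :: nat where ij: "i < j" "j <= card D" "V 1 #> v [^] j = V 1 #> v [^] i"
    unfolding inj_on_def by (metis atMost_iff linorder_neqE_nat)
  have "v [^] j \<otimes> inv (v [^] i) : V 1" using ij(3) V1_coset_eq[of "v [^] j" "v [^] i"] v(2) by simp
  moreover have "v [^] j = v [^] (j - i) \<otimes> v [^] i" using nat_pow_mult[OF v(2), of "j - i" i] ij(1) by simp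
  ultimately have 1: "v [^] (j - i) : V 1" using v(2) by (simp add: m_assoc)
  have "(j - i) dvd fact (card D)" by (rule dvd_fact) (use ij in auto)
  then obtain r where r: "fact (card D) = (j - i) * r" by (auto elim: dvdE)
  have "(v [^] (j - i)) [^] r : V 1" using 1 V_mult V_one by (induction r) auto
  then have "v [^] (fact (card D) :: nat) : V 1" using v(2) by (simp add: nat_pow_pow r)
  from V_a[OF this, of k] show ?thesis
    using a_pow[OF v(2), of k "fact (card D)"] V_carrier[OF x] by (simp add: v_def)
qed

text \<open>Raising to the power \<open>m\<close> gains a level, while \<open>(m + 1) ^ p\<close> is
  1 modulo \<open>m\<close>. So \<open>y\<close> times a power of itself that is one level deeper
  lies as deep as \<open>x [^] (m ^ p)\<close>, and \<open>y\<close> descends to that depth level by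
  level.\<close>

lemma V_contracts: assumes ab: "!!x y. x : M ==> y : M ==> x \<otimes> y = y \<otimes> x"
  and m: "fact (card D) dvd m" shows "contracts m M"
proof -
  obtain r where r: "m = fact (card D) * r" using m by (auto elim: dvdE)
  have Vm: "x [^] (m * s) : V (i + 1)" if "x : V i" for x i and s :: nat
  proof -
    have "y [^] (j::nat) : V (i + 1)" if "y : V (i + 1)" for y j
      using that V_mult V_one by (induction j) auto
    then have "(x [^] (fact (card D) :: nat)) [^] (r * s) : V (i + 1)" using V_pow[OF ab that] by blast
    then show ?thesis using V_carrier[OF that] by (simp add: nat_pow_pow r mult.assoc)
  qed
  have Vmp: "x [^] (m ^ p) : V (i + int p)" if x: "x : V i" for x i and p :: nat
  proof (induction p)
    case (Suc p)
    have "(x [^] (m ^ p)) [^] (m * 1) : V (i + int p + 1)" by (rule Vm[OF Suc])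
    then show ?case using V_carrier[OF x] by (simp add: nat_pow_pow algebra_simps)
  qed (use x V_carrier in simp)
  \<comment> \<open>The \<open>p\<close> levels gained by \<open>x [^] (m ^ p)\<close> must outweigh
    the loss \<open>n + c\<close> between balls and the subgroups \<open>V\<close> and leave one
    scale over.\<close>
  define p where "p = Suc (nat (n + c + 1))"
  have "EX s. (m + 1) ^ p = m * s + 1"
  proof (induction p)
    case (Suc p)
    then obtain s where s: "(m + 1) ^ p = m * s + 1" ..
    have "(m + 1) ^ Suc p = m * ((m + 1) * s + 1) + 1" unfolding power_Suc s by (simp add: algebra_simps)
    then show ?case ..
  qed simp
  then obtain s where s: "(m + 1) ^ p = m * s + 1" ..
  have "y : B (k + 1)" if xy: "x : M" "y : M" "y [^] ((m + 1) ^ p) = x [^] (m ^ p)" "x : B k" for k x y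
  proof -
    have yc: "y : carrier G" using M_carrier xy(2) by blast
    have "x : V (k - n - c)" using V_open[OF xy(1), of "k - n - c"] xy(4) by simp
    from Vmp[OF this, of p] have yV: "y [^] (m * s) \<otimes> y : V (k - n - c + int p)" using xy(3) s by simp
    have up: "y : V (l + 1)" if "l + 1 <= k - n - c + int p" "y : V l" for l
    proof -
      have "y [^] (m * s) \<otimes> y : V (l + 1)" using V_monoD[OF yV that(1)] .
      from V_mult[OF V_inv[OF Vm[OF that(2), of s]] this] show ?thesis using yc by simp
    qed
    obtain l where l: "y : V l" using V_exh[OF xy(2)] .
    have "y : V (k - n - c + int p)"
    proof (cases "l <= k - n - c + int p")
      case True
      have "y : V (l + int i)" if "l + int i <= k - n - c + int p" for i :: nat
        using that
      proof (induction i)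
        case (Suc i)
        then have "y : V (l + int i)" "l + int i + 1 <= k - n - c + int p" by auto
        then have "y : V (l + int i + 1)" using up by blast
        then show ?case by (simp add: algebra_simps)
      qed (use l in simp)
      from this[of "nat (k - n - c + int p - l)"] show ?thesis using True by simp
    next
      case False
      then show ?thesis using V_monoD[OF l] by simp
    qed
    from V_B[OF this] show "y : B (k + 1)" by (rule B_monoD) (simp add: p_def)
  qed
  then show ?thesis unfolding contracts_def by (intro exI[of _ p]) (auto simp: p_def)
qed

end

section \<open>Properness of powers and the two types of subgroup\<close>

context contraction_balls
begin

lemma nb_trivial: "nb {\<one>} k = B k"
proof
  show "nb {\<one>} k <= B k" using B_carrier by (auto simp: nb_def)
  show "B k <= nb {\<one>} k" using nbI[of \<one> "{\<one>}" _ k] B_carrier by force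
qed

lemma pow_continuous:
  assumes x: "x : carrier G"
  shows "EX l. ALL b:B l. inv (x [^] (n::nat)) \<otimes> (x \<otimes> b) [^] n : B k"
proof (induction n arbitrary: k)
  case 0
  then show ?case by simp
next
  case (Suc n)
  obtain j where j: "ALL b:B j. cj (inv x) b : B (k + 1)" by (rule B_conj[OF inv_closed[OF x], where k = "k + 1"])
  obtain l where l: "ALL b:B l. inv (x [^] n) \<otimes> (x \<otimes> b) [^] n : B j" using Suc by blast
  have "inv (x [^] Suc n) \<otimes> (x \<otimes> b) [^] Suc n : B k" if b: "b : B (max l (k + 1))" for b
  proof -
    have bl: "b : B l" "b : B (k + 1)" "b : carrier G" using B_monoD[OF b] B_carrier[OF b] by auto
    have "cj (inv x) (inv (x [^] n) \<otimes> (x \<otimes> b) [^] n) \<otimes> b : B k" using B_mult j l bl by blast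
    moreover have "inv (x [^] Suc n) \<otimes> (x \<otimes> b) [^] Suc n = cj (inv x) (inv (x [^] n) \<otimes> (x \<otimes> b) [^] n) \<otimes> b"
      using x bl by (simp add: cj_def inv_mult_group m_assoc)
    ultimately show ?thesis by simp
  qed
  then show ?case by blast
qed

text \<open>The power map need not be a homomorphism, but it commutes with \<open>a\<close>, which
  suffices for the annulus around the trivial subgroup. A cluster point of counterexamples has
  trivial \<open>n\<close>-th power and is trivial by \<open>tf\<close>.\<close>

lemma pow_proper:
  assumes X: "cas X" and tf: "!!x. x : X ==> x [^] (n::nat) = \<one> ==> x = \<one>"
  obtains N :: nat where "ALL k. ALL x:X. x [^] n : B (k + int N) --> x : B k"
proof -
  have "EX N::nat. ALL x:X. x [^] n : B (int N) --> x : B 0"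
  proof (rule ccontr)
    assume no: "~ ?thesis"
    have "ALL N::nat. EX y. y : X \<inter> B (-1) & y [^] n : B (int N) & y ~: B 0"
    proof
      fix N :: nat
      obtain x where x: "x : X" "x [^] n : B (int N)" "x ~: nb {\<one>} 0" using no nb_trivial by blast
      note xc = cas_carrier[OF X x(1)]
      obtain i where i: "i >= - 0" "a i x : nb {\<one>} (-1)" "a i x ~: nb {\<one>} 0"
        by (rule annulus[OF cas_trivial xc x(3)])
      have "a i x [^] n : B (int N)" using a_B[OF x(2), of i] a_pow[OF xc, of i n] i(1) B_monoD[of _ "i + int N" "int N"] by simp
      then show "EX y. y : X \<inter> B (-1) & y [^] n : B (int N) & y ~: B 0"
        using i(2,3) cas_a[OF X x(1), of i] unfolding nb_trivial by blast
    qed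
    from choice[OF this] obtain s where "ALL N. s N : X \<inter> B (-1) & s N [^] n : B (int N) & s N ~: B 0" ..
    then have s: "!!N. s N : X \<inter> B (-1)" "!!N. s N [^] n : B (int N)" "!!N. s N ~: B 0" by auto
    obtain x where x: "x : X \<inter> B (-1)" "clus s x"
      by (rule clo_cluster[of s, OF s(1)]) (use X cas_clo clo_Int clo_B in auto)
    have xX: "x : X" and xc: "x : carrier G" using x B_carrier by auto
    have xn: "x [^] n : B (int j)" for j
    proof -
      obtain l where l: "ALL b:B l. inv (x [^] n) \<otimes> (x \<otimes> b) [^] n : B (int j + 1)"
        using pow_continuous[OF xc, of n "int j + 1"] by blast
      obtain N where N: "N >= j + 1" "inv x \<otimes> s N : B l" by (rule clusD[OF x(2)])
      have sc: "s N : carrier G" using s(1)[of N] B_carrier by auto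
      have "inv (x [^] n) \<otimes> (x \<otimes> (inv x \<otimes> s N)) [^] n : B (int j + 1)" using l N(2) by blast
      then have 1: "inv (x [^] n) \<otimes> s N [^] n : B (int j + 1)" using xc sc by simp
      have 2: "s N [^] n : B (int j + 1)" by (rule B_monoD[OF s(2)]) (use N in simp)
      have "s N [^] n \<otimes> inv (inv (x [^] n) \<otimes> s N [^] n) : B (int j)" by (rule B_mult[OF 2 B_inv[OF 1]])
      then show ?thesis using xc sc by (simp add: inv_mult_group)
    qed
    have "x [^] n = \<one>" by (rule B_sep[OF _ xn]) (use xc in simp)
    then have x1: "x = \<one>" by (rule tf[OF xX])
    obtain N where "N >= 0" "inv x \<otimes> s N : B 0" by (rule clusD[OF x(2)])
    then show False using s(3)[of N] s(1)[of N] B_carrier x1 by auto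
  qed
  then obtain N :: nat where N: "ALL x:X. x [^] n : B (int N) --> x : B 0" by blast
  have "x : B k" if x: "x : X" "x [^] n : B (k + int N)" for x k
  proof -
    note xc = cas_carrier[OF X x(1)]
    have "a (- k) x [^] n : B (int N)" using a_B[OF x(2), of "- k"] a_pow[OF xc, of "- k" n] by simp
    then have "a (- k) x : B 0" using N cas_a[OF X x(1)] by blast
    then show ?thesis using a_B_iff[OF xc, of "- k" 0] by simp
  qed
  then show thesis using that by blast
qed

text \<open>Since \<open>\<nu>\<close> commutes with conjugation, it acts in \<open>comm g z\<close>
  on \<open>z\<close> alone, and a small \<open>g\<close> keeps the commutator small however often
  \<open>\<nu>\<close> is applied. With dense commutators all iterates of \<open>\<nu>\<close> would
  be bounded on some ball, whereas \<open>expand\<close> lets no nontrivial element have a bounded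
  orbit there.\<close>

lemma no_dense_commutators:
  assumes X: "cn X" "X ~= {\<one>}" and \<nu>X: "!!x. x : X ==> \<nu> x : X"
    and \<nu>mult: "!!x y. x : X ==> y : X ==> \<nu> (x \<otimes> y) = \<nu> x \<otimes> \<nu> y"
    and \<nu>a: "!!x k. x : X ==> \<nu> (a k x) = a k (\<nu> x)"
    and \<nu>cj: "!!x g. x : X ==> g : carrier G ==> \<nu> (cj g x) = cj g (\<nu> x)"
    and expand: "!!x k. x : X ==> \<nu> x : B (k - 1) ==> x : B k"
    and cont: "!!x k. x : X ==> x : B (k + int c) ==> \<nu> x : B k"
    and dense: "X <= cl (generate G {comm g z | g z. g : carrier G & z : X})"
  shows False
proof -
  note Xs = cn_cas[OF X(1)]
  note Xc = cas_carrier[OF Xs]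
  obtain n :: nat where n: "ALL k. ALL x:X \<inter> B k. EX ys y. length ys <= n &
    (ALL v:set ys. EX g:carrier G \<inter> B (k - int n). EX z:X \<inter> B (k - int n). v = comm g z) &
    y : X \<inter> B (k + (int c + 1)) & x = mlist ys \<otimes> y"
    by (rule comm_decomposition[OF X(1) cas_whole dense, where j = "int c + 1"])
  \<comment> \<open>Scales to be lost: \<open>n\<close> in a product of up to \<open>n\<close>
    factors, \<open>c\<close> in one application of \<open>\<nu>\<close>, and one in multiplying by
    the remainder.\<close>
  define J where "J = int n + int c + 1"
  obtain l where l: "ALL w:B (- int n). ALL g:B l. cj w g : B (J + 1)" by (rule conj_unif)
  define k0 where "k0 = max 0 (max l (J + 1) + int n)"
  have k0: "k0 >= 0" "k0 - int n >= l" "k0 - int n >= J + 1" by (auto simp: k0_def)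
  have small: "comm g w : B J" if g: "g : B (k0 - int n)" and w: "w : B (- int n)" for g w
  proof -
    have gl: "g : B l" "g : B (J + 1)" using B_monoD[OF g] k0 by auto
    have "cj w (inv g) : B (J + 1)" using l w B_inv[OF gl(1)] by blast
    from B_mult[OF gl(2) this] show ?thesis using g w B_carrier by (simp add: comm_def cj_def m_assoc)
  qed
  define Q where "Q f \<longleftrightarrow> (ALL x:X. f x : X) & (ALL x:X. ALL y:X. f (x \<otimes> y) = f x \<otimes> f y) &
    (ALL x:X. ALL k. f (a k x) = a k (f x)) & (ALL x:X. ALL g:carrier G. f (cj g x) = cj g (f x))" for f
  have Qi: "Q (\<nu> ^^ i)" for i
  proof (induction i)
    case (Suc i)
    then show ?case unfolding Q_def using \<nu>X \<nu>mult \<nu>a \<nu>cj by simp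
  qed (simp add: Q_def)
  have main: "ALL x:X \<inter> B k0. (\<nu> ^^ i) x : B 0" for i
  proof (induction i)
    case 0
    then show ?case using B_monoD[of _ k0 0] k0(1) by auto
  next
    case (Suc i)
    define f where "f = \<nu> ^^ i"
    have fX: "!!x. x : X ==> f x : X" and fm: "!!x y. x : X ==> y : X ==> f (x \<otimes> y) = f x \<otimes> f y"
      and fa: "!!x k. x : X ==> f (a k x) = a k (f x)"
      and fcj: "!!x g. x : X ==> g : carrier G ==> f (cj g x) = cj g (f x)"
      using Qi[of i] unfolding Q_def f_def by blast+
    have f0: "!!x. x : X ==> x : B k0 ==> f x : B 0" using Suc unfolding f_def by blast
    have f1: "f \<one> = \<one>"
      using fm[of \<one> \<one>] Xc[OF fX[OF cas_one[OF Xs]]] cas_one[OF Xs] by (simp add: l_cancel_one')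
    have finv: "f (inv x) = inv (f x)" if x: "x : X" for x
    proof -
      have "f (inv x) \<otimes> f x = \<one>" using fm[OF cas_inv[OF Xs x] x] Xc[OF x] f1 by simp
      then show ?thesis using inv_equality Xc fX x cas_inv[OF Xs] by metis
    qed
    have fcomm: "f (comm g z) = comm g (f z)" if "g : carrier G" "z : X" for g z
      using that fm[OF cn_cj[OF X(1)] cas_inv[OF Xs]] fcj finv Xc fX by (simp add: comm_cj)
    have shift: "f z : B (- j)" if z: "z : X" "z : B (k0 - j)" for z j
    proof -
      have "a j (f z) : B 0" using f0[OF cas_a[OF Xs z(1)], of j] a_B[OF z(2), of j] fa[OF z(1)] by simp
      then show ?thesis using a_B_iff[OF Xc[OF fX[OF z(1)]], of j 0] by simp
    qed
    show ?case
    proof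
      fix x assume "x : X \<inter> B k0"
      then obtain ys y where ys: "length ys <= n"
        "ALL v:set ys. EX g:carrier G \<inter> B (k0 - int n). EX z:X \<inter> B (k0 - int n). v = comm g z"
        "y : X \<inter> B (k0 + (int c + 1))" "x = mlist ys \<otimes> y" using n by blast
      have v: "v : X & f v : B J" if vs: "v : set ys" for v
      proof -
        obtain g z where g: "g : carrier G" "g : B (k0 - int n)" "z : X" "z : B (k0 - int n)" "v = comm g z"
          using ys(2) vs by blast
        have "v : X" using g cn_cj[OF X(1)] cas_mult[OF Xs] cas_inv[OF Xs] Xc by (simp add: comm_cj)
        moreover have "f v : B J" using fcomm[OF g(1,3)] small[OF g(2) shift[OF g(3,4)]] g(5) by simp
        ultimately show ?thesis ..
      qed
      have mX: "set zs <= X ==> mlist zs : X & f (mlist zs) = mlist (map f zs)" for zs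
        by (induction zs) (auto simp: cas_one[OF Xs] cas_mult[OF Xs] f1 fm)
      have ysX: "set ys <= X" using v by blast
      have mys: "mlist ys : X" "f (mlist ys) = mlist (map f ys)" using mX[OF ysX] by auto
      have "mlist (map f ys) : B (J - int (length ys))" using mlist_B[of "map f ys" J] v by auto
      then have "f (mlist ys) : B (1 + int c)"
        unfolding mys(2) by (rule B_monoD) (use ys(1) in \<open>simp add: J_def\<close>)
      then have 1: "\<nu> (f (mlist ys)) : B 1" by (rule cont[OF fX[OF mys(1)]])
      have yX: "y : X" "y : B (k0 - (- (int c + 1)))" using ys(3) by (simp_all add: algebra_simps)
      have "f y : B (1 + int c)" using shift[OF yX] by (simp add: add.commute)
      then have 2: "\<nu> (f y) : B 1" by (rule cont[OF fX[OF yX(1)]])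
      have "\<nu> (f x) = \<nu> (f (mlist ys)) \<otimes> \<nu> (f y)" using ys(4) fm[OF mys(1) yX(1)] \<nu>mult[OF fX[OF mys(1)] fX[OF yX(1)]] by simp
      moreover have "\<nu> (f (mlist ys)) \<otimes> \<nu> (f y) : B 0" using B_mult[of _ 0] 1 2 by simp
      ultimately show "(\<nu> ^^ Suc i) x : B 0" by (simp add: f_def)
    qed
  qed
  have descend: "x : X ==> (\<nu> ^^ i) x : B 0 ==> x : B (int i)" for i x
  proof (induction i arbitrary: x)
    case (Suc i)
    have "(\<nu> ^^ i) (\<nu> x) : B 0" using Suc.prems(2) by (simp only: funpow_Suc_right o_apply)
    then have "\<nu> x : B (int i)" by (rule Suc.IH[OF \<nu>X[OF Suc.prems(1)]])
    then show ?case using expand[OF Suc.prems(1), of "int (Suc i)"] by simp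
  qed simp
  have triv: "x = \<one>" if "x : X" "x : B k0" for x
    by (rule B_sep[OF Xc[OF that(1)]]) (use descend[OF that(1)] main that in blast)
  have "x = \<one>" if x: "x : X" for x
  proof -
    obtain m :: nat where m: "x : B (- int m)" using B_exh[OF Xc[OF x]] .
    have "a (k0 + int m) x : B k0" using a_B[OF m, of "k0 + int m"] by simp
    then have "a (k0 + int m) x = \<one>" by (rule triv[OF cas_a[OF Xs x]])
    then have "a (k0 + int m) x = a (k0 + int m) \<one>" by simp
    then show ?thesis using a_inj[OF Xc[OF x] one_closed] by blast
  qed
  then show False using X(2) cas_one[OF Xs] by blast
qed

text \<open>Local finiteness is only asked for two generators, the case needed to show that products
  of torsion elements are torsion.\<close>

definition typeI :: "'a set => bool" where
  "typeI M \<longleftrightarrow> (EX e>0. ALL x:M. x [^] (e::nat) = \<one>) & (ALL x:M. ALL y:M. finite (generate G {x, y}))"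

text \<open>The inclusion in \<open>contracts\<close> relative to \<open>A\<close>, with free
  exponents. Equality and smallness in the quotient are expressed by cosets and by
  \<open>nb\<close>, so that quotients by different subgroups can be compared inside
  \<open>G\<close>.\<close>

definition contr :: "'a set => nat => nat => 'a set => bool" where
  "contr A u v M \<longleftrightarrow> (ALL k. ALL x:M. ALL y:M. A #> y [^] u = A #> x [^] v --> x : nb A k --> y : nb A (k + 1))"

text \<open>Modulo \<open>A\<close>, the group \<open>M\<close> behaves like a torsion-free divisible nilpotent group on which
  the maps "raise to the power \<open>(m / (m + 1)) ^ p\<close>" are contractions.\<close>

definition good :: "'a set => 'a set => bool" where
  "good A M \<longleftrightarrow> (ALL x:M. ALL y:M. ALL n>0. A #> x [^] (n::nat) = A #> y [^] n --> A #> x = A #> y) &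
    (ALL x:M. ALL n>0. EX y:M. A #> y [^] (n::nat) = A #> x) &
    (EX m0>0. ALL m>0. m0 dvd m --> (EX p>0. contr A ((m + 1) ^ p) (m ^ p) M))"

lemma good_roots:
  assumes "good A M" "x : M" "y : M" "n > 0" "A #> x [^] (n::nat) = A #> y [^] n" shows "A #> x = A #> y"
proof -
  have "ALL x:M. ALL y:M. ALL n>0. A #> x [^] (n::nat) = A #> y [^] n --> A #> x = A #> y"
    using assms(1) unfolding good_def by (elim conjE)
  then show ?thesis using assms(2-5) by blast
qed

lemma good_div: assumes "good A M" "x : M" "n > 0" shows "EX y:M. A #> y [^] (n::nat) = A #> x"
proof -
  have "ALL x:M. ALL n>0. EX y:M. A #> y [^] (n::nat) = A #> x" using assms(1) unfolding good_def by (elim conjE)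
  then show ?thesis using assms(2,3) by blast
qed

lemma good_contr: assumes "good A M"
  shows "EX m0>0. ALL m>0. m0 dvd m --> (EX p>0. contr A ((m + 1) ^ p) (m ^ p) M)"
  using assms unfolding good_def by (elim conjE)

definition typeII :: "'a set => bool" where
  "typeII M \<longleftrightarrow> (ALL g:carrier G. ALL x:M. g \<otimes> x = x \<otimes> g) & good {\<one>} M"

lemma trivial_coset: "x : carrier G ==> {\<one>} #> x = {x}"
  by (simp add: r_coset_def)

end

section \<open>Torsion-free minimal subgroups\<close>

locale torsion_free_minimal = minimal_sin +
  assumes ab: "!!x y. x : M ==> y : M ==> x \<otimes> y = y \<otimes> x"
    and tf: "!!x n. x : M ==> (n::nat) > 0 ==> x [^] n = \<one> ==> x = \<one>"
begin

lemma pm: "x : M ==> y : M ==> (x \<otimes> y) [^] (n::nat) = x [^] n \<otimes> y [^] n"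
  using pow_mult_distrib[OF ab] M_carrier by blast

lemma pair: "contraction_balls_pair G a K G a K"
  by unfold_locales

text \<open>The image of the power map is closed by \<open>equivariant_image_clo\<close>, hence
  again a stable normal subgroup; it is nontrivial as \<open>M\<close> has no torsion, so minimality
  makes it all of \<open>M\<close>.\<close>

lemma divisible: assumes n: "n > 0" and x: "x : M" obtains y where "y : M" "y [^] (n::nat) = x"
proof -
  interpret PP: contraction_balls_pair G a K G a K by (rule pair)
  define P where "P = (%x. x [^] n) ` M"
  have PM: "P <= M" using M_pow unfolding P_def by auto
  have clo: "clo P" unfolding P_def
    by (rule PP.equivariant_image_clo[OF casM _ pm pow_cont]) (use M_carrier a_pow in auto)
  have "cn P" unfolding cn_def cas_def
  proof (intro conjI allI ballI clo)
    interpret f: group_hom "G\<lparr>carrier := M\<rparr>" G "%x. x [^] n"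
      by (rule group_hom.intro[OF subgroup_imp_group[OF subgroupM] is_group])
        (unfold_locales, use M_carrier pm in \<open>auto simp: hom_def\<close>)
    show "subgroup P G" using f.img_is_subgroup by (simp add: P_def)
    show "a k x : P" if px: "x : P" for x k
    proof -
      obtain y where "y : M" "x = y [^] n" using px unfolding P_def by blast
      then have "a k x = a k y [^] n" "a k y : M" using M_a M_carrier a_pow by auto
      then show ?thesis unfolding P_def by blast
    qed
    show "cj g x : P" if g: "g : carrier G" and px: "x : P" for g x
    proof -
      obtain y where "y : M" "x = y [^] n" using px unfolding P_def by blast
      then have "cj g x = cj g y [^] n" "cj g y : M" using M_cj M_carrier cj_pow g by auto
      then show ?thesis unfolding P_def by blast
    qed
  qed
  moreover have "P ~= {\<one>}"
  proof
    assume P1: "P = {\<one>}"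
    have "y = \<one>" if y: "y : M" for y
    proof -
      have "y [^] n : P" using y unfolding P_def by blast
      then show ?thesis using P1 tf[OF y n] by simp
    qed
    then show False using M_nontriv M_one by blast
  qed
  ultimately have "P = M" using M_min[OF _ PM] by blast
  then have "x : P" using x by simp
  then show thesis using that unfolding P_def by blast
qed

lemma roots_unique: assumes "x : M" "y : M" "x [^] (n::nat) = y [^] n" "n > 0" shows "x = y"
proof -
  have "(x \<otimes> inv y) [^] n = \<one>"
    using pm[OF assms(1) M_inv[OF assms(2)]] assms M_carrier nat_pow_inv by simp
  then have "x \<otimes> inv y = \<one>" using tf M_mult[OF assms(1) M_inv[OF assms(2)]] assms(4) by blast
  then show ?thesis using assms M_carrier by (metis inv_closed inv_equality inv_inv)
qed

text \<open>The map \<open>\<kappa>\<close> is the power with exponent \<open>u / v\<close>, inverse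
  to the contraction and hence expanding. Made of powers and unique roots, it commutes with
  conjugation and with \<open>a\<close>, so \<open>no_dense_commutators\<close> excludes dense
  commutators; by minimality all of them are trivial.\<close>

lemma contracts_central:
  assumes m: "m > 0" "contracts m M" and g: "g : carrier G" and x: "x : M"
  shows "g \<otimes> x = x \<otimes> g"
proof -
  define C where "C = {comm g z | g z. g : carrier G & z : M}"
  have "cn (cl (generate G C))" "cl (generate G C) <= M" unfolding C_def by (rule cn_commutators[OF cn_whole cnM])+
  then consider "cl (generate G C) = {\<one>}" | "cl (generate G C) = M" using M_min by blast
  then show ?thesis
  proof cases
    case 1
    have Cc: "C <= carrier G" using M_carrier unfolding C_def by auto
    have "comm g x : generate G C" using g x unfolding C_def by (intro generate.incl) blast
    then have "comm g x = \<one>"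
      using cl_superset[OF subgroup.subset[OF generate_is_subgroup[OF Cc]]] 1 by blast
    then show ?thesis using comm_one_iff g x M_carrier by simp
  next
    case 2
    obtain p where p: "ALL k. ALL x:M. ALL y:M. y [^] ((m + 1) ^ p) = x [^] (m ^ p) --> x : B k --> y : B (k + 1)"
      using m(2) unfolding contracts_def by blast
    define u v where "u = (m + 1) ^ p" and "v = m ^ p"
    have v: "v > 0" using m(1) by (simp add: v_def)
    have uv: "!!k x y. x : M ==> y : M ==> y [^] u = x [^] v ==> x : B k ==> y : B (k + 1)"
      using p unfolding u_def v_def by blast
    have "ALL x:M. EX y. y : M & y [^] v = x [^] u"
    proof
      fix x assume x: "x : M"
      obtain y where "y : M" "y [^] v = x [^] u" by (rule divisible[OF v M_pow[OF x]])
      then show "EX y. y : M & y [^] v = x [^] u" by blast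
    qed
    from bchoice[OF this] obtain \<kappa> where "ALL x:M. \<kappa> x : M & \<kappa> x [^] v = x [^] u" ..
    then have \<kappa>: "!!x. x : M ==> \<kappa> x : M" "!!x. x : M ==> \<kappa> x [^] v = x [^] u" by auto
    have \<kappa>eq: "\<kappa> x = y" if "x : M" "y : M" "y [^] v = x [^] u" for x y
      by (rule roots_unique[OF \<kappa>(1)[OF that(1)] that(2) _ v]) (use \<kappa>(2)[OF that(1)] that(3) in simp)
    have \<kappa>mult: "\<kappa> (x \<otimes> y) = \<kappa> x \<otimes> \<kappa> y" if "x : M" "y : M" for x y
      by (rule \<kappa>eq) (use that \<kappa> pm M_mult in \<open>simp_all\<close>)
    have \<kappa>a: "\<kappa> (a k x) = a k (\<kappa> x)" if "x : M" for x k
      by (rule \<kappa>eq) (use that \<kappa> M_a M_carrier in \<open>simp_all flip: a_pow\<close>)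
    have \<kappa>cj: "\<kappa> (cj h x) = cj h (\<kappa> x)" if "x : M" "h : carrier G" for x h
      by (rule \<kappa>eq) (use that \<kappa> M_cj M_carrier in \<open>simp_all flip: cj_pow\<close>)
    obtain N :: nat where N: "ALL k. ALL x:M. x [^] v : B (k + int N) --> x : B k" by (rule pow_proper[OF casM tf[OF _ v]])
    have False
    proof (rule no_dense_commutators[OF cnM M_nontriv \<kappa>(1) \<kappa>mult \<kappa>a \<kappa>cj, of "N + u"])
      show "M <= cl (generate G {comm g z | g z. g : carrier G & z : M})" using 2 by (simp add: C_def)
      show "x : B k" if x: "x : M" "\<kappa> x : B (k - 1)" for x k
        using uv[OF \<kappa>(1)[OF x(1)] x(1) \<kappa>(2)[OF x(1), symmetric] x(2)] by simp
      show "\<kappa> x : B k" if x: "x : M" "x : B (k + int (N + u))" for x k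
      proof -
        have "x [^] u : B (k + int N)" using B_pow[OF x(2), of u] by simp
        then show ?thesis using N \<kappa>[OF x(1)] by simp
      qed
    qed
    then show ?thesis ..
  qed
qed

lemma typeII_M: assumes "m0 > 0" "!!m. m > 0 ==> m0 dvd m ==> contracts m M" shows "typeII M"
proof -
  have "contr {\<one>} ((m + 1) ^ p) (m ^ p) M"
    if p: "ALL k. ALL x:M. ALL y:M. y [^] ((m + 1) ^ p) = x [^] (m ^ p) --> x : B k --> y : B (k + 1)" for m p :: nat
    unfolding contr_def nb_trivial
  proof (intro allI ballI impI)
    fix k x y assume xy: "x : M" "y : M" "{\<one>} #> y [^] ((m + 1) ^ p) = {\<one>} #> x [^] (m ^ p)" "x : B k"
    then have "y [^] ((m + 1) ^ p) = x [^] (m ^ p)" using M_carrier by (simp add: trivial_coset)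
    then show "y : B (k + 1)" using p xy by blast
  qed
  then have con: "EX m0>0. ALL m>0. m0 dvd m --> (EX p>0. contr {\<one>} ((m + 1) ^ p) (m ^ p) M)"
    using assms unfolding contracts_def by meson
  have div: "ALL x:M. ALL n>0. EX y:M. {\<one>} #> y [^] (n::nat) = {\<one>} #> x"
  proof (intro ballI allI impI)
    fix x and n :: nat assume "x : M" "n > 0"
    obtain y where "y : M" "y [^] n = x" by (rule divisible[OF \<open>n > 0\<close> \<open>x : M\<close>])
    then show "EX y:M. {\<one>} #> y [^] (n::nat) = {\<one>} #> x" by blast
  qed
  have "ALL x:M. ALL y:M. ALL n>0. {\<one>} #> x [^] (n::nat) = {\<one>} #> y [^] n --> {\<one>} #> x = {\<one>} #> y"
  proof (intro ballI allI impI)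
    fix x y and n :: nat assume xy: "x : M" "y : M" "n > 0" "{\<one>} #> x [^] n = {\<one>} #> y [^] n"
    then have "x [^] n = y [^] n" using M_carrier by (simp add: trivial_coset)
    then show "{\<one>} #> x = {\<one>} #> y" using roots_unique[OF xy(1,2) _ xy(3)] by simp
  qed
  moreover have "ALL g:carrier G. ALL x:M. g \<otimes> x = x \<otimes> g" using contracts_central[OF assms(1) assms(2)[OF assms(1) dvd_refl]] by blast
  ultimately show ?thesis using con div unfolding typeII_def good_def by blast
qed

end

section \<open>Every nontrivial group has a subgroup of one of the two types\<close>

context contraction_balls
begin

theorem exists_typed:
  assumes "carrier G ~= {\<one>}"
  obtains M where "cn M" "M ~= {\<one>}" "typeI M | typeII M"
proof -
  obtain M c where M: "cn M" "M ~= {\<one>}" "ALL X. cn X --> X <= M --> X = {\<one>} | X = M"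
    "ALL k. M \<inter> B (k + c) <= Y k" by (rule exists_minimal_sin[OF assms])
  interpret minimal_sin G a K M c by unfold_locales (use M in auto)
  \<comment> \<open>The number \<open>m0\<close> unites the two sources of contraction: it is 1 for
    full core, where every \<open>m\<close> contracts, and the factorial of \<open>card D\<close>
    for trivial core, where only its multiples are known to.\<close>
  have abelian_case: "typeI M | typeII M"
    if ab: "ALL x:M. ALL y:M. x \<otimes> y = y \<otimes> x" and m0: "(m0::nat) > 0" and con: "ALL m>0. m0 dvd m --> contracts m M" for m0
  proof -
    have ab': "!!x y. x : M ==> y : M ==> x \<otimes> y = y \<otimes> x" using ab by blast
    from exponent_or_torsion_free[OF ab'] show ?thesis
    proof
      assume "EX e>0. ALL x:M. x [^] (e::nat) = \<one>"
      then obtain e :: nat where e: "e > 0" "ALL x:M. x [^] e = \<one>" by blast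
      have "finite (generate G {x, y})" if "x : M" "y : M" for x y
        by (rule finite_generate_commuting[OF _ _ ab'[OF that] e(1)]) (use that e M_carrier in auto)
      then show ?thesis using e unfolding typeI_def by blast
    next
      assume tf: "ALL x:M. ALL n>0. x [^] (n::nat) = \<one> --> x = \<one>"
      interpret torsion_free_minimal G a K M c by unfold_locales (use ab' tf in auto)
      show ?thesis using typeII_M[OF m0] con by blast
    qed
  qed
  have "core M = {\<one>} | core M = M" using M_min[OF cn_core[OF cnM]] .
  then have "typeI M | typeII M"
  proof
    assume "core M = M"
    then interpret npo_minimal G a K M c by unfold_locales
    show ?thesis by (rule abelian_case[of 1]) (use M_commute M_contracts in auto)
  next
    assume "core M = {\<one>}"
    then obtain n :: nat where n: "generate G (M \<inter> B (int n)) <= B 0" by (rule core_trivial_bounded[OF casM])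
    have "M \<inter> Y (int n) <= M \<inter> B (int n)" using Y_B by auto
    then have "generate G (M \<inter> Y (int n)) <= B 0" using mono_generate n by blast
    then interpret td_minimal G a K M c "int n" by unfold_locales
    show ?thesis using J_cases[of 1]
    proof
      assume "J 1 = {\<one>}"
      then show ?thesis using J1_trivial unfolding typeI_def by blast
    next
      assume J1: "J 1 = M"
      have ab: "!!x y. x : M ==> y : M ==> x \<otimes> y = y \<otimes> x" by (rule J1_full_comm[OF J1])
      show ?thesis by (rule abelian_case[of "fact (card D)"]) (use ab V_contracts[OF ab] in auto)
    qed
  qed
  then show thesis using that M(1,2) by blast
qed

end

section \<open>Quotients by closed stable normal subgroups\<close>

declare mult_FactGroup [simp del] one_FactGroup [simp del]

locale contraction_quotient = contraction_balls G a K for G (structure) and a and K +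
  fixes A assumes cnA: "cn A"
begin

lemma casA: "cas A"
  using cnA by (rule cn_cas)

lemmas subgroupA = cas_subgroup[OF casA] and A_carrier = cas_carrier[OF casA]
  and normalA = cn_normal[OF cnA]

abbreviation q :: "'a => 'a set" where "q x \<equiv> A #> x"

lemma carrier_Q: "carrier (G Mod A) = q ` carrier G"
  by (auto simp: FactGroup_def RCOSETS_def)

lemma q_closed [simp]: "x : carrier G ==> q x : carrier (G Mod A)"
  by (simp add: carrier_Q)

lemma q_mult: "x : carrier G ==> y : carrier G ==> q x \<otimes>\<^bsub>G Mod A\<^esub> q y = q (x \<otimes> y)"
  using normal.rcos_sum[OF normalA] by (simp add: FactGroup_def)

lemma q_one: "q \<one> = \<one>\<^bsub>G Mod A\<^esub>"
  using coset_mult_one[OF subgroup.subset[OF subgroupA]] by (simp add: FactGroup_def)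

lemma group_Q: "group (G Mod A)"
  by (rule normal.factorgroup_is_group[OF normalA])

lemma q_eq: "x : carrier G ==> y : carrier G ==> q x = q y \<longleftrightarrow> x \<otimes> inv y : A"
  by (rule rcos_eq_iff[OF subgroupA])

lemma q_eq_one: "x : carrier G ==> q x = \<one>\<^bsub>G Mod A\<^esub> \<longleftrightarrow> x : A"
  using q_eq[of x \<one>] by (simp add: q_one)

lemma q_inv: "x : carrier G ==> inv\<^bsub>G Mod A\<^esub> (q x) = q (inv x)"
  using group.inv_equality[OF group_Q, of "q (inv x)" "q x"] by (simp add: q_mult q_one)

lemma q_pow: "x : carrier G ==> q x [^]\<^bsub>G Mod A\<^esub> (n::nat) = q (x [^] n)"
  by (induction n) (simp_all add: q_one q_mult)

lemma q_a: assumes x: "x : carrier G" shows "a k ` q x = q (a k x)"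
proof
  show "a k ` q x <= q (a k x)"
    using x A_carrier cas_a[OF casA] by (auto simp: r_coset_def a_mult)
  show "q (a k x) <= a k ` q x"
  proof
    fix y assume "y : q (a k x)"
    then obtain d where d: "d : A" "y = d \<otimes> a k x" by (auto simp: r_coset_def)
    then have "y = a k (a (- k) d \<otimes> x)" using x A_carrier by (simp add: a_mult)
    moreover have "a (- k) d \<otimes> x : q x" using cas_a[OF casA d(1)] unfolding r_coset_def by blast
    ultimately show "y : a k ` q x" by blast
  qed
qed

lemma q_cj: "g : carrier G ==> x : carrier G ==> group.cj (G Mod A) (q g) (q x) = q (cj g x)"
  by (simp add: group.cj_def[OF group_Q] cj_def q_inv q_mult)

lemma image_B: "(`) (a k) ` q ` K = q ` B k"
proof -
  have "(`) (a k) ` q ` K = (%x. q (a k x)) ` K"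
    unfolding image_image by (rule image_cong) (use K_sub q_a in blast)+
  then show ?thesis by (simp add: B_def image_image)
qed

lemma q_in_B: assumes "x : carrier G" shows "q x : q ` B k \<longleftrightarrow> x : nb A k"
proof
  assume "q x : q ` B k"
  then obtain b where b: "b : B k" "q x = q b" by blast
  then have "x : q b" using rcos_self[OF assms subgroupA] by simp
  then show "x : nb A k" using b(1) unfolding r_coset_def nb_def by blast
next
  assume "x : nb A k"
  then obtain d b where d: "d : A" "b : B k" "x = d \<otimes> b" by (rule nbE)
  then have "q x = q b" using q_eq[OF assms B_carrier[OF d(2)]] A_carrier B_carrier by (simp add: m_assoc)
  then show "q x : q ` B k" using d(2) by blast
qed

text \<open>The axioms pass to cosets through representatives. Only separation uses that
  \<open>A\<close> is closed: a coset meeting all balls consists of limits of \<open>A\<close>,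
  which is \<open>nb_sep\<close>.\<close>

lemma contraction_Q: "contraction_balls (G Mod A) (%k. (`) (a k)) (q ` K)"
proof (rule contraction_balls.intro[OF group_Q], rule contraction_balls_axioms.intro)
  fix X k assume "X : carrier (G Mod A)"
  then show "a k ` X : carrier (G Mod A)" unfolding carrier_Q by (auto simp: q_a)
next
  fix X Y k assume "X : carrier (G Mod A)" "Y : carrier (G Mod A)"
  then obtain x y where "x : carrier G" "y : carrier G" "X = q x" "Y = q y" unfolding carrier_Q by blast
  then show "a k ` (X \<otimes>\<^bsub>G Mod A\<^esub> Y) = a k ` X \<otimes>\<^bsub>G Mod A\<^esub> a k ` Y" by (simp add: q_a q_mult a_mult)
next
  fix X j k assume "X : carrier (G Mod A)"
  then obtain x where "x : carrier G" "X = q x" unfolding carrier_Q by blast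
  then show "a (j + k) ` X = a j ` a k ` X" by (simp add: q_a a_add)
next
  fix X assume "X : carrier (G Mod A)"
  then obtain x where "x : carrier G" "X = q x" unfolding carrier_Q by blast
  then show "a 0 ` X = X" by (simp add: q_a a_zero)
next
  show "q ` K <= carrier (G Mod A)" using K_sub unfolding carrier_Q by blast
  show "\<one>\<^bsub>G Mod A\<^esub> : q ` K" using one_K unfolding q_one[symmetric] by blast
next
  fix X assume "X : q ` K"
  then show "inv\<^bsub>G Mod A\<^esub> X : q ` K" using K_sub inv_K by (auto simp: q_inv subset_iff)
next
  fix X Y Z assume "X : (`) (a 1) ` q ` K" "Y : (`) (a 1) ` q ` K" "Z : (`) (a 1) ` q ` K"
  then obtain x y z where x: "x : B 1" "X = q x" and y: "y : B 1" "Y = q y" and z: "z : B 1" "Z = q z"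
    unfolding image_B by blast
  have "x \<otimes> y \<otimes> z : K" using B_cube[of x 0 y z] x(1) y(1) z(1) B_0 by simp
  then show "X \<otimes>\<^bsub>G Mod A\<^esub> Y \<otimes>\<^bsub>G Mod A\<^esub> Z : q ` K" using x y z B_carrier by (simp add: q_mult)
next
  fix X assume X: "X : carrier (G Mod A)" and *: "!!n. X : (`) (a (int n)) ` q ` K"
  obtain x where x: "x : carrier G" "X = q x" using X unfolding carrier_Q by blast
  have "x : nb A (int n)" for n using * x q_in_B unfolding image_B by blast
  then show "X = \<one>\<^bsub>G Mod A\<^esub>" using nb_sep[OF casA x(1)] q_eq_one x by blast
next
  fix X assume "X : carrier (G Mod A)"
  then obtain x where x: "x : carrier G" "X = q x" unfolding carrier_Q by blast
  obtain n :: nat where "x : B (- int n)" using B_exh[OF x(1)] .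
  then show "EX n. X : (`) (a (- int n)) ` q ` K" unfolding image_B x(2) by blast
next
  fix X assume "X : carrier (G Mod A)"
  then obtain g where g: "g : carrier G" "X = q g" unfolding carrier_Q by blast
  obtain n where n: "ALL x:B n. cj g x : B 0" by (rule B_conj[OF g(1), where k = 0])
  have "group.cj (G Mod A) X Y : q ` K" if Y: "Y : q ` B (int (nat n))" for Y
  proof -
    obtain b where b: "b : B (int (nat n))" "Y = q b" using Y by blast
    have "b : B n" by (rule B_monoD[OF b(1)]) simp
    then have "cj g b : K" using n B_0 by simp
    then show ?thesis using g b q_cj[OF g(1) B_carrier[OF b(1)]] by simp
  qed
  then show "EX n. ALL Y:(`) (a (int n)) ` q ` K. group.cj (G Mod A) X Y : q ` K" unfolding image_B by blast
next
  fix s :: "nat => 'a set" assume "!!n. s n : q ` K"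
  then have "ALL n. EX b. b : K & s n = q b" by blast
  from choice[OF this] obtain t where "ALL n. t n : K & s n = q (t n)" ..
  then have t: "!!n. t n : B 0" "!!n. s n = q (t n)" by (auto simp: B_0)
  obtain x where x: "x : B 0" "clus t x" by (rule B_cluster[OF t(1)])
  have xc: "x : carrier G" "!!n. t n : carrier G" using x(1) t(1) B_carrier by blast+
  show "EX X:q ` K. ALL k N. EX n>=N. inv\<^bsub>G Mod A\<^esub> X \<otimes>\<^bsub>G Mod A\<^esub> s n : (`) (a (int k)) ` q ` K"
    unfolding image_B
  proof (intro bexI[of _ "q x"] allI)
    fix k N :: nat
    obtain n where "n >= N" "inv x \<otimes> t n : B (int k)" by (rule clusD[OF x(2)])
    then show "EX n>=N. inv\<^bsub>G Mod A\<^esub> (q x) \<otimes>\<^bsub>G Mod A\<^esub> s n : q ` B (int k)"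
      using xc by (intro exI[of _ n]) (simp add: t(2) q_inv q_mult)
  qed (use x B_0 in simp)
qed

sublocale Q: contraction_balls "G Mod A" "%k. (`) (a k)" "q ` K"
  by (rule contraction_Q)

lemma Q_B: "Q.B k = q ` B k"
  by (simp add: Q.B_def image_B)

lemma q_B: "x : carrier G ==> q x : Q.B k \<longleftrightarrow> x : nb A k"
  by (simp add: Q_B q_in_B)

lemma cn_preimage: assumes M: "Q.cn M" shows "cn {x : carrier G. q x : M}"
  unfolding cn_def cas_def
proof (intro conjI allI ballI)
  note Ms = Q.cn_cas[OF M]
  show "subgroup {x : carrier G. q x : M} G"
  proof (rule subgroupI)
    show "{x : carrier G. q x : M} <= carrier G" by blast
    have "\<one> : {x : carrier G. q x : M}" using Q.cas_one[OF Ms] q_one by simp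
    then show "{x : carrier G. q x : M} ~= {}" by blast
    show "inv x : {x : carrier G. q x : M}" if "x : {x : carrier G. q x : M}" for x
      using that Q.cas_inv[OF Ms, of "q x"] q_inv[of x] by simp
    show "x \<otimes> y : {x : carrier G. q x : M}" if "x : {x : carrier G. q x : M}" "y : {x : carrier G. q x : M}" for x y
      using that Q.cas_mult[OF Ms, of "q x" "q y"] q_mult[of x y] by simp
  qed
  show "clo {x : carrier G. q x : M}"
  proof (rule cloI)
    fix x assume x: "x : carrier G" and *: "!!k. EX b:B k. x \<otimes> b : {x : carrier G. q x : M}"
    have "q x : M"
    proof (rule Q.cloD[OF Q.cas_clo[OF Ms] q_closed[OF x]])
      fix k
      obtain b where b: "b : B k" "q (x \<otimes> b) : M" using * by blast
      then have "q x \<otimes>\<^bsub>G Mod A\<^esub> q b : M" using q_mult[OF x B_carrier[OF b(1)]] by simp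
      then show "EX b:Q.B k. q x \<otimes>\<^bsub>G Mod A\<^esub> b : M" using b(1) unfolding Q_B by blast
    qed
    then show "x : {x : carrier G. q x : M}" using x by simp
  qed blast
  show "a k x : {x : carrier G. q x : M}" if "x : {x : carrier G. q x : M}" for x k
    using that Q.cas_a[OF Ms, of "q x" k] q_a[of x k] by simp
  show "cj g x : {x : carrier G. q x : M}" if "g : carrier G" "x : {x : carrier G. q x : M}" for g x
    using that Q.cn_cj[OF M, of "q g" "q x"] q_cj[of g x] by simp
qed

end

locale contraction_quotient2 = contraction_quotient +
  fixes D assumes cnD: "cn D" and AD: "A <= D"
begin

lemma casD: "cas D"
  using cnD by (rule cn_cas)

lemmas D_carrier = cas_carrier[OF casD]

lemma q_mem: assumes "x : carrier G" shows "q x : q ` D \<longleftrightarrow> x : D"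
proof
  assume "q x : q ` D"
  then obtain d where d: "d : D" "q x = q d" by blast
  then have "x \<otimes> inv d : D" using q_eq assms D_carrier AD by blast
  then have "x \<otimes> inv d \<otimes> d : D" using cas_mult[OF casD] d(1) by blast
  then show "x : D" using assms D_carrier d(1) by (simp add: m_assoc)
qed blast

lemma Q_cn_image: "Q.cn (q ` D)"
  unfolding Q.cn_def Q.cas_def
proof (intro conjI allI ballI)
  show "subgroup (q ` D) (G Mod A)"
  proof (rule Q.subgroupI)
    show "q ` D <= carrier (G Mod A)" using D_carrier by auto
    show "q ` D ~= {}" using cas_one[OF casD] by blast
    show "inv\<^bsub>G Mod A\<^esub> X : q ` D" if "X : q ` D" for X
      using that cas_inv[OF casD] D_carrier by (auto simp: q_inv)
    show "X \<otimes>\<^bsub>G Mod A\<^esub> Y : q ` D" if "X : q ` D" "Y : q ` D" for X Y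
      using that cas_mult[OF casD] D_carrier by (auto simp: q_mult)
  qed
  show "Q.clo (q ` D)"
  proof (rule Q.cloI)
    show "q ` D <= carrier (G Mod A)" using D_carrier by auto
    fix X assume X: "X : carrier (G Mod A)" and *: "!!k. EX b:Q.B k. X \<otimes>\<^bsub>G Mod A\<^esub> b : q ` D"
    obtain x where x: "x : carrier G" "X = q x" using X unfolding carrier_Q by blast
    have "x : D"
    proof (rule cloD[OF cas_clo[OF casD] x(1)])
      fix k
      obtain b where b: "b : B k" "q x \<otimes>\<^bsub>G Mod A\<^esub> q b : q ` D" using * x(2) unfolding Q_B by blast
      note bc = B_carrier[OF b(1)]
      have "x \<otimes> b : D" using b(2) q_mult[OF x(1) bc] q_mem[of "x \<otimes> b"] x(1) bc by simp
      then show "EX b:B k. x \<otimes> b : D" using b(1) by blast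
    qed
    then show "X : q ` D" using x(2) by blast
  qed
  show "a k ` X : q ` D" if "X : q ` D" for X k
    using that cas_a[OF casD] D_carrier by (auto simp: q_a)
  show "Q.cj g X : q ` D" if "g : carrier (G Mod A)" "X : q ` D" for g X
    using that cn_cj[OF cnD] D_carrier unfolding carrier_Q by (auto simp: q_cj)
qed

lemma Q_coset: assumes "x : carrier G" "y : carrier G"
  shows "(q ` D) #>\<^bsub>G Mod A\<^esub> q x = (q ` D) #>\<^bsub>G Mod A\<^esub> q y \<longleftrightarrow> D #> x = D #> y"
proof -
  have "(q ` D) #>\<^bsub>G Mod A\<^esub> q x = (q ` D) #>\<^bsub>G Mod A\<^esub> q y \<longleftrightarrow> q x \<otimes>\<^bsub>G Mod A\<^esub> inv\<^bsub>G Mod A\<^esub> q y : q ` D"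
    by (rule Q.rcos_eq_iff[OF Q.cas_subgroup[OF Q.cn_cas[OF Q_cn_image]]]) (use assms in auto)
  also have "\<dots> \<longleftrightarrow> x \<otimes> inv y : D" using assms q_mem[of "x \<otimes> inv y"] by (simp add: q_inv q_mult)
  also have "\<dots> \<longleftrightarrow> D #> x = D #> y" using rcos_eq_iff[OF cas_subgroup[OF casD] assms] by simp
  finally show ?thesis .
qed

lemma Q_nb: assumes "x : carrier G" shows "q x : Q.nb (q ` D) k \<longleftrightarrow> x : nb D k"
proof
  assume "q x : Q.nb (q ` D) k"
  then obtain Y X where "Y : q ` D" "X : Q.B k" "q x = Y \<otimes>\<^bsub>G Mod A\<^esub> X" by (rule Q.nbE)
  then obtain d b where d: "d : D" "b : B k" "q x = q d \<otimes>\<^bsub>G Mod A\<^esub> q b" unfolding Q_B by blast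
  note c = D_carrier[OF d(1)] B_carrier[OF d(2)]
  have "q x = q (d \<otimes> b)" using d(3) q_mult c by simp
  then have "x \<otimes> inv (d \<otimes> b) : D" using q_eq assms c AD by auto
  then have "x \<otimes> inv (d \<otimes> b) \<otimes> d : D" using cas_mult[OF casD] d(1) by blast
  then have "(x \<otimes> inv (d \<otimes> b) \<otimes> d) \<otimes> b : nb D k" using nbI d(2) by blast
  then show "x : nb D k" using assms c by (simp add: m_assoc inv_mult_group)
next
  assume "x : nb D k"
  then obtain d b where d: "d : D" "b : B k" "x = d \<otimes> b" by (rule nbE)
  then have "q x = q d \<otimes>\<^bsub>G Mod A\<^esub> q b" using q_mult D_carrier B_carrier by simp
  then show "q x : Q.nb (q ` D) k" using Q.nbI[of "q d" "q ` D" "q b" k] d(1,2) unfolding Q_B by simp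
qed

lemma Q_contr: "Q.contr (q ` D) u v (carrier (G Mod A)) \<longleftrightarrow> contr D u v (carrier G)"
  unfolding Q.contr_def contr_def carrier_Q ball_simps
  by (simp add: q_pow Q_coset Q_nb cong: ball_cong)

lemma Q_good: "Q.good (q ` D) (carrier (G Mod A)) \<longleftrightarrow> good D (carrier G)"
  unfolding Q.good_def good_def Q_contr
  unfolding carrier_Q ball_simps bex_simps
  by (simp add: q_pow Q_coset cong: ball_cong bex_cong)

end

context contraction_quotient
begin

lemma Q_good_trivial: "Q.good {\<one>\<^bsub>G Mod A\<^esub>} (carrier (G Mod A)) \<longleftrightarrow> good A (carrier G)"
proof -
  interpret contraction_quotient2 G a K A A
    by (intro contraction_quotient2.intro contraction_quotient2_axioms.intro contraction_quotient_axioms cnA subset_refl)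
  have "q ` A = (%_. \<one>\<^bsub>G Mod A\<^esub>) ` A"
    by (rule image_cong[OF refl]) (use q_eq_one A_carrier in blast)
  then have "q ` A = {\<one>\<^bsub>G Mod A\<^esub>}" using cas_one[OF casA] by blast
  then show ?thesis using Q_good by simp
qed

text \<open>Iteration goes through an intermediate point \<open>w\<close>, supplied by divisibility.
  Uniqueness of roots modulo \<open>A\<close> strips the common exponent \<open>u ^ r\<close> and
  leaves one application of \<open>c\<close>.\<close>

lemma contr_power:
  assumes M: "subgroup M G"
    and roots: "!!x y n. x : M ==> y : M ==> n > 0 ==> q (x [^] (n::nat)) = q (y [^] n) ==> q x = q y"
    and div: "!!x n. x : M ==> n > 0 ==> EX y:M. q (y [^] (n::nat)) = q x"
    and c: "contr A u v M" and u: "u > 0"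
  shows "x : M ==> y : M ==> q (y [^] (u ^ r)) = q (x [^] (v ^ r)) ==> x : nb A k ==> y : nb A (k + int r)"
proof (induction r arbitrary: y)
  case 0
  then show ?case using subgroup.mem_carrier[OF M] q_B[of x k] q_B[of y k] by simp
next
  case (Suc r)
  note Mc = subgroup.mem_carrier[OF M]
  have Mp: "z [^] (n::nat) : M" if "z : M" for z n
    using that subgroup.m_closed[OF M] subgroup.one_closed[OF M] by (induction n) auto
  obtain w where w: "w : M" "q (w [^] (u ^ r)) = q (x [^] (v ^ r))" using div[OF Mp[OF Suc.prems(1)], of "u ^ r"] u by auto
  have wk: "w : nb A (k + int r)" by (rule Suc.IH[OF Suc.prems(1) w Suc.prems(4)])
  have c3: "w : carrier G" "x : carrier G" "y : carrier G" using Mc w Suc.prems by auto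
  have "q ((y [^] u) [^] (u ^ r)) = q (x [^] (v ^ Suc r))" using Suc.prems(3) c3 by (simp add: nat_pow_pow)
  also have "\<dots> = q ((x [^] (v ^ r)) [^] v)" using c3 by (simp add: nat_pow_pow mult.commute)
  also have "\<dots> = q (x [^] (v ^ r)) [^]\<^bsub>G Mod A\<^esub> v" using c3 by (simp add: q_pow)
  also have "\<dots> = q (w [^] (u ^ r)) [^]\<^bsub>G Mod A\<^esub> v" using w(2) by simp
  also have "\<dots> = q ((w [^] v) [^] (u ^ r))" using c3 by (simp add: q_pow nat_pow_pow mult.commute)
  finally have "q ((y [^] u) [^] (u ^ r)) = q ((w [^] v) [^] (u ^ r))" .
  then have "q (y [^] u) = q (w [^] v)"
    by (rule roots[OF Mp[OF Suc.prems(2)] Mp[OF w(1)], rotated]) (use u in simp)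
  then have "y : nb A (k + int r + 1)" using c w(1) Suc.prems(2) wk unfolding contr_def by blast
  then show ?case by (simp add: algebra_simps)
qed

end

subsection \<open>Central torsion-free subgroups of finite index\<close>

context group
begin

text \<open>Schur's transfer into a central subgroup, built from the cosets of \<open>Z\<close> that
  \<open>\<Gamma>\<close> meets. The element \<open>w g C\<close> measures how far \<open>g\<close>
  moves the representative of \<open>C\<close> from that of its image; as \<open>Z\<close> is
  abelian, the product over all cosets is multiplicative in \<open>g\<close>.\<close>

lemma transfer:
  assumes Z: "subgroup Z G" and \<Gamma>: "subgroup \<Gamma> G"
    and cen: "!!z g. z : Z ==> g : carrier G ==> z \<otimes> g = g \<otimes> z"
    and fin: "finite ((%g. Z #> g) ` \<Gamma>)"
  obtains \<theta> n where "n > (0::nat)" "ALL g:\<Gamma>. \<theta> g : Z" "ALL g:\<Gamma>. ALL h:\<Gamma>. \<theta> (g \<otimes> h) = \<theta> g \<otimes> \<theta> h"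
    "ALL z:Z \<inter> \<Gamma>. \<theta> z = z [^] n"
proof -
  define D where "D = (%g. Z #> g) ` \<Gamma>"
  note Zc = subgroup.mem_carrier[OF Z] and \<Gamma>c = subgroup.mem_carrier[OF \<Gamma>]
  note Zm = subgroup.m_closed[OF Z] and Zi = subgroup.m_inv_closed[OF Z]
  note \<Gamma>m = subgroup.m_closed[OF \<Gamma>] and \<Gamma>i = subgroup.m_inv_closed[OF \<Gamma>]
  note eqI = rcos_eq_iff[OF Z]
  have "ALL C:D. EX g. g : \<Gamma> & C = Z #> g" unfolding D_def by blast
  from bchoice[OF this] obtain r where "ALL C:D. r C : \<Gamma> & C = Z #> r C" ..
  then have r: "!!C. C : D ==> r C : \<Gamma>" "!!C. C : D ==> Z #> r C = C" by auto
  define act where "act g C = Z #> (g \<otimes> r C)" for g C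
  have actD: "act g C : D" if "g : \<Gamma>" "C : D" for g C
    unfolding act_def D_def using that r(1) \<Gamma>m by blast
  define w where "w g C = g \<otimes> r C \<otimes> inv (r (act g C))" for g C
  have rc: "r C : carrier G" if "C : D" for C using r(1)[OF that] \<Gamma>c by blast
  have wZ: "w g C : Z" if g: "g : \<Gamma>" and C: "C : D" for g C
  proof -
    have "Z #> (g \<otimes> r C) = Z #> r (act g C)" using r(2)[OF actD[OF g C]] unfolding act_def by simp
    then show ?thesis unfolding w_def using eqI \<Gamma>c[OF g] rc[OF C] rc[OF actD[OF g C]] by simp
  qed
  have move: "g \<otimes> r C = w g C \<otimes> r (act g C)" if "g : \<Gamma>" "C : D" for g C
    unfolding w_def using \<Gamma>c[OF that(1)] rc[OF that(2)] rc[OF actD[OF that]] by (simp add: m_assoc)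
  have act_mult: "act (g \<otimes> h) C = act g (act h C)" "w (g \<otimes> h) C = w g (act h C) \<otimes> w h C"
    if g: "g : \<Gamma>" and h: "h : \<Gamma>" and C: "C : D" for g h C
  proof -
    define C1 C2 where "C1 = act h C" and "C2 = act g C1"
    have C12: "C1 : D" "C2 : D" using actD g h C unfolding C1_def C2_def by auto
    have wz: "w h C : Z" "w g C1 : Z" using wZ g h C C12 by auto
    note c = \<Gamma>c[OF g] \<Gamma>c[OF h] rc[OF C] rc[OF C12(1)] rc[OF C12(2)] Zc[OF wz(1)] Zc[OF wz(2)]
    have m1: "h \<otimes> r C = w h C \<otimes> r C1" using move[OF h C] by (simp add: C1_def)
    have m2: "g \<otimes> r C1 = w g C1 \<otimes> r C2" using move[OF g C12(1)] by (simp add: C2_def)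
    have "g \<otimes> h \<otimes> r C = g \<otimes> w h C \<otimes> r C1" using m1 c by (simp add: m_assoc)
    also have "g \<otimes> w h C = w h C \<otimes> g" using cen[OF wz(1) c(1)] by simp
    also have "w h C \<otimes> g \<otimes> r C1 = w h C \<otimes> w g C1 \<otimes> r C2" using m2 c by (simp add: m_assoc)
    also have "w h C \<otimes> w g C1 = w g C1 \<otimes> w h C" using cen[OF wz(1) c(7)] .
    finally have eq: "g \<otimes> h \<otimes> r C = w g C1 \<otimes> w h C \<otimes> r C2" .
    have "act (g \<otimes> h) C = Z #> r C2"
      unfolding act_def using eq eqI[of "g \<otimes> h \<otimes> r C" "r C2"] c Zm[OF wz(2,1)] by (simp add: m_assoc)
    then have a: "act (g \<otimes> h) C = C2" using r(2) C12 by simp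
    then show "act (g \<otimes> h) C = act g (act h C)" by (simp add: C2_def C1_def)
    show "w (g \<otimes> h) C = w g (act h C) \<otimes> w h C"
      unfolding w_def[of "g \<otimes> h"] a eq using c by (simp add: m_assoc flip: C1_def)
  qed
  interpret A: comm_group "G\<lparr>carrier := Z\<rparr>"
    by (rule group.group_comm_groupI[OF subgroup_imp_group[OF Z]]) (use cen Zc in simp)
  define \<theta> where "\<theta> g = finprod (G\<lparr>carrier := Z\<rparr>) (w g) D" for g
  have \<theta>Z: "\<theta> g : Z" if "g : \<Gamma>" for g
    using A.finprod_closed[of "w g" D] wZ[OF that] unfolding \<theta>_def by auto
  have inj: "inj_on (act h) D" if h: "h : \<Gamma>" for h
  proof (rule inj_on_inverseI)
    fix C assume C: "C : D"
    have "act (inv h) (act h C) = act (inv h \<otimes> h) C" using act_mult(1)[OF \<Gamma>i[OF h] h C] by simp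
    then show "act (inv h) (act h C) = C" using \<Gamma>c[OF h] rc[OF C] r(2)[OF C] by (simp add: act_def)
  qed
  have img: "act h ` D = D" if h: "h : \<Gamma>" for h
    using endo_inj_surj[OF fin[folded D_def] _ inj[OF h]] actD[OF h] by blast
  have \<theta>m: "\<theta> (g \<otimes> h) = \<theta> g \<otimes> \<theta> h" if g: "g : \<Gamma>" and h: "h : \<Gamma>" for g h
  proof -
    have "\<theta> (g \<otimes> h) = finprod (G\<lparr>carrier := Z\<rparr>) (%C. w g (act h C) \<otimes>\<^bsub>G\<lparr>carrier := Z\<rparr>\<^esub> w h C) D"
      unfolding \<theta>_def by (rule A.finprod_cong') (use act_mult(2)[OF g h] wZ g h actD Zm in auto)
    also have "\<dots> = finprod (G\<lparr>carrier := Z\<rparr>) (%C. w g (act h C)) D \<otimes> finprod (G\<lparr>carrier := Z\<rparr>) (w h) D"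
      by (subst A.finprod_multf) (use wZ g h actD in auto)
    also have "finprod (G\<lparr>carrier := Z\<rparr>) (%C. w g (act h C)) D = finprod (G\<lparr>carrier := Z\<rparr>) (w g) (act h ` D)"
      by (rule A.finprod_reindex[symmetric, OF _ inj[OF h]]) (use wZ g h actD in auto)
    finally show ?thesis unfolding img[OF h] \<theta>_def .
  qed
  have \<theta>z: "\<theta> z = z [^] card D" if z: "z : Z" "z : \<Gamma>" for z
  proof -
    have "w z C = z" if C: "C : D" for C
    proof -
      have "act z C = C"
        unfolding act_def using eqI[of "z \<otimes> r C" "r C"] Zc[OF z(1)] rc[OF C] r(2)[OF C] z(1) by (simp add: m_assoc)
      then show ?thesis unfolding w_def using Zc[OF z(1)] rc[OF C] by (simp add: m_assoc)
    qed
    then have "\<theta> z = finprod (G\<lparr>carrier := Z\<rparr>) (%C. z) D"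
      unfolding \<theta>_def by (intro A.finprod_cong') (use z in auto)
    also have "\<dots> = z [^]\<^bsub>G\<lparr>carrier := Z\<rparr>\<^esub> card D" by (rule A.finprod_const) (use z in simp)
    finally show ?thesis using nat_pow_consistent by metis
  qed
  have "card D > 0" using fin subgroup.one_closed[OF \<Gamma>] unfolding D_def card_gt_0_iff by blast
  then show thesis by (rule that) (use \<theta>Z \<theta>m \<theta>z in auto)
qed

text \<open>The transfer maps to a torsion-free group, so it kills \<open>x\<close>,
  \<open>y\<close> and their product. On the central element \<open>(x \<otimes> y) [^] e\<close> it
  is a positive power, so this element is torsion in \<open>Z\<close> and hence trivial.\<close>

lemma torsion_product:
  assumes Z: "subgroup Z G" and cen: "!!z g. z : Z ==> g : carrier G ==> z \<otimes> g = g \<otimes> z"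
    and tf: "!!z n. z : Z ==> n > 0 ==> z [^] (n::nat) = \<one> ==> z = \<one>"
    and xy: "x : carrier G" "y : carrier G" and e: "e > 0" "x [^] (e::nat) = \<one>" "y [^] e = \<one>"
    and xyZ: "(x \<otimes> y) [^] e : Z" and fin: "finite ((%g. Z #> g) ` generate G {x, y})"
  shows "(x \<otimes> y) [^] e = \<one>"
proof -
  have \<Gamma>: "subgroup (generate G {x, y}) G" by (rule generate_is_subgroup) (use xy in simp)
  note \<Gamma>m = subgroup.m_closed[OF \<Gamma>]
  obtain \<theta> n where \<theta>: "n > (0::nat)" "ALL g:generate G {x, y}. \<theta> g : Z"
    "ALL g:generate G {x, y}. ALL h:generate G {x, y}. \<theta> (g \<otimes> h) = \<theta> g \<otimes> \<theta> h"
    "ALL z:Z \<inter> generate G {x, y}. \<theta> z = z [^] n"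
    by (rule transfer[OF Z \<Gamma> cen fin])
  note Zc = subgroup.mem_carrier[OF Z]
  have one: "\<theta> \<one> = \<one>" using \<theta>(4) subgroup.one_closed[OF Z] subgroup.one_closed[OF \<Gamma>] by simp
  have pow: "g [^] i : generate G {x, y} & \<theta> (g [^] i) = \<theta> g [^] i" if "g : generate G {x, y}" for g and i :: nat
    using that one \<Gamma>m \<theta>(3) subgroup.one_closed[OF \<Gamma>] by (induction i) auto
  have in\<Gamma>: "x : generate G {x, y}" "y : generate G {x, y}" by (auto intro: generate.incl)
  have triv: "\<theta> g = \<one>" if "g : generate G {x, y}" "g [^] e = \<one>" for g
    using tf[OF _ e(1)] \<theta>(2) pow[OF that(1), of e] that one by simp
  have "\<theta> (x \<otimes> y) = \<one>" using \<theta>(3) in\<Gamma> triv[OF in\<Gamma>(1) e(2)] triv[OF in\<Gamma>(2) e(3)] by simp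
  then have "\<theta> ((x \<otimes> y) [^] e) = \<one>" using pow[OF \<Gamma>m[OF in\<Gamma>], of e] by simp
  moreover have "\<theta> ((x \<otimes> y) [^] e) = ((x \<otimes> y) [^] e) [^] n" using \<theta>(4) xyZ conjunct1[OF pow[OF \<Gamma>m[OF in\<Gamma>], of e]] by blast
  ultimately show ?thesis using tf[OF xyZ \<theta>(1)] by simp
qed

lemma finite_image_factor:
  assumes "finite (f ` S)" "!!u w. u : S ==> w : S ==> f u = f w ==> g u = g w" shows "finite (g ` S)"
proof -
  have "g ` S <= (%C. g (inv_into S f C)) ` f ` S"
  proof
    fix c assume "c : g ` S"
    then obtain s where s: "s : S" "c = g s" by blast
    have "g (inv_into S f (f s)) = g s"
      by (rule assms(2)) (use s inv_into_into[of "f s" f S] f_inv_into_f[of "f s" f S] in auto)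
    then show "c : (%C. g (inv_into S f C)) ` f ` S" using s by (metis image_eqI)
  qed
  then show ?thesis using assms(1) finite_surj by blast
qed

end

context contraction_balls
begin

subsection \<open>Central extensions\<close>

text \<open>Unique roots and divisibility lift because powers split over a central factor. For
  contraction, the quotient controls an element only up to a factor in \<open>Z\<close>;
  \<open>chain\<close> follows that factor along with the small one, and the contraction of
  \<open>Z\<close> absorbs the discrepancies between the small factors.\<close>

lemma good_extension:
  assumes Z: "cn Z" and II: "typeII Z" and gZ: "good Z (carrier G)"
  shows "good {\<one>} (carrier G)"
proof -
  interpret qZ: contraction_quotient G a K Z by unfold_locales (rule Z)
  interpret q1: contraction_quotient G a K "{\<one>}" by unfold_locales (rule cn_trivial)
  note Zs = cn_cas[OF Z]
  note Zc = cas_carrier[OF Zs] and Zsub = cas_subgroup[OF Zs]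
  have cen: "g \<otimes> z = z \<otimes> g" if "g : carrier G" "z : Z" for g z using II that unfolding typeII_def by blast
  have g1: "good {\<one>} Z" using II unfolding typeII_def by blast
  have Zp: "z [^] (n::nat) : Z" if "z : Z" for z n using cas_pow[OF Zs that] .
  have Zr: "z = w" if "z : Z" "w : Z" "n > 0" "z [^] (n::nat) = w [^] n" for z w n
  proof -
    have "{\<one>} #> z = {\<one>} #> w" by (rule good_roots[OF g1 that(1-3)]) (simp only: that(4))
    then show ?thesis using that Zc by (simp add: trivial_coset)
  qed
  have Zd: "EX w:Z. w [^] (n::nat) = z" if zn: "z : Z" "n > 0" for z n
  proof -
    obtain w where "w : Z" "{\<one>} #> w [^] n = {\<one>} #> z" using good_div[OF g1 zn] by blast
    then show ?thesis using zn Zc by (intro bexI[of _ w]) (simp_all add: trivial_coset)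
  qed
  have pm: "(z \<otimes> x) [^] (n::nat) = z [^] n \<otimes> x [^] n" if "z : Z" "x : carrier G" for z x n
    using pow_mult_distrib[OF cen[OF that(2,1), symmetric] Zc[OF that(1)] that(2)] .
  have roots: "x = y" if xy: "x : carrier G" "y : carrier G" "n > 0" "x [^] (n::nat) = y [^] n" for x y n
  proof -
    have "Z #> x = Z #> y" by (rule good_roots[OF gZ xy(1-3)]) (simp only: xy(4))
    then have "x \<otimes> inv y : Z" using qZ.q_eq xy(1,2) by blast
    moreover have "x = (x \<otimes> inv y) \<otimes> y" using xy(1,2) by (simp add: m_assoc)
    ultimately obtain z where z: "z : Z" "x = z \<otimes> y" by blast
    have "z [^] n \<otimes> y [^] n = y [^] n" using pm[OF z(1) xy(2), of n] xy(4) z(2) by simp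
    then have "z [^] n = \<one> [^] n" using r_cancel_one[of "y [^] n" "z [^] n"] xy(2) Zc[OF z(1)] by simp
    then have "z = \<one>" by (rule Zr[OF z(1) cas_one[OF Zs] xy(3)])
    then show ?thesis using z(2) xy(2) by simp
  qed
  have div: "EX y:carrier G. y [^] (n::nat) = x" if x: "x : carrier G" "n > 0" for x n
  proof -
    obtain y where y: "y : carrier G" "Z #> y [^] n = Z #> x" using good_div[OF gZ x] by blast
    then have "x \<otimes> inv (y [^] n) : Z" using qZ.q_eq[of x "y [^] n"] x by simp
    then obtain w where w: "w : Z" "w [^] n = x \<otimes> inv (y [^] n)" using Zd x(2) by blast
    have "(w \<otimes> y) [^] n = x" using pm[OF w(1) y(1), of n] w(2) x y(1) by (simp add: m_assoc)
    then show ?thesis using w(1) Zc y(1) by blast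
  qed
  obtain m1 where m1: "m1 > 0" "ALL m>0. m1 dvd m --> (EX p>0. contr {\<one>} ((m + 1) ^ p) (m ^ p) Z)"
    using good_contr[OF g1] by blast
  obtain m2 where m2: "m2 > 0" "ALL m>0. m2 dvd m --> (EX p>0. contr Z ((m + 1) ^ p) (m ^ p) (carrier G))"
    using good_contr[OF gZ] by blast
  have "EX p>0. contr {\<one>} ((m + 1) ^ p) (m ^ p) (carrier G)" if m: "m > 0" "m1 * m2 dvd m" for m
  proof -
    have "m1 dvd m" "m2 dvd m" using m(2) dvd_mult_left dvd_mult_right by blast+
    then obtain p1 p2 where p: "p1 > 0" "contr {\<one>} ((m + 1) ^ p1) (m ^ p1) Z"
      "p2 > 0" "contr Z ((m + 1) ^ p2) (m ^ p2) (carrier G)" using m1(2) m2(2) m(1) by blast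
    \<comment> \<open>The factor 2 lets \<open>Z\<close> gain two scales per round while one is used
      modulo \<open>Z\<close>; the surplus pays for one multiplication in
      \<open>chain\<close>.\<close>
    define P where "P = p1 * (2 * p2)"
    define u v where "u = (m + 1) ^ P" and "v = m ^ P"
    have u: "u > 0" by (simp add: u_def)
    have uZ: "((m + 1) ^ p1) ^ (2 * p2) = u" "(m ^ p1) ^ (2 * p2) = v"
      unfolding u_def v_def P_def by (simp_all only: power_mult)
    have uG: "((m + 1) ^ p2) ^ (2 * p1) = u" "(m ^ p2) ^ (2 * p1) = v"
      unfolding u_def v_def P_def by (simp_all only: mult.commute mult.left_commute flip: power_mult)
    have conZ: "w : B (k + 2)" if zw: "z : Z" "w : Z" "w [^] u = z [^] v" "z : B k" for z w k
    proof -
      have "w : nb {\<one>} (k + int (2 * p2))"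
      proof (rule q1.contr_power[OF Zsub _ _ p(2)])
        show "{\<one>} #> x = {\<one>} #> y" if "x : Z" "y : Z" "n > 0" "{\<one>} #> x [^] (n::nat) = {\<one>} #> y [^] n" for x y n
          by (rule good_roots[OF g1 that])
        show "EX y:Z. {\<one>} #> y [^] (n::nat) = {\<one>} #> x" if "x : Z" "n > 0" for x n
          by (rule good_div[OF g1 that])
        show "{\<one>} #> w [^] (((m + 1) ^ p1) ^ (2 * p2)) = {\<one>} #> z [^] ((m ^ p1) ^ (2 * p2))"
          unfolding uZ using zw by simp
      qed (use zw in \<open>auto simp: nb_trivial\<close>)
      then have "w : B (k + int (2 * p2))" unfolding nb_trivial .
      then show ?thesis by (rule B_monoD) (use p(3) in simp)
    qed
    have conG: "y : nb Z (k + 1)" if xy: "x : carrier G" "y : carrier G" "y [^] u = x [^] v" "x : nb Z k" for x y k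
    proof -
      have "y : nb Z (k + int (2 * p1))"
      proof (rule qZ.contr_power[OF subgroup_self _ _ p(4)])
        show "Z #> x = Z #> y" if "x : carrier G" "y : carrier G" "n > 0" "Z #> x [^] (n::nat) = Z #> y [^] n" for x y n
          by (rule good_roots[OF gZ that])
        show "EX y:carrier G. Z #> y [^] (n::nat) = Z #> x" if "x : carrier G" "n > 0" for x n
          by (rule good_div[OF gZ that])
        show "Z #> y [^] (((m + 1) ^ p2) ^ (2 * p1)) = Z #> x [^] ((m ^ p2) ^ (2 * p1))"
          unfolding uG using xy by simp
      qed (use xy in auto)
      then show ?thesis by (rule subsetD[OF nb_mono, rotated]) (use p(1) in simp)
    qed
    have "!!z. z : Z ==> z [^] u = \<one> ==> z = \<one>" using Zr[of _ \<one> u] cas_one[OF Zs] u by simp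
    then obtain N :: nat where N: "ALL k. ALL z:Z. z [^] u : B (k + int N) --> z : B k" using pow_proper[OF Zs] by blast
    \<comment> \<open>Forming and comparing powers of the small factors loses
      \<open>v + u + 1\<close> scales, and taking a \<open>u\<close>-th root in \<open>Z\<close>
      loses \<open>N\<close> more. This lag stays fixed while the scale grows with
      \<open>i\<close>.\<close>
    define c where "c = v + u + 1 + N"
    have chain: "EX \<zeta> b. \<zeta> : Z & \<zeta> : B (k + int i - int c - 2) & b : B (k + int i) & z = \<zeta> \<otimes> b"
      if x: "x : carrier G" "x : B k" and z: "z : carrier G" "z [^] (u ^ i) = x [^] (v ^ i)" for x k z i
      using z
    proof (induction i arbitrary: z)
      case 0
      then have "z = \<one> \<otimes> x" using x by simp
      then show ?case using x cas_one[OF Zs] by (intro exI[of _ \<one>] exI[of _ x]) auto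
    next
      case (Suc i)
      obtain w where w: "w : carrier G" "w [^] (u ^ i) = x [^] (v ^ i)" using div[of "x [^] (v ^ i)" "u ^ i"] x u by auto
      obtain \<zeta> b where b: "\<zeta> : Z" "\<zeta> : B (k + int i - int c - 2)" "b : B (k + int i)" "w = \<zeta> \<otimes> b"
        using Suc.IH[OF w] by blast
      have "(z [^] u) [^] (u ^ i) = x [^] (v ^ Suc i)" using Suc.prems by (simp add: nat_pow_pow)
      also have "\<dots> = (x [^] (v ^ i)) [^] v" using x by (simp add: nat_pow_pow mult.commute)
      also have "\<dots> = (w [^] v) [^] (u ^ i)" using w by (simp add: nat_pow_pow mult.commute flip: w(2))
      finally have zw: "z [^] u = w [^] v" using roots[of "z [^] u" "w [^] v" "u ^ i"] Suc.prems(1) w(1) u by simp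
      have "w : nb Z (k + int i)" unfolding b(4) by (rule nbI[OF b(1,3)])
      then have "z : nb Z (k + int i + 1)" by (rule conG[OF w(1) Suc.prems(1) zw])
      then obtain \<zeta>' b' where b': "\<zeta>' : Z" "b' : B (k + int i + 1)" "z = \<zeta>' \<otimes> b'" by (rule nbE)
      obtain \<eta> where \<eta>: "\<eta> : Z" "\<eta> [^] u = \<zeta> [^] v" using Zd[OF Zp[OF b(1)] u] by blast
      have \<eta>B: "\<eta> : B (k + int i - int c)" using conZ[OF b(1) \<eta>(1) \<eta>(2) b(2)] by simp
      note cc = Zc[OF b(1)] Zc[OF b'(1)] Zc[OF \<eta>(1)] B_carrier[OF b(3)] B_carrier[OF b'(2)]
      have eq: "\<zeta>' [^] u \<otimes> b' [^] u = \<zeta> [^] v \<otimes> b [^] v"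
        using zw unfolding b'(3) b(4) pm[OF b'(1) cc(5)] pm[OF b(1) cc(4)] .
      have "\<zeta>' [^] u = \<zeta> [^] v \<otimes> b [^] v \<otimes> inv (b' [^] u)"
        using eq cc by (metis inv_solve_right m_closed nat_pow_closed)
      then have eq2: "inv (\<zeta> [^] v) \<otimes> \<zeta>' [^] u = b [^] v \<otimes> inv (b' [^] u)" using cc by (simp add: m_assoc)
      have i\<eta>: "inv \<eta> : Z" using cas_inv[OF Zs \<eta>(1)] .
      have "(inv \<eta> \<otimes> \<zeta>') [^] u = b [^] v \<otimes> inv (b' [^] u)"
        using pm[OF i\<eta> cc(2), of u] nat_pow_inv[OF cc(3), of u] \<eta>(2) eq2 by simp
      moreover have "b [^] v \<otimes> inv (b' [^] u) : B (k + int i - int v - int u - 1)"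
        by (rule B_mult'[OF B_pow[OF b(3), of v] B_inv[OF B_pow[OF b'(2), of u]]]) auto
      ultimately have "inv \<eta> \<otimes> \<zeta>' : B (k + int i - int c)"
        using N cas_mult[OF Zs i\<eta> b'(1)] by (simp add: c_def algebra_simps)
      then have "\<eta> \<otimes> (inv \<eta> \<otimes> \<zeta>') : B (k + int i - int c - 1)" using B_mult'[OF \<eta>B] by simp
      then have "\<zeta>' : B (k + int (Suc i) - int c - 2)" using cc by (simp add: algebra_simps)
      moreover have "b' : B (k + int (Suc i))" using b'(2) by (simp add: algebra_simps)
      ultimately show ?case using b'(1,3) by blast
    qed
    \<comment> \<open>The central factor lags by \<open>c + 2\<close>. After \<open>c + 4\<close>
      rounds it lies in \<open>B (k + 2)\<close>, which is just enough for the product to lie in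
      \<open>B (k + 1)\<close>.\<close>
    have "contr {\<one>} (u ^ (c + 4)) (v ^ (c + 4)) (carrier G)"
      unfolding contr_def nb_trivial
    proof (intro allI ballI impI)
      fix k x y assume xy: "x : carrier G" "y : carrier G" "{\<one>} #> y [^] (u ^ (c + 4)) = {\<one>} #> x [^] (v ^ (c + 4))" "x : B k"
      then have "y [^] (u ^ (c + 4)) = x [^] (v ^ (c + 4))" by (simp add: trivial_coset)
      from chain[OF xy(1,4,2) this] obtain \<zeta> b where
        "\<zeta> : B (k + int (c + 4) - int c - 2)" "b : B (k + int (c + 4))" "y = \<zeta> \<otimes> b" by blast
      then show "y : B (k + 1)" using B_mult'[of \<zeta> _ b _ "k + 1"] by simp
    qed
    then have "contr {\<one>} ((m + 1) ^ (P * (c + 4))) (m ^ (P * (c + 4))) (carrier G)"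
      unfolding u_def v_def power_mult .
    moreover have "P * (c + 4) > 0" using p by (simp add: P_def)
    ultimately show ?thesis by blast
  qed
  moreover have "m1 * m2 > 0" using m1 m2 by simp
  moreover have "ALL x:carrier G. ALL y:carrier G. ALL n>0. {\<one>} #> x [^] (n::nat) = {\<one>} #> y [^] n --> {\<one>} #> x = {\<one>} #> y"
    using roots by (simp add: trivial_coset)
  moreover have "ALL x:carrier G. ALL n>0. EX y:carrier G. {\<one>} #> y [^] (n::nat) = {\<one>} #> x"
  proof (intro ballI allI impI)
    fix x and n :: nat assume "x : carrier G" "n > 0"
    then obtain y where "y : carrier G" "y [^] n = x" using div by blast
    then show "EX y:carrier G. {\<one>} #> y [^] (n::nat) = {\<one>} #> x" by blast
  qed
  ultimately show ?thesis unfolding good_def by blast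
qed

subsection \<open>The torsion subgroup\<close>

text \<open>The normal subgroups \<open>J\<close> that are to be excluded are those for which \<open>J / S\<close> is of
  \<open>typeI\<close>.\<close>

definition no_torsion_above :: "'a set => bool" where
  "no_torsion_above S \<longleftrightarrow> (ALL J. cn J --> S <= J --> (EX e>0. ALL x:J. x [^] (e::nat) : S) -->
     (ALL x:J. ALL y:J. finite ((%z. S #> z) ` generate G {x, y})) --> J = S)"

end

context contraction_quotient2
begin

text \<open>The elements of \<open>J\<close> that are torsion over \<open>A\<close> form a set
  \<open>X\<close>, closed under products by \<open>torsion_product\<close> in
  \<open>G Mod A\<close>. The hypothesis on \<open>A\<close> gives \<open>X = A\<close>, and
  divisibility of \<open>D\<close> modulo \<open>A\<close> corrects each element of \<open>J\<close>
  by an element of \<open>D\<close> into \<open>X\<close>.\<close>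

lemma no_torsion_extension:
  assumes II: "Q.typeII (q ` D)" and no: "no_torsion_above A"
  shows "no_torsion_above D"
  unfolding no_torsion_above_def
proof (intro allI impI)
  fix J assume J: "cn J" "D <= J" "EX e>0. ALL x:J. x [^] (e::nat) : D"
    and fin: "ALL x:J. ALL y:J. finite ((%z. D #> z) ` generate G {x, y})"
  obtain e :: nat where e: "e > 0" "ALL x:J. x [^] e : D" using J(3) by blast
  note Js = cn_cas[OF J(1)]
  note Jc = cas_carrier[OF Js]
  have cen: "q x \<otimes>\<^bsub>G Mod A\<^esub> q d = q d \<otimes>\<^bsub>G Mod A\<^esub> q x" if "x : carrier G" "d : D" for x d
    using II that unfolding Q.typeII_def carrier_Q by blast
  have g1: "Q.good {\<one>\<^bsub>G Mod A\<^esub>} (q ` D)" using II unfolding Q.typeII_def by blast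
  have Ddiv: "EX w:D. q (w [^] (n::nat)) = q d" if dn: "d : D" "n > 0" for d n
  proof -
    have "q d : q ` D" using dn(1) by blast
    from Q.good_div[OF g1 this dn(2)] obtain w where
      "w : D" "{\<one>\<^bsub>G Mod A\<^esub>} #>\<^bsub>G Mod A\<^esub> (q w [^]\<^bsub>G Mod A\<^esub> n) = {\<one>\<^bsub>G Mod A\<^esub>} #>\<^bsub>G Mod A\<^esub> q d" by blast
    then show ?thesis using D_carrier dn by (intro bexI[of _ w]) (simp_all add: Q.trivial_coset q_pow)
  qed
  have Dtf: "Z = \<one>\<^bsub>G Mod A\<^esub>" if Z: "Z : q ` D" "n > 0" "Z [^]\<^bsub>G Mod A\<^esub> (n::nat) = \<one>\<^bsub>G Mod A\<^esub>" for Z n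
  proof -
    have "\<one>\<^bsub>G Mod A\<^esub> : q ` D" unfolding q_one[symmetric] using cas_one[OF casD] by blast
    moreover have "{\<one>\<^bsub>G Mod A\<^esub>} #>\<^bsub>G Mod A\<^esub> (Z [^]\<^bsub>G Mod A\<^esub> n) = {\<one>\<^bsub>G Mod A\<^esub>} #>\<^bsub>G Mod A\<^esub> (\<one>\<^bsub>G Mod A\<^esub> [^]\<^bsub>G Mod A\<^esub> n)"
      using Z(3) by simp
    ultimately have "{\<one>\<^bsub>G Mod A\<^esub>} #>\<^bsub>G Mod A\<^esub> Z = {\<one>\<^bsub>G Mod A\<^esub>} #>\<^bsub>G Mod A\<^esub> \<one>\<^bsub>G Mod A\<^esub>"
      by (rule Q.good_roots[OF g1 Z(1) _ Z(2)])
    moreover have "Z : carrier (G Mod A)" using Z(1) D_carrier by auto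
    ultimately show ?thesis by (simp add: Q.trivial_coset)
  qed
  have Dtf': "d : A" if "d : D" "n > 0" "d [^] (n::nat) : A" for d n
    using Dtf[of "q d" n] that q_eq_one D_carrier by (simp add: q_pow)
  define X where "X = {x : J. x [^] e : A}"
  have Xone: "q x [^]\<^bsub>G Mod A\<^esub> e = \<one>\<^bsub>G Mod A\<^esub>" "x : carrier G" "x : J" if "x : X" for x
    using that q_eq_one Jc by (simp_all add: X_def q_pow)
  have XI: "x : X" if "x : J" "q x [^]\<^bsub>G Mod A\<^esub> e = \<one>\<^bsub>G Mod A\<^esub>" for x
    using that q_eq_one Jc by (simp add: X_def q_pow)
  have gen: "generate (G Mod A) {q x, q y} = q ` generate G {x, y}" if "x : carrier G" "y : carrier G" for x y
  proof -
    interpret qh: group_hom G "G Mod A" q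
      by (rule group_hom.intro[OF is_group group_Q], unfold_locales) (auto simp: hom_def q_mult)
    show ?thesis using qh.generate_img[of "{x, y}"] that by simp
  qed
  have Xmult: "x \<otimes> y : X" if x: "x : X" and y: "y : X" for x y
  proof (rule XI)
    note xj = Xone(2,3)[OF x] and yj = Xone(2,3)[OF y]
    show xy: "x \<otimes> y : J" using cas_mult[OF Js xj(2) yj(2)] .
    have "(q x \<otimes>\<^bsub>G Mod A\<^esub> q y) [^]\<^bsub>G Mod A\<^esub> e = \<one>\<^bsub>G Mod A\<^esub>"
    proof (rule Q.torsion_product[OF Q.cas_subgroup[OF Q.cn_cas[OF Q_cn_image]] _ Dtf _ _ e(1) Xone(1)[OF x] Xone(1)[OF y]])
      show "z \<otimes>\<^bsub>G Mod A\<^esub> g = g \<otimes>\<^bsub>G Mod A\<^esub> z" if "z : q ` D" "g : carrier (G Mod A)" for z g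
        using that cen unfolding carrier_Q by auto
      have "q ((x \<otimes> y) [^] e) : q ` D" using e(2) xy by blast
      then show "(q x \<otimes>\<^bsub>G Mod A\<^esub> q y) [^]\<^bsub>G Mod A\<^esub> e : q ` D" using xj yj by (simp add: q_mult q_pow)
      have cos: "(q ` D) #>\<^bsub>G Mod A\<^esub> q z = q ` (D #> z)" if "z : carrier G" for z
        unfolding r_coset_def[of "G Mod A" "q ` D"] r_coset_def[of G D]
        using that D_carrier by (auto simp: q_mult image_iff)
      have gc: "z : carrier G" if "z : generate G {x, y}" for z
        using generate_in_carrier[of "{x, y}" z] that xj yj by simp
      have "(%g. (q ` D) #>\<^bsub>G Mod A\<^esub> g) ` generate (G Mod A) {q x, q y} = (`) q ` ((%z. D #> z) ` generate G {x, y})"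
        unfolding gen[OF xj(1) yj(1)] image_image by (rule image_cong) (use cos gc in auto)
      then show "finite ((%g. (q ` D) #>\<^bsub>G Mod A\<^esub> g) ` generate (G Mod A) {q x, q y})"
        using fin xj(2) yj(2) by simp
    qed (use xj yj in auto)
    then show "q (x \<otimes> y) [^]\<^bsub>G Mod A\<^esub> e = \<one>\<^bsub>G Mod A\<^esub>" using xj yj by (simp add: q_mult)
  qed
  have "cn X" unfolding cn_def cas_def
  proof (intro conjI allI ballI)
    show "subgroup X G"
    proof (rule subgroupI)
      show "X <= carrier G" using Xone by blast
      have "\<one> : X" using cas_one[OF Js] cas_one[OF casA] by (simp add: X_def)
      then show "X ~= {}" by blast
      show "inv x : X" if "x : X" for x
        using that cas_inv[OF Js] cas_inv[OF casA] Jc nat_pow_inv by (auto simp: X_def)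
      show "x \<otimes> y : X" if "x : X" "y : X" for x y using Xmult that by blast
    qed
    show "clo X"
    proof (rule cloI)
      show "X <= carrier G" using Xone by blast
      fix x assume x: "x : carrier G" and *: "!!k. EX b:B k. x \<otimes> b : X"
      have xJ: "x : J" by (rule cloD[OF cas_clo[OF Js] x]) (use * in \<open>auto simp: X_def\<close>)
      have "x [^] e : A"
      proof (rule cloD[OF cas_clo[OF casA]])
        fix k
        obtain l where l: "ALL b:B l. inv (x [^] e) \<otimes> (x \<otimes> b) [^] e : B k" using pow_continuous[OF x] by blast
        obtain b where b: "b : B l" "x \<otimes> b : X" using * by blast
        have "x [^] e \<otimes> (inv (x [^] e) \<otimes> (x \<otimes> b) [^] e) : A" using b x B_carrier by (simp add: X_def)
        then show "EX b:B k. x [^] e \<otimes> b : A" using l b(1) by blast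
      qed (use x in simp)
      then show "x : X" using xJ by (simp add: X_def)
    qed
    show "a k x : X" if "x : X" for x k
    proof -
      have "a k x [^] e = a k (x [^] e)" using a_pow that Jc by (simp add: X_def)
      then show ?thesis using that cas_a[OF Js] cas_a[OF casA] by (simp add: X_def)
    qed
    show "cj g x : X" if "g : carrier G" "x : X" for g x
    proof -
      have "cj g x [^] e = cj g (x [^] e)" using cj_pow that Jc by (simp add: X_def)
      then show ?thesis using that cn_cj[OF J(1)] cn_cj[OF cnA] by (simp add: X_def)
    qed
  qed
  moreover have "A <= X"
    using AD J(2) cas_pow[OF casA] by (auto simp: X_def)
  moreover have "EX e>0. ALL x:X. x [^] (e::nat) : A" using e(1) by (auto simp: X_def)
  moreover have "ALL x:X. ALL y:X. finite ((%z. A #> z) ` generate G {x, y})"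
  proof (intro ballI)
    fix x y assume xy: "x : X" "y : X"
    have gX: "generate G {x, y} <= X"
      by (rule generate_subgroup_incl) (use xy cas_subgroup[OF cn_cas[OF \<open>cn X\<close>]] in auto)
    \<comment> \<open>On \<open>X\<close> the coset of \<open>D\<close> determines that of
      \<open>A\<close>, since the quotient of \<open>D\<close> by \<open>A\<close> has no torsion.
      Finiteness over \<open>D\<close> therefore descends to \<open>A\<close>.\<close>
    show "finite ((%z. A #> z) ` generate G {x, y})"
    proof (rule finite_image_factor)
      show "finite ((%z. D #> z) ` generate G {x, y})" using fin xy Xone(3) by blast
      fix s w assume sw: "s : generate G {x, y}" "w : generate G {x, y}" "D #> s = D #> w"
      then have swX: "s : X" "w : X" using gX by auto
      have "s \<otimes> inv w : D" using rcos_eq_iff[OF cas_subgroup[OF casD]] sw(3) Xone(2) swX by blast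
      moreover have "(s \<otimes> inv w) [^] e : A"
        using cas_mult[OF cn_cas[OF \<open>cn X\<close>] swX(1) cas_inv[OF cn_cas[OF \<open>cn X\<close>] swX(2)]] by (simp add: X_def)
      ultimately have "s \<otimes> inv w : A" using Dtf' e(1) by blast
      then show "A #> s = A #> w" using q_eq Xone(2) swX by blast
    qed
  qed
  ultimately have XA: "X = A" using no unfolding no_torsion_above_def by blast
  have "J <= D"
  proof
    fix x assume x: "x : J"
    note xc = Jc[OF x]
    obtain w where w: "w : D" "q (w [^] e) = q (x [^] e)" using Ddiv[of "x [^] e" e] e x by blast
    note wc = D_carrier[OF w(1)]
    have "(q x \<otimes>\<^bsub>G Mod A\<^esub> q (inv w)) [^]\<^bsub>G Mod A\<^esub> e = q x [^]\<^bsub>G Mod A\<^esub> e \<otimes>\<^bsub>G Mod A\<^esub> q (inv w) [^]\<^bsub>G Mod A\<^esub> e"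
      by (rule Q.pow_mult_distrib[OF cen[OF xc cas_inv[OF casD w(1)]]]) (use xc wc in auto)
    also have "\<dots> = q (x [^] e) \<otimes>\<^bsub>G Mod A\<^esub> inv\<^bsub>G Mod A\<^esub> q (w [^] e)"
      using xc wc by (simp add: q_pow q_inv nat_pow_inv)
    also have "\<dots> = \<one>\<^bsub>G Mod A\<^esub>" using w(2) xc by simp
    finally have "x \<otimes> inv w : X"
      using XI[of "x \<otimes> inv w"] x w(1) J(2) cas_mult[OF Js] cas_inv[OF Js] xc wc by (auto simp: q_mult)
    then have "x \<otimes> inv w : D" using XA AD by blast
    then have "x \<otimes> inv w \<otimes> w : D" using cas_mult[OF casD _ w(1)] by blast
    then show "x : D" using xc wc by (simp add: m_assoc)
  qed
  then show "J = D" using J(2) by blast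
qed

lemma good_descend: assumes II: "Q.typeII (q ` D)" and g: "good D (carrier G)" shows "good A (carrier G)"
  using Q.good_extension[OF Q_cn_image II] g Q_good Q_good_trivial by simp

end

context contraction_balls
begin

text \<open>Maximality of \<open>R\<close> gives \<open>no_torsion_above R\<close>. Climbing from
  \<open>R\<close> through typed subgroups of quotients, this property rules out the torsion type at
  each level and survives each step of the other type; a maximal level can then only be
  \<open>carrier G\<close>.\<close>

theorem torsion_subgroup:
  obtains R e where "cn R" "e > (0::nat)" "ALL x:R. x [^] e = \<one>" "good R (carrier G)"
proof -
  define F where "F = {X. cn X & (EX e>0. ALL x:X. x [^] (e::nat) = \<one>)}"
  obtain R where R: "R : F" "ALL X. X : F --> R <= X --> X = R"
  proof -
    have 1: "!!X. X : F ==> cas X" using cn_cas by (auto simp: F_def)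
    have "{\<one>} : F" using cn_trivial by (auto simp: F_def intro!: exI[of _ 1])
    then have 2: "F ~= {}" by blast
    obtain M where "M : F" "!!X. X : F ==> M <= X ==> X = M" using cas_maximal[of F, OF 1 2] by blast
    then show thesis using that by blast
  qed
  obtain e :: nat where e: "e > 0" "ALL x:R. x [^] e = \<one>" and cnR: "cn R" using R(1) by (auto simp: F_def)
  have noR: "no_torsion_above R"
    unfolding no_torsion_above_def
  proof (intro allI impI)
    fix J assume J: "cn J" "R <= J" "EX f>0. ALL x:J. x [^] (f::nat) : R"
    obtain f :: nat where f: "f > 0" "ALL x:J. x [^] f : R" using J(3) by blast
    have "x [^] (f * e) = \<one>" if "x : J" for x
      using e(2) f(2) that cas_carrier[OF cn_cas[OF J(1)] that] by (simp flip: nat_pow_pow)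
    moreover have "f * e > 0" using e f by simp
    ultimately have "J : F" using J(1) unfolding F_def by blast
    then show "J = R" using R(2) J(2) by blast
  qed
  \<comment> \<open>The property \<open>good\<close> is carried as an implication: it is known only
    at the top, modulo \<open>carrier G\<close>, and flows back down to \<open>R\<close> from
    there.\<close>
  define E where "E = {S. cn S & R <= S & no_torsion_above S & (good S (carrier G) --> good R (carrier G))}"
  obtain S where S: "S : E" "ALL X. X : E --> S <= X --> X = S"
  proof -
    have 1: "!!X. X : E ==> cas X" using cn_cas by (auto simp: E_def)
    have 2: "E ~= {}" using cnR noR by (auto simp: E_def)
    obtain M where "M : E" "!!X. X : E ==> M <= X ==> X = M" using cas_maximal[of E, OF 1 2] by blast
    then show thesis using that by blast
  qed
  have SE: "cn S" "R <= S" "no_torsion_above S" "good S (carrier G) --> good R (carrier G)"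
    using S(1) by (auto simp: E_def)
  interpret qS: contraction_quotient G a K S by unfold_locales (rule SE(1))
  have "S = carrier G"
  proof (rule ccontr)
    assume "S ~= carrier G"
    then obtain x where x: "x : carrier G" "x ~: S" using qS.A_carrier by blast
    then have "S #> x ~= \<one>\<^bsub>G Mod S\<^esub>" using qS.q_eq_one by blast
    then have "carrier (G Mod S) ~= {\<one>\<^bsub>G Mod S\<^esub>}" using qS.q_closed[OF x(1)] by blast
    then obtain M where M: "qS.Q.cn M" "M ~= {\<one>\<^bsub>G Mod S\<^esub>}" "qS.Q.typeI M | qS.Q.typeII M"
      by (rule qS.Q.exists_typed)
    define D where "D = {x : carrier G. S #> x : M}"
    have cnD: "cn D" unfolding D_def by (rule qS.cn_preimage[OF M(1)])
    have one: "\<one>\<^bsub>G Mod S\<^esub> : M" using qS.Q.cas_one[OF qS.Q.cn_cas[OF M(1)]] .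
    have SD: "S <= D"
    proof
      fix x assume x: "x : S"
      have "S #> x = \<one>\<^bsub>G Mod S\<^esub>" using qS.q_eq_one[OF qS.A_carrier[OF x]] x by blast
      then have "S #> x : M" by (simp only: one)
      then show "x : D" using qS.A_carrier[OF x] by (simp add: D_def)
    qed
    have MD: "M = (%x. S #> x) ` D"
      using qS.Q.cas_carrier[OF qS.Q.cn_cas[OF M(1)]] unfolding D_def qS.carrier_Q by blast
    have DS: "D ~= S"
    proof
      assume "D = S"
      then have "M <= {\<one>\<^bsub>G Mod S\<^esub>}" using MD qS.q_eq_one qS.A_carrier by auto
      then show False using M(2) one by blast
    qed
    interpret q2: contraction_quotient2 G a K S D by unfold_locales (use cnD SD in auto)
    from M(3) show False
    proof
      assume I: "qS.Q.typeI M"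
      obtain f :: nat where f: "f > 0" "ALL X:M. X [^]\<^bsub>G Mod S\<^esub> f = \<one>\<^bsub>G Mod S\<^esub>"
        using I unfolding qS.Q.typeI_def by blast
      have "x [^] f : S" if x: "x : D" for x
      proof -
        note xc = q2.D_carrier[OF x]
        have "S #> x : M" using x MD by blast
        then have "S #> x [^] f = \<one>\<^bsub>G Mod S\<^esub>" using f(2) qS.q_pow[OF xc, of f] by simp
        then show ?thesis using qS.q_eq_one[of "x [^] f"] xc by simp
      qed
      then have 1: "EX f>0. ALL x:D. x [^] (f::nat) : S" using f(1) by blast
      have 2: "ALL x:D. ALL y:D. finite ((%z. S #> z) ` generate G {x, y})"
      proof (intro ballI)
        fix x y assume xy: "x : D" "y : D"
        interpret qh: group_hom G "G Mod S" "%x. S #> x"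
          by (rule group_hom.intro[OF is_group qS.group_Q], unfold_locales) (auto simp: hom_def qS.q_mult)
        have "generate (G Mod S) {S #> x, S #> y} = (%x. S #> x) ` generate G {x, y}"
          using qh.generate_img[of "{x, y}"] xy q2.D_carrier by simp
        moreover have "finite (generate (G Mod S) {S #> x, S #> y})"
          using I xy MD unfolding qS.Q.typeI_def by blast
        ultimately show "finite ((%z. S #> z) ` generate G {x, y})" by simp
      qed
      show False using SE(3) cnD SD 1 2 DS unfolding no_torsion_above_def by blast
    next
      assume II: "qS.Q.typeII M"
      have "no_torsion_above D" by (rule q2.no_torsion_extension[OF II[unfolded MD] SE(3)])
      moreover have "good D (carrier G) --> good R (carrier G)"
        using q2.good_descend[OF II[unfolded MD]] SE(4) by blast
      ultimately have "D : E" using cnD SE(2) SD by (auto simp: E_def)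
      then show False using S(2) SD DS by blast
    qed
  qed
  moreover have "good (carrier G) (carrier G)"
  proof -
    have eq: "carrier G #> x = carrier G #> y" if "x : carrier G" "y : carrier G" for x y
      using rcos_eq_iff[OF subgroup_self that] that by simp
    have nb: "x : nb (carrier G) k" if "x : carrier G" for x k using nb_self[OF cas_whole that] .
    have "contr (carrier G) u v (carrier G)" for u v unfolding contr_def using nb by blast
    then have con: "EX m0>0. ALL m>0. m0 dvd m --> (EX p>0. contr (carrier G) ((m + 1) ^ p) (m ^ p) (carrier G))"
      by (intro exI[of _ "1::nat"]) (auto intro!: exI[of _ "1::nat"])
    show ?thesis unfolding good_def
    proof (intro conjI ballI allI impI)
      fix x y assume "x : carrier G" "y : carrier G"
      then show "carrier G #> x = carrier G #> y" by (rule eq)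
    next
      fix x and n :: nat assume "x : carrier G"
      then have "carrier G #> \<one> [^] n = carrier G #> x" by (intro eq) simp_all
      moreover have "\<one> : carrier G" by simp
      ultimately show "EX y:carrier G. carrier G #> y [^] n = carrier G #> x" by blast
    qed (rule con)
  qed
  ultimately have "good R (carrier G)" using SE(4) by simp
  then show thesis using that cnR e by blast
qed

end

section \<open>Images of arbitrary continuous homomorphisms\<close>

context contraction_balls
begin

lemma torsion_in: assumes "cn R" "good R (carrier G)" "x : carrier G" "n > 0" "x [^] (n::nat) : R" shows "x : R"
proof -
  interpret contraction_quotient G a K R by unfold_locales (rule assms(1))
  have "q (x [^] n) = q (\<one> [^] n)" using q_eq_one[of "x [^] n"] assms(3,5) by (simp add: q_one)
  then have "q x = q \<one>" by (rule good_roots[OF assms(2,3) one_closed assms(4)])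
  then show ?thesis using q_eq_one[OF assms(3)] by (simp add: q_one)
qed

lemma good_contr_power:
  assumes "cn R" "good R (carrier G)" "contr R u v (carrier G)" "u > 0" "x : carrier G" "y : carrier G"
    "R #> y [^] (u ^ r) = R #> x [^] (v ^ r)" "x : nb R k"
  shows "y : nb R (k + int r)"
proof -
  interpret contraction_quotient G a K R by unfold_locales (rule assms(1))
  show ?thesis
    by (rule contr_power[OF subgroup_self _ _ assms(3-8)])
      (fact good_roots[OF assms(2)], fact good_div[OF assms(2)])
qed

text \<open>Modulo \<open>R\<close> there is no torsion by \<open>torsion_in\<close>, so
  \<open>pow_proper\<close> holds in the quotient. It bounds how much the inverse of the contracting
  power map can expand.\<close>

lemma good_pow_proper:
  assumes R: "cn R" and g: "good R (carrier G)" and v: "v > 0"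
  obtains c :: nat where "ALL k. ALL x:carrier G. ALL y:carrier G. R #> x [^] (v::nat) = R #> y [^] (u::nat) --> y : nb R (k + int c) --> x : nb R k"
proof -
  interpret contraction_quotient G a K R by unfold_locales (rule R)
  have tf: "X = \<one>\<^bsub>G Mod R\<^esub>" if X: "X : carrier (G Mod R)" "X [^]\<^bsub>G Mod R\<^esub> v = \<one>\<^bsub>G Mod R\<^esub>" for X
  proof -
    obtain x where x: "x : carrier G" "X = q x" using X(1) unfolding carrier_Q by blast
    then have "x [^] v : R" using X(2) q_eq_one[of "x [^] v"] by (simp add: q_pow)
    then show ?thesis using torsion_in[OF R g x(1) v] q_eq_one x by simp
  qed
  obtain N :: nat where N: "ALL k. ALL X:carrier (G Mod R). X [^]\<^bsub>G Mod R\<^esub> v : Q.B (k + int N) --> X : Q.B k"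
    using Q.pow_proper[OF Q.cas_whole tf] by blast
  have "x : nb R k" if xy: "x : carrier G" "y : carrier G" "q (x [^] v) = q (y [^] u)" "y : nb R (k + int (N + u))" for k x y
  proof -
    have "q y [^]\<^bsub>G Mod R\<^esub> u : Q.B (k + int (N + u) - int u)" by (rule Q.B_pow) (use xy q_B in simp)
    then have "q x [^]\<^bsub>G Mod R\<^esub> v : Q.B (k + int N)" using xy by (simp add: q_pow)
    then have "q x : Q.B k" using N xy(1) by simp
    then show ?thesis using q_B xy(1) by simp
  qed
  then show thesis using that by blast
qed

end

context contraction_balls_pair
begin

text \<open>The bounded factors cluster at some \<open>x\<close>, and \<open>h\<close> divided by
  \<open>\<phi> x\<close> is then a limit of elements of \<open>P\<close>.\<close>

lemma closed_times_bounded_image: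
  assumes hom: "\<phi> : hom G H" and cont: "!!k. EX n. ALL x:B n. \<phi> x : H.B k" and P: "H.clo P"
  shows "H.clo {p \<otimes>\<^bsub>H\<^esub> \<phi> x | p x. p : P & x : B j}"
proof (rule H.cloI)
  have \<phi>c: "\<phi> x : carrier H" if "x : carrier G" for x using hom that by (auto simp: hom_def)
  have \<phi>m: "\<phi> (x \<otimes> y) = \<phi> x \<otimes>\<^bsub>H\<^esub> \<phi> y" if "x : carrier G" "y : carrier G" for x y
    using hom that by (simp add: hom_def)
  show "{p \<otimes>\<^bsub>H\<^esub> \<phi> x | p x. p : P & x : B j} <= carrier H"
    using H.clo_sub[OF P] \<phi>c B_carrier by blast
  fix h assume h: "h : carrier H" and *: "!!k. EX c:H.B k. h \<otimes>\<^bsub>H\<^esub> c : {p \<otimes>\<^bsub>H\<^esub> \<phi> x | p x. p : P & x : B j}"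
  have "ALL n::nat. EX x. x : B j & (EX c:H.B (int n). EX p:P. h \<otimes>\<^bsub>H\<^esub> c = p \<otimes>\<^bsub>H\<^esub> \<phi> x)" using * by blast
  from choice[OF this] obtain s where
    "ALL n. s n : B j & (EX c:H.B (int n). EX p:P. h \<otimes>\<^bsub>H\<^esub> c = p \<otimes>\<^bsub>H\<^esub> \<phi> (s n))" ..
  then have s: "!!n. s n : B j" "!!n. EX c:H.B (int n). EX p:P. h \<otimes>\<^bsub>H\<^esub> c = p \<otimes>\<^bsub>H\<^esub> \<phi> (s n)" by auto
  obtain x where x: "x : B j" "clus s x" by (rule B_cluster[OF s(1)])
  note xc = B_carrier[OF x(1)]
  note fx = \<phi>c[OF xc]
  have "h \<otimes>\<^bsub>H\<^esub> inv\<^bsub>H\<^esub> \<phi> x : P"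
  proof (rule H.cloD[OF P])
    fix k
    obtain l where l: "ALL c:H.B l. H.cj (\<phi> x) c : H.B k" by (rule H.B_conj[OF fx, where k = k])
    obtain i where i: "ALL x:B i. \<phi> x : H.B (l + 1)" using cont by blast
    obtain n where n: "n >= nat (l + 1)" "inv x \<otimes> s n : B i" by (rule clusD[OF x(2)])
    obtain c p where c: "c : H.B (int n)" "p : P" "h \<otimes>\<^bsub>H\<^esub> c = p \<otimes>\<^bsub>H\<^esub> \<phi> (s n)" using s(2) by blast
    define d where "d = inv x \<otimes> s n"
    have sc: "s n : carrier G" using s(1) B_carrier by blast
    have dc: "d : carrier G" using xc sc by (simp add: d_def)
    have sd: "\<phi> (s n) = \<phi> x \<otimes>\<^bsub>H\<^esub> \<phi> d" using \<phi>m[OF xc dc] xc sc by (simp add: d_def)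
    have cl: "c : H.B (l + 1)" by (rule H.B_monoD[OF c(1)]) (use n in simp)
    have "\<phi> d : H.B (l + 1)" using i n(2) by (simp add: d_def)
    then have "c \<otimes>\<^bsub>H\<^esub> inv\<^bsub>H\<^esub> \<phi> d : H.B l" by (rule H.B_mult[OF cl H.B_inv])
    then have "H.cj (\<phi> x) (c \<otimes>\<^bsub>H\<^esub> inv\<^bsub>H\<^esub> \<phi> d) : H.B k" using l by blast
    moreover have "(h \<otimes>\<^bsub>H\<^esub> inv\<^bsub>H\<^esub> \<phi> x) \<otimes>\<^bsub>H\<^esub> H.cj (\<phi> x) (c \<otimes>\<^bsub>H\<^esub> inv\<^bsub>H\<^esub> \<phi> d) = p"
    proof -
      note cc = h fx \<phi>c[OF dc] H.B_carrier[OF c(1)] subsetD[OF H.clo_sub[OF P] c(2)]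
      have "(h \<otimes>\<^bsub>H\<^esub> inv\<^bsub>H\<^esub> \<phi> x) \<otimes>\<^bsub>H\<^esub> H.cj (\<phi> x) (c \<otimes>\<^bsub>H\<^esub> inv\<^bsub>H\<^esub> \<phi> d)
          = (h \<otimes>\<^bsub>H\<^esub> c) \<otimes>\<^bsub>H\<^esub> inv\<^bsub>H\<^esub> \<phi> d \<otimes>\<^bsub>H\<^esub> inv\<^bsub>H\<^esub> \<phi> x"
        using cc by (simp add: H.cj_def H.m_assoc)
      also have "\<dots> = p" unfolding c(3) sd using cc by (simp add: H.m_assoc)
      finally show ?thesis .
    qed
    ultimately show "EX b:H.B k. (h \<otimes>\<^bsub>H\<^esub> inv\<^bsub>H\<^esub> \<phi> x) \<otimes>\<^bsub>H\<^esub> b : P" using c(2) by metis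
  qed (use h fx in simp)
  moreover have "h = (h \<otimes>\<^bsub>H\<^esub> inv\<^bsub>H\<^esub> \<phi> x) \<otimes>\<^bsub>H\<^esub> \<phi> x" using h fx by (simp add: H.m_assoc)
  ultimately show "h : {p \<otimes>\<^bsub>H\<^esub> \<phi> x | p x. p : P & x : B j}" using x(1) by blast
qed

theorem image_clo_iff:
  assumes hom: "\<phi> : hom G H" and cont: "!!k. EX n. ALL x:B n. \<phi> x : H.B k"
  shows "H.clo (\<phi> ` carrier G) \<longleftrightarrow> H.clo (\<phi> ` {x : carrier G. EX n::nat. n > 0 & x [^] n = \<one>})"
proof -
  interpret \<phi>: group_hom G H \<phi>
    by (rule group_hom.intro[OF is_group H.is_group]) (unfold_locales, rule hom)
  obtain R e where R: "cn R" "e > (0::nat)" "ALL x:R. x [^] e = \<one>" "good R (carrier G)" by (rule torsion_subgroup)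
  obtain S f where S: "H.cn S" "f > (0::nat)" "ALL x:S. x [^]\<^bsub>H\<^esub> f = \<one>\<^bsub>H\<^esub>" "H.good S (carrier H)" by (rule H.torsion_subgroup)
  interpret qR: contraction_quotient G a K R by unfold_locales (rule R(1))
  interpret qS: contraction_quotient H b L S by unfold_locales (rule S(1))
  note Rc = qR.A_carrier and Sc = qS.A_carrier
  note Rs = qR.casA and Ss = qS.casA
  have tor: "{x : carrier G. EX n::nat. n > 0 & x [^] n = \<one>} = R"
  proof (intro subset_antisym subsetI)
    fix x assume "x : {x : carrier G. EX n::nat. n > 0 & x [^] n = \<one>}"
    then obtain n :: nat where "x : carrier G" "n > 0" "x [^] n = \<one>" by blast
    then show "x : R" using torsion_in[OF R(1,4), of x n] cas_one[OF Rs] by simp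
  next
    fix x assume "x : R"
    then show "x : {x : carrier G. EX n::nat. n > 0 & x [^] n = \<one>}" using R(2,3) Rc by blast
  qed
  have Sin: "h : S" if "h : carrier H" "n > 0" "h [^]\<^bsub>H\<^esub> (n::nat) : S" for h n
    by (rule H.torsion_in[OF S(1,4) that])
  have RS: "\<phi> x : S" if x: "x : R" for x
    using Sin[of "\<phi> x" e] R(2,3) x Rc[OF x] H.cas_one[OF Ss] \<phi>.hom_nat_pow[OF Rc[OF x], of e] by simp
  \<comment> \<open>A value in \<open>S\<close> comes from a torsion element: write \<open>x\<close>
    as \<open>r\<close> in \<open>R\<close> times an \<open>f\<close>-th power. The root is mapped
    into \<open>S\<close> as well, so \<open>\<phi>\<close> kills its \<open>f\<close>-th power. As
    \<open>S\<close> is closed, this settles one direction of the equivalence.\<close>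
  have img: "\<phi> ` R = \<phi> ` carrier G \<inter> S"
  proof
    show "\<phi> ` R <= \<phi> ` carrier G \<inter> S" using RS Rc by blast
    show "\<phi> ` carrier G \<inter> S <= \<phi> ` R"
    proof
      fix h assume "h : \<phi> ` carrier G \<inter> S"
      then obtain x where x: "x : carrier G" "h = \<phi> x" "\<phi> x : S" by blast
      obtain y where y: "y : carrier G" "R #> y [^] f = R #> x" using good_div[OF R(4) x(1) S(2)] by blast
      define r where "r = x \<otimes> inv (y [^] f)"
      have r: "r : R" unfolding r_def using qR.q_eq[of x "y [^] f"] x(1) y by (metis nat_pow_closed)
      have xr: "x = r \<otimes> y [^] f" using x(1) y(1) by (simp add: r_def m_assoc)
      have fy: "\<phi> y [^]\<^bsub>H\<^esub> f : S"
      proof -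
        have "inv\<^bsub>H\<^esub> \<phi> r \<otimes>\<^bsub>H\<^esub> \<phi> x : S" using H.cas_mult[OF Ss H.cas_inv[OF Ss RS[OF r]] x(3)] .
        moreover have "\<phi> x = \<phi> r \<otimes>\<^bsub>H\<^esub> \<phi> y [^]\<^bsub>H\<^esub> f" using xr Rc[OF r] y(1) by (simp add: \<phi>.hom_nat_pow)
        ultimately show ?thesis using Rc[OF r] y(1) by simp
      qed
      have "\<phi> y : S" by (rule Sin[OF _ S(2) fy]) (use y in simp)
      then have "\<phi> y [^]\<^bsub>H\<^esub> f = \<one>\<^bsub>H\<^esub>" using S(3) by blast
      then have "\<phi> x = \<phi> r" using xr Rc[OF r] y(1) by (simp add: \<phi>.hom_nat_pow)
      then show "h : \<phi> ` R" using x r by blast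
    qed
  qed
  have "H.clo (\<phi> ` carrier G)" if clR: "H.clo (\<phi> ` R)"
  proof -
    \<comment> \<open>Powers are matched only modulo torsion, so the preimage of \<open>S\<close>
      takes the place of the kernel in the annulus argument, and \<open>NB\<close> that of a
      neighbourhood of it.\<close>
    define N where "N = {x : carrier G. \<phi> x : S}"
    define NB where "NB = {n \<otimes> b | n b. n : N & b : B 0}"
    have Nc: "x : carrier G" if "x : N" for x using that by (simp add: N_def)
    have Nm: "x \<otimes> y : N" if "x : N" "y : N" for x y
      using that H.cas_mult[OF Ss] by (simp add: N_def)
    have RN: "R <= N" using RS Rc by (auto simp: N_def)
    have NBm: "n \<otimes> x : NB" if nx: "n : N" "x : NB" for n x
    proof -
      obtain n' b' where "n' : N" "b' : B 0" "x = n' \<otimes> b'" using nx(2) unfolding NB_def by blast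
      then have "n \<otimes> x = (n \<otimes> n') \<otimes> b'" "n \<otimes> n' : N" "b' : B 0" using nx Nm Nc B_carrier by (auto simp: m_assoc)
      then show ?thesis unfolding NB_def by blast
    qed
    obtain m1 where m1: "m1 > 0" "ALL m>0. m1 dvd m --> (EX p>0. contr R ((m + 1) ^ p) (m ^ p) (carrier G))"
      using good_contr[OF R(4)] by blast
    obtain m2 where m2: "m2 > 0" "ALL m>0. m2 dvd m --> (EX p>0. H.contr S ((m + 1) ^ p) (m ^ p) (carrier H))"
      using H.good_contr[OF S(4)] by blast
    define m where "m = m1 * m2"
    have m: "m > 0" "m1 dvd m" "m2 dvd m" using m1 m2 by (simp_all add: m_def)
    obtain p1 where p1: "p1 > 0" "contr R ((m + 1) ^ p1) (m ^ p1) (carrier G)" using m1(2) m by blast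
    obtain p2 where p2: "p2 > 0" "H.contr S ((m + 1) ^ p2) (m ^ p2) (carrier H)" using m2(2) m by blast
    \<comment> \<open>Multiplying \<open>p1\<close> and \<open>p2\<close> yields one pair of
      exponents that contracts both groups; \<open>\<phi>\<close> can only match equal
      exponents.\<close>
    define u v where "u = (m + 1) ^ (p1 * p2)" and "v = m ^ (p1 * p2)"
    have uv: "u > 0" "v > 0" using m(1) by (simp_all add: u_def v_def)
    have e1: "((m + 1) ^ p1) ^ p2 = u" "(m ^ p1) ^ p2 = v" unfolding u_def v_def by (simp_all only: power_mult)
    have e2: "((m + 1) ^ p2) ^ p1 = u" "(m ^ p2) ^ p1 = v"
      unfolding u_def v_def by (simp_all only: mult.commute flip: power_mult)
    have conG: "y : nb R (k + 1)" if xy: "x : carrier G" "y : carrier G" "R #> y [^] u = R #> x [^] v" "x : nb R k" for x y k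
    proof -
      have "y : nb R (k + int p2)"
        by (rule good_contr_power[OF R(1,4) p1(2) _ xy(1,2) _ xy(4)], simp, simp only: e1 xy(3))
      then show ?thesis by (rule subsetD[OF nb_mono, rotated]) (use p2(1) in simp)
    qed
    have conH: "y : H.nb S (k + 1)" if xy: "x : carrier H" "y : carrier H"
      "S #>\<^bsub>H\<^esub> (y [^]\<^bsub>H\<^esub> u) = S #>\<^bsub>H\<^esub> (x [^]\<^bsub>H\<^esub> v)" "x : H.nb S k" for x y k
    proof -
      have "y : H.nb S (k + int p1)"
        by (rule H.good_contr_power[OF S(1,4) p2(2) _ xy(1,2) _ xy(4)], simp, simp only: e2 xy(3))
      then show ?thesis by (rule subsetD[OF H.nb_mono, rotated]) (use p1(1) in simp)
    qed
    obtain c :: nat where c: "ALL k. ALL x:carrier G. ALL y:carrier G. R #> x [^] v = R #> y [^] u --> y : nb R (k + int c) --> x : nb R k"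
      by (rule good_pow_proper[OF R(1,4) uv(2)])
    have cos: "S #>\<^bsub>H\<^esub> \<phi> x = S #>\<^bsub>H\<^esub> \<phi> y" if "x : carrier G" "y : carrier G" "R #> x = R #> y" for x y
    proof -
      have "\<phi> (x \<otimes> inv y) : S" using RS qR.q_eq that by blast
      then show ?thesis using qS.q_eq[of "\<phi> x" "\<phi> y"] that by simp
    qed
    have nbS: "\<phi> x : H.nb S k" if "x : carrier G" "y : carrier G" "S #>\<^bsub>H\<^esub> \<phi> x = S #>\<^bsub>H\<^esub> \<phi> y" "\<phi> y : H.nb S k" for x y k
      using qS.q_B[of "\<phi> x" k] qS.q_B[of "\<phi> y" k] that by simp
    have "ALL x:carrier G. EX y. y : carrier G & R #> y [^] u = R #> x [^] v"
    proof
      fix x assume "x : carrier G"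
      then have "x [^] v : carrier G" by simp
      then show "EX y. y : carrier G & R #> y [^] u = R #> x [^] v" using good_div[OF R(4) _ uv(1)] by blast
    qed
    from bchoice[OF this] obtain \<mu> where "ALL x:carrier G. \<mu> x : carrier G & R #> \<mu> x [^] u = R #> x [^] v" ..
    then have \<mu>: "!!x. x : carrier G ==> \<mu> x : carrier G" "!!x. x : carrier G ==> R #> \<mu> x [^] u = R #> x [^] v" by auto
    have "EX k::nat. ALL x:carrier G. \<phi> x : H.B (int k) --> x : NB"
    proof (rule ccontr)
      assume no: "~ ?thesis"
      have "ALL n::nat. EX d. d : B (- int c) & d ~: NB & \<phi> d : H.nb S (int n)"
      proof
        fix n :: nat
        obtain x where x: "x : carrier G" "\<phi> x : H.B (int n)" "x ~: NB" using no by blast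
        define X where "X i = (\<mu> ^^ i) x" for i
        have Xc: "X i : carrier G" for i unfolding X_def using x(1) \<mu>(1) by (induction i) auto
        have XS: "R #> X (Suc i) [^] u = R #> X i [^] v" for i using \<mu>(2)[OF Xc[of i]] by (simp add: X_def)
        have \<phi>X: "\<phi> (X i) : H.nb S (int n + int i)" for i
        proof (induction i)
          case 0
          then show ?case using H.nb_B[OF Ss x(2)] by (simp add: X_def)
        next
          case (Suc i)
          have "S #>\<^bsub>H\<^esub> (\<phi> (X (Suc i)) [^]\<^bsub>H\<^esub> u) = S #>\<^bsub>H\<^esub> (\<phi> (X i) [^]\<^bsub>H\<^esub> v)"
            using cos[OF _ _ XS[of i]] Xc by (simp add: \<phi>.hom_nat_pow)
          from conH[OF _ _ this Suc] show ?case using Xc by (simp add: algebra_simps)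
        qed
        obtain j :: nat where j: "x : B (- int j)" using B_exh[OF x(1)] .
        have "X i : nb R (- int j + int i)" for i
        proof (induction i)
          case 0
          then show ?case using nb_B[OF Rs j] by (simp add: X_def)
        next
          case (Suc i)
          from conG[OF Xc Xc XS Suc] show ?case by (simp add: algebra_simps)
        qed
        from this[of j] have "X j : nb R 0" by simp
        then have Xj: "X j : NB" using RN unfolding nb_def NB_def by blast
        \<comment> \<open>This crossing replaces the annulus: \<open>X i\<close> is off
          \<open>NB\<close>, but one inverse step of \<open>\<mu>\<close> from it, hence bounded
          modulo \<open>N\<close>.\<close>
        have "EX i. X i ~: NB & X (Suc i) : NB"
        proof (rule ccontr)
          assume no: "\<nexists>i. X i ~: NB & X (Suc i) : NB"
          have "X i ~: NB" for i by (induction i) (use no x(3) in \<open>auto simp: X_def\<close>)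
          then show False using Xj by blast
        qed
        then obtain i where i: "X i ~: NB" "X (Suc i) : NB" by blast
        obtain n' b' where n': "n' : N" "b' : B 0" "X (Suc i) = n' \<otimes> b'" using i(2) unfolding NB_def by blast
        note bc = B_carrier[OF n'(2)]
        \<comment> \<open>The step of \<open>\<mu>\<close> is undone for the bounded factor
          \<open>b'\<close> alone. By uniqueness of roots modulo \<open>S\<close>, \<open>d\<close>
          and \<open>X i\<close> have the same image there, so \<open>d\<close>, which is bounded
          modulo \<open>R\<close>, may replace \<open>X i\<close>.\<close>
        obtain d where d: "d : carrier G" "R #> d [^] v = R #> b' [^] u" using good_div[OF R(4) _ uv(2), of "b' [^] u"] bc by auto
        have dB: "d : nb R (- int c)" using c d bc nb_B[OF Rs n'(2)] by simp
        have 1: "S #>\<^bsub>H\<^esub> \<phi> (X (Suc i)) = S #>\<^bsub>H\<^esub> \<phi> b'"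
          using qS.q_eq[of "\<phi> (X (Suc i))" "\<phi> b'"] n'(1) Nc[OF n'(1)] bc unfolding n'(3)
          by (simp add: H.m_assoc N_def)
        have "S #>\<^bsub>H\<^esub> (\<phi> d [^]\<^bsub>H\<^esub> v) = S #>\<^bsub>H\<^esub> (\<phi> b' [^]\<^bsub>H\<^esub> u)"
          using cos[OF _ _ d(2)] d(1) bc by (simp add: \<phi>.hom_nat_pow)
        also have "\<dots> = (S #>\<^bsub>H\<^esub> \<phi> b') [^]\<^bsub>H Mod S\<^esub> u" using bc by (simp add: qS.q_pow)
        also have "\<dots> = (S #>\<^bsub>H\<^esub> \<phi> (X (Suc i))) [^]\<^bsub>H Mod S\<^esub> u" using 1 by simp
        also have "\<dots> = S #>\<^bsub>H\<^esub> (\<phi> (X (Suc i)) [^]\<^bsub>H\<^esub> u)" using Xc by (simp add: qS.q_pow)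
        also have "\<dots> = S #>\<^bsub>H\<^esub> (\<phi> (X i) [^]\<^bsub>H\<^esub> v)" using cos[OF _ _ XS[of i]] Xc by (simp add: \<phi>.hom_nat_pow)
        finally have "S #>\<^bsub>H\<^esub> (\<phi> d [^]\<^bsub>H\<^esub> v) = S #>\<^bsub>H\<^esub> (\<phi> (X i) [^]\<^bsub>H\<^esub> v)" .
        then have 2: "S #>\<^bsub>H\<^esub> \<phi> d = S #>\<^bsub>H\<^esub> \<phi> (X i)" using H.good_roots[OF S(4) _ _ uv(2)] d(1) Xc by simp
        obtain r d' where r: "r : R" "d' : B (- int c)" "d = r \<otimes> d'" using nbE[OF dB] .
        note dc = B_carrier[OF r(2)]
        have 3: "S #>\<^bsub>H\<^esub> \<phi> d' = S #>\<^bsub>H\<^esub> \<phi> d"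
          using cos[OF dc d(1)] qR.q_eq[OF d(1) dc] r Rc[OF r(1)] dc by (simp add: m_assoc)
        have "X i \<otimes> inv d' : N"
          using qS.q_eq[of "\<phi> (X i)" "\<phi> d'"] 2 3 Xc dc by (simp add: N_def)
        then have "d' ~: NB" using NBm[of "X i \<otimes> inv d'" d'] i(1) Xc[of i] dc by (auto simp: m_assoc)
        moreover have "\<phi> d' : H.nb S (int n)"
        proof -
          have "\<phi> (X i) : H.nb S (int n)" by (rule subsetD[OF H.nb_mono \<phi>X[of i]]) simp
          then show ?thesis using nbS[OF dc Xc] 2 3 by simp
        qed
        ultimately show "EX d. d : B (- int c) & d ~: NB & \<phi> d : H.nb S (int n)" using r(2) by blast
      qed
      from choice[OF this] obtain s where "ALL n. s n : B (- int c) & s n ~: NB & \<phi> (s n) : H.nb S (int n)" ..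
      then have s: "!!n. s n : B (- int c)" "!!n. s n ~: NB" "!!n. \<phi> (s n) : H.nb S (int n)" by auto
      obtain x where x: "x : B (- int c)" "clus s x" by (rule B_cluster[OF s(1)])
      note xc = B_carrier[OF x(1)] and sc = B_carrier[OF s(1)]
      have xn: "\<phi> x : H.nb S (int j)" for j
      proof -
        obtain l where l: "ALL x:B l. \<phi> x : H.B (int j + 1)" using cont by blast
        obtain n where n: "n >= j + 1" "inv x \<otimes> s n : B l" by (rule clusD[OF x(2)])
        obtain t h where t: "t : S" "h : H.B (int n)" "\<phi> (s n) = t \<otimes>\<^bsub>H\<^esub> h" using H.nbE[OF s(3)] .
        have h: "h : H.B (int j + 1)" by (rule H.B_monoD[OF t(2)]) (use n in simp)
        have "\<phi> (inv x \<otimes> s n) : H.B (int j + 1)" using l n(2) by blast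
        then have "h \<otimes>\<^bsub>H\<^esub> inv\<^bsub>H\<^esub> \<phi> (inv x \<otimes> s n) : H.B (int j)" by (rule H.B_mult[OF h H.B_inv])
        then have "t \<otimes>\<^bsub>H\<^esub> (h \<otimes>\<^bsub>H\<^esub> inv\<^bsub>H\<^esub> \<phi> (inv x \<otimes> s n)) : H.nb S (int j)" by (rule H.nbI[OF t(1)])
        moreover have "t \<otimes>\<^bsub>H\<^esub> (h \<otimes>\<^bsub>H\<^esub> inv\<^bsub>H\<^esub> \<phi> (inv x \<otimes> s n)) = \<phi> x"
        proof -
          have "t \<otimes>\<^bsub>H\<^esub> (h \<otimes>\<^bsub>H\<^esub> inv\<^bsub>H\<^esub> \<phi> (inv x \<otimes> s n)) = \<phi> (s n) \<otimes>\<^bsub>H\<^esub> inv\<^bsub>H\<^esub> \<phi> (inv x \<otimes> s n)"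
            unfolding t(3) using Sc[OF t(1)] H.B_carrier[OF t(2)] xc sc by (simp add: H.m_assoc)
          also have "\<dots> = \<phi> x" using xc sc[of n] by (simp add: H.inv_mult_group)
          finally show ?thesis .
        qed
        ultimately show ?thesis by simp
      qed
      have "\<phi> x : S" by (rule H.nb_sep[OF Ss _ xn]) (use xc in simp)
      then have xN: "x : N" using xc by (simp add: N_def)
      obtain n where n: "n >= 0" "inv x \<otimes> s n : B 0" by (rule clusD[OF x(2)])
      have "x \<otimes> (inv x \<otimes> s n) : NB" unfolding NB_def using xN n(2) by blast
      then show False using s(2)[of n] xc sc[of n] by simp
    qed
    then obtain k :: nat where k: "ALL x:carrier G. \<phi> x : H.B (int k) --> x : NB" by blast
    show ?thesis
    proof (rule H.locally_closed_subgroup[OF \<phi>.img_is_subgroup])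
      show "H.clo {p \<otimes>\<^bsub>H\<^esub> \<phi> x | p x. p : \<phi> ` R & x : B 0}"
        by (rule closed_times_bounded_image[OF hom cont clR])
      show "\<phi> ` carrier G \<inter> H.B (int k) <= {p \<otimes>\<^bsub>H\<^esub> \<phi> x | p x. p : \<phi> ` R & x : B 0}"
      proof
        fix h assume "h : \<phi> ` carrier G \<inter> H.B (int k)"
        then obtain x where x: "x : carrier G" "h = \<phi> x" "x : NB" using k by blast
        obtain n b' where n: "n : N" "b' : B 0" "x = n \<otimes> b'"
          using x(3) unfolding NB_def mem_Collect_eq by (elim exE conjE)
        have "\<phi> n : S" using n(1) by (simp only: N_def mem_Collect_eq)
        then have "\<phi> n : \<phi> ` R" unfolding img by (rule IntI[OF imageI[OF Nc[OF n(1)]]])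
        moreover have "h = \<phi> n \<otimes>\<^bsub>H\<^esub> \<phi> b'" using x n Nc B_carrier by simp
        ultimately show "h : {p \<otimes>\<^bsub>H\<^esub> \<phi> x | p x. p : \<phi> ` R & x : B 0}" using n(2) by blast
      qed
      show "{p \<otimes>\<^bsub>H\<^esub> \<phi> x | p x. p : \<phi> ` R & x : B 0} <= \<phi> ` carrier G"
      proof
        fix h assume "h : {p \<otimes>\<^bsub>H\<^esub> \<phi> x | p x. p : \<phi> ` R & x : B 0}"
        then obtain r x where "r : R" "x : B 0" "h = \<phi> r \<otimes>\<^bsub>H\<^esub> \<phi> x" by blast
        then have "h = \<phi> (r \<otimes> x)" "r \<otimes> x : carrier G" using Rc B_carrier by auto
        then show "h : \<phi> ` carrier G" by blast
      qed
    qed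
  qed
  moreover have "H.clo (\<phi> ` R)" if "H.clo (\<phi> ` carrier G)"
    unfolding img by (rule H.clo_Int[OF that H.cas_clo[OF Ss]])
  ultimately show ?thesis unfolding tor by blast
qed

end

section \<open>Topological groups\<close>

context topological_group
begin

lemma carrier_topspace [simp]: "topspace T = carrier G"
  by (rule topspace_eq_carrier)

lemma openin_carrier: "openin T U ==> x : U ==> x : carrier G"
  using openin_subset by fastforce

lemma continuous_left: assumes "g : carrier G" shows "continuous_map T T (%x. g \<otimes> x)"
proof -
  have "continuous_map T (prod_topology T T) (%x. (g, x))"
    by (intro continuous_map_pairedI) (use assms in auto)
  from continuous_map_compose[OF this continuous_map_mult] show ?thesis by (simp add: o_def)
qed

lemma continuous_right: assumes "g : carrier G" shows "continuous_map T T (%x. x \<otimes> g)"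
proof -
  have "continuous_map T (prod_topology T T) (%x. (x, g))"
    by (intro continuous_map_pairedI) (use assms in auto)
  from continuous_map_compose[OF this continuous_map_mult] show ?thesis by (simp add: o_def)
qed

lemma continuous_cj: assumes "g : carrier G" shows "continuous_map T T (cj g)"
proof -
  have "continuous_map T T ((%x. x \<otimes> inv g) \<circ> (%x. g \<otimes> x))"
    by (rule continuous_map_compose[OF continuous_left continuous_right]) (use assms in auto)
  then show ?thesis by (simp add: o_def cj_def[abs_def])
qed

lemma openin_preimage: "continuous_map T T f ==> openin T U ==> openin T {x : carrier G. f x : U}"
  using openin_continuous_map_preimage[of T T f U] by simp

lemma openin_translate: assumes "g : carrier G" "openin T U" shows "openin T ((%x. g \<otimes> x) ` U)"
proof -
  have "(%x. g \<otimes> x) ` U = {x : carrier G. inv g \<otimes> x : U}"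
  proof
    show "(%x. g \<otimes> x) ` U <= {x : carrier G. inv g \<otimes> x : U}" using assms openin_carrier by auto
    show "{x : carrier G. inv g \<otimes> x : U} <= (%x. g \<otimes> x) ` U"
    proof
      fix x assume "x : {x : carrier G. inv g \<otimes> x : U}"
      then have "x = g \<otimes> (inv g \<otimes> x)" "inv g \<otimes> x : U" using assms by auto
      then show "x : (%x. g \<otimes> x) ` U" by blast
    qed
  qed
  then show ?thesis using openin_preimage[OF continuous_left assms(2), of "inv g"] assms(1) by simp
qed

lemma nbhd_mult: assumes "openin T U" "\<one> : U"
  obtains V where "openin T V" "\<one> : V" "ALL x:V. ALL y:V. x \<otimes> y : U"
proof -
  define P where "P = {p : topspace (prod_topology T T). (%(x, y). x \<otimes> y) p : U}"
  have op: "openin (prod_topology T T) P"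
    unfolding P_def by (rule openin_continuous_map_preimage[OF continuous_map_mult assms(1)])
  have P1: "(\<one>, \<one>) : P" using assms by (simp add: P_def)
  have "EX V W. openin T V & openin T W & \<one> : V & \<one> : W & V \<times> W <= P"
    by (rule openin_prod_topology_alt[THEN iffD1, rule_format, OF op P1])
  then obtain V W where VW: "openin T V" "openin T W" "\<one> : V" "\<one> : W" "V \<times> W <= P" by (elim exE conjE)
  have "ALL x:V \<inter> W. ALL y:V \<inter> W. x \<otimes> y : U" using VW(5) by (auto simp: P_def)
  moreover have "openin T (V \<inter> W)" by (rule openin_Int[OF VW(1,2)])
  ultimately show thesis using that[of "V \<inter> W"] VW(3,4) by simp
qed

lemma nbhd_inv: assumes "openin T U" "\<one> : U"
  obtains V where "openin T V" "\<one> : V" "V <= U" "ALL x:V. inv x : V"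
proof -
  define V where "V = U \<inter> {x : carrier G. inv x : U}"
  have "openin T V" unfolding V_def
    by (intro openin_Int assms(1) openin_preimage[OF continuous_map_inv assms(1)])
  moreover have "\<one> : V" "V <= U" using assms by (auto simp: V_def)
  moreover have "ALL x:V. inv x : V" using openin_carrier[OF assms(1)] by (auto simp: V_def)
  ultimately show thesis using that by blast
qed

end

section \<open>From the topology to balls\<close>

context locally_compact_contraction_group
begin

definition \<alpha>i :: "'a => 'a" where "\<alpha>i = inv_into (carrier G) \<alpha>"

lemma bij: "bij_betw \<alpha> (carrier G) (carrier G)"
  using automorphism by (simp add: iso_def)

lemma \<alpha>_closed [simp]: "x : carrier G ==> \<alpha> x : carrier G"
  using bij bij_betwE by blast

lemma \<alpha>i_closed [simp]: "x : carrier G ==> \<alpha>i x : carrier G"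
  unfolding \<alpha>i_def using bij by (metis bij_betw_def inv_into_into)

lemma \<alpha>_\<alpha>i [simp]: "x : carrier G ==> \<alpha> (\<alpha>i x) = x" and \<alpha>i_\<alpha> [simp]: "x : carrier G ==> \<alpha>i (\<alpha> x) = x"
  unfolding \<alpha>i_def using bij bij_betw_inv_into_right bij_betw_inv_into_left by metis+

lemma \<alpha>_mult: "x : carrier G ==> y : carrier G ==> \<alpha> (x \<otimes> y) = \<alpha> x \<otimes> \<alpha> y"
  using automorphism by (simp add: iso_def hom_def)

lemma \<alpha>i_mult: assumes "x : carrier G" "y : carrier G" shows "\<alpha>i (x \<otimes> y) = \<alpha>i x \<otimes> \<alpha>i y"
proof -
  have "\<alpha>i (\<alpha> (\<alpha>i x \<otimes> \<alpha>i y)) = \<alpha>i x \<otimes> \<alpha>i y" using assms by (intro \<alpha>i_\<alpha>) simp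
  then show ?thesis using assms by (simp add: \<alpha>_mult)
qed

lemma continuous_\<alpha>: "continuous_map T T \<alpha>"
  using bicontinuous homeomorphic_imp_continuous_map by blast

lemma continuous_\<alpha>i: "continuous_map T T \<alpha>i"
proof -
  obtain g where g: "homeomorphic_maps T T \<alpha> g" using bicontinuous homeomorphic_map_maps by blast
  have "g y = \<alpha>i y" if "y : carrier G" for y
    using g that unfolding homeomorphic_maps_def by (metis \<alpha>_\<alpha>i \<alpha>i_closed carrier_topspace)
  then show ?thesis using g continuous_map_eq[of T T g \<alpha>i] unfolding homeomorphic_maps_def by simp
qed

definition az :: "int => 'a => 'a" where
  "az k x = (if k >= 0 then (\<alpha> ^^ nat k) x else (\<alpha>i ^^ nat (- k)) x)"

lemma pow_closed: "x : carrier G ==> (\<alpha> ^^ n) x : carrier G" "x : carrier G ==> (\<alpha>i ^^ n) x : carrier G"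
  by (induction n) auto

lemma az_closed [simp]: "x : carrier G ==> az k x : carrier G"
  by (simp add: az_def pow_closed)

lemma az_0 [simp]: "az 0 x = x"
  by (simp add: az_def)

lemma az_nat: "az (int n) x = (\<alpha> ^^ n) x"
  by (simp add: az_def)

lemma az_Suc: assumes "x : carrier G" shows "az (k + 1) x = \<alpha> (az k x)"
proof (cases "k >= 0")
  case True
  then have "nat (k + 1) = Suc (nat k)" by simp
  then show ?thesis using True by (simp add: az_def)
next
  case False
  then have "nat (- k) = Suc (nat (- (k + 1)))" by simp
  then have "\<alpha> (az k x) = (\<alpha>i ^^ nat (- (k + 1))) x" using False assms pow_closed by (simp add: az_def)
  also have "\<dots> = az (k + 1) x" using False by (auto simp: az_def)
  finally show ?thesis ..
qed

lemma az_pred: assumes "x : carrier G" shows "az (k - 1) x = \<alpha>i (az k x)"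
  using az_Suc[OF assms, of "k - 1"] assms by simp

lemma az_add: assumes x: "x : carrier G" shows "az (j + k) x = az j (az k x)"
proof (induction j rule: int_induct[of _ 0])
  case (step1 i)
  have "az (i + 1 + k) x = az (i + k + 1) x" by (simp add: algebra_simps)
  also have "\<dots> = \<alpha> (az (i + k) x)" by (rule az_Suc[OF x])
  also have "\<dots> = az (i + 1) (az k x)" unfolding step1(2) by (rule az_Suc[symmetric]) (use x in simp)
  finally show ?case .
next
  case (step2 i)
  have "az (i - 1 + k) x = az (i + k - 1) x" by (simp add: algebra_simps)
  also have "\<dots> = \<alpha>i (az (i + k) x)" by (rule az_pred[OF x])
  also have "\<dots> = az (i - 1) (az k x)" unfolding step2(2) by (rule az_pred[symmetric]) (use x in simp)
  finally show ?case .
qed simp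

lemma az_mult: assumes "x : carrier G" "y : carrier G" shows "az k (x \<otimes> y) = az k x \<otimes> az k y"
proof (induction k rule: int_induct[of _ 0])
  case (step1 i)
  then show ?case using assms by (simp add: az_Suc \<alpha>_mult)
next
  case (step2 i)
  then show ?case using assms by (simp add: az_pred \<alpha>i_mult)
qed simp

lemma az_cancel: "x : carrier G ==> az (- k) (az k x) = x" "x : carrier G ==> az k (az (- k) x) = x"
  using az_add[of x "- k" k] az_add[of x k "- k"] by simp_all

lemma az_one [simp]: "az k \<one> = \<one>"
proof -
  have "az k \<one> \<otimes> az k \<one> = az k \<one>" using az_mult[of \<one> \<one> k] by simp
  then show ?thesis by (simp add: l_cancel_one')
qed

lemma continuous_az: "continuous_map T T (az k)"
proof -
  have pw: "continuous_map T T (f ^^ n)" if "continuous_map T T f" for f and n :: nat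
  proof (induction n)
    case (Suc n)
    show ?case using continuous_map_compose[OF Suc that] by (simp add: o_def)
  qed (simp add: id_def[symmetric])
  show ?thesis using pw[OF continuous_\<alpha>] pw[OF continuous_\<alpha>i] by (cases "k >= 0") (simp_all add: az_def[abs_def])
qed

lemma openin_az: assumes "openin T U" shows "openin T (az k ` U)"
proof -
  have "az k ` U = {x : carrier G. az (- k) x : U}"
  proof
    show "az k ` U <= {x : carrier G. az (- k) x : U}" using assms openin_carrier by (auto simp: az_cancel)
    show "{x : carrier G. az (- k) x : U} <= az k ` U"
    proof
      fix x assume x: "x : {x : carrier G. az (- k) x : U}"
      then have "x = az k (az (- k) x)" using az_cancel(2) by simp
      then show "x : az k ` U" using x by blast
    qed
  qed
  then show ?thesis using openin_preimage[OF continuous_az assms] by simp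
qed

lemma eventually_in: assumes "x : carrier G" "openin T U" "\<one> : U" obtains N where "ALL n>=N. (\<alpha> ^^ n) x : U"
  using contractive[OF assms(1)] assms(2,3) unfolding limitin_def eventually_sequentially by blast

lemma regular: "regular_space T"
  using locally_compact_Hausdorff_imp_regular_space[OF locally_compact Hausdorff] .

lemma closed_nbhd: assumes "openin T U" "\<one> : U"
  obtains V C where "openin T V" "closedin T C" "\<one> : V" "V <= C" "C <= U"
  using regular[folded neighbourhood_base_of_closedin] assms unfolding neighbourhood_base_of by metis

text \<open>Baire category turns pointwise into locally uniform contraction.\<close>

lemma uniform_near_one: assumes U: "openin T U" "\<one> : U"
  obtains P n where "openin T P" "\<one> : P" "ALL m>=n. (\<alpha> ^^ m) ` P <= U"
proof -
  obtain V where V: "openin T V" "\<one> : V" "ALL x:V. ALL y:V. x \<otimes> y : U" by (rule nbhd_mult[OF U])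
  obtain V' where V': "openin T V'" "\<one> : V'" "V' <= V" "ALL x:V'. inv x : V'" by (rule nbhd_inv[OF V(1,2)])
  obtain W C where W: "openin T W" "closedin T C" "\<one> : W" "W <= C" "C <= V'" by (rule closed_nbhd[OF V'(1,2)])
  define D where "D n = (\<Inter>m\<in>{n..}. {x : carrier G. (\<alpha> ^^ m) x : C})" for n :: nat
  have cl1: "closedin T {x : carrier G. (\<alpha> ^^ m) x : C}" for m
    using closedin_continuous_map_preimage[OF continuous_az[of "int m"] W(2)] by (simp add: az_nat)
  have Dcl: "closedin T (D n)" for n unfolding D_def by (intro closedin_INT) (use cl1 in auto)
  have "\<Union>(range D) = carrier G"
  proof
    show "\<Union>(range D) <= carrier G" unfolding D_def by auto
    show "carrier G <= \<Union>(range D)"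
    proof
      fix x assume x: "x : carrier G"
      obtain N where "ALL n>=N. (\<alpha> ^^ n) x : W" by (rule eventually_in[OF x W(1,3)])
      then have "x : D N" using x W(4) unfolding D_def by auto
      then show "x : \<Union>(range D)" by blast
    qed
  qed
  then have "T interior_of \<Union>(range D) ~= {}"
    using interior_of_topspace[of T] one_closed by (metis carrier_topspace empty_iff)
  moreover have "T interior_of \<Union>(range D) = {}" if "ALL n. T interior_of D n = {}"
    by (rule Baire_category_alt) (use locally_compact regular Dcl that in auto)
  ultimately have "EX n. T interior_of D n ~= {}" by blast
  then obtain n x0 where x0: "x0 : T interior_of D n" by blast
  define Q where "Q = T interior_of D n"
  have Q: "openin T Q" "x0 : Q" "Q <= D n" using x0 interior_of_subset[of T "D n"] by (auto simp: Q_def)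
  have x0c: "x0 : carrier G" using openin_carrier[OF Q(1,2)] .
  \<comment> \<open>Uniform contraction near \<open>x0\<close> is translated to the identity: the
    image of \<open>x\<close> is the quotient of the images of \<open>x0 \<otimes> x\<close> and
    \<open>x0\<close>, both in \<open>C\<close>.\<close>
  show thesis
  proof (rule that[of "{x : carrier G. x0 \<otimes> x : Q}" n])
    show "openin T {x : carrier G. x0 \<otimes> x : Q}" by (rule openin_preimage[OF continuous_left[OF x0c] Q(1)])
    show "\<one> : {x : carrier G. x0 \<otimes> x : Q}" using x0c Q by simp
    show "ALL m>=n. (\<alpha> ^^ m) ` {x : carrier G. x0 \<otimes> x : Q} <= U"
    proof (intro allI impI subsetI)
      fix m y assume m: "m >= n" and "y : (\<alpha> ^^ m) ` {x : carrier G. x0 \<otimes> x : Q}"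
      then obtain x where x: "x : carrier G" "x0 \<otimes> x : Q" "y = (\<alpha> ^^ m) x" by blast
      have "(\<alpha> ^^ m) x0 : C" "(\<alpha> ^^ m) (x0 \<otimes> x) : C" using Q m x unfolding D_def by auto
      then have "inv ((\<alpha> ^^ m) x0) : V" "(\<alpha> ^^ m) (x0 \<otimes> x) : V" using W(5) V'(3,4) by blast+
      then have "inv ((\<alpha> ^^ m) x0) \<otimes> (\<alpha> ^^ m) (x0 \<otimes> x) : U" using V(3) by blast
      moreover have "(\<alpha> ^^ m) (x0 \<otimes> x) = (\<alpha> ^^ m) x0 \<otimes> (\<alpha> ^^ m) x"
        using az_mult[OF x0c x(1), of "int m"] by (simp add: az_nat)
      ultimately show "y : U" using x x0c pow_closed by simp
    qed
  qed
qed

text \<open>Finitely many translates of a uniformly contracted neighbourhood cover \<open>C\<close>,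
  and their finitely many centres contract pointwise.\<close>

lemma uniform_contraction: assumes C: "compactin T C" and U: "openin T U" "\<one> : U"
  obtains N where "ALL n>=N. (\<alpha> ^^ n) ` C <= U"
proof -
  obtain V where V: "openin T V" "\<one> : V" "ALL x:V. ALL y:V. x \<otimes> y : U" by (rule nbhd_mult[OF U])
  obtain P n where P: "openin T P" "\<one> : P" "ALL m>=n. (\<alpha> ^^ m) ` P <= V" by (rule uniform_near_one[OF V(1,2)])
  have Cc: "C <= carrier G" using compactin_subset_topspace[OF C] by simp
  have cov: "C <= \<Union>((%x. (%y. x \<otimes> y) ` P) ` C)"
  proof
    fix x assume x: "x : C"
    then have "x = x \<otimes> \<one>" using Cc by auto
    then show "x : \<Union>((%x. (%y. x \<otimes> y) ` P) ` C)" using x P(2) by blast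
  qed
  have "ALL W:(%x. (%y. x \<otimes> y) ` P) ` C. openin T W" using openin_translate[OF _ P(1)] Cc by auto
  then obtain \<F> where F: "finite \<F>" "\<F> <= (%x. (%y. x \<otimes> y) ` P) ` C" "C <= \<Union>\<F>"
    using C cov unfolding compactin_def by meson
  obtain F where F': "F <= C" "finite F" "\<F> = (%x. (%y. x \<otimes> y) ` P) ` F" using finite_subset_image[OF F(1,2)] by blast
  have "ALL x:F. EX N. ALL m>=N. (\<alpha> ^^ m) x : V"
  proof
    fix x assume "x : F"
    then have "x : carrier G" using F'(1) Cc by blast
    then obtain N where "ALL m>=N. (\<alpha> ^^ m) x : V" by (rule eventually_in[OF _ V(1,2)])
    then show "EX N. ALL m>=N. (\<alpha> ^^ m) x : V" by blast
  qed
  from bchoice[OF this] obtain M where M: "ALL x:F. ALL m>=M x. (\<alpha> ^^ m) x : V" ..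
  define N where "N = n + (\<Sum>x\<in>F. M x)"
  have "(\<alpha> ^^ m) ` C <= U" if m: "m >= N" for m
  proof
    fix y assume "y : (\<alpha> ^^ m) ` C"
    then obtain z where z: "z : C" "y = (\<alpha> ^^ m) z" by blast
    then obtain x p where x: "x : F" "p : P" "z = x \<otimes> p" using F(3) F'(3) by blast
    have c: "x : carrier G" "p : carrier G" using x F'(1) Cc openin_carrier[OF P(1)] by blast+
    have "M x <= (\<Sum>x\<in>F. M x)" by (rule member_le_sum[OF x(1) _ F'(2)]) simp
    then have mm: "m >= M x" "m >= n" using m by (simp_all add: N_def)
    have "(\<alpha> ^^ m) x : V" "(\<alpha> ^^ m) p : V" using M P(3) x(1,2) mm by blast+
    then have "(\<alpha> ^^ m) x \<otimes> (\<alpha> ^^ m) p : U" using V(3) by blast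
    then show "y : U" using z x az_mult[OF c, of "int m"] by (simp add: az_nat)
  qed
  then show thesis using that by blast
qed

text \<open>A single application of \<open>\<alpha>\<close> need not map \<open>K\<close> far enough
  into itself for the cube axiom, so its \<open>N\<close>-th power is used. The number
  \<open>N\<close> remains a parameter in order that two groups can share it.\<close>

definition balls :: "nat => 'a set => bool" where
  "balls N K \<longleftrightarrow> contraction_balls G (%k. az (int N * k)) K & compactin T K &
     (ALL k. EX U. openin T U & \<one> : U & U <= az (int N * k) ` K) &
     (ALL U. openin T U --> \<one> : U --> (EX n::nat. az (int N * int n) ` K <= U))"

theorem balls_exist: obtains K N0 where "ALL N>=N0. balls N K"
proof -
  obtain V0 K0 where V0: "openin T V0" "compactin T K0" "closedin T K0" "\<one> : V0" "V0 <= K0"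
    using locally_compact locally_compact_space_compact_closedin[of T] Hausdorff one_closed carrier_topspace by metis
  define K where "K = K0 \<inter> {x : carrier G. inv x : K0}"
  define V where "V = V0 \<inter> {x : carrier G. inv x : V0}"
  have K0c: "K0 <= carrier G" using compactin_subset_topspace[OF V0(2)] by simp
  have Kc: "K <= carrier G" by (auto simp: K_def)
  have "closedin T {x : carrier G. inv x : K0}"
    using closedin_continuous_map_preimage[OF continuous_map_inv V0(3)] by simp
  then have comp: "compactin T K" unfolding K_def by (rule compact_Int_closedin[OF V0(2)])
  have V: "openin T V" "\<one> : V" "V <= K"
    unfolding V_def K_def using V0 openin_preimage[OF continuous_map_inv V0(1)] by auto
  have invK: "inv x : K" if "x : K" for x using that K0c by (auto simp: K_def)
  obtain W1 where W1: "openin T W1" "\<one> : W1" "ALL x:W1. ALL y:W1. x \<otimes> y : V" by (rule nbhd_mult[OF V(1,2)])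
  obtain W2 where W2: "openin T W2" "\<one> : W2" "ALL x:W2. ALL y:W2. x \<otimes> y : W1" by (rule nbhd_mult[OF W1(1,2)])
  have W: "openin T (W1 \<inter> W2)" "\<one> : W1 \<inter> W2" using W1 W2 by auto
  obtain N1 where N1: "ALL n>=N1. (\<alpha> ^^ n) ` K <= W1 \<inter> W2" by (rule uniform_contraction[OF comp W])
  have azc: "x : az k ` K ==> x : carrier G" for x k using Kc by auto
  have "balls N K" if N: "N >= max 1 N1" for N
  proof -
    have small: "EX n::nat. az (int N * int n) ` K <= U" if U: "openin T U" "\<one> : U" for U
    proof -
      obtain n where n: "ALL m>=n. (\<alpha> ^^ m) ` K <= U" by (rule uniform_contraction[OF comp U])
      have "n <= N * n" using N by simp
      then have "az (int N * int n) ` K <= U" using n az_nat[of "N * n"] by simp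
      then show ?thesis by blast
    qed
    have nb: "EX U. openin T U & \<one> : U & U <= az (int N * k) ` K" for k
    proof (intro exI conjI)
      show "openin T (az (int N * k) ` V)" by (rule openin_az[OF V(1)])
      show "\<one> : az (int N * k) ` V" using V(2) by (metis az_one imageI)
      show "az (int N * k) ` V <= az (int N * k) ` K" using V(3) by blast
    qed
    have "contraction_balls G (%k. az (int N * k)) K"
    proof
      fix x y k assume "x : carrier G" "y : carrier G"
      then show "az (int N * k) (x \<otimes> y) = az (int N * k) x \<otimes> az (int N * k) y" by (rule az_mult)
    next
      fix x j k assume "x : carrier G"
      then show "az (int N * (j + k)) x = az (int N * j) (az (int N * k) x)"
        using az_add[of x "int N * j" "int N * k"] by (simp add: distrib_left)
    next
      fix x y z assume "x : az (int N * 1) ` K" "y : az (int N * 1) ` K" "z : az (int N * 1) ` K"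
      then have xyz: "x : W1 \<inter> W2" "y : W1 \<inter> W2" "z : W1 \<inter> W2" using N1 N az_nat[of N] by auto
      then have "x \<otimes> y : W1" using W2(3) by blast
      then show "x \<otimes> y \<otimes> z : K" using W1(3) xyz V(3) by blast
    next
      fix x assume x: "x : carrier G" and *: "!!n::nat. x : az (int N * int n) ` K"
      show "x = \<one>"
      proof (rule ccontr)
        assume "x ~= \<one>"
        then obtain U where U: "openin T U" "\<one> : U" "x ~: U"
          using Hausdorff x unfolding Hausdorff_space_def disjnt_iff by (metis carrier_topspace one_closed)
        then show False using small[OF U(1,2)] * by blast
      qed
    next
      fix x assume x: "x : carrier G"
      obtain n where n: "ALL m>=n. (\<alpha> ^^ m) x : V" by (rule eventually_in[OF x V(1,2)])
      have "n <= N * n" using N by simp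
      then have "az (int N * int n) x : K" using n V(3) az_nat[of "N * n" x] by auto
      moreover have "x = az (int N * - int n) (az (int N * int n) x)" using az_cancel(1)[OF x, of "int N * int n"] by simp
      ultimately show "EX n::nat. x : az (int N * - int n) ` K" by blast
    next
      fix g assume g: "g : carrier G"
      have "openin T {x : carrier G. cj g x : V}" by (rule openin_preimage[OF continuous_cj[OF g] V(1)])
      moreover have "\<one> : {x : carrier G. cj g x : V}" using g V(2) by simp
      ultimately obtain n :: nat where "az (int N * int n) ` K <= {x : carrier G. cj g x : V}" using small by blast
      then show "EX n::nat. ALL x:az (int N * int n) ` K. cj g x : K" using V(3) by blast
    next
      fix s :: "nat => 'a" assume s: "!!n. s n : K"
      show "EX x:K. ALL k M. EX n>=M. inv x \<otimes> s n : az (int N * int k) ` K"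
      proof (rule ccontr)
        \<comment> \<open>Without a cluster point, each point of \<open>K\<close> has a
          neighbourhood that the sequence avoids from some index on; finitely many of these cover
          \<open>K\<close>, and a late term has nowhere to be.\<close>
        assume "~ ?thesis"
        then have "ALL x:K. EX U M. openin T U & x : U & (ALL n>=M. s n ~: U)"
        proof (intro ballI)
          fix x assume no: "~ (EX x:K. ALL k M. EX n>=M. inv x \<otimes> s n : az (int N * int k) ` K)" and x: "x : K"
          then obtain k M where kM: "ALL n>=M. inv x \<otimes> s n ~: az (int N * int k) ` K" by blast
          obtain U where U: "openin T U" "\<one> : U" "U <= az (int N * int k) ` K" using nb by blast
          have xc: "x : carrier G" using x Kc by blast
          have "openin T ((%y. x \<otimes> y) ` U)" by (rule openin_translate[OF xc U(1)])
          moreover have "x : (%y. x \<otimes> y) ` U" using U(2) xc by (metis imageI r_one)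
          moreover have "s n ~: (%y. x \<otimes> y) ` U" if "n >= M" for n
          proof
            assume "s n : (%y. x \<otimes> y) ` U"
            then obtain y where y: "y : U" "s n = x \<otimes> y" by blast
            then have "inv x \<otimes> s n = y" using xc openin_carrier[OF U(1)] by simp
            then show False using kM that y(1) U(3) by blast
          qed
          ultimately show "EX U M. openin T U & x : U & (ALL n>=M. s n ~: U)" by blast
        qed
        from bchoice[OF this] obtain U where "ALL x:K. EX M. openin T (U x) & x : U x & (ALL n>=M. s n ~: U x)" ..
        from bchoice[OF this] obtain M where M: "ALL x:K. openin T (U x) & x : U x & (ALL n>=M x. s n ~: U x)" ..
        have "ALL W:U ` K. openin T W" "K <= \<Union>(U ` K)" using M by auto
        then obtain \<F> where F: "finite \<F>" "\<F> <= U ` K" "K <= \<Union>\<F>"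
          using comp unfolding compactin_def by meson
        obtain F where F': "F <= K" "finite F" "\<F> = U ` F" using finite_subset_image[OF F(1,2)] by blast
        define n where "n = (\<Sum>x\<in>F. M x)"
        obtain x where x: "x : F" "s n : U x" using s[of n] F(3) F'(3) by blast
        have "M x <= n" unfolding n_def by (rule member_le_sum[OF x(1) _ F'(2)]) simp
        then show False using M x F'(1) by blast
      qed
    qed (use Kc V invK in auto)
    then show ?thesis using comp nb small unfolding balls_def by blast
  qed
  then show thesis using that by blast
qed

lemma clo_iff_closedin: assumes b: "balls N K"
  shows "contraction_balls.clo G (%k. az (int N * k)) K X \<longleftrightarrow> closedin T X"
proof -
  interpret contraction_balls G "%k. az (int N * k)" K using b unfolding balls_def by blast
  have nb: "EX U. openin T U & \<one> : U & U <= B k" for k using b unfolding balls_def B_def by blast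
  have small: "EX n::nat. B (int n) <= U" if "openin T U" "\<one> : U" for U using b that unfolding balls_def B_def by blast
  show ?thesis
  proof
    assume X: "clo X"
    have "openin T (carrier G - X)"
    proof (subst openin_subopen, intro ballI)
      fix x assume x: "x : carrier G - X"
      then obtain k where k: "ALL b:B k. x \<otimes> b ~: X" using cloD[OF X, of x] by blast
      obtain U where U: "openin T U" "\<one> : U" "U <= B k" using nb by blast
      show "EX W. openin T W & x : W & W <= carrier G - X"
      proof (intro exI conjI)
        show "openin T ((%y. x \<otimes> y) ` U)" using openin_translate U(1) x by simp
        show "x : (%y. x \<otimes> y) ` U" using U(2) x by (metis DiffD1 imageI r_one)
        show "(%y. x \<otimes> y) ` U <= carrier G - X" using k U(3) x B_carrier by auto
      qed
    qed
    then show "closedin T X" using clo_sub[OF X] unfolding closedin_def by simp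
  next
    assume X: "closedin T X"
    show "clo X"
    proof (rule cloI)
      show "X <= carrier G" using closedin_subset[OF X] by simp
      fix x assume x: "x : carrier G" and *: "!!k. EX b:B k. x \<otimes> b : X"
      show "x : X"
      proof (rule ccontr)
        assume "x ~: X"
        have "openin T {y : carrier G. x \<otimes> y : carrier G - X}"
          by (rule openin_preimage[OF continuous_left[OF x]]) (use X in \<open>simp add: closedin_def\<close>)
        moreover have "\<one> : {y : carrier G. x \<otimes> y : carrier G - X}" using x \<open>x ~: X\<close> by simp
        ultimately obtain n :: nat where "B (int n) <= {y : carrier G. x \<otimes> y : carrier G - X}" using small by blast
        then show False using * by blast
      qed
    qed
  qed
qed

end

section \<open>The open mapping theorem\<close>

text \<open>Total boundedness of the exhausting balls gives countably many compact translates of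
  \<open>B (k + 1)\<close> whose images fill the image of \<open>\<phi>\<close>. That image is
  locally compact because it is closed, so one of these sets has interior points; dividing by such a
  point shows that \<open>B k\<close> has a neighbourhood of the identity as image.\<close>

lemma open_map_onto_closed_image:
  fixes G (structure) and H (structure)
  assumes "locally_compact_contraction_group G T \<alpha>" "locally_compact_contraction_group H S \<beta>"
    and hom: "\<phi> : hom G H" and cont: "continuous_map T S \<phi>" and cl: "closedin S (\<phi> ` carrier G)"
  shows "open_map T (subtopology S (\<phi> ` carrier G)) \<phi>"
proof -
  interpret G: locally_compact_contraction_group G T \<alpha> by fact
  interpret H: locally_compact_contraction_group H S \<beta> by fact
  interpret \<phi>: group_hom G H \<phi> by (rule group_hom.intro[OF G.is_group H.is_group]) (unfold_locales, rule hom)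
  obtain K N0 where "ALL N>=N0. G.balls N K" by (rule G.balls_exist)
  then have b: "G.balls N0 K" by simp
  interpret B: contraction_balls G "%k. G.az (int N0 * k)" K using b unfolding G.balls_def by blast
  have nb: "EX U. openin T U & \<one> : U & U <= B.B k" for k using b unfolding G.balls_def B.B_def by blast
  have small: "EX n::nat. B.B (int n) <= U" if "openin T U" "\<one> : U" for U
    using b that unfolding G.balls_def B.B_def by blast
  have compB: "compactin T (B.B k)" for k
    using b image_compactin[OF _ G.continuous_az] unfolding G.balls_def B.B_def by blast
  define P where "P = \<phi> ` carrier G"
  define SP where "SP = subtopology S P"
  have PH: "P <= carrier H" unfolding P_def by auto
  have topSP: "topspace SP = P" unfolding SP_def using PH by auto
  have lc: "locally_compact_space SP" unfolding SP_def P_def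
    by (rule locally_compact_space_closed_subset[OF H.locally_compact cl])
  have rg: "regular_space SP" unfolding SP_def by (rule regular_space_subtopology[OF H.regular])
  have key: "EX W. openin S W & \<one>\<^bsub>H\<^esub> : W & W \<inter> P <= \<phi> ` B.B k" for k
  proof -
    have "ALL n::nat. EX F. finite F & F <= B.B (- int n) & B.B (- int n) <= (\<Union>f\<in>F. (%b. f \<otimes> b) ` B.B (k + 1))"
    proof
      fix n :: nat
      obtain F where "finite F" "F <= B.B (- int n)" "B.B (- int n) <= (\<Union>f\<in>F. (%b. f \<otimes> b) ` B.B (k + 1))"
        by (rule B.totally_bounded)
      then show "EX F. finite F & F <= B.B (- int n) & B.B (- int n) <= (\<Union>f\<in>F. (%b. f \<otimes> b) ` B.B (k + 1))" by blast
    qed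
    from choice[OF this] obtain F where F: "ALL n::nat. finite (F n) & F n <= B.B (- int n) &
      B.B (- int n) <= (\<Union>f\<in>F n. (%b. f \<otimes> b) ` B.B (k + 1))" ..
    define E where "E = (\<Union>n. F n)"
    have Ec: "f : carrier G" if "f : E" for f using that F B.B_carrier unfolding E_def by blast
    have "countable E" unfolding E_def using F countable_finite by blast
    define \<G> where "\<G> = (%f. \<phi> ` (%b. f \<otimes> b) ` B.B (k + 1)) ` E"
    have cG: "countable \<G>" unfolding \<G>_def using \<open>countable E\<close> by simp
    have clG: "closedin SP W" if W: "W : \<G>" for W
    proof -
      obtain f where f: "f : E" "W = \<phi> ` (%b. f \<otimes> b) ` B.B (k + 1)" using W unfolding \<G>_def by blast
      have "compactin S W" unfolding f(2)
        by (intro image_compactin[OF _ cont] image_compactin[OF compB G.continuous_left] Ec f(1))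
      then have "closedin S W" using H.Hausdorff Hausdorff_imp_kc_space compactin_imp_closedin_gen by blast
      moreover have "W <= P" unfolding f(2) P_def using Ec[OF f(1)] B.B_carrier by auto
      ultimately show ?thesis unfolding SP_def closedin_subtopology by blast
    qed
    have "P <= \<Union>\<G>"
    proof
      fix h assume "h : P"
      then obtain x where x: "x : carrier G" "h = \<phi> x" unfolding P_def by blast
      obtain n :: nat where "x : B.B (- int n)" using B.B_exh[OF x(1)] .
      then obtain f b where "f : F n" "b : B.B (k + 1)" "x = f \<otimes> b" using F by blast
      then show "h : \<Union>\<G>" using x(2) unfolding \<G>_def E_def by blast
    qed
    moreover have "\<Union>\<G> <= P"
    proof (rule Union_least)
      fix W assume "W : \<G>"
      then show "W <= P" using closedin_subset[OF clG] topSP by simp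
    qed
    ultimately have "\<Union>\<G> = topspace SP" using topSP by blast
    then have "SP interior_of \<Union>\<G> = P" using interior_of_topspace[of SP] topSP by simp
    moreover have "P ~= {}" unfolding P_def by auto
    moreover have "SP interior_of \<Union>\<G> = {}" if "ALL W:\<G>. SP interior_of W = {}"
      by (rule Baire_category_alt) (use lc rg cG clG that in auto)
    ultimately obtain W where W: "W : \<G>" "SP interior_of W ~= {}" by blast
    obtain f where f: "f : E" "W = \<phi> ` (%b. f \<otimes> b) ` B.B (k + 1)" using W(1) unfolding \<G>_def by blast
    obtain h0 O1 where O1: "openin SP O1" "h0 : O1" "O1 <= W" using W(2) unfolding interior_of_def by blast
    obtain O2 where O2: "openin S O2" "O1 = O2 \<inter> P" using O1(1) unfolding SP_def openin_subtopology by blast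
    obtain b0 where b0: "b0 : B.B (k + 1)" "h0 = \<phi> (f \<otimes> b0)" using O1(2,3) f(2) by blast
    note cc = Ec[OF f(1)] B.B_carrier[OF b0(1)]
    have h0: "h0 : carrier H" "h0 : P" using b0(2) cc unfolding P_def by (simp, blast intro: G.m_closed)
    define W' where "W' = {h : carrier H. h0 \<otimes>\<^bsub>H\<^esub> h : O2}"
    have "openin S W'" unfolding W'_def by (rule H.openin_preimage[OF H.continuous_left[OF h0(1)] O2(1)])
    moreover have "\<one>\<^bsub>H\<^esub> : W'" using O1(2) O2(2) h0(1) by (simp add: W'_def)
    moreover have "W' \<inter> P <= \<phi> ` B.B k"
    proof
      fix h assume h: "h : W' \<inter> P"
      then obtain x where x: "x : carrier G" "h = \<phi> x" unfolding P_def by blast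
      have "h0 \<otimes>\<^bsub>H\<^esub> h = \<phi> (f \<otimes> b0 \<otimes> x)" using x b0(2) cc by simp
      then have "h0 \<otimes>\<^bsub>H\<^esub> h : P" unfolding P_def using x(1) cc by blast
      then have "h0 \<otimes>\<^bsub>H\<^esub> h : W" using h O1(3) O2(2) unfolding W'_def by blast
      then obtain b where b: "b : B.B (k + 1)" "h0 \<otimes>\<^bsub>H\<^esub> h = \<phi> (f \<otimes> b)" using f(2) by blast
      note bc = B.B_carrier[OF b(1)]
      have hc: "h : carrier H" using h PH by blast
      have "h = inv\<^bsub>H\<^esub> h0 \<otimes>\<^bsub>H\<^esub> \<phi> (f \<otimes> b)" using hc h0(1) by (simp flip: b(2))
      also have "\<dots> = \<phi> (inv b0 \<otimes> b)" unfolding b0(2) using cc bc by (simp add: H.inv_mult_group H.m_assoc)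
      finally have "h = \<phi> (inv b0 \<otimes> b)" .
      moreover have "inv b0 \<otimes> b : B.B k" by (rule B.B_mult[OF B.B_inv[OF b0(1)] b(1)])
      ultimately show "h : \<phi> ` B.B k" by blast
    qed
    ultimately show ?thesis by blast
  qed
  have "openin SP (\<phi> ` U)" if U: "openin T U" for U
  proof (subst openin_subopen, intro ballI)
    fix h assume "h : \<phi> ` U"
    then obtain x where x: "x : U" "h = \<phi> x" by blast
    have xc: "x : carrier G" using G.openin_carrier[OF U x(1)] .
    have hc: "h : carrier H" using x xc by simp
    have "openin T {y : carrier G. x \<otimes> y : U}" by (rule G.openin_preimage[OF G.continuous_left[OF xc] U])
    moreover have "\<one> : {y : carrier G. x \<otimes> y : U}" using x xc by simp
    ultimately obtain n :: nat where n: "B.B (int n) <= {y : carrier G. x \<otimes> y : U}" using small by blast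
    obtain W where W: "openin S W" "\<one>\<^bsub>H\<^esub> : W" "W \<inter> P <= \<phi> ` B.B (int n)" using key by blast
    have "openin S ((%y. h \<otimes>\<^bsub>H\<^esub> y) ` W)" by (rule H.openin_translate[OF hc W(1)])
    then have "openin SP ((%y. h \<otimes>\<^bsub>H\<^esub> y) ` W \<inter> P)" unfolding SP_def openin_subtopology by blast
    moreover have "h : (%y. h \<otimes>\<^bsub>H\<^esub> y) ` W \<inter> P"
    proof
      show "h : (%y. h \<otimes>\<^bsub>H\<^esub> y) ` W" using W(2) hc by (metis H.r_one imageI)
      show "h : P" using x xc by (simp add: P_def)
    qed
    moreover have "(%y. h \<otimes>\<^bsub>H\<^esub> y) ` W \<inter> P <= \<phi> ` U"
    proof
      fix z assume z: "z : (%y. h \<otimes>\<^bsub>H\<^esub> y) ` W \<inter> P"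
      then obtain y where y: "y : W" "z = h \<otimes>\<^bsub>H\<^esub> y" by blast
      obtain w where w: "w : carrier G" "z = \<phi> w" using z unfolding P_def by blast
      have yc: "y : carrier H" using H.openin_carrier[OF W(1) y(1)] .
      have "y = inv\<^bsub>H\<^esub> h \<otimes>\<^bsub>H\<^esub> z" using y(2) hc yc by simp
      also have "\<dots> = \<phi> (inv x \<otimes> w)" using x w xc by simp
      finally have "y : P" unfolding P_def using xc w(1) by blast
      then obtain v where v: "v : B.B (int n)" "y = \<phi> v" using W(3) y(1) by blast
      have "z = \<phi> (x \<otimes> v)" using y(2) v x xc B.B_carrier by simp
      moreover have "x \<otimes> v : U" using n v(1) by blast
      ultimately show "z : \<phi> ` U" by blast
    qed
    ultimately show "EX W. openin SP W & h : W & W <= \<phi> ` U" by blast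
  qed
  then show ?thesis unfolding open_map_def SP_def P_def by blast
qed

theorem theoremG:
  fixes G :: "('a, 'c) monoid_scheme" and T :: "'a topology" and \<alpha> :: "'a \<Rightarrow> 'a"
    and H :: "('b, 'd) monoid_scheme" and S :: "'b topology" and \<beta> :: "'b \<Rightarrow> 'b"
    and \<phi> :: "'a \<Rightarrow> 'b"
  assumes "locally_compact_contraction_group G T \<alpha>"
    and "locally_compact_contraction_group H S \<beta>"
    and "\<phi> \<in> hom G H"
    and "continuous_map T S \<phi>"
  shows "(closedin S (\<phi> ` carrier G) \<longleftrightarrow> closedin S (\<phi> ` tor G)) \<and>
         (closedin S (\<phi> ` carrier G) \<longrightarrow>
            open_map T (subtopology S (\<phi> ` carrier G)) \<phi>) \<and>
         ((\<forall>x\<in>carrier G. \<beta> (\<phi> x) = \<phi> (\<alpha> x)) \<longrightarrow> closedin S (\<phi> ` carrier G))"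
proof (intro conjI impI)
  interpret G: locally_compact_contraction_group G T \<alpha> by fact
  interpret H: locally_compact_contraction_group H S \<beta> by fact
  interpret \<phi>: group_hom G H \<phi> by (rule group_hom.intro[OF G.is_group H.is_group]) (unfold_locales, fact)
  obtain K N1 where K: "ALL N>=N1. G.balls N K" by (rule G.balls_exist)
  obtain L N2 where L: "ALL N>=N2. H.balls N L" by (rule H.balls_exist)
  \<comment> \<open>Both groups use the same \<open>N\<close>, since equivariance in (b) relates
    equal powers of \<open>\<alpha>\<close> and \<open>\<beta>\<close> only.\<close>
  define N where "N = max N1 N2"
  have bG: "G.balls N K" and bH: "H.balls N L" using K L by (simp_all add: N_def)
  interpret P: contraction_balls_pair G "%k. G.az (int N * k)" K H "%k. H.az (int N * k)" L
    by (rule contraction_balls_pair.intro) (use bG bH in \<open>simp_all add: G.balls_def H.balls_def\<close>)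
  have clo: "P.H.clo X \<longleftrightarrow> closedin S X" for X by (rule H.clo_iff_closedin[OF bH])
  have cont: "EX n. ALL x:P.B n. \<phi> x : P.H.B k" for k
  proof -
    obtain U where U: "openin S U" "\<one>\<^bsub>H\<^esub> : U" "U <= P.H.B k" using bH unfolding H.balls_def P.H.B_def by blast
    have "openin T {x : carrier G. \<phi> x : U}"
      using openin_continuous_map_preimage[OF assms(4) U(1)] by simp
    moreover have "\<one>\<^bsub>G\<^esub> : {x : carrier G. \<phi> x : U}" using U(2) by simp
    ultimately obtain n :: nat where "P.B (int n) <= {x : carrier G. \<phi> x : U}"
      using bG unfolding G.balls_def P.B_def by blast
    then show ?thesis using U(3) by blast
  qed
  show "closedin S (\<phi> ` carrier G) \<longleftrightarrow> closedin S (\<phi> ` tor G)"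
    using P.image_clo_iff[OF assms(3) cont] unfolding clo tor_def .
  show "open_map T (subtopology S (\<phi> ` carrier G)) \<phi>" if "closedin S (\<phi> ` carrier G)"
    by (rule open_map_onto_closed_image[OF assms that])
  show "closedin S (\<phi> ` carrier G)" if eqv: "ALL x:carrier G. \<beta> (\<phi> x) = \<phi> (\<alpha> x)"
  proof -
    have az: "\<phi> (G.az k x) = H.az k (\<phi> x)" if x: "x : carrier G" for x k
    proof (induction k rule: int_induct[of _ 0])
      case (step1 i)
      then show ?case using x eqv by (simp add: G.az_Suc H.az_Suc flip: eqv)
    next
      case (step2 i)
      have "\<phi> (G.\<alpha>i y) = H.\<alpha>i (\<phi> y)" if y: "y : carrier G" for y
      proof -
        have "H.\<alpha>i (\<beta> (\<phi> (G.\<alpha>i y))) = \<phi> (G.\<alpha>i y)" using y by (intro H.\<alpha>i_\<alpha>) simp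
        then show ?thesis using eqv y by simp
      qed
      then show ?case using step2 x by (simp add: G.az_pred H.az_pred)
    qed simp
    have "P.H.clo (\<phi> ` carrier G)"
      by (rule P.equivariant_image_clo[OF P.cas_whole]) (use az in simp_all, use cont in blast)
    then show ?thesis unfolding clo .
  qed
qed

end
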